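(* Let $k$ be a field, $R$ an associative $k$-algebra, and $\mathbb F=(F,d)$ a projective complex of left $R$-modules with $\dim_k\mathrm{Ext}^1_R(\mathbb F,\mathbb F)<\infty$. Let $P_0=T/I_0$ be the parameter algebra of the universal lift of $\mathbb F$, where $T$ is a non-commutative formal power series ring over $k$ and $I_0\subseteq\mathfrak m_T^2$ is a closed ideal. Suppose $\ell=\dim_k\mathrm{Ext}^2_R(\mathbb F,\mathbb F)$ is finite. Then the ideal $I_0$ is analytically generated by at most $\ell$ elements.
   Context: Modules are left modules and ideals are two-sided. A complete local $k$-algebra is an associative local $k$-algebra $A$ with Jacobson radical $\mathfrak m_A$ such that $k\to A/\mathfrak m_A$ is an isomorphism, $\dim_k\mathfrak m_A/\mathfrak m_A^2<\infty$, and $A\cong\varprojlim A/\mathfrak m_A^n$. Let $\widehat{\mathcal A}_k$ be the category of complete local $k$-algebras and $k$-algebra homomorphisms, and $\mathcal A_k$ its full subcategory of artinian local $k$-algebras with residue field $k$ (not necessarily commutative). The closure of an ideal $I$ of $A\in\widehat{\mathcal A}_k$ is $\overline I=\bigcap_n(I+\mathfrak m_A^n)$, and $I$ is closed if $I=\overline I$. An ideal $I$ is analytically generated by a subset $S$ if $I=\overline{(S)}$, where $(S)$ is the two-sided ideal generated by $S$. The non-commutative formal power series ring $k\langle\langle t_1,\dots,t_r\rangle\rangle$ is the completion of the free algebra $k\langle t_1,\dots,t_r\rangle$ with respect to the powers of $(t_1,\dots,t_r)$. A projective complex $\mathbb F=(F,d)$ over $R$ is a graded projective $R$-module $F=\bigoplus_{i\in\mathbb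 Z}F_i$ with a graded homomorphism $d:F\to F[-1]$, $d^2=0$, where $F[j]_i=F_{i+j}$. $\mathrm{Ext}^i_R(\mathbb F,\mathbb F)$ is the $k$-space of homotopy classes of chain homomorphisms $\mathbb F\to\mathbb F$ of degree $-i$ (a chain homomorphism of degree $j$ is a graded $f:F\to F[j]$ with $fd+(-1)^{j+1}df=0$; $f\sim g$ if $f-g=hd+(-1)^jdh$ for a graded $h:F\to F[j+1]$). For $A\in\widehat{\mathcal A}_k$, $R\,\widehat\otimes_k A^{op}=\varprojlim_n R\otimes_k(A/\mathfrak m_A^n)^{op}$ and $F\,\widehat\otimes_k A=\bigoplus_i\varprojlim_n F_i\otimes_k A/\mathfrak m_A^n$ (ordinary tensor products if $A$ is artinian). A lift of $\mathbb F$ to $A$ is a chain complex $(F\,\widehat\otimes_kA,\Delta)$ of left $R\,\widehat\otimes_kA^{op}$-modules with $\Delta\otimes_Ak=d$. For a $k$-algebra map $f:P\to A$ with $P\in\widehat{\mathcal A}_k$, $A\in\mathcal A_k$, and a lift $(F\,\widehat\otimes_kP,\Delta)$, the base change $(F\,\widehat\otimes_kP,\Delta)\otimes_P{}_fA$ means the complex $(F\otimes_kA,\Delta\otimes_P{}_fA)$ ($f$ factors through some $P/\mathfrak m_P^n$; take the differential induced by $\Delta$ on $F\otimes_kP/\mathfrak m_P^n$ and base change it to $A$). The functor $\mathcal F:\mathcal A_k\to(Sets)$ sends $A$ to the set of isomorphism classes (as chain complexes over $R\otimes_kA^{op}$) of lifts of $\mathbb F$ to $A$, with functoriality by base change. A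 lift $\mathbb L=(F\,\widehat\otimes_kP,\Delta)$ of $\mathbb F$ to $P\in\widehat{\mathcal A}_k$ is a universal lift of $\mathbb F$ if the morphism $\phi_{\mathbb L}:\mathrm{Hom}_{k\text{-alg}}(P,-)\to\mathcal F$, $f\mapsto \mathbb L\otimes_P{}_fA$ (for $f:P\to A$, $A\in\mathcal A_k$), is an isomorphism of functors on $\mathcal A_k$; then $P$ is called a parameter algebra of the universal lift of $\mathbb F$. *)

theory Defs
  imports
    "Jordan_Normal_Form.Missing_VectorSpace"
    "HOL-Algebra.Free_Abelian_Groups"
    "HOL-Algebra.QuotRing"
    "HOL-Algebra.Ideal_Product"
begin

section \<open>Algebras and modules over a not necessarily commutative ring\<close>

text \<open>The library's locale for algebras asks for a commutative ring; here only the ring of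
  scalars \<open>K\<close> is commutative.\<close>

locale nc_algebra = module K A + ring A for K (structure) and A (structure) +
  assumes smult_mult_left:
      "\<lbrakk>c \<in> carrier K; x \<in> carrier A; y \<in> carrier A\<rbrakk>
        \<Longrightarrow> (c \<odot>\<^bsub>A\<^esub> x) \<otimes>\<^bsub>A\<^esub> y = c \<odot>\<^bsub>A\<^esub> (x \<otimes>\<^bsub>A\<^esub> y)"
    and smult_mult_right:
      "\<lbrakk>c \<in> carrier K; x \<in> carrier A; y \<in> carrier A\<rbrakk>
        \<Longrightarrow> x \<otimes>\<^bsub>A\<^esub> (c \<odot>\<^bsub>A\<^esub> y) = c \<odot>\<^bsub>A\<^esub> (x \<otimes>\<^bsub>A\<^esub> y)"

text \<open>Left modules over a ring. The multiplicative part of the record \<open>M\<close> is ignored.\<close>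

locale lmodule = R?: ring R + M?: abelian_group M
  for R :: "('r, 'e) ring_scheme" (structure) and M :: "('r, 'm, 'f) module_scheme" (structure) +
  assumes lsmult_closed:
      "\<lbrakk>a \<in> carrier R; x \<in> carrier M\<rbrakk> \<Longrightarrow> a \<odot>\<^bsub>M\<^esub> x \<in> carrier M"
    and lsmult_l_distr:
      "\<lbrakk>a \<in> carrier R; b \<in> carrier R; x \<in> carrier M\<rbrakk>
        \<Longrightarrow> (a \<oplus>\<^bsub>R\<^esub> b) \<odot>\<^bsub>M\<^esub> x = (a \<odot>\<^bsub>M\<^esub> x) \<oplus>\<^bsub>M\<^esub> (b \<odot>\<^bsub>M\<^esub> x)"
    and lsmult_r_distr:
      "\<lbrakk>a \<in> carrier R; x \<in> carrier M; y \<in> carrier M\<rbrakk>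
        \<Longrightarrow> a \<odot>\<^bsub>M\<^esub> (x \<oplus>\<^bsub>M\<^esub> y) = (a \<odot>\<^bsub>M\<^esub> x) \<oplus>\<^bsub>M\<^esub> (a \<odot>\<^bsub>M\<^esub> y)"
    and lsmult_assoc:
      "\<lbrakk>a \<in> carrier R; b \<in> carrier R; x \<in> carrier M\<rbrakk>
        \<Longrightarrow> (a \<otimes>\<^bsub>R\<^esub> b) \<odot>\<^bsub>M\<^esub> x = a \<odot>\<^bsub>M\<^esub> (b \<odot>\<^bsub>M\<^esub> x)"
    and lsmult_one: "x \<in> carrier M \<Longrightarrow> \<one>\<^bsub>R\<^esub> \<odot>\<^bsub>M\<^esub> x = x"

text \<open>Homomorphisms are normalised to be \<open>undefined\<close> off the carrier, so that equal
  homomorphisms are equal as HOL functions.\<close>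

definition lmod_hom ::
  "('r, 'e) ring_scheme \<Rightarrow> ('r, 'a, 'f) module_scheme \<Rightarrow> ('r, 'b, 'g) module_scheme
    \<Rightarrow> ('a \<Rightarrow> 'b) set" where
  "lmod_hom R M N = {f \<in> carrier M \<rightarrow>\<^sub>E carrier N.
     (\<forall>x\<in>carrier M. \<forall>y\<in>carrier M. f (x \<oplus>\<^bsub>M\<^esub> y) = f x \<oplus>\<^bsub>N\<^esub> f y) \<and>
     (\<forall>a\<in>carrier R. \<forall>x\<in>carrier M. f (a \<odot>\<^bsub>M\<^esub> x) = a \<odot>\<^bsub>N\<^esub> f x)}"

text \<open>The lifting property, for surjections from modules living on the type \<open>'m \<Rightarrow> 'r\<close> onto
  modules living on the type \<open>'m\<close>. These types suffice: the free module on the set \<open>carrier P\<close>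
  lives on \<open>'m \<Rightarrow> 'r\<close>, so its canonical surjection onto \<open>P\<close> splits and \<open>P\<close> has the lifting
  property for surjections between modules on arbitrary types.\<close>

definition projective_lmodule ::
  "('r, 'e) ring_scheme \<Rightarrow> ('r, 'm) module \<Rightarrow> bool" where
  "projective_lmodule R P \<longleftrightarrow> lmodule R P \<and>
     (\<forall>(M :: ('r, 'm \<Rightarrow> 'r) module) (N :: ('r, 'm) module) g f.
        lmodule R M \<and> lmodule R N \<and> g \<in> lmod_hom R M N \<and> g ` carrier M = carrier N \<and>
        f \<in> lmod_hom R P N
        \<longrightarrow> (\<exists>h\<in>lmod_hom R P M. \<forall>x\<in>carrier P. g (h x) = f x))"

definition mk_module :: "('a, 'e) ring_scheme \<Rightarrow> ('s \<Rightarrow> 'a \<Rightarrow> 'a) \<Rightarrow> ('s, 'a) module" where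
  "mk_module M s = \<lparr>carrier = carrier M, mult = monoid.mult M, one = monoid.one M,
     ring.zero = ring.zero M, ring.add = ring.add M, smult = s\<rparr>"

definition restrict_scalars ::
  "('k, 'e) ring_scheme \<Rightarrow> ('k, 'r) module \<Rightarrow> ('r, 'm) module \<Rightarrow> ('k, 'm) module" where
  "restrict_scalars K R M = mk_module M (\<lambda>c x. (c \<odot>\<^bsub>R\<^esub> \<one>\<^bsub>R\<^esub>) \<odot>\<^bsub>M\<^esub> x)"

text \<open>The quotient \<open>V/B\<close>, used both for an algebra modulo an ideal and for a vector space modulo
  a subspace (then the multiplication is irrelevant).\<close>

definition quot :: "('k, 'a) module \<Rightarrow> 'a set \<Rightarrow> ('k, 'a set) module" where
  "quot V B = mk_module (V Quot B) (\<lambda>c X. \<Union>x\<in>X. B +>\<^bsub>V\<^esub> (c \<odot>\<^bsub>V\<^esub> x))"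

definition opp :: "('k, 'a) module \<Rightarrow> ('k, 'a) module" where
  "opp A = A\<lparr>mult := \<lambda>x y. y \<otimes>\<^bsub>A\<^esub> x\<rparr>"

definition alg_homs ::
  "('k, 'e) ring_scheme \<Rightarrow> ('k, 'a) module \<Rightarrow> ('k, 'b) module \<Rightarrow> ('a \<Rightarrow> 'b) set" where
  "alg_homs K A B = {f \<in> ring_hom A B \<inter> extensional (carrier A).
     \<forall>c\<in>carrier K. \<forall>x\<in>carrier A. f (c \<odot>\<^bsub>A\<^esub> x) = c \<odot>\<^bsub>B\<^esub> f x}"

definition left_ideal :: "'a set \<Rightarrow> ('a, 'e) ring_scheme \<Rightarrow> bool" where
  "left_ideal I A \<longleftrightarrow> additive_subgroup I A \<and> (\<forall>a\<in>carrier A. \<forall>x\<in>I. a \<otimes>\<^bsub>A\<^esub> x \<in> I)"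

definition maximal_left_ideal :: "'a set \<Rightarrow> ('a, 'e) ring_scheme \<Rightarrow> bool" where
  "maximal_left_ideal I A \<longleftrightarrow> left_ideal I A \<and> I \<noteq> carrier A \<and>
     (\<forall>J. left_ideal J A \<and> I \<subseteq> J \<longrightarrow> J = I \<or> J = carrier A)"

definition jacobson_radical :: "('a, 'e) ring_scheme \<Rightarrow> 'a set" where
  "jacobson_radical A = carrier A \<inter> \<Inter>{I. maximal_left_ideal I A}"

definition local_ring :: "('a, 'e) ring_scheme \<Rightarrow> bool" where
  "local_ring A \<longleftrightarrow> ring A \<and> (\<exists>!I. maximal_left_ideal I A)"

definition left_artinian :: "('a, 'e) ring_scheme \<Rightarrow> bool" where
  "left_artinian A \<longleftrightarrow> (\<forall>I :: nat \<Rightarrow> 'a set.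
     (\<forall>n. left_ideal (I n) A \<and> I (Suc n) \<subseteq> I n) \<longrightarrow> (\<exists>n. \<forall>m\<ge>n. I m = I n))"

primrec ideal_pow :: "('a, 'e) ring_scheme \<Rightarrow> 'a set \<Rightarrow> nat \<Rightarrow> 'a set" where
  "ideal_pow A I 0 = carrier A"
| "ideal_pow A I (Suc n) = ideal_prod A (ideal_pow A I n) I"


section \<open>Inverse limits and complete local algebras\<close>

text \<open>\<open>p n\<close> is the transition map from \<open>X (Suc n)\<close> to \<open>X n\<close>.\<close>

definition inv_lim :: "(nat \<Rightarrow> ('a, 'e) ring_scheme) \<Rightarrow> (nat \<Rightarrow> 'a \<Rightarrow> 'a) \<Rightarrow> (nat \<Rightarrow> 'a) ring" where
  "inv_lim X p = \<lparr>carrier = {x. \<forall>n. x n \<in> carrier (X n) \<and> p n (x (Suc n)) = x n},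
     mult = \<lambda>x y n. x n \<otimes>\<^bsub>X n\<^esub> y n, one = \<lambda>n. \<one>\<^bsub>X n\<^esub>,
     ring.zero = \<lambda>n. \<zero>\<^bsub>X n\<^esub>, ring.add = \<lambda>x y n. x n \<oplus>\<^bsub>X n\<^esub> y n\<rparr>"

text \<open>The projection from \<open>A/I\<^sup>n\<^sup>+\<^sup>1\<close> to \<open>A/I\<^sup>n\<close> sends a coset \<open>C\<close> to \<open>I\<^sup>n + C\<close>.\<close>

definition completion :: "('k, 'a) module \<Rightarrow> 'a set \<Rightarrow> ('k, nat \<Rightarrow> 'a set) module" where
  "completion A I =
     mk_module (inv_lim (\<lambda>n. quot A (ideal_pow A I n)) (\<lambda>n C. ideal_pow A I n <+>\<^bsub>A\<^esub> C))
       (\<lambda>c x n. c \<odot>\<^bsub>quot A (ideal_pow A I n)\<^esub> x n)"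

definition complete_local_algebra :: "('k, 'e) ring_scheme \<Rightarrow> ('k, 'a) module \<Rightarrow> bool" where
  "complete_local_algebra K A \<longleftrightarrow> nc_algebra K A \<and> local_ring A \<and>
     (let \<mm> = jacobson_radical A in
       bij_betw (\<lambda>c. \<mm> +>\<^bsub>A\<^esub> (c \<odot>\<^bsub>A\<^esub> \<one>\<^bsub>A\<^esub>)) (carrier K) (carrier (quot A \<mm>)) \<and>
       vectorspace.fin_dim K (quot (A\<lparr>carrier := \<mm>\<rparr>) (ideal_pow A \<mm> 2)) \<and>
       bij_betw (\<lambda>a n. ideal_pow A \<mm> n +>\<^bsub>A\<^esub> a) (carrier A) (carrier (completion A \<mm>)))"

definition artinian_local_algebra :: "('k, 'e) ring_scheme \<Rightarrow> ('k, 'a) module \<Rightarrow> bool" where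
  "artinian_local_algebra K A \<longleftrightarrow> complete_local_algebra K A \<and> left_artinian A"

text \<open>The residue class of \<open>a\<close>, read as a scalar through the isomorphism of \<open>K\<close> with the residue
  field.\<close>

definition residue :: "('k, 'e) ring_scheme \<Rightarrow> ('k, 'a) module \<Rightarrow> 'a \<Rightarrow> 'k" where
  "residue K A a =
     (THE c. c \<in> carrier K \<and> a \<ominus>\<^bsub>A\<^esub> (c \<odot>\<^bsub>A\<^esub> \<one>\<^bsub>A\<^esub>) \<in> jacobson_radical A)"

definition ideal_closure :: "('a, 'e) ring_scheme \<Rightarrow> 'a set \<Rightarrow> 'a set" where
  "ideal_closure A I = (\<Inter>n. I <+>\<^bsub>A\<^esub> ideal_pow A (jacobson_radical A) n)"

definition closed_ideal :: "'a set \<Rightarrow> ('a, 'e) ring_scheme \<Rightarrow> bool" where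
  "closed_ideal I A \<longleftrightarrow> ideal I A \<and> I = ideal_closure A I"

definition analytically_generated ::
  "('a, 'e) ring_scheme \<Rightarrow> 'a set \<Rightarrow> 'a set \<Rightarrow> bool" where
  "analytically_generated A I S \<longleftrightarrow> S \<subseteq> carrier A \<and> I = ideal_closure A (genideal A S)"


section \<open>Non-commutative formal power series\<close>

text \<open>The free algebra on \<open>t\<^sub>0, \<dots>, t\<^sub>r\<^sub>-\<^sub>1\<close>: finitely supported functions on the words in the
  letters \<open>0, \<dots>, r - 1\<close>, with the concatenation product.\<close>

definition free_algebra :: "('k, 'e) ring_scheme \<Rightarrow> nat \<Rightarrow> ('k, nat list \<Rightarrow> 'k) module" where
  "free_algebra K r = \<lparr>
     carrier = {u. (\<forall>w. u w \<in> carrier K) \<and> finite {w. u w \<noteq> \<zero>\<^bsub>K\<^esub>} \<and>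
                   (\<forall>w. u w \<noteq> \<zero>\<^bsub>K\<^esub> \<longrightarrow> set w \<subseteq> {..<r})},
     mult = \<lambda>u v w. \<Oplus>\<^bsub>K\<^esub>i\<in>{..length w}. u (take i w) \<otimes>\<^bsub>K\<^esub> v (drop i w),
     one = \<lambda>w. if w = [] then \<one>\<^bsub>K\<^esub> else \<zero>\<^bsub>K\<^esub>,
     ring.zero = \<lambda>w. \<zero>\<^bsub>K\<^esub>,
     ring.add = \<lambda>u v w. u w \<oplus>\<^bsub>K\<^esub> v w,
     smult = \<lambda>c u w. c \<otimes>\<^bsub>K\<^esub> u w\<rparr>"

definition free_algebra_var :: "('k, 'e) ring_scheme \<Rightarrow> nat \<Rightarrow> nat list \<Rightarrow> 'k" where
  "free_algebra_var K i = (\<lambda>w. if w = [i] then \<one>\<^bsub>K\<^esub> else \<zero>\<^bsub>K\<^esub>)"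

definition nc_power_series ::
  "('k, 'e) ring_scheme \<Rightarrow> nat \<Rightarrow> ('k, nat \<Rightarrow> (nat list \<Rightarrow> 'k) set) module" where
  "nc_power_series K r = completion (free_algebra K r)
     (genideal (free_algebra K r) (free_algebra_var K ` {..<r}))"


section \<open>Tensor products over the ground field\<close>

text \<open>\<open>V \<otimes>\<^sub>K W\<close> is the free abelian group on \<open>V \<times> W\<close> modulo the subgroup generated by the
  relations of biadditivity and \<open>K\<close>-balancedness.\<close>

type_synonym ('v, 'w) tensor = "(('v \<times> 'w) \<Rightarrow>\<^sub>0 int) set"

definition tensor_rels ::
  "('k, 'e) ring_scheme \<Rightarrow> ('k, 'v) module \<Rightarrow> ('k, 'w) module \<Rightarrow> (('v \<times> 'w) \<Rightarrow>\<^sub>0 int) set" where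
  "tensor_rels K V W = generate (free_Abelian_group (carrier V \<times> carrier W))
     ({frag_of (x \<oplus>\<^bsub>V\<^esub> y, z) - frag_of (x, z) - frag_of (y, z) | x y z.
         x \<in> carrier V \<and> y \<in> carrier V \<and> z \<in> carrier W} \<union>
      {frag_of (x, y \<oplus>\<^bsub>W\<^esub> z) - frag_of (x, y) - frag_of (x, z) | x y z.
         x \<in> carrier V \<and> y \<in> carrier W \<and> z \<in> carrier W} \<union>
      {frag_of (c \<odot>\<^bsub>V\<^esub> x, y) - frag_of (x, c \<odot>\<^bsub>W\<^esub> y) | c x y.
         c \<in> carrier K \<and> x \<in> carrier V \<and> y \<in> carrier W})"

definition tensor_group ::
  "('k, 'e) ring_scheme \<Rightarrow> ('k, 'v) module \<Rightarrow> ('k, 'w) module \<Rightarrow> ('v, 'w) tensor monoid" where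
  "tensor_group K V W = free_Abelian_group (carrier V \<times> carrier W) Mod tensor_rels K V W"

text \<open>The same group in additive notation; the multiplication is a dummy.\<close>

definition tensor_add_group ::
  "('k, 'e) ring_scheme \<Rightarrow> ('k, 'v) module \<Rightarrow> ('k, 'w) module \<Rightarrow> ('v, 'w) tensor ring" where
  "tensor_add_group K V W = \<lparr>carrier = carrier (tensor_group K V W),
     mult = undefined, one = undefined,
     ring.zero = monoid.one (tensor_group K V W), ring.add = monoid.mult (tensor_group K V W)\<rparr>"

definition pure_tensor ::
  "('k, 'e) ring_scheme \<Rightarrow> ('k, 'v) module \<Rightarrow> ('k, 'w) module \<Rightarrow> 'v \<Rightarrow> 'w \<Rightarrow> ('v, 'w) tensor" where
  "pure_tensor K V W x y =
     tensor_rels K V W #>\<^bsub>free_Abelian_group (carrier V \<times> carrier W)\<^esub> frag_of (x, y)"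

text \<open>The additive map from \<open>V \<otimes>\<^sub>K W\<close> to \<open>M\<close> that sends \<open>x \<otimes> y\<close> to \<open>g (x, y)\<close>, for a biadditive
  balanced \<open>g\<close> (then all formal sums in one coset have the same value).\<close>

definition tensor_lift :: "('m, 'e) ring_scheme \<Rightarrow> ('v \<times> 'w \<Rightarrow> 'm) \<Rightarrow> ('v, 'w) tensor \<Rightarrow> 'm" where
  "tensor_lift M g X = the_elem
     ((\<lambda>u. \<Oplus>\<^bsub>M\<^esub>p\<in>Poly_Mapping.keys u. add_pow M (Poly_Mapping.lookup u p) (g p)) ` X)"

definition tensor_algebra ::
  "('k, 'e) ring_scheme \<Rightarrow> ('k, 'a) module \<Rightarrow> ('k, 'b) module \<Rightarrow> ('a, 'b) tensor ring" where
  "tensor_algebra K A B = (tensor_add_group K A B)\<lparr>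
     mult := \<lambda>X Y. tensor_lift (tensor_add_group K A B) (\<lambda>(a, b).
               tensor_lift (tensor_add_group K A B) (\<lambda>(a', b').
                 pure_tensor K A B (a \<otimes>\<^bsub>A\<^esub> a') (b \<otimes>\<^bsub>B\<^esub> b')) Y) X,
     one := pure_tensor K A B \<one>\<^bsub>A\<^esub> \<one>\<^bsub>B\<^esub>\<rparr>"

text \<open>For a left \<open>R\<close>-module \<open>M\<close>, the left \<open>R \<otimes>\<^sub>K A\<^sup>o\<^sup>p\<close>-module \<open>M \<otimes>\<^sub>K A\<close>, with
  \<open>(r \<otimes> a) (x \<otimes> b) = r x \<otimes> b a\<close>.\<close>

definition tensor_module ::
  "('k, 'e) ring_scheme \<Rightarrow> ('k, 'r) module \<Rightarrow> ('r, 'm) module \<Rightarrow> ('k, 'a) module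
    \<Rightarrow> (('r, 'a) tensor, ('m, 'a) tensor) module" where
  "tensor_module K R M A = (let V = restrict_scalars K R M; MA = tensor_add_group K V A in
     mk_module MA (\<lambda>U X.
       tensor_lift MA (\<lambda>(r, a). tensor_lift MA (\<lambda>(x, b).
         pure_tensor K V A (r \<odot>\<^bsub>M\<^esub> x) (b \<otimes>\<^bsub>A\<^esub> a)) X) U))"

text \<open>The map \<open>id \<otimes> h\<close> from \<open>V \<otimes>\<^sub>K A\<close> to \<open>V \<otimes>\<^sub>K B\<close>, for a linear map \<open>h\<close> from \<open>A\<close> to \<open>B\<close>.\<close>

definition tensor_map ::
  "('k, 'e) ring_scheme \<Rightarrow> ('k, 'v) module \<Rightarrow> ('k, 'b) module \<Rightarrow> ('a \<Rightarrow> 'b)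
    \<Rightarrow> ('v, 'a) tensor \<Rightarrow> ('v, 'b) tensor" where
  "tensor_map K V B h =
     tensor_lift (tensor_add_group K V B) (\<lambda>(x, a). pure_tensor K V B x (h a))"


section \<open>Complexes and their Ext spaces\<close>

text \<open>A graded module is given by the family of its homogeneous components.\<close>

definition is_complex ::
  "('r, 'e) ring_scheme \<Rightarrow> (int \<Rightarrow> ('r, 'm) module) \<Rightarrow> (int \<Rightarrow> 'm \<Rightarrow> 'm) \<Rightarrow> bool" where
  "is_complex R F d \<longleftrightarrow> (\<forall>n. d n \<in> lmod_hom R (F n) (F (n - 1))) \<and>
     (\<forall>n. \<forall>x\<in>carrier (F n). d (n - 1) (d n x) = \<zero>\<^bsub>F (n - 2)\<^esub>)"

definition complexes_isomorphic ::
  "('r, 'e) ring_scheme \<Rightarrow> (int \<Rightarrow> ('r, 'm) module) \<Rightarrow> (int \<Rightarrow> 'm \<Rightarrow> 'm) \<Rightarrow> (int \<Rightarrow> 'm \<Rightarrow> 'm)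
    \<Rightarrow> bool" where
  "complexes_isomorphic R F d d' \<longleftrightarrow> (\<exists>\<phi> :: int \<Rightarrow> 'm \<Rightarrow> 'm.
     (\<forall>n. \<phi> n \<in> lmod_hom R (F n) (F n) \<and> bij_betw (\<phi> n) (carrier (F n)) (carrier (F n))) \<and>
     (\<forall>n. \<forall>x\<in>carrier (F n). \<phi> (n - 1) (d n x) = d' n (\<phi> n x)))"

definition projective_complex ::
  "('r, 'e) ring_scheme \<Rightarrow> (int \<Rightarrow> ('r, 'm) module) \<Rightarrow> (int \<Rightarrow> 'm \<Rightarrow> 'm) \<Rightarrow> bool" where
  "projective_complex R F d \<longleftrightarrow> (\<forall>n. projective_lmodule R (F n)) \<and> is_complex R F d"

text \<open>The \<open>K\<close>-space of graded homomorphisms of degree \<open>j\<close> from \<open>F\<close> to \<open>F[j]\<close>; the multiplication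
  is a dummy.\<close>

definition graded_homs ::
  "('k, 'r) module \<Rightarrow> (int \<Rightarrow> ('r, 'm) module) \<Rightarrow> int \<Rightarrow> ('k, int \<Rightarrow> 'm \<Rightarrow> 'm) module" where
  "graded_homs R F j = \<lparr>
     carrier = {f. \<forall>n. f n \<in> lmod_hom R (F n) (F (n + j))},
     mult = undefined, one = undefined,
     ring.zero = \<lambda>n. \<lambda>x\<in>carrier (F n). \<zero>\<^bsub>F (n + j)\<^esub>,
     ring.add = \<lambda>f g n. \<lambda>x\<in>carrier (F n). f n x \<oplus>\<^bsub>F (n + j)\<^esub> g n x,
     smult = \<lambda>c f n. \<lambda>x\<in>carrier (F n). (c \<odot>\<^bsub>R\<^esub> \<one>\<^bsub>R\<^esub>) \<odot>\<^bsub>F (n + j)\<^esub> f n x\<rparr>"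

text \<open>\<open>signed M j x\<close> is \<open>(-1)\<^sup>j x\<close>.\<close>

definition signed :: "('a, 'e) ring_scheme \<Rightarrow> int \<Rightarrow> 'a \<Rightarrow> 'a" where
  "signed M j x = (if even j then x else \<ominus>\<^bsub>M\<^esub> x)"

definition chain_homs ::
  "('k, 'r) module \<Rightarrow> (int \<Rightarrow> ('r, 'm) module) \<Rightarrow> (int \<Rightarrow> 'm \<Rightarrow> 'm) \<Rightarrow> int
    \<Rightarrow> (int \<Rightarrow> 'm \<Rightarrow> 'm) set" where
  "chain_homs R F d j = {f \<in> carrier (graded_homs R F j). \<forall>n. \<forall>x\<in>carrier (F n).
     f (n - 1) (d n x) \<oplus>\<^bsub>F (n + j - 1)\<^esub> signed (F (n + j - 1)) (j + 1) (d (n + j) (f n x))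
       = \<zero>\<^bsub>F (n + j - 1)\<^esub>}"

definition null_homotopic ::
  "('k, 'r) module \<Rightarrow> (int \<Rightarrow> ('r, 'm) module) \<Rightarrow> (int \<Rightarrow> 'm \<Rightarrow> 'm) \<Rightarrow> int
    \<Rightarrow> (int \<Rightarrow> 'm \<Rightarrow> 'm) set" where
  "null_homotopic R F d j = {f \<in> carrier (graded_homs R F j).
     \<exists>h\<in>carrier (graded_homs R F (j + 1)). \<forall>n. \<forall>x\<in>carrier (F n).
       f n x = h (n - 1) (d n x) \<oplus>\<^bsub>F (n + j)\<^esub> signed (F (n + j)) j (d (n + j + 1) (h n x))}"

definition Ext_space ::
  "('k, 'r) module \<Rightarrow> (int \<Rightarrow> ('r, 'm) module) \<Rightarrow> (int \<Rightarrow> 'm \<Rightarrow> 'm) \<Rightarrow> int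
    \<Rightarrow> ('k, (int \<Rightarrow> 'm \<Rightarrow> 'm) set) module" where
  "Ext_space R F d i =
     quot ((graded_homs R F (- i))\<lparr>carrier := chain_homs R F d (- i)\<rparr>) (null_homotopic R F d (- i))"


section \<open>Lifts to artinian algebras\<close>

text \<open>The map from \<open>M \<otimes>\<^sub>K A\<close> to \<open>(M \<otimes>\<^sub>K A) \<otimes>\<^sub>A K = M\<close>.\<close>

definition tensor_reduction ::
  "('k, 'e) ring_scheme \<Rightarrow> ('k, 'r) module \<Rightarrow> ('r, 'm) module \<Rightarrow> ('k, 'a) module
    \<Rightarrow> ('m, 'a) tensor \<Rightarrow> 'm" where
  "tensor_reduction K R M A =
     tensor_lift M (\<lambda>(x, a). (residue K A a \<odot>\<^bsub>R\<^esub> \<one>\<^bsub>R\<^esub>) \<odot>\<^bsub>M\<^esub> x)"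

text \<open>\<open>\<Delta> \<otimes>\<^sub>A K = d\<close> is expressed by compatibility with the surjective reduction maps, which
  determines \<open>\<Delta> \<otimes>\<^sub>A K\<close>.\<close>

definition artinian_lifts ::
  "('k, 'e) ring_scheme \<Rightarrow> ('k, 'r) module \<Rightarrow> (int \<Rightarrow> ('r, 'm) module) \<Rightarrow> (int \<Rightarrow> 'm \<Rightarrow> 'm)
    \<Rightarrow> ('k, 'a) module \<Rightarrow> (int \<Rightarrow> ('m, 'a) tensor \<Rightarrow> ('m, 'a) tensor) set" where
  "artinian_lifts K R F d A =
     {\<Delta>. is_complex (tensor_algebra K R (opp A)) (\<lambda>n. tensor_module K R (F n) A) \<Delta> \<and>
        (\<forall>n. \<forall>X\<in>carrier (tensor_module K R (F n) A).
           tensor_reduction K R (F (n - 1)) A (\<Delta> n X) = d n (tensor_reduction K R (F n) A X))}"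

definition lift_iso ::
  "('k, 'e) ring_scheme \<Rightarrow> ('k, 'r) module \<Rightarrow> (int \<Rightarrow> ('r, 'm) module) \<Rightarrow> (int \<Rightarrow> 'm \<Rightarrow> 'm)
    \<Rightarrow> ('k, 'a) module
    \<Rightarrow> ((int \<Rightarrow> ('m, 'a) tensor \<Rightarrow> ('m, 'a) tensor) \<times> (int \<Rightarrow> ('m, 'a) tensor \<Rightarrow> ('m, 'a) tensor)) set"
  where
  "lift_iso K R F d A =
     {(\<Delta>, \<Delta>'). \<Delta> \<in> artinian_lifts K R F d A \<and> \<Delta>' \<in> artinian_lifts K R F d A \<and>
        complexes_isomorphic (tensor_algebra K R (opp A)) (\<lambda>n. tensor_module K R (F n) A) \<Delta> \<Delta>'}"

text \<open>\<open>\<Delta>'\<close> is the base change of \<open>\<Delta>\<close> along the algebra map \<open>h\<close> from \<open>A\<close> to \<open>B\<close>. As the image of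
  \<open>F \<otimes>\<^sub>K A\<close> generates \<open>F \<otimes>\<^sub>K B = (F \<otimes>\<^sub>K A) \<otimes>\<^sub>A B\<close> over \<open>B\<close>, the linear map \<open>\<Delta>' = \<Delta> \<otimes>\<^sub>A B\<close> is
  determined by the commuting square.\<close>

definition is_base_change ::
  "('k, 'e) ring_scheme \<Rightarrow> ('k, 'r) module \<Rightarrow> (int \<Rightarrow> ('r, 'm) module)
    \<Rightarrow> ('k, 'b) module \<Rightarrow> ('k, 'a) module \<Rightarrow> ('a \<Rightarrow> 'b)
    \<Rightarrow> (int \<Rightarrow> ('m, 'a) tensor \<Rightarrow> ('m, 'a) tensor)
    \<Rightarrow> (int \<Rightarrow> ('m, 'b) tensor \<Rightarrow> ('m, 'b) tensor) \<Rightarrow> bool" where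
  "is_base_change K R F B A h \<Delta> \<Delta>' \<longleftrightarrow>
     (\<forall>n. \<Delta>' n \<in> lmod_hom (tensor_algebra K R (opp B))
             (tensor_module K R (F n) B) (tensor_module K R (F (n - 1)) B)) \<and>
     (\<forall>n. \<forall>X\<in>carrier (tensor_module K R (F n) A).
        \<Delta>' n (tensor_map K (restrict_scalars K R (F n)) B h X) =
        tensor_map K (restrict_scalars K R (F (n - 1))) B h (\<Delta> n X))"

definition lift_functor ::
  "('k, 'e) ring_scheme \<Rightarrow> ('k, 'r) module \<Rightarrow> (int \<Rightarrow> ('r, 'm) module) \<Rightarrow> (int \<Rightarrow> 'm \<Rightarrow> 'm)
    \<Rightarrow> ('k, 'a) module \<Rightarrow> (int \<Rightarrow> ('m, 'a) tensor \<Rightarrow> ('m, 'a) tensor) set set" where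
  "lift_functor K R F d A = artinian_lifts K R F d A // lift_iso K R F d A"

definition lift_functor_map ::
  "('k, 'e) ring_scheme \<Rightarrow> ('k, 'r) module \<Rightarrow> (int \<Rightarrow> ('r, 'm) module) \<Rightarrow> (int \<Rightarrow> 'm \<Rightarrow> 'm)
    \<Rightarrow> ('k, 'b) module \<Rightarrow> ('k, 'a) module \<Rightarrow> ('a \<Rightarrow> 'b)
    \<Rightarrow> (int \<Rightarrow> ('m, 'a) tensor \<Rightarrow> ('m, 'a) tensor) set
    \<Rightarrow> (int \<Rightarrow> ('m, 'b) tensor \<Rightarrow> ('m, 'b) tensor) set" where
  "lift_functor_map K R F d B A h C =
     lift_iso K R F d B `` {\<Delta>'. \<exists>\<Delta>\<in>C. is_base_change K R F B A h \<Delta> \<Delta>'}"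


section \<open>Lifts to complete algebras\<close>

definition trunc :: "('k, 'a) module \<Rightarrow> nat \<Rightarrow> ('k, 'a set) module" where
  "trunc A n = quot A (ideal_pow A (jacobson_radical A) n)"

definition trunc_proj :: "('k, 'a) module \<Rightarrow> nat \<Rightarrow> 'a set \<Rightarrow> 'a set" where
  "trunc_proj A n C = ideal_pow A (jacobson_radical A) n <+>\<^bsub>A\<^esub> C"

definition completed_tensor_algebra ::
  "('k, 'e) ring_scheme \<Rightarrow> ('k, 'r) module \<Rightarrow> ('k, 'a) module \<Rightarrow> (nat \<Rightarrow> ('r, 'a set) tensor) ring"
  where
  "completed_tensor_algebra K R A =
     inv_lim (\<lambda>n. tensor_algebra K R (opp (trunc A n)))
       (\<lambda>n. tensor_map K R (opp (trunc A n)) (trunc_proj A n))"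

definition completed_tensor_module ::
  "('k, 'e) ring_scheme \<Rightarrow> ('k, 'r) module \<Rightarrow> ('r, 'm) module \<Rightarrow> ('k, 'a) module
    \<Rightarrow> (nat \<Rightarrow> ('r, 'a set) tensor, nat \<Rightarrow> ('m, 'a set) tensor) module" where
  "completed_tensor_module K R M A =
     mk_module
       (inv_lim (\<lambda>n. tensor_module K R M (trunc A n))
          (\<lambda>n. tensor_map K (restrict_scalars K R M) (trunc A n) (trunc_proj A n)))
       (\<lambda>U X n. U n \<odot>\<^bsub>tensor_module K R M (trunc A n)\<^esub> X n)"

text \<open>The reduction modulo the maximal ideal factors through the component \<open>F \<otimes>\<^sub>K P/\<mm>\<^sup>1\<close>.\<close>

definition complete_lifts ::
  "('k, 'e) ring_scheme \<Rightarrow> ('k, 'r) module \<Rightarrow> (int \<Rightarrow> ('r, 'm) module) \<Rightarrow> (int \<Rightarrow> 'm \<Rightarrow> 'm)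
    \<Rightarrow> ('k, 'a) module \<Rightarrow> (int \<Rightarrow> (nat \<Rightarrow> ('m, 'a set) tensor) \<Rightarrow> (nat \<Rightarrow> ('m, 'a set) tensor)) set"
  where
  "complete_lifts K R F d P =
     {\<Delta>. is_complex (completed_tensor_algebra K R P)
           (\<lambda>n. completed_tensor_module K R (F n) P) \<Delta> \<and>
        (\<forall>n. \<forall>X\<in>carrier (completed_tensor_module K R (F n) P).
           tensor_reduction K R (F (n - 1)) (trunc P 1) (\<Delta> n X 1) =
           d n (tensor_reduction K R (F n) (trunc P 1) (X 1)))}"

text \<open>\<open>\<Delta>N\<close> is the differential on \<open>F \<otimes>\<^sub>K P/\<mm>\<^sup>N\<close> induced by \<open>\<Delta>\<close>.\<close>

definition is_induced ::
  "('k, 'e) ring_scheme \<Rightarrow> ('k, 'r) module \<Rightarrow> (int \<Rightarrow> ('r, 'm) module) \<Rightarrow> ('k, 'a) module \<Rightarrow> nat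
    \<Rightarrow> (int \<Rightarrow> (nat \<Rightarrow> ('m, 'a set) tensor) \<Rightarrow> (nat \<Rightarrow> ('m, 'a set) tensor))
    \<Rightarrow> (int \<Rightarrow> ('m, 'a set) tensor \<Rightarrow> ('m, 'a set) tensor) \<Rightarrow> bool" where
  "is_induced K R F P N \<Delta> \<Delta>N \<longleftrightarrow>
     (\<forall>n. \<Delta>N n \<in> lmod_hom (tensor_algebra K R (opp (trunc P N)))
             (tensor_module K R (F n) (trunc P N)) (tensor_module K R (F (n - 1)) (trunc P N))) \<and>
     (\<forall>n. \<forall>X\<in>carrier (completed_tensor_module K R (F n) P). \<Delta>N n (X N) = \<Delta> n X N)"

definition is_complete_base_change ::
  "('k, 'e) ring_scheme \<Rightarrow> ('k, 'r) module \<Rightarrow> (int \<Rightarrow> ('r, 'm) module)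
    \<Rightarrow> ('k, 'b) module \<Rightarrow> ('k, 'a) module \<Rightarrow> ('a \<Rightarrow> 'b)
    \<Rightarrow> (int \<Rightarrow> (nat \<Rightarrow> ('m, 'a set) tensor) \<Rightarrow> (nat \<Rightarrow> ('m, 'a set) tensor))
    \<Rightarrow> (int \<Rightarrow> ('m, 'b) tensor \<Rightarrow> ('m, 'b) tensor) \<Rightarrow> bool" where
  "is_complete_base_change K R F A P f \<Delta> \<Delta>' \<longleftrightarrow>
     (\<exists>N \<Delta>N. (\<forall>x\<in>ideal_pow P (jacobson_radical P) N. f x = \<zero>\<^bsub>A\<^esub>) \<and>
        is_induced K R F P N \<Delta> \<Delta>N \<and>
        is_base_change K R F A (trunc P N) (\<lambda>C. the_elem (f ` C)) \<Delta>N \<Delta>')"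

text \<open>The morphism \<open>\<phi>\<close> from \<open>Hom(P, -)\<close> to the functor of lifts: \<open>f\<close> goes to the isomorphism class
  of the base change of \<open>\<Delta>\<close> along \<open>f\<close>.\<close>

definition lift_transformation ::
  "('k, 'e) ring_scheme \<Rightarrow> ('k, 'r) module \<Rightarrow> (int \<Rightarrow> ('r, 'm) module) \<Rightarrow> (int \<Rightarrow> 'm \<Rightarrow> 'm)
    \<Rightarrow> ('k, 'b) module \<Rightarrow> ('k, 'a) module
    \<Rightarrow> (int \<Rightarrow> (nat \<Rightarrow> ('m, 'a set) tensor) \<Rightarrow> (nat \<Rightarrow> ('m, 'a set) tensor))
    \<Rightarrow> ('a \<Rightarrow> 'b) \<Rightarrow> (int \<Rightarrow> ('m, 'b) tensor \<Rightarrow> ('m, 'b) tensor) set" where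
  "lift_transformation K R F d A P \<Delta> f =
     lift_iso K R F d A `` {\<Delta>'. is_complete_base_change K R F A P f \<Delta> \<Delta>'}"

text \<open>The category of artinian test algebras is represented by the algebras with carrier in
  \<open>nat \<Rightarrow> 'k\<close>. It is equivalent to the whole category: in an artinian local algebra the maximal
  ideal is nilpotent, so the algebra is finite-dimensional over \<open>K\<close> and is isomorphic to one whose
  carrier is the set of functions from \<open>nat\<close> to \<open>K\<close> vanishing outside \<open>{..<dim}\<close>.\<close>

definition universal_lift ::
  "('k, 'e) ring_scheme \<Rightarrow> ('k, 'r) module \<Rightarrow> (int \<Rightarrow> ('r, 'm) module) \<Rightarrow> (int \<Rightarrow> 'm \<Rightarrow> 'm)
    \<Rightarrow> ('k, 'a) module \<Rightarrow> (int \<Rightarrow> (nat \<Rightarrow> ('m, 'a set) tensor) \<Rightarrow> (nat \<Rightarrow> ('m, 'a set) tensor))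
    \<Rightarrow> bool" where
  "universal_lift K R F d P \<Delta> \<longleftrightarrow>
     complete_local_algebra K P \<and> \<Delta> \<in> complete_lifts K R F d P \<and>
     (\<forall>A :: ('k, nat \<Rightarrow> 'k) module. artinian_local_algebra K A \<longrightarrow>
        bij_betw (lift_transformation K R F d A P \<Delta>) (alg_homs K P A) (lift_functor K R F d A)) \<and>
     (\<forall>(A :: ('k, nat \<Rightarrow> 'k) module) (B :: ('k, nat \<Rightarrow> 'k) module).
        artinian_local_algebra K A \<and> artinian_local_algebra K B \<longrightarrow>
        (\<forall>h\<in>alg_homs K A B. \<forall>f\<in>alg_homs K P A.
           lift_transformation K R F d B P \<Delta> (compose (carrier P) h f) =
           lift_functor_map K R F d B A h (lift_transformation K R F d A P \<Delta> f)))"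

definition is_parameter_algebra ::
  "('k, 'e) ring_scheme \<Rightarrow> ('k, 'r) module \<Rightarrow> (int \<Rightarrow> ('r, 'm) module) \<Rightarrow> (int \<Rightarrow> 'm \<Rightarrow> 'm)
    \<Rightarrow> ('k, 'a) module \<Rightarrow> bool" where
  "is_parameter_algebra K R F d P \<longleftrightarrow> (\<exists>\<Delta>. universal_lift K R F d P \<Delta>)"

end

theory Submission
  imports Defs
begin

text \<open>For \<open>n \<ge> 2\<close> put \<open>J = I\<^sub>0 + \<mm>\<^sup>n\<close> and \<open>A = T/J\<close>, and let \<open>\<Delta>\<close> be the lift of the complex to \<open>A\<close> that
  corresponds to the projection \<open>P\<^sub>0 \<rightarrow> A\<close>. A functional \<open>\<chi>\<close> on \<open>I\<^sub>0\<close> modulo \<open>\<mm>I\<^sub>0 + I\<^sub>0\<mm> + \<mm>\<^sup>n\<close> defines a small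
  extension \<open>B = T/(J \<inter> ker \<chi>)\<close> of \<open>A\<close>, and the obstruction to lifting \<open>\<Delta>\<close> to \<open>B\<close> is a class in \<open>Ext\<^sup>2\<close>
  that depends linearly on \<open>\<chi>\<close>. If it vanishes, universality extends the projection to a homomorphism
  \<open>P\<^sub>0 \<rightarrow> B\<close>. The composite \<open>T \<rightarrow> P\<^sub>0 \<rightarrow> B\<close> differs from the canonical map \<open>T \<rightarrow> B\<close> by values in \<open>J/(J \<inter> ker \<chi>)\<close>,
  hence agrees with it on \<open>\<mm>\<^sup>2 \<supseteq> I\<^sub>0\<close>, and so \<open>\<chi> = 0\<close> on \<open>I\<^sub>0\<close>. Therefore at most \<open>dim Ext\<^sup>2\<close> elements of \<open>I\<^sub>0\<close> are
  independent modulo \<open>\<mm>I\<^sub>0 + I\<^sub>0\<mm> + \<mm>\<^sup>n\<close>, for every \<open>n\<close>. A maximal independent family, over all \<open>n\<close>,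
  generates \<open>I\<^sub>0\<close> analytically by Nakayama's argument.\<close>

section \<open>Tensor products\<close>

text \<open>All functionals \<chi> are treated with one choice of data: a K-linear section of T ->
  T/J lifts \<Delta> to a single map \<open>D\<close> on F \<otimes> T before any small extension is
  chosen. The obstruction for \<chi> is \<chi> applied to \<open>D \<circ> D\<close>, so it is
  visibly linear in \<chi>, and the extensions B for different \<chi> never have to be compared. The
  section also describes the kernel of F \<otimes> T -> F \<otimes> T/J without exactness arguments.
  The truncation by \<mm>^n is forced by the universal property, which speaks only of artinian
  algebras: T/J and B become finite-dimensional, and both are written in coordinates so that they
  live on the type of the test algebras. The price is that independence is seen only modulo \<mm>^n.
  But a family that is independent at level n stays independent at every higher level, and the bound
  dim Ext^2 is the same for all n. So one p is maximal for all levels at once, which lets Nakayama's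
  induction raise n without changing the generators.\<close>

definition balanced ::
  "('k, 'e) ring_scheme \<Rightarrow> ('k, 'v) module \<Rightarrow> ('k, 'w) module \<Rightarrow> ('m, 'f) ring_scheme
    \<Rightarrow> ('v \<times> 'w \<Rightarrow> 'm) \<Rightarrow> bool" where
  "balanced K V W M g \<longleftrightarrow> abelian_group M \<and>
     (\<forall>x\<in>carrier V. \<forall>y\<in>carrier W. g (x, y) \<in> carrier M) \<and>
     (\<forall>x\<in>carrier V. \<forall>x'\<in>carrier V. \<forall>y\<in>carrier W.
        g (x \<oplus>\<^bsub>V\<^esub> x', y) = g (x, y) \<oplus>\<^bsub>M\<^esub> g (x', y)) \<and>
     (\<forall>x\<in>carrier V. \<forall>y\<in>carrier W. \<forall>y'\<in>carrier W.
        g (x, y \<oplus>\<^bsub>W\<^esub> y') = g (x, y) \<oplus>\<^bsub>M\<^esub> g (x, y')) \<and>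
     (\<forall>c\<in>carrier K. \<forall>x\<in>carrier V. \<forall>y\<in>carrier W.
        g (c \<odot>\<^bsub>V\<^esub> x, y) = g (x, c \<odot>\<^bsub>W\<^esub> y))"

text \<open>The expression inside \<open>tensor_lift\<close>, namely the homomorphism from the free
  abelian group that extends \<open>g\<close>. Named separately, it turns independence of the
  representative into a statement about its kernel.\<close>

definition frag_eval :: "('m, 'f) ring_scheme \<Rightarrow> ('a \<Rightarrow> 'm) \<Rightarrow> ('a \<Rightarrow>\<^sub>0 int) \<Rightarrow> 'm" where
  "frag_eval M g u =
     (\<Oplus>\<^bsub>M\<^esub>p\<in>Poly_Mapping.keys u. add_pow M (Poly_Mapping.lookup u p) (g p))"

lemma tensor_lift_frag_eval: "tensor_lift M g X = the_elem (frag_eval M g ` X)"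
  by (simp add: tensor_lift_def frag_eval_def)

text \<open>Terms may cancel in a sum, so the keys of \<open>u + v\<close> can be fewer than those
  of \<open>u\<close> and \<open>v\<close> together. Additivity therefore compares all sums over one
  common finite index set, where the surplus terms are zero multiples.\<close>

lemma (in abelian_group) frag_eval_superset:
  assumes "finite A" "Poly_Mapping.keys u \<subseteq> A" "\<And>p. p \<in> A \<Longrightarrow> g p \<in> carrier G"
  shows "frag_eval G g u = (\<Oplus>p\<in>A. add_pow G (Poly_Mapping.lookup u p) (g p))"
  unfolding frag_eval_def
proof (rule add.finprod_mono_neutral_cong_left)
  show "\<And>i. i \<in> A - Poly_Mapping.keys u \<Longrightarrow> add_pow G (Poly_Mapping.lookup u i) (g i) = \<zero>"
    by (simp add: in_keys_iff add_pow_def)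
  show "(\<lambda>p. add_pow G (Poly_Mapping.lookup u p) (g p)) \<in> A \<rightarrow> carrier G"
    using assms(3) by (intro Pi_I add.int_pow_closed)
qed (use assms in auto)

lemma (in abelian_group) frag_eval_closed:
  assumes "\<And>p. p \<in> S \<Longrightarrow> g p \<in> carrier G" "Poly_Mapping.keys u \<subseteq> S"
  shows "frag_eval G g u \<in> carrier G"
  unfolding frag_eval_def using assms by (intro finsum_closed) (auto intro!: add.int_pow_closed)

lemma (in abelian_group) frag_eval_add:
  assumes g: "\<And>p. p \<in> S \<Longrightarrow> g p \<in> carrier G"
    and u: "Poly_Mapping.keys u \<subseteq> S" and v: "Poly_Mapping.keys v \<subseteq> S"
  shows "frag_eval G g (u + v) = frag_eval G g u \<oplus> frag_eval G g v"
proof -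
  let ?A = "Poly_Mapping.keys u \<union> Poly_Mapping.keys v"
  have A: "finite ?A" "\<And>p. p \<in> ?A \<Longrightarrow> g p \<in> carrier G" using g u v by auto
  have "frag_eval G g (u + v)
      = (\<Oplus>p\<in>?A. add_pow G (Poly_Mapping.lookup u p + Poly_Mapping.lookup v p) (g p))"
    using A Poly_Mapping.keys_add[of u v] by (subst frag_eval_superset[of ?A]) (auto simp: lookup_add)
  also have "\<dots> = (\<Oplus>p\<in>?A. add_pow G (Poly_Mapping.lookup u p) (g p)
      \<oplus> add_pow G (Poly_Mapping.lookup v p) (g p))"
    using A(2) by (intro finsum_cong') (auto intro!: add.int_pow_closed simp: add.int_pow_mult)
  also have "\<dots> = (\<Oplus>p\<in>?A. add_pow G (Poly_Mapping.lookup u p) (g p))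
      \<oplus> (\<Oplus>p\<in>?A. add_pow G (Poly_Mapping.lookup v p) (g p))"
    using A(2) by (intro finsum_addf) (auto intro!: add.int_pow_closed)
  also have "\<dots> = frag_eval G g u \<oplus> frag_eval G g v"
    using A frag_eval_superset[of ?A u g] frag_eval_superset[of ?A v g] by simp
  finally show ?thesis .
qed

lemma (in abelian_group) frag_eval_frag_of [simp]:
  "g p \<in> carrier G \<Longrightarrow> frag_eval G g (frag_of p) = g p"
  by (simp add: frag_eval_def add.int_pow_1)

lemma (in abelian_group) frag_eval_hom:
  assumes "\<And>p. p \<in> S \<Longrightarrow> g p \<in> carrier G"
  shows "frag_eval G g \<in> hom (free_Abelian_group S) (add_monoid G)"
  using assms frag_eval_closed[of S g] frag_eval_add[of S g] by (auto simp: hom_def)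

locale tensor_pair = V: module K V + W: module K W
  for K :: "('k, 'e) ring_scheme" (structure) and V :: "('k, 'v) module" and W :: "('k, 'w) module"
begin

abbreviation "fr \<equiv> free_Abelian_group (carrier V \<times> carrier W)"
abbreviation "N \<equiv> tensor_rels K V W"
abbreviation "TG \<equiv> tensor_add_group K V W"
abbreviation "pt \<equiv> pure_tensor K V W"

sublocale fr: comm_group fr
  by (rule abelian_free_Abelian_group)

lemma fr_diff_closed: "u \<in> carrier fr \<Longrightarrow> v \<in> carrier fr \<Longrightarrow> u - v \<in> carrier fr"
  using keys_diff[of u v] by auto

definition "rel_gens = {frag_of (x \<oplus>\<^bsub>V\<^esub> y, z) - frag_of (x, z) - frag_of (y, z) | x y z.
         x \<in> carrier V \<and> y \<in> carrier V \<and> z \<in> carrier W} \<union>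
      {frag_of (x, y \<oplus>\<^bsub>W\<^esub> z) - frag_of (x, y) - frag_of (x, z) | x y z.
         x \<in> carrier V \<and> y \<in> carrier W \<and> z \<in> carrier W} \<union>
      {frag_of (c \<odot>\<^bsub>V\<^esub> x, y) - frag_of (x, c \<odot>\<^bsub>W\<^esub> y) | c x y.
         c \<in> carrier K \<and> x \<in> carrier V \<and> y \<in> carrier W}"

lemma rels_generate: "N = generate fr rel_gens"
  by (simp add: tensor_rels_def rel_gens_def)

lemma rel_gens_closed: "rel_gens \<subseteq> carrier fr"
  unfolding rel_gens_def
  by (intro Un_least subsetI; elim CollectE exE conjE; hypsubst;
      intro fr_diff_closed iffD2[OF frag_of_in_free_Abelian_group]; simp)

lemma subgroup_rels: "subgroup N fr"
  unfolding rels_generate by (rule fr.generate_is_subgroup[OF rel_gens_closed])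

sublocale rels: normal N fr
  using fr.normal_iff_subgroup subgroup_rels by blast

lemma add_monoid_tensor: "add_monoid TG = tensor_group K V W"
  by (simp add: tensor_add_group_def)

sublocale T: abelian_group TG
proof -
  have "comm_group (tensor_group K V W)"
    unfolding tensor_group_def by (rule fr.abelian_FactGroup[OF subgroup_rels])
  then show "abelian_group TG"
    using add_monoid_tensor
    by (metis abelian_group_axioms_def abelian_group_def abelian_monoid_def comm_group.axioms(1))
qed

definition "q u = N #>\<^bsub>fr\<^esub> u"

lemma q_add: "u \<in> carrier fr \<Longrightarrow> v \<in> carrier fr \<Longrightarrow> q (u + v) = q u \<oplus>\<^bsub>TG\<^esub> q v"
  using rels.rcos_sum[of u v] unfolding q_def by (simp add: tensor_add_group_def tensor_group_def)

lemma carrier_TG: "carrier TG = q ` carrier fr"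
  by (simp add: tensor_add_group_def tensor_group_def carrier_FactGroup q_def[abs_def])

lemma q_closed: "u \<in> carrier fr \<Longrightarrow> q u \<in> carrier TG"
  unfolding carrier_TG by (rule imageI)

lemma zero_TG: "\<zero>\<^bsub>TG\<^esub> = N"
  by (simp add: tensor_add_group_def tensor_group_def)

lemma q_rel: "u \<in> N \<Longrightarrow> q u = \<zero>\<^bsub>TG\<^esub>"
  unfolding q_def zero_TG by (rule fr.coset_join2[OF subsetD[OF rels.subset] subgroup_rels])

lemma q_eqI:
  assumes "u - v \<in> N" "u \<in> carrier fr" "v \<in> carrier fr"
  shows "q u = q v"
proof -
  have "q u = q ((u - v) + v)" by (rule arg_cong[OF diff_add_cancel[symmetric]])
  also have "\<dots> = q (u - v) \<oplus>\<^bsub>TG\<^esub> q v" using assms by (intro q_add fr_diff_closed)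
  also have "\<dots> = q v" using assms(1,3) by (simp only: q_rel T.l_zero q_closed)
  finally show ?thesis .
qed

lemma pure_eq: "pt x y = q (frag_of (x, y))"
  unfolding pure_tensor_def q_def by (rule refl)

lemma pure_closed [simp, intro]: "x \<in> carrier V \<Longrightarrow> y \<in> carrier W \<Longrightarrow> pt x y \<in> carrier TG"
  by (auto simp: pure_eq intro!: q_closed)

lemma rels_gen_in: "u \<in> rel_gens \<Longrightarrow> u \<in> N"
  unfolding rels_generate by (rule generate.incl)

lemma pure_add_left:
  assumes "x \<in> carrier V" "x' \<in> carrier V" "y \<in> carrier W"
  shows "pt (x \<oplus>\<^bsub>V\<^esub> x') y = pt x y \<oplus>\<^bsub>TG\<^esub> pt x' y"
proof -
  have "pt (x \<oplus>\<^bsub>V\<^esub> x') y = q (frag_of (x, y) + frag_of (x', y))"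
    unfolding pure_eq
  proof (rule q_eqI)
    show "frag_of (x \<oplus>\<^bsub>V\<^esub> x', y) - (frag_of (x, y) + frag_of (x', y)) \<in> N"
      using assms by (intro rels_gen_in) (auto simp: diff_diff_eq rel_gens_def)
  qed (use assms in \<open>auto intro!: order_trans[OF Poly_Mapping.keys_add]\<close>)
  then show ?thesis using assms by (simp add: q_add pure_eq)
qed

lemma pure_add_right:
  assumes "x \<in> carrier V" "y \<in> carrier W" "y' \<in> carrier W"
  shows "pt x (y \<oplus>\<^bsub>W\<^esub> y') = pt x y \<oplus>\<^bsub>TG\<^esub> pt x y'"
proof -
  have "pt x (y \<oplus>\<^bsub>W\<^esub> y') = q (frag_of (x, y) + frag_of (x, y'))"
    unfolding pure_eq
  proof (rule q_eqI)
    show "frag_of (x, y \<oplus>\<^bsub>W\<^esub> y') - (frag_of (x, y) + frag_of (x, y')) \<in> N"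
      using assms by (intro rels_gen_in) (auto simp: diff_diff_eq rel_gens_def)
  qed (use assms in \<open>auto intro!: order_trans[OF Poly_Mapping.keys_add]\<close>)
  then show ?thesis using assms by (simp add: q_add pure_eq)
qed

lemma pure_smult:
  assumes "c \<in> carrier K" "x \<in> carrier V" "y \<in> carrier W"
  shows "pt (c \<odot>\<^bsub>V\<^esub> x) y = pt x (c \<odot>\<^bsub>W\<^esub> y)"
  unfolding pure_eq using assms by (intro q_eqI rels_gen_in) (auto simp: rel_gens_def)

lemma pure_zero_left: "y \<in> carrier W \<Longrightarrow> pt \<zero>\<^bsub>V\<^esub> y = \<zero>\<^bsub>TG\<^esub>"
  using pure_add_left[of "\<zero>\<^bsub>V\<^esub>" "\<zero>\<^bsub>V\<^esub>" y] T.add.l_cancel_one' by auto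

lemma pure_zero_right: "x \<in> carrier V \<Longrightarrow> pt x \<zero>\<^bsub>W\<^esub> = \<zero>\<^bsub>TG\<^esub>"
  using pure_add_right[of x "\<zero>\<^bsub>W\<^esub>" "\<zero>\<^bsub>W\<^esub>"] T.add.l_cancel_one' by auto

lemma pure_minus_left: "x \<in> carrier V \<Longrightarrow> y \<in> carrier W \<Longrightarrow> pt (\<ominus>\<^bsub>V\<^esub> x) y = \<ominus>\<^bsub>TG\<^esub> pt x y"
  by (rule T.add.inv_equality[symmetric])
    (simp_all add: pure_add_left[symmetric] V.M.l_neg pure_zero_left)

text \<open>There is no case for negatives because the negative of x \<otimes> y is the pure tensor
  (-x) \<otimes> y.\<close>

lemma tensor_induct [consumes 1, case_names pure add]:
  assumes X: "X \<in> carrier TG"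
    and pure: "\<And>x y. x \<in> carrier V \<Longrightarrow> y \<in> carrier W \<Longrightarrow> P (pt x y)"
    and add: "\<And>X Y. X \<in> carrier TG \<Longrightarrow> Y \<in> carrier TG \<Longrightarrow> P X \<Longrightarrow> P Y \<Longrightarrow> P (X \<oplus>\<^bsub>TG\<^esub> Y)"
  shows "P X"
proof -
  have zero: "P \<zero>\<^bsub>TG\<^esub>"
    using pure[of "\<zero>\<^bsub>V\<^esub>" "\<zero>\<^bsub>W\<^esub>"] by (simp add: pure_zero_left)
  \<comment> \<open>The induction principle of the free abelian group has a step for differences, so
    the claim must carry the negative of \<open>u\<close> along.\<close>
  have "P (q u) \<and> P (q (- u))" if "Poly_Mapping.keys u \<subseteq> carrier V \<times> carrier W" for u
  proof (rule free_Abelian_group_induct[OF that, where P = "\<lambda>u. P (q u) \<and> P (q (- u))"], goal_cases)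
    case 1
    have "q 0 = \<zero>\<^bsub>TG\<^esub>" using subgroup.one_closed[OF subgroup_rels] by (intro q_rel) simp
    then show ?case using zero by simp
  next
    case (2 u v)
    have c: "q u \<in> carrier TG" "q v \<in> carrier TG" "q (- u) \<in> carrier TG" "q (- v) \<in> carrier TG"
      using 2 by (auto intro!: q_closed)
    have "q (u - v) = q u \<oplus>\<^bsub>TG\<^esub> q (- v)" using 2 q_add[of u "- v"] by simp
    moreover have "q (- (u - v)) = q v \<oplus>\<^bsub>TG\<^esub> q (- u)" using 2 q_add[of v "- u"] by simp
    ultimately show ?case using 2 c add by simp
  next
    case (3 a)
    obtain x y where a: "a = (x, y)" "x \<in> carrier V" "y \<in> carrier W" using 3 by auto
    have "q (- frag_of a) \<oplus>\<^bsub>TG\<^esub> q (frag_of a) = q (- frag_of a + frag_of a)"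
      using 3 by (subst q_add) auto
    also have "\<dots> = \<zero>\<^bsub>TG\<^esub>" using subgroup.one_closed[OF subgroup_rels] q_rel[of 0] by simp
    finally have "\<ominus>\<^bsub>TG\<^esub> q (frag_of a) = q (- frag_of a)"
      using 3 by (intro T.add.inv_equality) (auto intro!: q_closed)
    then have "q (- frag_of a) = pt (\<ominus>\<^bsub>V\<^esub> x) y" using a pure_minus_left[of x y] by (simp add: pure_eq)
    then show ?case using a pure[of x y] pure[of "\<ominus>\<^bsub>V\<^esub> x" y] by (simp add: pure_eq)
  qed
  then show ?thesis using X by (auto simp: carrier_TG)
qed

section \<open>The universal property of the tensor product\<close>

context
  fixes M :: "('m, 'f) ring_scheme" and g
  assumes bal: "balanced K V W M g"
begin

interpretation M: abelian_group M using bal by (simp add: balanced_def)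

lemma bal_closed: "p \<in> carrier V \<times> carrier W \<Longrightarrow> g p \<in> carrier M"
  using bal by (auto simp: balanced_def)

text \<open>A homomorphism kills a subgroup once it kills the generators, and on the three kinds of
  generators this is what the three laws in \<open>balanced\<close> say.\<close>

lemma frag_eval_rels:
  assumes "u \<in> N" shows "frag_eval M g u = \<zero>\<^bsub>M\<^esub>"
proof -
  interpret h: group_hom fr "add_monoid M" "frag_eval M g"
    by unfold_locales (rule M.frag_eval_hom[OF bal_closed])
  have minus: "frag_eval M g (u - v) = frag_eval M g u \<ominus>\<^bsub>M\<^esub> frag_eval M g v"
    if "u \<in> carrier fr" "v \<in> carrier fr" for u v
    using h.hom_mult[of u "inv\<^bsub>fr\<^esub> v"] h.hom_inv[of v] that
    by (simp add: a_minus_def a_inv_def)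
  have c: "frag_of p - frag_of p' \<in> carrier fr" if "p \<in> carrier V \<times> carrier W"
    "p' \<in> carrier V \<times> carrier W" for p p'
    using that by (intro fr_diff_closed) auto
  have cancel: "a \<oplus>\<^bsub>M\<^esub> b \<ominus>\<^bsub>M\<^esub> a \<ominus>\<^bsub>M\<^esub> b = \<zero>\<^bsub>M\<^esub>" if "a \<in> carrier M" "b \<in> carrier M" for a b
    using that by (simp add: M.minus_eq M.a_assoc M.a_lcomm[of b "\<ominus>\<^bsub>M\<^esub> a"] M.r_neg)
  have vals: "frag_eval M g v = \<zero>\<^bsub>M\<^esub>" if "v \<in> rel_gens" for v
    using that unfolding rel_gens_def
  proof (elim UnE CollectE exE conjE)
    fix x y z assume *: "x \<in> carrier V" "y \<in> carrier V" "z \<in> carrier W"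
      and v: "v = frag_of (x \<oplus>\<^bsub>V\<^esub> y, z) - frag_of (x, z) - frag_of (y, z)"
    have "frag_eval M g v = g (x \<oplus>\<^bsub>V\<^esub> y, z) \<ominus>\<^bsub>M\<^esub> g (x, z) \<ominus>\<^bsub>M\<^esub> g (y, z)"
      using * unfolding v
      by (simp add: minus c bal_closed fr_diff_closed del: carrier_free_Abelian_group_iff)
    then show ?thesis
      using * bal cancel[of "g (x, z)" "g (y, z)"] by (simp add: balanced_def)
  next
    fix x y z assume *: "x \<in> carrier V" "y \<in> carrier W" "z \<in> carrier W"
      and v: "v = frag_of (x, y \<oplus>\<^bsub>W\<^esub> z) - frag_of (x, y) - frag_of (x, z)"
    have "frag_eval M g v = g (x, y \<oplus>\<^bsub>W\<^esub> z) \<ominus>\<^bsub>M\<^esub> g (x, y) \<ominus>\<^bsub>M\<^esub> g (x, z)"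
      using * unfolding v
      by (simp add: minus c bal_closed fr_diff_closed del: carrier_free_Abelian_group_iff)
    then show ?thesis
      using * bal cancel[of "g (x, y)" "g (x, z)"] by (simp add: balanced_def)
  next
    fix k x y assume *: "k \<in> carrier K" "x \<in> carrier V" "y \<in> carrier W"
      and v: "v = frag_of (k \<odot>\<^bsub>V\<^esub> x, y) - frag_of (x, k \<odot>\<^bsub>W\<^esub> y)"
    have "frag_eval M g v = g (k \<odot>\<^bsub>V\<^esub> x, y) \<ominus>\<^bsub>M\<^esub> g (x, k \<odot>\<^bsub>W\<^esub> y)"
      using * unfolding v
      by (simp add: minus c bal_closed fr_diff_closed del: carrier_free_Abelian_group_iff)
    then show ?thesis
      using * bal bal_closed[of "(x, k \<odot>\<^bsub>W\<^esub> y)"] by (simp add: balanced_def M.minus_eq M.r_neg)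
  qed
  have "N \<subseteq> kernel fr (add_monoid M) (frag_eval M g)"
    unfolding rels_generate
  proof (rule fr.generate_subgroup_incl[OF subsetI h.subgroup_kernel])
    fix v assume "v \<in> rel_gens"
    then have "v \<in> carrier fr" "frag_eval M g v = \<zero>\<^bsub>M\<^esub>" using rel_gens_closed vals by blast+
    then show "v \<in> kernel fr (add_monoid M) (frag_eval M g)" by (simp add: kernel_def)
  qed
  then have "u \<in> kernel fr (add_monoid M) (frag_eval M g)" using assms by (rule subsetD)
  then show ?thesis by (simp add: kernel_def)
qed

text \<open>Two members of one coset differ by a relation, on which \<open>frag_eval\<close>
  vanishes. The image of the coset is therefore a singleton and \<open>the_elem\<close> is
  meaningful.\<close>

lemma tensor_lift_q:
  assumes u: "u \<in> carrier fr" shows "tensor_lift M g (q u) = frag_eval M g u"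
proof -
  have "frag_eval M g v = frag_eval M g u" if v: "v \<in> q u" for v
  proof -
    obtain w where w: "w \<in> N" "v = w + u" using v unfolding q_def r_coset_def by auto
    have "w \<in> carrier fr" using w(1) rels.subset by blast
    then show ?thesis
      using u w M.frag_eval_add[where u = w and v = u, OF bal_closed]
        frag_eval_rels[of w]
        M.frag_eval_closed[where u = u, OF bal_closed] by simp
  qed
  moreover have "u \<in> q u" unfolding q_def using u subgroup_rels by (rule fr.rcos_self)
  ultimately have "frag_eval M g ` q u = {frag_eval M g u}" by blast
  then show ?thesis by (simp add: tensor_lift_frag_eval)
qed

lemma tensor_lift_closed: "X \<in> carrier TG \<Longrightarrow> tensor_lift M g X \<in> carrier M"
  using M.frag_eval_closed[OF bal_closed] by (auto simp: carrier_TG tensor_lift_q)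

lemma tensor_lift_add: "X \<in> carrier TG \<Longrightarrow> Y \<in> carrier TG \<Longrightarrow>
    tensor_lift M g (X \<oplus>\<^bsub>TG\<^esub> Y) = tensor_lift M g X \<oplus>\<^bsub>M\<^esub> tensor_lift M g Y"
  using M.frag_eval_add[OF bal_closed]
  by (auto simp: carrier_TG q_add[symmetric] tensor_lift_q
      simp del: carrier_free_Abelian_group_iff intro!: order_trans[OF Poly_Mapping.keys_add])
    (subst tensor_lift_q; auto intro!: order_trans[OF Poly_Mapping.keys_add])

lemma tensor_lift_pure: "x \<in> carrier V \<Longrightarrow> y \<in> carrier W \<Longrightarrow> tensor_lift M g (pt x y) = g (x, y)"
  by (simp add: pure_eq tensor_lift_q bal_closed)

end

end

lemma (in nc_algebra) scalar_mult_left: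
  "c \<in> carrier K \<Longrightarrow> x \<in> carrier A \<Longrightarrow> (c \<odot>\<^bsub>A\<^esub> \<one>\<^bsub>A\<^esub>) \<otimes>\<^bsub>A\<^esub> x = c \<odot>\<^bsub>A\<^esub> x"
  by (simp add: smult_mult_left)

lemma (in nc_algebra) scalar_mult_right:
  "c \<in> carrier K \<Longrightarrow> x \<in> carrier A \<Longrightarrow> x \<otimes>\<^bsub>A\<^esub> (c \<odot>\<^bsub>A\<^esub> \<one>\<^bsub>A\<^esub>) = c \<odot>\<^bsub>A\<^esub> x"
  by (simp add: smult_mult_right)

lemma (in nc_algebra) scalar_closed: "c \<in> carrier K \<Longrightarrow> c \<odot>\<^bsub>A\<^esub> \<one>\<^bsub>A\<^esub> \<in> carrier A"
  by simp

lemma restrict_scalars_simps [simp]: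
  "carrier (restrict_scalars K R M) = carrier M"
  "\<zero>\<^bsub>restrict_scalars K R M\<^esub> = \<zero>\<^bsub>M\<^esub>"
  "ring.add (restrict_scalars K R M) = ring.add M"
  "smult (restrict_scalars K R M) = (\<lambda>c x. (c \<odot>\<^bsub>R\<^esub> \<one>\<^bsub>R\<^esub>) \<odot>\<^bsub>M\<^esub> x)"
  by (simp_all add: restrict_scalars_def mk_module_def)

lemma opp_simps [simp]:
  "carrier (opp A) = carrier A" "\<zero>\<^bsub>opp A\<^esub> = \<zero>\<^bsub>A\<^esub>" "ring.add (opp A) = ring.add A"
  "smult (opp A) = smult A"
  by (simp_all add: opp_def)

lemma tensor_opp [simp]:
  "tensor_rels K V (opp A) = tensor_rels K V A"
  "tensor_add_group K V (opp A) = tensor_add_group K V A"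
  "pure_tensor K V (opp A) = pure_tensor K V A"
  by (simp_all add: tensor_rels_def tensor_add_group_def tensor_group_def pure_tensor_def fun_eq_iff)

lemma carrier_tensor_algebra [simp]:
  "carrier (tensor_algebra K A B) = carrier (tensor_add_group K A B)"
  by (simp add: tensor_algebra_def)

lemma abelian_group_congI:
  assumes "abelian_group M" "carrier M' = carrier M" "\<zero>\<^bsub>M'\<^esub> = \<zero>\<^bsub>M\<^esub>" "ring.add M' = ring.add M"
  shows "abelian_group M'"
proof -
  interpret abelian_group M by fact
  show ?thesis
    by (rule abelian_groupI) (auto simp: assms a_ac intro: a_inv_closed l_neg)
qed

lemma restrict_scalars_module:
  assumes "nc_algebra K R" "lmodule R M"
  shows "module K (restrict_scalars K R M)"
proof -
  interpret R: nc_algebra K R by fact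
  interpret M: lmodule R M by fact
  show ?thesis
  proof (rule moduleI)
    show "abelian_group (restrict_scalars K R M)"
      by (rule abelian_group_congI[OF M.abelian_group_axioms]) simp_all
  qed (simp_all add: R.is_cring M.lsmult_closed M.lsmult_r_distr R.smult_l_distr M.lsmult_l_distr
      M.lsmult_assoc[symmetric] R.smult_assoc1 R.scalar_mult_left M.lsmult_one)
qed

section \<open>The module M \<otimes> A over R \<otimes> A^op\<close>

abbreviation tens ::
  "('k, 'e) ring_scheme \<Rightarrow> ('k, 'r) module \<Rightarrow> ('r, 'm) module \<Rightarrow> ('k, 'a) module
    \<Rightarrow> ('m, 'a) tensor ring" where
  "tens K R M A \<equiv> tensor_add_group K (restrict_scalars K R M) A"

abbreviation pure ::
  "('k, 'e) ring_scheme \<Rightarrow> ('k, 'r) module \<Rightarrow> ('r, 'm) module \<Rightarrow> ('k, 'a) module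
    \<Rightarrow> 'm \<Rightarrow> 'a \<Rightarrow> ('m, 'a) tensor" where
  "pure K R M A \<equiv> pure_tensor K (restrict_scalars K R M) A"

text \<open>The action of the pure tensor r \<otimes> a, that is, the inner of the two nested lifts
  in \<open>tensor_module\<close>. Nearly all calculations are done with it instead of the action of
  a general element.\<close>

definition pact ::
  "('k, 'e) ring_scheme \<Rightarrow> ('k, 'r) module \<Rightarrow> ('r, 'm) module \<Rightarrow> ('k, 'a) module
    \<Rightarrow> 'r \<Rightarrow> 'a \<Rightarrow> ('m, 'a) tensor \<Rightarrow> ('m, 'a) tensor" where
  "pact K R M A r a X =
     tensor_lift (tens K R M A) (\<lambda>(x, b). pure K R M A (r \<odot>\<^bsub>M\<^esub> x) (b \<otimes>\<^bsub>A\<^esub> a)) X"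

lemma tensor_module_simps:
  "carrier (tensor_module K R M A) = carrier (tens K R M A)"
  "\<zero>\<^bsub>tensor_module K R M A\<^esub> = \<zero>\<^bsub>tens K R M A\<^esub>"
  "ring.add (tensor_module K R M A) = ring.add (tens K R M A)"
  "U \<odot>\<^bsub>tensor_module K R M A\<^esub> X = tensor_lift (tens K R M A) (\<lambda>(r, a). pact K R M A r a X) U"
  by (simp_all add: tensor_module_def mk_module_def Let_def pact_def)

locale tensor_mod = R: nc_algebra K R + M: lmodule R M + A: nc_algebra K A
  for K :: "('k, 'e) ring_scheme" and R :: "('k, 'r) module" and M :: "('r, 'm) module"
    and A :: "('k, 'a) module"
begin

sublocale P: tensor_pair K "restrict_scalars K R M" A
  by (intro tensor_pair.intro restrict_scalars_module R.nc_algebra_axioms M.lmodule_axioms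
      A.module_axioms)

sublocale U: tensor_pair K R A
  by (intro tensor_pair.intro R.module_axioms A.module_axioms)

abbreviation "MA \<equiv> tens K R M A"
abbreviation "pr \<equiv> pure K R M A"
abbreviation "pa \<equiv> pact K R M A"

lemma smult_scalar_comm: "c \<in> carrier K \<Longrightarrow> r \<in> carrier R \<Longrightarrow> x \<in> carrier M \<Longrightarrow>
    r \<odot>\<^bsub>M\<^esub> ((c \<odot>\<^bsub>R\<^esub> \<one>\<^bsub>R\<^esub>) \<odot>\<^bsub>M\<^esub> x) = (c \<odot>\<^bsub>R\<^esub> \<one>\<^bsub>R\<^esub>) \<odot>\<^bsub>M\<^esub> (r \<odot>\<^bsub>M\<^esub> x)"
  by (simp add: M.lsmult_assoc[symmetric] R.scalar_mult_left R.scalar_mult_right)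

lemma pure_scalar: "c \<in> carrier K \<Longrightarrow> x \<in> carrier M \<Longrightarrow> a \<in> carrier A \<Longrightarrow>
    pr ((c \<odot>\<^bsub>R\<^esub> \<one>\<^bsub>R\<^esub>) \<odot>\<^bsub>M\<^esub> x) a = pr x (c \<odot>\<^bsub>A\<^esub> a)"
  using P.pure_smult[of c x a] by simp

lemma pure_add_l: "x \<in> carrier M \<Longrightarrow> y \<in> carrier M \<Longrightarrow> a \<in> carrier A \<Longrightarrow>
    pr (x \<oplus>\<^bsub>M\<^esub> y) a = pr x a \<oplus>\<^bsub>MA\<^esub> pr y a"
  using P.pure_add_left[of x y a] by simp

lemma pure_add_r: "x \<in> carrier M \<Longrightarrow> a \<in> carrier A \<Longrightarrow> b \<in> carrier A \<Longrightarrow>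
    pr x (a \<oplus>\<^bsub>A\<^esub> b) = pr x a \<oplus>\<^bsub>MA\<^esub> pr x b"
  using P.pure_add_right[of x a b] by simp

lemma pure_closed: "x \<in> carrier M \<Longrightarrow> a \<in> carrier A \<Longrightarrow> pr x a \<in> carrier MA"
  by simp

lemma balanced_pact:
  assumes "r \<in> carrier R" "a \<in> carrier A"
  shows "balanced K (restrict_scalars K R M) A MA (\<lambda>(x, b). pr (r \<odot>\<^bsub>M\<^esub> x) (b \<otimes>\<^bsub>A\<^esub> a))"
  using assms P.T.abelian_group_axioms
  by (auto simp: balanced_def M.lsmult_closed M.lsmult_r_distr pure_add_l pure_add_r A.l_distr
      smult_scalar_comm pure_scalar A.smult_mult_left)

lemma pact_closed: "r \<in> carrier R \<Longrightarrow> a \<in> carrier A \<Longrightarrow> X \<in> carrier MA \<Longrightarrow> pa r a X \<in> carrier MA"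
  unfolding pact_def by (rule P.tensor_lift_closed[OF balanced_pact])

lemma pact_add: "r \<in> carrier R \<Longrightarrow> a \<in> carrier A \<Longrightarrow> X \<in> carrier MA \<Longrightarrow> Y \<in> carrier MA \<Longrightarrow>
    pa r a (X \<oplus>\<^bsub>MA\<^esub> Y) = pa r a X \<oplus>\<^bsub>MA\<^esub> pa r a Y"
  unfolding pact_def by (rule P.tensor_lift_add[OF balanced_pact])

lemma pact_pure: "r \<in> carrier R \<Longrightarrow> a \<in> carrier A \<Longrightarrow> x \<in> carrier M \<Longrightarrow> b \<in> carrier A \<Longrightarrow>
    pa r a (pr x b) = pr (r \<odot>\<^bsub>M\<^esub> x) (b \<otimes>\<^bsub>A\<^esub> a)"
  unfolding pact_def by (subst P.tensor_lift_pure[OF balanced_pact]) simp_all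

lemma tens_induct [consumes 1, case_names pure add]:
  assumes "X \<in> carrier MA" "\<And>x a. x \<in> carrier M \<Longrightarrow> a \<in> carrier A \<Longrightarrow> Q (pr x a)"
    "\<And>X Y. X \<in> carrier MA \<Longrightarrow> Y \<in> carrier MA \<Longrightarrow> Q X \<Longrightarrow> Q Y \<Longrightarrow> Q (X \<oplus>\<^bsub>MA\<^esub> Y)"
  shows "Q X"
  using assms by (rule P.tensor_induct) simp_all

lemma add4: "X \<in> carrier MA \<Longrightarrow> Y \<in> carrier MA \<Longrightarrow> Z \<in> carrier MA \<Longrightarrow> W \<in> carrier MA \<Longrightarrow>
   (X \<oplus>\<^bsub>MA\<^esub> Y) \<oplus>\<^bsub>MA\<^esub> (Z \<oplus>\<^bsub>MA\<^esub> W) = (X \<oplus>\<^bsub>MA\<^esub> Z) \<oplus>\<^bsub>MA\<^esub> (Y \<oplus>\<^bsub>MA\<^esub> W)"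
  by (simp add: P.T.a_ac)

text \<open>The second factors come out reversed because A acts on M \<otimes> A by multiplication
  from the right.\<close>

lemma pact_pact:
  assumes "r \<in> carrier R" "a \<in> carrier A" "r' \<in> carrier R" "a' \<in> carrier A" "X \<in> carrier MA"
  shows "pa r a (pa r' a' X) = pa (r \<otimes>\<^bsub>R\<^esub> r') (a' \<otimes>\<^bsub>A\<^esub> a) X"
  using assms(5)
  by (induction rule: tens_induct)
    (simp_all add: assms(1-4) pact_add pact_closed pact_pure M.lsmult_closed M.lsmult_assoc A.m_assoc)

lemma pact_one: "X \<in> carrier MA \<Longrightarrow> pa \<one>\<^bsub>R\<^esub> \<one>\<^bsub>A\<^esub> X = X"
  by (induction rule: tens_induct) (simp_all add: pact_add pact_pure M.lsmult_one)

lemma pact_add_l: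
  assumes "r \<in> carrier R" "r' \<in> carrier R" "a \<in> carrier A" "X \<in> carrier MA"
  shows "pa (r \<oplus>\<^bsub>R\<^esub> r') a X = pa r a X \<oplus>\<^bsub>MA\<^esub> pa r' a X"
  using assms(4)
  by (induction rule: tens_induct)
    (simp_all add: assms(1-3) pact_add pact_closed pact_pure M.lsmult_closed M.lsmult_l_distr
      pure_add_l add4)

lemma pact_add_r:
  assumes "r \<in> carrier R" "a \<in> carrier A" "a' \<in> carrier A" "X \<in> carrier MA"
  shows "pa r (a \<oplus>\<^bsub>A\<^esub> a') X = pa r a X \<oplus>\<^bsub>MA\<^esub> pa r a' X"
  using assms(4)
  by (induction rule: tens_induct)
    (simp_all add: assms(1-3) pact_add pact_closed pact_pure M.lsmult_closed A.r_distr
      pure_add_r add4)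

lemma pact_scalar:
  assumes "r \<in> carrier R" "a \<in> carrier A" "c \<in> carrier K" "X \<in> carrier MA"
  shows "pa (c \<odot>\<^bsub>R\<^esub> r) a X = pa r (c \<odot>\<^bsub>A\<^esub> a) X"
  using assms(4)
proof (induction rule: tens_induct)
  case (pure x b)
  have "(c \<odot>\<^bsub>R\<^esub> r) \<odot>\<^bsub>M\<^esub> x = (c \<odot>\<^bsub>R\<^esub> \<one>\<^bsub>R\<^esub>) \<odot>\<^bsub>M\<^esub> (r \<odot>\<^bsub>M\<^esub> x)"
    using assms pure by (simp add: M.lsmult_assoc[symmetric] R.scalar_mult_left)
  then show ?case
    using assms pure by (simp add: pact_pure pure_scalar M.lsmult_closed A.smult_mult_right)
qed (simp add: assms(1-3) pact_add pact_closed)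

lemma balanced_act:
  assumes "X \<in> carrier MA"
  shows "balanced K R A MA (\<lambda>(r, a). pa r a X)"
  using assms P.T.abelian_group_axioms
  by (auto simp: balanced_def pact_closed pact_add_l pact_add_r pact_scalar)

abbreviation "act U X \<equiv> U \<odot>\<^bsub>tensor_module K R M A\<^esub> X"

lemma act_pure: "r \<in> carrier R \<Longrightarrow> a \<in> carrier A \<Longrightarrow> X \<in> carrier MA \<Longrightarrow>
    act (pure_tensor K R A r a) X = pa r a X"
  unfolding tensor_module_simps by (subst U.tensor_lift_pure[OF balanced_act]) simp_all

lemma act_add: "U \<in> carrier U.TG \<Longrightarrow> V \<in> carrier U.TG \<Longrightarrow> X \<in> carrier MA \<Longrightarrow>
    act (U \<oplus>\<^bsub>U.TG\<^esub> V) X = act U X \<oplus>\<^bsub>MA\<^esub> act V X"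
  unfolding tensor_module_simps by (rule U.tensor_lift_add[OF balanced_act])

lemma act_closed: "U \<in> carrier U.TG \<Longrightarrow> X \<in> carrier MA \<Longrightarrow> act U X \<in> carrier MA"
  unfolding tensor_module_simps by (rule U.tensor_lift_closed[OF balanced_act])

end

text \<open>Commutation with \<open>pact\<close> on pure tensors spreads to the whole action by two
  inductions, one over the module element and one over the ring element.\<close>

lemma tensor_mod_homI:
  assumes "tensor_mod K R M A" "tensor_mod K R N A"
    and f: "f \<in> carrier (tens K R M A) \<rightarrow>\<^sub>E carrier (tens K R N A)"
    and add: "\<And>X Y. X \<in> carrier (tens K R M A) \<Longrightarrow> Y \<in> carrier (tens K R M A) \<Longrightarrow>
      f (X \<oplus>\<^bsub>tens K R M A\<^esub> Y) = f X \<oplus>\<^bsub>tens K R N A\<^esub> f Y"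
    and pact: "\<And>r a x b. r \<in> carrier R \<Longrightarrow> a \<in> carrier A \<Longrightarrow> x \<in> carrier M \<Longrightarrow> b \<in> carrier A \<Longrightarrow>
      f (pact K R M A r a (pure K R M A x b)) = pact K R N A r a (f (pure K R M A x b))"
  shows "f \<in> lmod_hom (tensor_algebra K R (opp A)) (tensor_module K R M A) (tensor_module K R N A)"
proof -
  interpret M: tensor_mod K R M A by fact
  interpret N: tensor_mod K R N A by fact
  have fc: "X \<in> carrier M.MA \<Longrightarrow> f X \<in> carrier N.MA" for X using f by auto
  have p: "f (M.pa r a X) = N.pa r a (f X)"
    if "r \<in> carrier R" "a \<in> carrier A" "X \<in> carrier M.MA" for r a X
    using that(3) that(1,2)
    by (induction rule: M.tens_induct)
      (simp_all add: pact M.pact_add N.pact_add add M.pact_closed fc)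
  have "f (M.act U X) = N.act U (f X)" if "U \<in> carrier M.U.TG" "X \<in> carrier M.MA" for U X
    using that
    by (induction rule: M.U.tensor_induct)
      (simp_all add: M.act_pure N.act_pure M.act_add N.act_add p fc add M.act_closed)
  then show ?thesis
    using f add by (simp add: lmod_hom_def tensor_module_simps(1,3))
qed

lemma tensor_mod_homD:
  assumes "tensor_mod K R M A" "tensor_mod K R N A"
    and f: "f \<in> lmod_hom (tensor_algebra K R (opp A)) (tensor_module K R M A) (tensor_module K R N A)"
  shows "f \<in> carrier (tens K R M A) \<rightarrow>\<^sub>E carrier (tens K R N A)"
    and "\<And>X Y. X \<in> carrier (tens K R M A) \<Longrightarrow> Y \<in> carrier (tens K R M A) \<Longrightarrow>
      f (X \<oplus>\<^bsub>tens K R M A\<^esub> Y) = f X \<oplus>\<^bsub>tens K R N A\<^esub> f Y"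
    and "\<And>r a X. r \<in> carrier R \<Longrightarrow> a \<in> carrier A \<Longrightarrow> X \<in> carrier (tens K R M A) \<Longrightarrow>
      f (pact K R M A r a X) = pact K R N A r a (f X)"
proof -
  interpret M: tensor_mod K R M A by fact
  interpret N: tensor_mod K R N A by fact
  show fE: "f \<in> carrier (tens K R M A) \<rightarrow>\<^sub>E carrier (tens K R N A)"
    and "\<And>X Y. X \<in> carrier (tens K R M A) \<Longrightarrow> Y \<in> carrier (tens K R M A) \<Longrightarrow>
      f (X \<oplus>\<^bsub>tens K R M A\<^esub> Y) = f X \<oplus>\<^bsub>tens K R N A\<^esub> f Y"
    using f by (simp_all add: lmod_hom_def tensor_module_simps(1,3))
  fix r a X assume *: "r \<in> carrier R" "a \<in> carrier A" "X \<in> carrier (tens K R M A)"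
  have "f (M.act (pure_tensor K R A r a) X) = N.act (pure_tensor K R A r a) (f X)"
    using f * by (simp add: lmod_hom_def tensor_module_simps(1,3))
  moreover have "f X \<in> carrier N.MA" using fE *(3) by auto
  ultimately show "f (pact K R M A r a X) = pact K R N A r a (f X)"
    using * by (simp add: M.act_pure N.act_pure)
qed

text \<open>M \<otimes> A is the module induced from M along R -> R \<otimes> A^op, so an R-linear
  map f on M extends uniquely by x \<otimes> a \<mapsto> f(x) a. Differentials over A are prescribed
  in this way by their values on the elements x \<otimes> 1.\<close>

definition extend ::
  "('k, 'e) ring_scheme \<Rightarrow> ('k, 'r) module \<Rightarrow> ('r, 'm) module \<Rightarrow> ('r, 'n) module \<Rightarrow> ('k, 'a) module
    \<Rightarrow> ('m \<Rightarrow> ('n, 'a) tensor) \<Rightarrow> ('m, 'a) tensor \<Rightarrow> ('n, 'a) tensor" where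
  "extend K R M N A f = (\<lambda>X\<in>carrier (tens K R M A).
     tensor_lift (tens K R N A) (\<lambda>(x, a). pact K R N A \<one>\<^bsub>R\<^esub> a (f x)) X)"

definition tens_linear ::
  "('k, 'e) ring_scheme \<Rightarrow> ('k, 'r) module \<Rightarrow> ('r, 'm) module \<Rightarrow> ('r, 'n) module \<Rightarrow> ('k, 'a) module
    \<Rightarrow> ('m \<Rightarrow> ('n, 'a) tensor) \<Rightarrow> bool" where
  "tens_linear K R M N A f \<longleftrightarrow> f \<in> carrier M \<rightarrow> carrier (tens K R N A) \<and>
     (\<forall>x\<in>carrier M. \<forall>y\<in>carrier M. f (x \<oplus>\<^bsub>M\<^esub> y) = f x \<oplus>\<^bsub>tens K R N A\<^esub> f y) \<and>
     (\<forall>r\<in>carrier R. \<forall>x\<in>carrier M. f (r \<odot>\<^bsub>M\<^esub> x) = pact K R N A r \<one>\<^bsub>A\<^esub> (f x))"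

lemma
  assumes "tensor_mod K R M A" "tensor_mod K R N A" and f: "tens_linear K R M N A f"
  shows extend_pure: "\<And>x a. x \<in> carrier M \<Longrightarrow> a \<in> carrier A \<Longrightarrow>
      extend K R M N A f (pure K R M A x a) = pact K R N A \<one>\<^bsub>R\<^esub> a (f x)"
    and extend_hom: "extend K R M N A f \<in>
      lmod_hom (tensor_algebra K R (opp A)) (tensor_module K R M A) (tensor_module K R N A)"
proof -
  interpret M: tensor_mod K R M A by fact
  interpret N: tensor_mod K R N A by fact
  have fc: "\<And>x. x \<in> carrier M \<Longrightarrow> f x \<in> carrier N.MA"
    and fa: "\<And>x y. x \<in> carrier M \<Longrightarrow> y \<in> carrier M \<Longrightarrow> f (x \<oplus>\<^bsub>M\<^esub> y) = f x \<oplus>\<^bsub>N.MA\<^esub> f y"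
    and fr: "\<And>r x. r \<in> carrier R \<Longrightarrow> x \<in> carrier M \<Longrightarrow> f (r \<odot>\<^bsub>M\<^esub> x) = N.pa r \<one>\<^bsub>A\<^esub> (f x)"
    using f by (auto simp: tens_linear_def)
  have bal: "balanced K (restrict_scalars K R M) A N.MA (\<lambda>(x, a). N.pa \<one>\<^bsub>R\<^esub> a (f x))"
    using N.P.T.abelian_group_axioms
    by (auto simp: balanced_def fc fa fr N.pact_closed N.pact_add N.pact_add_r N.pact_pact
        N.pact_scalar M.A.scalar_mult_left)
  have c: "X \<in> carrier M.MA \<Longrightarrow> extend K R M N A f X \<in> carrier N.MA" for X
    using M.P.tensor_lift_closed[OF bal] by (simp add: extend_def)
  have a: "X \<in> carrier M.MA \<Longrightarrow> Y \<in> carrier M.MA \<Longrightarrow> extend K R M N A f (X \<oplus>\<^bsub>M.MA\<^esub> Y) =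
      extend K R M N A f X \<oplus>\<^bsub>N.MA\<^esub> extend K R M N A f Y" for X Y
    using M.P.tensor_lift_add[OF bal] by (simp add: extend_def)
  show p: "extend K R M N A f (pure K R M A x a) = pact K R N A \<one>\<^bsub>R\<^esub> a (f x)"
    if "x \<in> carrier M" "a \<in> carrier A" for x a
    using M.P.tensor_lift_pure[OF bal] that by (simp add: extend_def)
  show "extend K R M N A f \<in>
      lmod_hom (tensor_algebra K R (opp A)) (tensor_module K R M A) (tensor_module K R N A)"
  proof (rule tensor_mod_homI[OF assms(1,2)])
    show "extend K R M N A f \<in> carrier M.MA \<rightarrow>\<^sub>E carrier N.MA"
      using c by (auto simp: extend_def)
  qed (simp_all add: a p M.pact_pure fr fc N.pact_pact M.M.lsmult_closed)
qed

section \<open>Maps induced by linear maps of the second factor\<close>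

context tensor_pair
begin

lemma balanced_tensor_map:
  assumes "module K B" "h \<in> module_hom K W B"
  shows "balanced K V W (tensor_add_group K V B) (\<lambda>(x, a). pure_tensor K V B x (h a))"
proof -
  interpret B: tensor_pair K V B by (intro tensor_pair.intro V.module_axioms assms(1))
  show ?thesis
    using assms(2) B.T.abelian_group_axioms
    by (auto simp: balanced_def module_hom_def B.pure_add_left B.pure_add_right B.pure_smult Pi_iff)
qed

lemma tensor_map_closed:
  assumes "module K B" "h \<in> module_hom K W B" "X \<in> carrier TG"
  shows "tensor_map K V B h X \<in> carrier (tensor_add_group K V B)"
  unfolding tensor_map_def by (rule tensor_lift_closed[OF balanced_tensor_map[OF assms(1,2)] assms(3)])

lemma tensor_map_add:
  assumes "module K B" "h \<in> module_hom K W B" "X \<in> carrier TG" "Y \<in> carrier TG"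
  shows "tensor_map K V B h (X \<oplus>\<^bsub>TG\<^esub> Y)
    = tensor_map K V B h X \<oplus>\<^bsub>tensor_add_group K V B\<^esub> tensor_map K V B h Y"
  unfolding tensor_map_def by (rule tensor_lift_add[OF balanced_tensor_map[OF assms(1,2)] assms(3,4)])

lemma tensor_map_pure:
  assumes "module K B" "h \<in> module_hom K W B" "x \<in> carrier V" "a \<in> carrier W"
  shows "tensor_map K V B h (pt x a) = pure_tensor K V B x (h a)"
  unfolding tensor_map_def
  by (subst tensor_lift_pure[OF balanced_tensor_map[OF assms(1,2)] assms(3,4)]) simp

end

text \<open>The map id \<otimes> \<chi> from M \<otimes> A to M \<otimes> K = M. For the residue map
  it is the reduction modulo the maximal ideal; for a functional on the kernel of a small extension
  it reads off the obstruction.\<close>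

definition contract ::
  "('k, 'r) module \<Rightarrow> ('r, 'm) module \<Rightarrow> ('a \<Rightarrow> 'k) \<Rightarrow> ('m, 'a) tensor \<Rightarrow> 'm" where
  "contract R M \<chi> = tensor_lift M (\<lambda>(x, a). (\<chi> a \<odot>\<^bsub>R\<^esub> \<one>\<^bsub>R\<^esub>) \<odot>\<^bsub>M\<^esub> x)"

lemma tensor_reduction_contract: "tensor_reduction K R M A = contract R M (residue K A)"
  by (simp add: tensor_reduction_def contract_def)

definition functional :: "('k, 'e) ring_scheme \<Rightarrow> ('k, 'a) module \<Rightarrow> ('a \<Rightarrow> 'k) \<Rightarrow> bool" where
  "functional K A \<chi> \<longleftrightarrow> \<chi> \<in> carrier A \<rightarrow> carrier K \<and>
     (\<forall>a\<in>carrier A. \<forall>b\<in>carrier A. \<chi> (a \<oplus>\<^bsub>A\<^esub> b) = \<chi> a \<oplus>\<^bsub>K\<^esub> \<chi> b) \<and>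
     (\<forall>c\<in>carrier K. \<forall>a\<in>carrier A. \<chi> (c \<odot>\<^bsub>A\<^esub> a) = c \<otimes>\<^bsub>K\<^esub> \<chi> a)"

context tensor_mod
begin

lemma balanced_contract:
  assumes "functional K A \<chi>"
  shows "balanced K (restrict_scalars K R M) A M (\<lambda>(x, a). (\<chi> a \<odot>\<^bsub>R\<^esub> \<one>\<^bsub>R\<^esub>) \<odot>\<^bsub>M\<^esub> x)"
  using assms M.abelian_group_axioms
  by (auto simp: balanced_def functional_def Pi_iff M.lsmult_closed M.lsmult_r_distr
      M.lsmult_l_distr R.smult_l_distr smult_scalar_comm M.lsmult_assoc[symmetric]
      R.scalar_mult_left R.scalar_mult_right R.smult_assoc1)

lemma contract_closed: "functional K A \<chi> \<Longrightarrow> X \<in> carrier MA \<Longrightarrow> contract R M \<chi> X \<in> carrier M"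
  unfolding contract_def by (rule P.tensor_lift_closed[OF balanced_contract])

lemma contract_add: "functional K A \<chi> \<Longrightarrow> X \<in> carrier MA \<Longrightarrow> Y \<in> carrier MA \<Longrightarrow>
    contract R M \<chi> (X \<oplus>\<^bsub>MA\<^esub> Y) = contract R M \<chi> X \<oplus>\<^bsub>M\<^esub> contract R M \<chi> Y"
  unfolding contract_def by (rule P.tensor_lift_add[OF balanced_contract])

lemma contract_pure: "functional K A \<chi> \<Longrightarrow> x \<in> carrier M \<Longrightarrow> a \<in> carrier A \<Longrightarrow>
    contract R M \<chi> (pr x a) = (\<chi> a \<odot>\<^bsub>R\<^esub> \<one>\<^bsub>R\<^esub>) \<odot>\<^bsub>M\<^esub> x"
  unfolding contract_def by (subst P.tensor_lift_pure[OF balanced_contract]) simp_all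

lemma functional_closed: "functional K A \<chi> \<Longrightarrow> a \<in> carrier A \<Longrightarrow> \<chi> a \<in> carrier K"
  by (auto simp: functional_def)

lemma contract_pact:
  assumes "functional K A \<chi>" "r \<in> carrier R" "X \<in> carrier MA"
  shows "contract R M \<chi> (pa r \<one>\<^bsub>A\<^esub> X) = r \<odot>\<^bsub>M\<^esub> contract R M \<chi> X"
  using assms(3)
  by (induction rule: tens_induct)
    (simp_all add: assms(1,2) contract_add pact_add pact_closed contract_closed M.lsmult_r_distr
      pact_pure contract_pure M.lsmult_closed functional_closed[OF assms(1)] smult_scalar_comm)

lemma contract_fadd:
  assumes "functional K A \<chi>" "functional K A \<psi>" "X \<in> carrier MA"
    "functional K A \<omega>" "\<And>a. a \<in> carrier A \<Longrightarrow> \<omega> a = \<chi> a \<oplus>\<^bsub>K\<^esub> \<psi> a"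
  shows "contract R M \<omega> X = contract R M \<chi> X \<oplus>\<^bsub>M\<^esub> contract R M \<psi> X"
  using assms(3)
  by (induction rule: tens_induct)
    (simp_all add: assms(1,2,4,5) contract_add contract_closed contract_pure M.lsmult_closed
      functional_closed[OF assms(1)] functional_closed[OF assms(2)] R.smult_l_distr
      M.lsmult_l_distr M.a_ac)

lemma contract_fsmult:
  assumes "functional K A \<chi>" "c \<in> carrier K" "X \<in> carrier MA"
    "functional K A \<omega>" "\<And>a. a \<in> carrier A \<Longrightarrow> \<omega> a = c \<otimes>\<^bsub>K\<^esub> \<chi> a"
  shows "contract R M \<omega> X = (c \<odot>\<^bsub>R\<^esub> \<one>\<^bsub>R\<^esub>) \<odot>\<^bsub>M\<^esub> contract R M \<chi> X"
  using assms(3)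
  by (induction rule: tens_induct)
    (simp_all add: assms(1,2,4,5) contract_add contract_closed contract_pure M.lsmult_closed
      functional_closed[OF assms(1)] M.lsmult_r_distr M.lsmult_assoc[symmetric]
      R.scalar_mult_left R.smult_assoc1)

end

section \<open>The obstruction to lifting along a small extension\<close>

text \<open>The right factor of the action is 1, so linearity of \<open>h\<close> suffices. This
  covers the section \<open>s\<close> below, which need not be multiplicative; arbitrary right
  factors call for a multiplicative \<open>h\<close>.\<close>

lemma tensor_map_pact_left:
  assumes "tensor_mod K R M A" "tensor_mod K R M B" and h: "h \<in> module_hom K A B"
    and "r \<in> carrier R" "X \<in> carrier (tens K R M A)"
  shows "tensor_map K (restrict_scalars K R M) B h (pact K R M A r \<one>\<^bsub>A\<^esub> X)
    = pact K R M B r \<one>\<^bsub>B\<^esub> (tensor_map K (restrict_scalars K R M) B h X)"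
proof -
  interpret A: tensor_mod K R M A by fact
  interpret B: tensor_mod K R M B by fact
  have hc: "a \<in> carrier A \<Longrightarrow> h a \<in> carrier B" for a using h by (auto simp: module_hom_def)
  note [simp] = A.P.tensor_map_add[OF B.A.module_axioms h] A.P.tensor_map_closed[OF B.A.module_axioms h]
    A.P.tensor_map_pure[OF B.A.module_axioms h]
  show ?thesis
    using assms(5)
    by (induction rule: A.tens_induct)
      (simp_all add: assms(4) A.pact_add A.pact_closed A.pact_pure B.pact_add
        B.pact_pure hc A.M.lsmult_closed)
qed

lemma tensor_map_pact:
  assumes "tensor_mod K R M A" "tensor_mod K R M B" and h: "h \<in> module_hom K A B"
    and mult: "\<And>a b. a \<in> carrier A \<Longrightarrow> b \<in> carrier A \<Longrightarrow> h (a \<otimes>\<^bsub>A\<^esub> b) = h a \<otimes>\<^bsub>B\<^esub> h b"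
    and "r \<in> carrier R" "a \<in> carrier A" "X \<in> carrier (tens K R M A)"
  shows "tensor_map K (restrict_scalars K R M) B h (pact K R M A r a X)
    = pact K R M B r (h a) (tensor_map K (restrict_scalars K R M) B h X)"
proof -
  interpret A: tensor_mod K R M A by fact
  interpret B: tensor_mod K R M B by fact
  have hc: "a \<in> carrier A \<Longrightarrow> h a \<in> carrier B" for a using h by (auto simp: module_hom_def)
  note [simp] = A.P.tensor_map_add[OF B.A.module_axioms h] A.P.tensor_map_closed[OF B.A.module_axioms h]
    A.P.tensor_map_pure[OF B.A.module_axioms h]
  show ?thesis
    using assms(7)
    by (induction rule: A.tens_induct)
      (simp_all add: assms(5,6) mult A.pact_add A.pact_closed A.pact_pure B.pact_add
        B.pact_pure hc A.M.lsmult_closed)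
qed

lemma contract_tensor_map:
  assumes "tensor_mod K R M A" "tensor_mod K R M B" and h: "h \<in> module_hom K A B"
    and \<chi>: "functional K B \<chi>" and \<psi>: "functional K A \<psi>"
    and eq: "\<And>a. a \<in> carrier A \<Longrightarrow> \<psi> a = \<chi> (h a)"
    and "X \<in> carrier (tens K R M A)"
  shows "contract R M \<chi> (tensor_map K (restrict_scalars K R M) B h X) = contract R M \<psi> X"
proof -
  interpret A: tensor_mod K R M A by fact
  interpret B: tensor_mod K R M B by fact
  have hc: "a \<in> carrier A \<Longrightarrow> h a \<in> carrier B" for a using h by (auto simp: module_hom_def)
  note [simp] = A.P.tensor_map_add[OF B.A.module_axioms h] A.P.tensor_map_closed[OF B.A.module_axioms h]
    A.P.tensor_map_pure[OF B.A.module_axioms h]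
  show ?thesis
    using assms(7)
    by (induction rule: A.tens_induct)
      (simp_all add: eq A.contract_add[OF \<psi>] B.contract_add[OF \<chi>] A.contract_pure[OF \<psi>]
        B.contract_pure[OF \<chi>] hc)
qed

lemma tensor_map_comp:
  assumes "tensor_mod K R M A" "tensor_mod K R M B" "tensor_mod K R M C"
    and h: "h \<in> module_hom K A B" and g: "g \<in> module_hom K B C" and k: "k \<in> module_hom K A C"
    and eq: "\<And>a. a \<in> carrier A \<Longrightarrow> g (h a) = k a"
    and "X \<in> carrier (tens K R M A)"
  shows "tensor_map K (restrict_scalars K R M) C g (tensor_map K (restrict_scalars K R M) B h X)
    = tensor_map K (restrict_scalars K R M) C k X"
proof -
  interpret A: tensor_mod K R M A by fact
  interpret B: tensor_mod K R M B by fact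
  interpret C: tensor_mod K R M C by fact
  have hc: "a \<in> carrier A \<Longrightarrow> h a \<in> carrier B" for a using h by (auto simp: module_hom_def)
  note [simp] = A.P.tensor_map_add[OF B.A.module_axioms h] A.P.tensor_map_closed[OF B.A.module_axioms h]
    A.P.tensor_map_pure[OF B.A.module_axioms h]
    A.P.tensor_map_add[OF C.A.module_axioms k] A.P.tensor_map_closed[OF C.A.module_axioms k]
    A.P.tensor_map_pure[OF C.A.module_axioms k]
    B.P.tensor_map_add[OF C.A.module_axioms g] B.P.tensor_map_closed[OF C.A.module_axioms g]
    B.P.tensor_map_pure[OF C.A.module_axioms g]
  show ?thesis
    using assms(8) by (induction rule: A.tens_induct) (simp_all add: eq hc)
qed

lemma tensor_map_id:
  assumes "tensor_mod K R M A" and h: "h \<in> module_hom K A A"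
    and eq: "\<And>a. a \<in> carrier A \<Longrightarrow> h a = a" and "X \<in> carrier (tens K R M A)"
  shows "tensor_map K (restrict_scalars K R M) A h X = X"
proof -
  interpret A: tensor_mod K R M A by fact
  note [simp] = A.P.tensor_map_add[OF A.A.module_axioms h] A.P.tensor_map_pure[OF A.A.module_axioms h]
  show ?thesis
    using assms(4) by (induction rule: A.tens_induct) (simp_all add: eq)
qed

locale complex_setup =
  fixes K :: "('k, 'e) ring_scheme" and R :: "('k, 'r) module" and F :: "int \<Rightarrow> ('r, 'm) module"
    and d :: "int \<Rightarrow> 'm \<Rightarrow> 'm"
  assumes R: "nc_algebra K R" and lm: "\<And>n. lmodule R (F n)" and cx: "is_complex R F d"
begin

lemma tm: "nc_algebra K A \<Longrightarrow> tensor_mod K R (F n) A"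
  using R lm by (intro tensor_mod.intro)

lemma d_closed: "x \<in> carrier (F n) \<Longrightarrow> d n x \<in> carrier (F (n - 1))"
  using cx by (auto simp: is_complex_def lmod_hom_def)

lemma d_add: "x \<in> carrier (F n) \<Longrightarrow> y \<in> carrier (F n) \<Longrightarrow>
    d n (x \<oplus>\<^bsub>F n\<^esub> y) = d n x \<oplus>\<^bsub>F (n - 1)\<^esub> d n y"
  using cx by (auto simp: is_complex_def lmod_hom_def)

lemma d_smult: "r \<in> carrier R \<Longrightarrow> x \<in> carrier (F n) \<Longrightarrow>
    d n (r \<odot>\<^bsub>F n\<^esub> x) = r \<odot>\<^bsub>F (n - 1)\<^esub> d n x"
  using cx by (auto simp: is_complex_def lmod_hom_def)

abbreviation "VF n \<equiv> restrict_scalars K R (F n)"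
abbreviation "sc n c x \<equiv> (c \<odot>\<^bsub>R\<^esub> \<one>\<^bsub>R\<^esub>) \<odot>\<^bsub>F n\<^esub> x"

end

text \<open>The section \<open>s\<close> of \<kappa> is only K-linear, and \<epsilon> is the
  augmentation of T that induces the residue map of A. Transporting \<Delta> along \<open>s\<close>
  may lose the relation \<Delta> \<circ> \<Delta> = 0, and this loss is the obstruction.\<close>

locale obstruction = complex_setup K R F d
  for K :: "('k, 'e) ring_scheme" and R :: "('k, 'r) module" and F :: "int \<Rightarrow> ('r, 'm) module"
    and d :: "int \<Rightarrow> 'm \<Rightarrow> 'm" +
  fixes A :: "('k, 'a) module" and T :: "('k, 't) module" and \<kappa> :: "'t \<Rightarrow> 'a" and s :: "'a \<Rightarrow> 't"
    and \<epsilon> :: "'t \<Rightarrow> 'k" and \<Delta> :: "int \<Rightarrow> ('m, 'a) tensor \<Rightarrow> ('m, 'a) tensor"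
  assumes A: "nc_algebra K A" and T: "nc_algebra K T"
    and \<kappa>: "\<kappa> \<in> module_hom K T A"
    and \<kappa>_mult: "\<And>t u. t \<in> carrier T \<Longrightarrow> u \<in> carrier T \<Longrightarrow> \<kappa> (t \<otimes>\<^bsub>T\<^esub> u) = \<kappa> t \<otimes>\<^bsub>A\<^esub> \<kappa> u"
    and \<kappa>_one: "\<kappa> \<one>\<^bsub>T\<^esub> = \<one>\<^bsub>A\<^esub>"
    and s: "s \<in> module_hom K A T" and \<kappa>_s: "\<And>a. a \<in> carrier A \<Longrightarrow> \<kappa> (s a) = a"
    and \<epsilon>: "functional K T \<epsilon>" and \<epsilon>_one: "\<epsilon> \<one>\<^bsub>T\<^esub> = \<one>\<^bsub>K\<^esub>"
    and \<epsilon>_mult: "\<And>t u. t \<in> carrier T \<Longrightarrow> u \<in> carrier T \<Longrightarrow> \<epsilon> (t \<otimes>\<^bsub>T\<^esub> u) = \<epsilon> t \<otimes>\<^bsub>K\<^esub> \<epsilon> u"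
    and \<epsilon>_\<kappa>: "\<And>t. t \<in> carrier T \<Longrightarrow> residue K A (\<kappa> t) = \<epsilon> t"
    and \<Delta>: "\<Delta> \<in> artinian_lifts K R F d A"
begin

sublocale A: nc_algebra K A by (rule A)
sublocale T: nc_algebra K T by (rule T)

lemmas tA = tm[OF A] and tT = tm[OF T]

abbreviation "FA n \<equiv> tens K R (F n) A"
abbreviation "FT n \<equiv> tens K R (F n) T"
abbreviation "pA n \<equiv> pure K R (F n) A"
abbreviation "pT n \<equiv> pure K R (F n) T"
abbreviation "aA n \<equiv> pact K R (F n) A"
abbreviation "aT n \<equiv> pact K R (F n) T"
abbreviation "km n \<equiv> tensor_map K (VF n) A \<kappa>"
abbreviation "sm n \<equiv> tensor_map K (VF n) T s"
abbreviation "ct n \<chi> \<equiv> contract R (F n) \<chi>"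

lemma \<kappa>_closed: "t \<in> carrier T \<Longrightarrow> \<kappa> t \<in> carrier A"
  using \<kappa> by (auto simp: module_hom_def)

lemma s_closed: "a \<in> carrier A \<Longrightarrow> s a \<in> carrier T"
  using s by (auto simp: module_hom_def)

lemma residue_A: "a \<in> carrier A \<Longrightarrow> residue K A a = \<epsilon> (s a)"
  using \<epsilon>_\<kappa>[OF s_closed] \<kappa>_s by simp

lemma functional_residue_A: "functional K A (residue K A)"
  using \<epsilon> s by (auto simp: functional_def residue_A s_closed Pi_iff module_hom_def)

lemma \<Delta>_hom: "\<Delta> n \<in> lmod_hom (tensor_algebra K R (opp A)) (tensor_module K R (F n) A)
    (tensor_module K R (F (n - 1)) A)"
  using \<Delta> by (simp add: artinian_lifts_def is_complex_def)

lemmas \<Delta>_props = tensor_mod_homD[OF tA tA \<Delta>_hom]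

lemma \<Delta>_closed: "X \<in> carrier (FA n) \<Longrightarrow> \<Delta> n X \<in> carrier (FA (n - 1))"
  using \<Delta>_props(1)[of n] by auto

lemma \<Delta>_square: "X \<in> carrier (FA n) \<Longrightarrow> \<Delta> (n - 1) (\<Delta> n X) = \<zero>\<^bsub>FA (n - 2)\<^esub>"
  using \<Delta> by (simp add: artinian_lifts_def is_complex_def tensor_module_simps)

lemma \<Delta>_reduction: "X \<in> carrier (FA n) \<Longrightarrow>
    ct (n - 1) (residue K A) (\<Delta> n X) = d n (ct n (residue K A) X)"
  using \<Delta> by (simp add: artinian_lifts_def tensor_reduction_contract tensor_module_simps)

text \<open>\<open>D\<close> lifts \<open>\<Delta>\<close> to \<open>F \<otimes> T\<close> through the linear section \<open>s\<close>. The maps \<open>D\<^sup>2\<close> need not vanish, but they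
  take values in the kernel of \<open>F \<otimes> T \<rightarrow> F \<otimes> A\<close>, where the functionals \<open>\<chi>\<close> below read off the
  obstruction.\<close>

definition \<phi> :: "int \<Rightarrow> 'm \<Rightarrow> ('m, 't) tensor" where
  "\<phi> n x = sm (n - 1) (\<Delta> n (pA n x \<one>\<^bsub>A\<^esub>))"

definition D :: "int \<Rightarrow> ('m, 't) tensor \<Rightarrow> ('m, 't) tensor" where
  "D n = extend K R (F n) (F (n - 1)) T (\<phi> n)"

lemma sm_closed: "X \<in> carrier (FA n) \<Longrightarrow> sm n X \<in> carrier (FT n)"
proof -
  interpret tensor_mod K R "F n" A by (rule tA)
  show "X \<in> carrier (FA n) \<Longrightarrow> sm n X \<in> carrier (FT n)"
    by (rule P.tensor_map_closed[OF T.module_axioms s])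
qed

lemma sm_add: "X \<in> carrier (FA n) \<Longrightarrow> Y \<in> carrier (FA n) \<Longrightarrow>
    sm n (X \<oplus>\<^bsub>FA n\<^esub> Y) = sm n X \<oplus>\<^bsub>FT n\<^esub> sm n Y"
proof -
  interpret tensor_mod K R "F n" A by (rule tA)
  show "X \<in> carrier (FA n) \<Longrightarrow> Y \<in> carrier (FA n) \<Longrightarrow> ?thesis"
    by (rule P.tensor_map_add[OF T.module_axioms s])
qed

lemma km_closed: "X \<in> carrier (FT n) \<Longrightarrow> km n X \<in> carrier (FA n)"
proof -
  interpret tensor_mod K R "F n" T by (rule tT)
  show "X \<in> carrier (FT n) \<Longrightarrow> km n X \<in> carrier (FA n)"
    by (rule P.tensor_map_closed[OF A.module_axioms \<kappa>])
qed

lemma km_add: "X \<in> carrier (FT n) \<Longrightarrow> Y \<in> carrier (FT n) \<Longrightarrow>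
    km n (X \<oplus>\<^bsub>FT n\<^esub> Y) = km n X \<oplus>\<^bsub>FA n\<^esub> km n Y"
proof -
  interpret tensor_mod K R "F n" T by (rule tT)
  show "X \<in> carrier (FT n) \<Longrightarrow> Y \<in> carrier (FT n) \<Longrightarrow> ?thesis"
    by (rule P.tensor_map_add[OF A.module_axioms \<kappa>])
qed

lemma km_pure: "x \<in> carrier (F n) \<Longrightarrow> t \<in> carrier T \<Longrightarrow> km n (pT n x t) = pA n x (\<kappa> t)"
proof -
  interpret tensor_mod K R "F n" T by (rule tT)
  show "x \<in> carrier (F n) \<Longrightarrow> t \<in> carrier T \<Longrightarrow> ?thesis"
    by (subst P.tensor_map_pure[OF A.module_axioms \<kappa>]) simp_all
qed

lemma km_sm: "X \<in> carrier (FA n) \<Longrightarrow> km n (sm n X) = X"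
  using tensor_map_comp[OF tA tT tA s \<kappa>, of "\<lambda>a. a"] tensor_map_id[OF tA, of "\<lambda>a. a"]
  by (simp add: \<kappa>_s module_hom_def)

lemma \<phi>_linear: "tens_linear K R (F n) (F (n - 1)) T (\<phi> n)"
proof -
  interpret X: tensor_mod K R "F n" A by (rule tA)
  interpret Y: tensor_mod K R "F (n - 1)" A by (rule tA)
  have p: "pA n (r \<odot>\<^bsub>F n\<^esub> x) \<one>\<^bsub>A\<^esub> = aA n r \<one>\<^bsub>A\<^esub> (pA n x \<one>\<^bsub>A\<^esub>)"
    if "r \<in> carrier R" "x \<in> carrier (F n)" for r x
    using that by (simp add: X.pact_pure)
  show ?thesis
    unfolding tens_linear_def
    by (auto simp: \<phi>_def sm_closed \<Delta>_closed X.pure_add_l \<Delta>_props sm_add p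
        tensor_map_pact_left[OF tA tT s])
qed

lemma D_hom: "D n \<in> lmod_hom (tensor_algebra K R (opp T)) (tensor_module K R (F n) T)
    (tensor_module K R (F (n - 1)) T)"
  unfolding D_def by (rule extend_hom[OF tT tT \<phi>_linear])

lemmas D_props = tensor_mod_homD[OF tT tT D_hom]

lemma D_closed: "X \<in> carrier (FT n) \<Longrightarrow> D n X \<in> carrier (FT (n - 1))"
  using D_props(1)[of n] by auto

lemma \<phi>_closed: "x \<in> carrier (F n) \<Longrightarrow> \<phi> n x \<in> carrier (FT (n - 1))"
  using \<phi>_linear[of n] by (auto simp: tens_linear_def)

lemma D_pure: "x \<in> carrier (F n) \<Longrightarrow> t \<in> carrier T \<Longrightarrow>
    D n (pT n x t) = aT (n - 1) \<one>\<^bsub>R\<^esub> t (\<phi> n x)"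
  unfolding D_def by (rule extend_pure[OF tT tT \<phi>_linear])

lemma D_pure_one: "x \<in> carrier (F n) \<Longrightarrow> D n (pT n x \<one>\<^bsub>T\<^esub>) = \<phi> n x"
  using tensor_mod.pact_one[OF tT \<phi>_closed] by (simp add: D_pure)

text \<open>Both sides carry the action of t to that of \<kappa> t, so the claim comes down to x
  \<otimes> 1, where it says that \<open>s\<close> is a section of \<kappa>.\<close>

lemma km_D: "X \<in> carrier (FT n) \<Longrightarrow> km (n - 1) (D n X) = \<Delta> n (km n X)"
proof -
  interpret X: tensor_mod K R "F n" T by (rule tT)
  interpret XA: tensor_mod K R "F n" A by (rule tA)
  interpret Y: tensor_mod K R "F (n - 1)" T by (rule tT)
  show "X \<in> carrier (FT n) \<Longrightarrow> ?thesis"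
  proof (induction rule: X.tens_induct)
    case (pure x t)
    have "km (n - 1) (D n (pT n x t)) = aA (n - 1) \<one>\<^bsub>R\<^esub> (\<kappa> t) (km (n - 1) (\<phi> n x))"
      using pure by (simp add: D_pure tensor_map_pact[OF tT tA \<kappa> \<kappa>_mult] \<phi>_closed)
    also have "km (n - 1) (\<phi> n x) = \<Delta> n (pA n x \<one>\<^bsub>A\<^esub>)"
      using pure by (simp add: \<phi>_def km_sm \<Delta>_closed)
    also have "aA (n - 1) \<one>\<^bsub>R\<^esub> (\<kappa> t) \<dots> = \<Delta> n (aA n \<one>\<^bsub>R\<^esub> (\<kappa> t) (pA n x \<one>\<^bsub>A\<^esub>))"
      using pure by (simp add: \<Delta>_props \<kappa>_closed)
    also have "aA n \<one>\<^bsub>R\<^esub> (\<kappa> t) (pA n x \<one>\<^bsub>A\<^esub>) = km n (pT n x t)"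
      using pure by (simp add: XA.pact_pure \<kappa>_closed km_pure X.M.lsmult_one)
    finally show ?case .
  qed (simp_all add: D_props D_closed km_add km_closed \<Delta>_props)
qed

text \<open>The projection of T onto the kernel of \<kappa> along the image of
  \<open>s\<close>.\<close>

definition \<pi> :: "'t \<Rightarrow> 't" where "\<pi> t = t \<ominus>\<^bsub>T\<^esub> s (\<kappa> t)"

lemma \<pi>_closed: "t \<in> carrier T \<Longrightarrow> \<pi> t \<in> carrier T"
  by (simp add: \<pi>_def s_closed \<kappa>_closed)

lemma \<pi>_hom: "\<pi> \<in> module_hom K T T"
  using \<kappa> s
  by (auto simp: \<pi>_def module_hom_def \<kappa>_closed s_closed T.minus_eq T.minus_add T.a_ac
      T.smult_r_distr T.smult_r_minus)

lemma \<kappa>_minus: "t \<in> carrier T \<Longrightarrow> u \<in> carrier T \<Longrightarrow> \<kappa> (t \<ominus>\<^bsub>T\<^esub> u) = \<kappa> t \<ominus>\<^bsub>A\<^esub> \<kappa> u"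
proof -
  interpret mod_hom K T A \<kappa>
    by (intro mod_hom.intro mod_hom_axioms.intro T.module_axioms A.module_axioms \<kappa>)
  show "t \<in> carrier T \<Longrightarrow> u \<in> carrier T \<Longrightarrow> ?thesis" by (rule f_minus)
qed

lemma \<kappa>_zero: "\<kappa> \<zero>\<^bsub>T\<^esub> = \<zero>\<^bsub>A\<^esub>"
  using \<kappa>_minus[of "\<zero>\<^bsub>T\<^esub>" "\<zero>\<^bsub>T\<^esub>"] by (simp add: \<kappa>_closed A.minus_eq A.r_neg T.minus_eq T.r_neg)

lemma \<kappa>_\<pi>: "t \<in> carrier T \<Longrightarrow> \<kappa> (\<pi> t) = \<zero>\<^bsub>A\<^esub>"
  by (simp add: \<pi>_def \<kappa>_minus \<kappa>_closed s_closed \<kappa>_s A.minus_eq A.r_neg)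

abbreviation "pim n \<equiv> tensor_map K (VF n) T \<pi>"

lemma decompose: "X \<in> carrier (FT n) \<Longrightarrow> X = sm n (km n X) \<oplus>\<^bsub>FT n\<^esub> pim n X"
proof -
  interpret X: tensor_mod K R "F n" T by (rule tT)
  interpret XA: tensor_mod K R "F n" A by (rule tA)
  note [simp] = X.P.tensor_map_add[OF T.module_axioms \<pi>_hom]
    X.P.tensor_map_pure[OF T.module_axioms \<pi>_hom]
    XA.P.tensor_map_pure[OF T.module_axioms s] X.P.tensor_map_closed[OF T.module_axioms \<pi>_hom]
  show "X \<in> carrier (FT n) \<Longrightarrow> ?thesis"
  proof (induction rule: X.tens_induct)
    case (pure x t)
    then have "s (\<kappa> t) \<oplus>\<^bsub>T\<^esub> \<pi> t = t"
      by (simp add: \<kappa>_closed s_closed \<pi>_def T.minus_eq T.a_lcomm[of "s (\<kappa> t)" t] T.r_neg)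
    then show ?case
      using pure by (simp add: km_pure \<kappa>_closed s_closed \<pi>_closed X.pure_add_r[symmetric])
  next
    case (add X Y)
    have "sm n (km n (X \<oplus>\<^bsub>FT n\<^esub> Y)) \<oplus>\<^bsub>FT n\<^esub> pim n (X \<oplus>\<^bsub>FT n\<^esub> Y)
      = (sm n (km n X) \<oplus>\<^bsub>FT n\<^esub> pim n X) \<oplus>\<^bsub>FT n\<^esub> (sm n (km n Y) \<oplus>\<^bsub>FT n\<^esub> pim n Y)"
      using add(1,2) by (simp add: km_add sm_add km_closed sm_closed X.add4)
    also have "\<dots> = X \<oplus>\<^bsub>FT n\<^esub> Y"
      by (simp only: add(3,4)[symmetric])
    finally show ?case by (rule sym)
  qed
qed

lemma sm_zero: "sm n \<zero>\<^bsub>FA n\<^esub> = \<zero>\<^bsub>FT n\<^esub>"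
proof -
  interpret X: tensor_mod K R "F n" T by (rule tT)
  interpret XA: tensor_mod K R "F n" A by (rule tA)
  have "sm n \<zero>\<^bsub>FA n\<^esub> \<oplus>\<^bsub>FT n\<^esub> sm n \<zero>\<^bsub>FA n\<^esub> = sm n \<zero>\<^bsub>FA n\<^esub>"
    using sm_add[of "\<zero>\<^bsub>FA n\<^esub>" n "\<zero>\<^bsub>FA n\<^esub>"] by simp
  then show ?thesis
    using X.P.T.add.l_cancel_one'[of "sm n \<zero>\<^bsub>FA n\<^esub>" "sm n \<zero>\<^bsub>FA n\<^esub>"] by (simp add: sm_closed)
qed

text \<open>The linear splitting of \<kappa> does the work of exactness: an element of the kernel of
  \<open>km\<close> is its own image under \<open>pim\<close>, hence a sum of tensors x \<otimes>
  \<pi> t with \<pi> t in the kernel of \<kappa>. Claims about the kernel are proved below for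
  \<open>pim n Y\<close> with arbitrary \<open>Y\<close>, by induction over \<open>Y\<close>, and
  then specialised.\<close>

lemma ker_pim: "Z \<in> carrier (FT n) \<Longrightarrow> km n Z = \<zero>\<^bsub>FA n\<^esub> \<Longrightarrow> pim n Z = Z"
proof -
  interpret X: tensor_mod K R "F n" T by (rule tT)
  show "Z \<in> carrier (FT n) \<Longrightarrow> km n Z = \<zero>\<^bsub>FA n\<^esub> \<Longrightarrow> ?thesis"
    using decompose[of Z n] X.P.tensor_map_closed[OF T.module_axioms \<pi>_hom, of Z]
    by (simp add: sm_zero)
qed

text \<open>The functionals that vanish on \<open>\<mm> J + J \<mm>\<close> for \<open>J = ker \<kappa>\<close>.\<close>

definition small :: "('t \<Rightarrow> 'k) \<Rightarrow> bool" where
  "small \<chi> \<longleftrightarrow> functional K T \<chi> \<and>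
     (\<forall>j\<in>carrier T. \<forall>t\<in>carrier T. \<kappa> j = \<zero>\<^bsub>A\<^esub> \<longrightarrow>
        \<chi> (j \<otimes>\<^bsub>T\<^esub> t) = \<epsilon> t \<otimes>\<^bsub>K\<^esub> \<chi> j \<and> \<chi> (t \<otimes>\<^bsub>T\<^esub> j) = \<epsilon> t \<otimes>\<^bsub>K\<^esub> \<chi> j)"

lemma DD_closed: "X \<in> carrier (FT n) \<Longrightarrow> D (n - 1) (D n X) \<in> carrier (FT (n - 2))"
  using D_closed[OF D_closed, of X n] by simp

lemma km_DD: "X \<in> carrier (FT n) \<Longrightarrow> km (n - 2) (D (n - 1) (D n X)) = \<zero>\<^bsub>FA (n - 2)\<^esub>"
  using km_D[of "D n X" "n - 1"] by (simp add: km_D D_closed \<Delta>_square km_closed)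

text \<open>The value of \<chi> on the curvature \<open>D \<circ> D\<close> at x \<otimes> 1. Since
  \<open>D\<close> is fixed before \<chi>, this is linear in \<chi>.\<close>

definition obs :: "('t \<Rightarrow> 'k) \<Rightarrow> int \<Rightarrow> 'm \<Rightarrow> 'm" where
  "obs \<chi> n = (\<lambda>x\<in>carrier (F n). ct (n - 2) \<chi> (D (n - 1) (D n (pT n x \<one>\<^bsub>T\<^esub>))))"

lemma functional_closed: "functional K T \<chi> \<Longrightarrow> t \<in> carrier T \<Longrightarrow> \<chi> t \<in> carrier K"
  by (auto simp: functional_def)

context
  fixes \<chi> assumes \<chi>: "small \<chi>"
begin

lemma \<chi>_fun: "functional K T \<chi>"
  using \<chi> by (simp add: small_def)

lemma \<chi>_small:
  assumes "j \<in> carrier T" "t \<in> carrier T" "\<kappa> j = \<zero>\<^bsub>A\<^esub>"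
  shows "\<chi> (j \<otimes>\<^bsub>T\<^esub> t) = \<epsilon> t \<otimes>\<^bsub>K\<^esub> \<chi> j" "\<chi> (t \<otimes>\<^bsub>T\<^esub> j) = \<epsilon> t \<otimes>\<^bsub>K\<^esub> \<chi> j"
  using \<chi> assms by (auto simp: small_def)

text \<open>As far as \<chi> can see, the kernel of \<epsilon> annihilates the kernel of \<kappa>,
  so t acts there as the scalar \<epsilon> t. \<open>small\<close> gives this for x \<otimes> j, and
  \<open>ker_pim\<close> reduces the rest to it.\<close>

lemma ct_ker_pact:
  assumes "Z \<in> carrier (FT n)" "km n Z = \<zero>\<^bsub>FA n\<^esub>" "t \<in> carrier T"
  shows "ct n \<chi> (aT n \<one>\<^bsub>R\<^esub> t Z) = sc n (\<epsilon> t) (ct n \<chi> Z)"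
proof -
  interpret X: tensor_mod K R "F n" T by (rule tT)
  note [simp] = X.P.tensor_map_add[OF T.module_axioms \<pi>_hom]
    X.P.tensor_map_pure[OF T.module_axioms \<pi>_hom] X.P.tensor_map_closed[OF T.module_axioms \<pi>_hom]
    X.functional_closed[OF \<chi>_fun] X.functional_closed[OF \<epsilon>]
  have "ct n \<chi> (aT n \<one>\<^bsub>R\<^esub> t (pim n Y)) = sc n (\<epsilon> t) (ct n \<chi> (pim n Y))" if "Y \<in> carrier (FT n)" for Y
    using that
    by (induction rule: X.tens_induct)
      (simp_all add: X.pact_add X.pact_pure X.pact_closed assms(3) \<pi>_closed \<chi>_small \<kappa>_\<pi>
        X.contract_add[OF \<chi>_fun] X.contract_pure[OF \<chi>_fun] X.contract_closed[OF \<chi>_fun]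
        X.M.lsmult_one X.M.lsmult_assoc[symmetric] X.R.scalar_mult_left X.R.smult_assoc1
        X.M.lsmult_r_distr)
  from this[OF assms(1)] show ?thesis by (simp add: ker_pim assms)
qed

text \<open>The mirror image of the preceding lemma: since \<chi>(t j) = \<epsilon>(t) \<chi>(j),
  multiplication by j from the right leaves of Y only its reduction.\<close>

lemma ct_pact_ker:
  assumes "Y \<in> carrier (FT n)" "j \<in> carrier T" "\<kappa> j = \<zero>\<^bsub>A\<^esub>"
  shows "ct n \<chi> (aT n \<one>\<^bsub>R\<^esub> j Y) = sc n (\<chi> j) (ct n \<epsilon> Y)"
proof -
  interpret X: tensor_mod K R "F n" T by (rule tT)
  note [simp] = X.functional_closed[OF \<chi>_fun] X.functional_closed[OF \<epsilon>]
  show ?thesis using assms(1)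
    by (induction rule: X.tens_induct)
      (simp_all add: assms(2,3) X.pact_add X.pact_pure X.pact_closed \<chi>_small
        X.contract_add[OF \<chi>_fun] X.contract_pure[OF \<chi>_fun] X.contract_closed[OF \<chi>_fun]
        X.contract_add[OF \<epsilon>] X.contract_pure[OF \<epsilon>] X.contract_closed[OF \<epsilon>]
        X.M.lsmult_one X.M.lsmult_assoc[symmetric] X.R.scalar_mult_left X.R.smult_assoc1
        X.M.lsmult_r_distr A.R.m_comm)
qed

lemma ct_\<phi>: "x \<in> carrier (F n) \<Longrightarrow> ct (n - 1) \<epsilon> (\<phi> n x) = d n x"
proof -
  assume x: "x \<in> carrier (F n)"
  interpret X: tensor_mod K R "F n" A by (rule tA)
  have "ct (n - 1) \<epsilon> (\<phi> n x) = ct (n - 1) (residue K A) (\<Delta> n (pA n x \<one>\<^bsub>A\<^esub>))"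
    unfolding \<phi>_def using x
    by (intro contract_tensor_map[OF tA tT s \<epsilon> functional_residue_A]) (auto simp: residue_A \<Delta>_closed)
  also have "\<dots> = d n (sc n (residue K A \<one>\<^bsub>A\<^esub>) x)"
    using x by (simp add: \<Delta>_reduction X.contract_pure[OF functional_residue_A])
  also have "residue K A \<one>\<^bsub>A\<^esub> = \<one>\<^bsub>K\<^esub>"
    using \<epsilon>_\<kappa>[of "\<one>\<^bsub>T\<^esub>"] by (simp add: \<kappa>_one \<epsilon>_one)
  finally show ?thesis using x by (simp add: X.M.lsmult_one)
qed

text \<open>For x \<otimes> j the value of \<open>D\<close> is \<phi>(x) j, and of \<phi>(x) only
  the reduction d x survives multiplication by j. So \<chi> sees \<open>D\<close> on the kernel as
  the original differential.\<close>

lemma ct_D_ker: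
  assumes "Z \<in> carrier (FT n)" "km n Z = \<zero>\<^bsub>FA n\<^esub>"
  shows "ct (n - 1) \<chi> (D n Z) = d n (ct n \<chi> Z)"
proof -
  interpret X: tensor_mod K R "F n" T by (rule tT)
  interpret Y: tensor_mod K R "F (n - 1)" T by (rule tT)
  note [simp] = X.P.tensor_map_add[OF T.module_axioms \<pi>_hom]
    X.P.tensor_map_pure[OF T.module_axioms \<pi>_hom] X.P.tensor_map_closed[OF T.module_axioms \<pi>_hom]
    X.functional_closed[OF \<chi>_fun]
  have "ct (n - 1) \<chi> (D n (pim n Y)) = d n (ct n \<chi> (pim n Y))" if "Y \<in> carrier (FT n)" for Y
    using that
    by (induction rule: X.tens_induct)
      (simp_all add: D_pure D_props D_closed \<pi>_closed \<kappa>_\<pi> ct_pact_ker ct_\<phi> \<phi>_closed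
        X.contract_add[OF \<chi>_fun] X.contract_pure[OF \<chi>_fun] X.contract_closed[OF \<chi>_fun]
        Y.contract_add[OF \<chi>_fun] d_add d_smult)
  from this[OF assms(1)] show ?thesis by (simp add: ker_pim assms)
qed

lemma D_DD: "X \<in> carrier (FT n) \<Longrightarrow> t \<in> carrier T \<Longrightarrow> r \<in> carrier R \<Longrightarrow>
    D (n - 1) (D n (aT n r t X)) = aT (n - 2) r t (D (n - 1) (D n X))"
  using D_props(3)[of r t "D n X" "n - 1"] by (simp add: D_props D_closed)

lemma obs_closed: "x \<in> carrier (F n) \<Longrightarrow> obs \<chi> n x \<in> carrier (F (n - 2))"
proof -
  interpret X: tensor_mod K R "F n" T by (rule tT)
  interpret Y: tensor_mod K R "F (n - 2)" T by (rule tT)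
  show "x \<in> carrier (F n) \<Longrightarrow> obs \<chi> n x \<in> carrier (F (n - 2))"
    by (simp add: obs_def Y.contract_closed[OF \<chi>_fun] DD_closed)
qed

lemma DD_add: "X \<in> carrier (FT n) \<Longrightarrow> Y \<in> carrier (FT n) \<Longrightarrow>
    D (n - 1) (D n (X \<oplus>\<^bsub>FT n\<^esub> Y)) = D (n - 1) (D n X) \<oplus>\<^bsub>FT (n - 2)\<^esub> D (n - 1) (D n Y)"
  using D_props(2)[of "D n X" "n - 1" "D n Y"] by (simp add: D_props D_closed)

lemma obs_hom: "obs \<chi> n \<in> lmod_hom R (F n) (F (n - 2))"
proof -
  interpret X: tensor_mod K R "F n" T by (rule tT)
  interpret Y: tensor_mod K R "F (n - 2)" T by (rule tT)
  have p: "pT n (r \<odot>\<^bsub>F n\<^esub> x) \<one>\<^bsub>T\<^esub> = aT n r \<one>\<^bsub>T\<^esub> (pT n x \<one>\<^bsub>T\<^esub>)"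
    if "r \<in> carrier R" "x \<in> carrier (F n)" for r x
    using that by (simp add: X.pact_pure)
  have "obs \<chi> n \<in> carrier (F n) \<rightarrow>\<^sub>E carrier (F (n - 2))"
    using obs_closed by (auto simp: obs_def)
  then show ?thesis
    by (auto simp: lmod_hom_def obs_def X.pure_add_l DD_add Y.contract_add[OF \<chi>_fun] DD_closed
        X.M.lsmult_closed p D_DD Y.contract_pact[OF \<chi>_fun])
qed

text \<open>\<open>D \<circ> D\<close> is linear over T with values in the kernel of
  \<open>km\<close>, so t acts through \<epsilon> t and only the reduction of X matters.\<close>

lemma ct_DD: "X \<in> carrier (FT n) \<Longrightarrow>
    ct (n - 2) \<chi> (D (n - 1) (D n X)) = obs \<chi> n (ct n \<epsilon> X)"
proof -
  interpret X: tensor_mod K R "F n" T by (rule tT)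
  interpret Y: tensor_mod K R "F (n - 2)" T by (rule tT)
  note [simp] = X.functional_closed[OF \<epsilon>]
  have o_add: "obs \<chi> n (x \<oplus>\<^bsub>F n\<^esub> y) = obs \<chi> n x \<oplus>\<^bsub>F (n - 2)\<^esub> obs \<chi> n y"
    if "x \<in> carrier (F n)" "y \<in> carrier (F n)" for x y
    using obs_hom that by (simp add: lmod_hom_def)
  have o_smult: "obs \<chi> n (sc n c x) = sc (n - 2) c (obs \<chi> n x)"
    if "x \<in> carrier (F n)" "c \<in> carrier K" for x c
    using obs_hom that by (simp add: lmod_hom_def)
  show "X \<in> carrier (FT n) \<Longrightarrow> ?thesis"
  proof (induction rule: X.tens_induct)
    case (pure x t)
    have "pT n x t = aT n \<one>\<^bsub>R\<^esub> t (pT n x \<one>\<^bsub>T\<^esub>)"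
      using pure by (simp add: X.pact_pure X.M.lsmult_one)
    then have "ct (n - 2) \<chi> (D (n - 1) (D n (pT n x t)))
        = ct (n - 2) \<chi> (aT (n - 2) \<one>\<^bsub>R\<^esub> t (D (n - 1) (D n (pT n x \<one>\<^bsub>T\<^esub>))))"
      using pure by (simp add: D_DD)
    also have "\<dots> = sc (n - 2) (\<epsilon> t) (obs \<chi> n x)"
      using pure by (simp add: ct_ker_pact DD_closed km_DD obs_def)
    finally show ?case using pure by (simp add: X.contract_pure[OF \<epsilon>] o_smult)
  qed (simp_all add: DD_add DD_closed X.contract_add[OF \<epsilon>] Y.contract_add[OF \<chi>_fun]
      X.contract_closed[OF \<epsilon>] o_add)
qed

text \<open>A Bianchi identity: the triple composite of \<open>D\<close> is evaluated once as D
  after D^2, by \<open>ct_D_ker\<close>, and once as D^2 after D, by \<open>ct_DD\<close>.\<close>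

lemma obs_chain:
  assumes "x \<in> carrier (F n)"
  shows "d (n - 2) (obs \<chi> n x) = obs \<chi> (n - 1) (d n x)"
proof -
  have x: "pT n x \<one>\<^bsub>T\<^esub> \<in> carrier (FT n)"
    using assms tensor_mod.pure_closed[OF tT] by simp
  have "d (n - 2) (obs \<chi> n x) = ct (n - 2 - 1) \<chi> (D (n - 2) (D (n - 1) (D n (pT n x \<one>\<^bsub>T\<^esub>))))"
    using assms x ct_D_ker[OF DD_closed km_DD, OF x x] by (simp add: obs_def)
  also have "\<dots> = obs \<chi> (n - 1) (ct (n - 1) \<epsilon> (D n (pT n x \<one>\<^bsub>T\<^esub>)))"
    using ct_DD[of "D n (pT n x \<one>\<^bsub>T\<^esub>)" "n - 1"] x by (simp add: D_closed)
  also have "\<dots> = obs \<chi> (n - 1) (d n x)"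
    using assms by (simp add: D_pure_one ct_\<phi>)
  finally show ?thesis .
qed

lemma obs_chain_homs: "obs \<chi> \<in> chain_homs R F d (- 2)"
proof -
  \<comment> \<open>In degree -2 the sign exponent j + 1 is odd, so the chain condition asks for a
    difference.\<close>
  have "obs \<chi> (n - 1) (d n x) \<oplus>\<^bsub>F (n - 3)\<^esub> \<ominus>\<^bsub>F (n - 3)\<^esub> d (n - 2) (obs \<chi> n x)
      = \<zero>\<^bsub>F (n - 3)\<^esub>" if x: "x \<in> carrier (F n)" for n x
  proof -
    interpret M: lmodule R "F (n - 3)" by (rule lm)
    have "d (n - 2) (obs \<chi> n x) \<in> carrier (F (n - 3))"
      using d_closed[OF obs_closed[OF x]] by simp
    then show ?thesis using x by (simp add: obs_chain[symmetric] M.r_neg)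
  qed
  then show ?thesis
    using obs_hom by (simp add: chain_homs_def graded_homs_def signed_def)
qed

end

lemma obs_add:
  assumes "functional K T \<chi>" "functional K T \<psi>" "functional K T \<omega>"
    "\<And>t. t \<in> carrier T \<Longrightarrow> \<omega> t = \<chi> t \<oplus>\<^bsub>K\<^esub> \<psi> t"
  shows "obs \<omega> = obs \<chi> \<oplus>\<^bsub>graded_homs R F (- 2)\<^esub> obs \<psi>"
proof (intro ext)
  fix n x
  interpret X: tensor_mod K R "F n" T by (rule tT)
  interpret Y: tensor_mod K R "F (n - 2)" T by (rule tT)
  show "obs \<omega> n x = (obs \<chi> \<oplus>\<^bsub>graded_homs R F (- 2)\<^esub> obs \<psi>) n x"
    using assms by (auto simp: graded_homs_def obs_def DD_closed intro!: Y.contract_fadd)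
qed

lemma obs_smult:
  assumes "functional K T \<chi>" "functional K T \<omega>" "c \<in> carrier K"
    "\<And>t. t \<in> carrier T \<Longrightarrow> \<omega> t = c \<otimes>\<^bsub>K\<^esub> \<chi> t"
  shows "obs \<omega> = c \<odot>\<^bsub>graded_homs R F (- 2)\<^esub> obs \<chi>"
proof (intro ext)
  fix n x
  interpret X: tensor_mod K R "F n" T by (rule tT)
  interpret Y: tensor_mod K R "F (n - 2)" T by (rule tT)
  show "obs \<omega> n x = (c \<odot>\<^bsub>graded_homs R F (- 2)\<^esub> obs \<chi>) n x"
    using assms by (auto simp: graded_homs_def obs_def DD_closed intro!: Y.contract_fsmult)
qed

end

text \<open>\<open>B\<close> is a small extension of \<open>A\<close> with kernel \<open>K e'\<close>, where \<open>e' = \<theta> e\<close>. As \<open>\<chi> e = -1\<close>, \<open>\<theta> j = - \<chi> j e'\<close>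
  for \<open>j\<close> in the kernel of \<open>\<kappa>\<close>, so a null homotopy \<open>\<eta>\<close> of the obstruction makes the
  differential induced by \<open>D + \<eta> e'\<close> on \<open>F \<otimes> B\<close> square to zero.\<close>

locale correction = obstruction K R F d A T \<kappa> s \<epsilon> \<Delta>
  for K :: "('k, 'e) ring_scheme" and R :: "('k, 'r) module" and F :: "int \<Rightarrow> ('r, 'm) module"
    and d :: "int \<Rightarrow> 'm \<Rightarrow> 'm" and A :: "('k, 'a) module" and T :: "('k, 't) module"
    and \<kappa> :: "'t \<Rightarrow> 'a" and s :: "'a \<Rightarrow> 't" and \<epsilon> :: "'t \<Rightarrow> 'k"
    and \<Delta> :: "int \<Rightarrow> ('m, 'a) tensor \<Rightarrow> ('m, 'a) tensor" +
  fixes B :: "('k, 'b) module" and \<theta> :: "'t \<Rightarrow> 'b" and h :: "'b \<Rightarrow> 'a" and \<chi> :: "'t \<Rightarrow> 'k"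
    and e :: 't and \<eta> :: "int \<Rightarrow> 'm \<Rightarrow> 'm"
  assumes B: "nc_algebra K B"
    and lam: "\<theta> \<in> module_hom K T B"
    and lam_mult: "\<And>t u. t \<in> carrier T \<Longrightarrow> u \<in> carrier T \<Longrightarrow> \<theta> (t \<otimes>\<^bsub>T\<^esub> u) = \<theta> t \<otimes>\<^bsub>B\<^esub> \<theta> u"
    and lam_one: "\<theta> \<one>\<^bsub>T\<^esub> = \<one>\<^bsub>B\<^esub>" and lam_surj: "\<theta> ` carrier T = carrier B"
    and h: "h \<in> module_hom K B A"
    and h_mult: "\<And>t u. t \<in> carrier B \<Longrightarrow> u \<in> carrier B \<Longrightarrow> h (t \<otimes>\<^bsub>B\<^esub> u) = h t \<otimes>\<^bsub>A\<^esub> h u"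
    and h_lam: "\<And>t. t \<in> carrier T \<Longrightarrow> h (\<theta> t) = \<kappa> t"
    and \<chi>: "small \<chi>" and e: "e \<in> carrier T" "\<kappa> e = \<zero>\<^bsub>A\<^esub>" "\<chi> e = \<ominus>\<^bsub>K\<^esub> \<one>\<^bsub>K\<^esub>"
    and lam_eqI: "\<And>t u. t \<in> carrier T \<Longrightarrow> u \<in> carrier T \<Longrightarrow> \<kappa> t = \<kappa> u \<Longrightarrow> \<chi> t = \<chi> u \<Longrightarrow> \<theta> t = \<theta> u"
    and residue_lam: "\<And>t. t \<in> carrier T \<Longrightarrow> residue K B (\<theta> t) = \<epsilon> t"
    and residue_B: "functional K B (residue K B)"
    and \<eta>: "\<And>n. \<eta> n \<in> lmod_hom R (F n) (F (n - 1))"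
    and null: "\<And>n x. x \<in> carrier (F n) \<Longrightarrow>
      obs \<chi> n x = \<eta> (n - 1) (d n x) \<oplus>\<^bsub>F (n - 2)\<^esub> d (n - 1) (\<eta> n x)"
begin

sublocale B: nc_algebra K B by (rule B)

lemmas tB = tm[OF B]

abbreviation "FB n \<equiv> tens K R (F n) B"
abbreviation "pB n \<equiv> pure K R (F n) B"
abbreviation "aB n \<equiv> pact K R (F n) B"
abbreviation "lamm n \<equiv> tensor_map K (VF n) B \<theta>"
abbreviation "e' \<equiv> \<theta> e"

lemma lam_closed: "t \<in> carrier T \<Longrightarrow> \<theta> t \<in> carrier B"
  using lam by (auto simp: module_hom_def)

lemma lam_smult: "c \<in> carrier K \<Longrightarrow> t \<in> carrier T \<Longrightarrow> \<theta> (c \<odot>\<^bsub>T\<^esub> t) = c \<odot>\<^bsub>B\<^esub> \<theta> t"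
  using lam by (auto simp: module_hom_def)

lemma lam_add: "u \<in> carrier T \<Longrightarrow> t \<in> carrier T \<Longrightarrow> \<theta> (u \<oplus>\<^bsub>T\<^esub> t) = \<theta> u \<oplus>\<^bsub>B\<^esub> \<theta> t"
  using lam by (auto simp: module_hom_def)

lemma e'_closed: "e' \<in> carrier B"
  by (simp add: lam_closed e)

lemmas \<epsilon>_closed = functional_closed[OF \<epsilon>]
lemmas \<chi>_functional = \<chi>_fun[OF \<chi>]
lemmas \<chi>_closed = functional_closed[OF \<chi>_functional]

lemma \<kappa>_smult: "c \<in> carrier K \<Longrightarrow> t \<in> carrier T \<Longrightarrow> \<kappa> (c \<odot>\<^bsub>T\<^esub> t) = c \<odot>\<^bsub>A\<^esub> \<kappa> t"
  using \<kappa> by (auto simp: module_hom_def)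

lemma \<chi>_smult: "c \<in> carrier K \<Longrightarrow> t \<in> carrier T \<Longrightarrow> \<chi> (c \<odot>\<^bsub>T\<^esub> t) = c \<otimes>\<^bsub>K\<^esub> \<chi> t"
  using \<chi>_functional by (auto simp: functional_def)

text \<open>By \<open>lam_eqI\<close> an equation in B can be checked under \<kappa> and \<chi>.
  Here \<kappa> kills both sides and \<open>small\<close> compares the values of \<chi>; so B acts
  on the line of e' through its residue field.\<close>

lemma e'_lam: "t \<in> carrier T \<Longrightarrow> e' \<otimes>\<^bsub>B\<^esub> \<theta> t = \<epsilon> t \<odot>\<^bsub>B\<^esub> e'"
proof -
  assume t: "t \<in> carrier T"
  have "\<theta> (e \<otimes>\<^bsub>T\<^esub> t) = \<theta> (\<epsilon> t \<odot>\<^bsub>T\<^esub> e)"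
    using t e \<chi>_small(1)[OF \<chi> e(1) t e(2)]
    by (intro lam_eqI) (auto simp: \<kappa>_mult \<kappa>_smult \<chi>_smult \<epsilon>_closed \<kappa>_closed)
  then show ?thesis using t e by (simp add: lam_mult lam_smult \<epsilon>_closed)
qed

lemma lam_e': "t \<in> carrier T \<Longrightarrow> \<theta> t \<otimes>\<^bsub>B\<^esub> e' = \<epsilon> t \<odot>\<^bsub>B\<^esub> e'"
proof -
  assume t: "t \<in> carrier T"
  have "\<theta> (t \<otimes>\<^bsub>T\<^esub> e) = \<theta> (\<epsilon> t \<odot>\<^bsub>T\<^esub> e)"
    using t e \<chi>_small(2)[OF \<chi> e(1) t e(2)]
    by (intro lam_eqI) (auto simp: \<kappa>_mult \<kappa>_smult \<chi>_smult \<epsilon>_closed \<kappa>_closed)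
  then show ?thesis using t e by (simp add: lam_mult lam_smult \<epsilon>_closed)
qed

lemma \<epsilon>_e: "\<epsilon> e = \<zero>\<^bsub>K\<^esub>"
proof -
  have "\<epsilon> e = residue K A (\<kappa> \<zero>\<^bsub>T\<^esub>)" using \<epsilon>_\<kappa>[of e] e by (simp add: \<kappa>_zero)
  also have "\<dots> = \<epsilon> (\<zero>\<^bsub>K\<^esub> \<odot>\<^bsub>T\<^esub> \<zero>\<^bsub>T\<^esub>)" by (simp add: \<epsilon>_\<kappa>)
  also have "\<dots> = \<zero>\<^bsub>K\<^esub> \<otimes>\<^bsub>K\<^esub> \<epsilon> \<zero>\<^bsub>T\<^esub>"
    using \<epsilon> by (simp only: functional_def A.R.zero_closed T.zero_closed)
  finally show ?thesis by (simp add: \<epsilon>_closed)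
qed

lemma e'_e': "e' \<otimes>\<^bsub>B\<^esub> e' = \<zero>\<^bsub>B\<^esub>"
  using e'_lam[of e] e by (simp add: \<epsilon>_e e'_closed)

lemma \<eta>_closed: "x \<in> carrier (F n) \<Longrightarrow> \<eta> n x \<in> carrier (F (n - 1))"
  using \<eta>[of n] by (auto simp: lmod_hom_def)

lemma \<eta>_add: "x \<in> carrier (F n) \<Longrightarrow> y \<in> carrier (F n) \<Longrightarrow>
    \<eta> n (x \<oplus>\<^bsub>F n\<^esub> y) = \<eta> n x \<oplus>\<^bsub>F (n - 1)\<^esub> \<eta> n y"
  using \<eta>[of n] by (auto simp: lmod_hom_def)

lemma \<eta>_smult: "r \<in> carrier R \<Longrightarrow> x \<in> carrier (F n) \<Longrightarrow>
    \<eta> n (r \<odot>\<^bsub>F n\<^esub> x) = r \<odot>\<^bsub>F (n - 1)\<^esub> \<eta> n x"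
  using \<eta>[of n] by (auto simp: lmod_hom_def)

lemma lamm_closed: "X \<in> carrier (FT n) \<Longrightarrow> lamm n X \<in> carrier (FB n)"
proof -
  interpret tensor_mod K R "F n" T by (rule tT)
  show "X \<in> carrier (FT n) \<Longrightarrow> ?thesis"
    by (rule P.tensor_map_closed[OF B.module_axioms lam])
qed

lemma lamm_add: "X \<in> carrier (FT n) \<Longrightarrow> Y \<in> carrier (FT n) \<Longrightarrow>
    lamm n (X \<oplus>\<^bsub>FT n\<^esub> Y) = lamm n X \<oplus>\<^bsub>FB n\<^esub> lamm n Y"
proof -
  interpret tensor_mod K R "F n" T by (rule tT)
  show "X \<in> carrier (FT n) \<Longrightarrow> Y \<in> carrier (FT n) \<Longrightarrow> ?thesis"
    by (rule P.tensor_map_add[OF B.module_axioms lam])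
qed

lemma lamm_pure: "x \<in> carrier (F n) \<Longrightarrow> t \<in> carrier T \<Longrightarrow> lamm n (pT n x t) = pB n x (\<theta> t)"
proof -
  interpret tensor_mod K R "F n" T by (rule tT)
  show "x \<in> carrier (F n) \<Longrightarrow> t \<in> carrier T \<Longrightarrow> ?thesis"
    by (subst P.tensor_map_pure[OF B.module_axioms lam]) simp_all
qed

definition \<phi>' :: "int \<Rightarrow> 'm \<Rightarrow> ('m, 'b) tensor" where
  "\<phi>' n x = lamm (n - 1) (\<phi> n x) \<oplus>\<^bsub>FB (n - 1)\<^esub> pB (n - 1) (\<eta> n x) e'"

definition \<Delta>' :: "int \<Rightarrow> ('m, 'b) tensor \<Rightarrow> ('m, 'b) tensor" where
  "\<Delta>' n = extend K R (F n) (F (n - 1)) B (\<phi>' n)"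

lemma \<phi>'_linear: "tens_linear K R (F n) (F (n - 1)) B (\<phi>' n)"
proof -
  interpret X: tensor_mod K R "F n" B by (rule tB)
  interpret Y: tensor_mod K R "F (n - 1)" B by (rule tB)
  have *: "\<phi> n (x \<oplus>\<^bsub>F n\<^esub> y) = \<phi> n x \<oplus>\<^bsub>FT (n - 1)\<^esub> \<phi> n y"
    if "x \<in> carrier (F n)" "y \<in> carrier (F n)" for x y
    using \<phi>_linear[of n] that by (auto simp: tens_linear_def)
  have **: "\<phi> n (r \<odot>\<^bsub>F n\<^esub> x) = aT (n - 1) r \<one>\<^bsub>T\<^esub> (\<phi> n x)"
    if "x \<in> carrier (F n)" "r \<in> carrier R" for x r
    using \<phi>_linear[of n] that by (auto simp: tens_linear_def)
  show ?thesis
    unfolding tens_linear_def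
    by (auto simp: \<phi>'_def lamm_closed \<phi>_closed \<eta>_closed e'_closed * ** \<eta>_add lamm_add Y.pure_add_l
        Y.add4 \<eta>_smult tensor_map_pact_left[OF tT tB lam] Y.pact_add Y.pact_pure)
qed

lemma \<phi>'_closed: "x \<in> carrier (F n) \<Longrightarrow> \<phi>' n x \<in> carrier (FB (n - 1))"
  using \<phi>'_linear[of n] by (auto simp: tens_linear_def)

lemma \<Delta>'_hom: "\<Delta>' n \<in> lmod_hom (tensor_algebra K R (opp B)) (tensor_module K R (F n) B)
    (tensor_module K R (F (n - 1)) B)"
  unfolding \<Delta>'_def by (rule extend_hom[OF tB tB \<phi>'_linear])

lemmas \<Delta>'_props = tensor_mod_homD[OF tB tB \<Delta>'_hom]

lemma \<Delta>'_closed: "X \<in> carrier (FB n) \<Longrightarrow> \<Delta>' n X \<in> carrier (FB (n - 1))"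
  using \<Delta>'_props(1)[of n] by auto

lemma \<Delta>'_pure: "x \<in> carrier (F n) \<Longrightarrow> b \<in> carrier B \<Longrightarrow>
    \<Delta>' n (pB n x b) = aB (n - 1) \<one>\<^bsub>R\<^esub> b (\<phi>' n x)"
  unfolding \<Delta>'_def by (rule extend_pure[OF tB tB \<phi>'_linear])

text \<open>Since e' \<theta>(t) = \<epsilon>(t) e', the correction term sees only the reduction of
  Y. This brings calculations in F \<otimes> B back to F \<otimes> T.\<close>

lemma \<Delta>'_lamm: "Y \<in> carrier (FT n) \<Longrightarrow> \<Delta>' n (lamm n Y)
    = lamm (n - 1) (D n Y) \<oplus>\<^bsub>FB (n - 1)\<^esub> pB (n - 1) (\<eta> n (ct n \<epsilon> Y)) e'"
proof -
  interpret X: tensor_mod K R "F n" T by (rule tT)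
  interpret XB: tensor_mod K R "F n" B by (rule tB)
  interpret YB: tensor_mod K R "F (n - 1)" B by (rule tB)
  show "Y \<in> carrier (FT n) \<Longrightarrow> ?thesis"
  proof (induction rule: X.tens_induct)
    case (pure y t)
    then show ?case
      by (simp add: lamm_pure \<Delta>'_pure lam_closed \<phi>'_def YB.pact_add lamm_closed \<phi>_closed \<eta>_closed
          e'_closed D_pure tensor_map_pact[OF tT tB lam lam_mult] YB.pact_pure e'_lam
          X.contract_pure[OF \<epsilon>] \<eta>_smult YB.pure_scalar \<epsilon>_closed YB.M.lsmult_one)
  next
    case (add X Y)
    then show ?case
      by (simp add: lamm_add \<Delta>'_props lamm_closed D_props D_closed X.contract_add[OF \<epsilon>]
          X.contract_closed[OF \<epsilon>] \<eta>_add \<eta>_closed YB.pure_add_l e'_closed YB.add4)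
  qed
qed

lemma lamm_e: "Y \<in> carrier (FT n) \<Longrightarrow> lamm n (aT n \<one>\<^bsub>R\<^esub> e Y) = pB n (ct n \<epsilon> Y) e'"
proof -
  interpret X: tensor_mod K R "F n" T by (rule tT)
  interpret XB: tensor_mod K R "F n" B by (rule tB)
  show "Y \<in> carrier (FT n) \<Longrightarrow> ?thesis"
    by (induction rule: X.tens_induct)
      (simp_all add: X.pact_pure e lamm_pure lam_mult lam_e' X.contract_pure[OF \<epsilon>]
        XB.pure_scalar \<epsilon>_closed e'_closed X.M.lsmult_one X.pact_add lamm_add X.pact_closed
        X.contract_add[OF \<epsilon>] XB.pure_add_l X.contract_closed[OF \<epsilon>])
qed

text \<open>Multiplication by e' leaves only the reduction d y of \<phi>(y), and it kills the
  correction because e' e' = 0.\<close>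

lemma \<Delta>'_e': "y \<in> carrier (F n) \<Longrightarrow> \<Delta>' n (pB n y e') = pB (n - 1) (d n y) e'"
proof -
  assume y: "y \<in> carrier (F n)"
  interpret X: tensor_mod K R "F n" B by (rule tB)
  interpret Y: tensor_mod K R "F (n - 1)" B by (rule tB)
  have "\<Delta>' n (pB n y e') = aB (n - 1) \<one>\<^bsub>R\<^esub> e' (lamm (n - 1) (\<phi> n y))
      \<oplus>\<^bsub>FB (n - 1)\<^esub> pB (n - 1) (\<eta> n y) (e' \<otimes>\<^bsub>B\<^esub> e')"
    using y by (simp add: \<Delta>'_pure e'_closed \<phi>'_def Y.pact_add lamm_closed \<phi>_closed \<eta>_closed
        Y.pact_pure Y.M.lsmult_one)
  also have "aB (n - 1) \<one>\<^bsub>R\<^esub> e' (lamm (n - 1) (\<phi> n y)) = pB (n - 1) (d n y) e'"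
    using y lamm_e[of "\<phi> n y" "n - 1"]
    by (simp add: tensor_map_pact[OF tT tB lam lam_mult] e \<phi>_closed ct_\<phi>[OF \<chi>])
  finally show ?thesis
    using y Y.P.pure_zero_right[of "\<eta> n y"] by (simp add: e'_e' \<eta>_closed d_closed e'_closed)
qed

lemma lamm_ker:
  assumes "Z \<in> carrier (FT n)" "km n Z = \<zero>\<^bsub>FA n\<^esub>"
  shows "lamm n Z \<oplus>\<^bsub>FB n\<^esub> pB n (ct n \<chi> Z) e' = \<zero>\<^bsub>FB n\<^esub>"
proof -
  interpret X: tensor_mod K R "F n" T by (rule tT)
  interpret XB: tensor_mod K R "F n" B by (rule tB)
  note [simp] = X.P.tensor_map_add[OF T.module_axioms \<pi>_hom]
    X.P.tensor_map_pure[OF T.module_axioms \<pi>_hom] X.P.tensor_map_closed[OF T.module_axioms \<pi>_hom]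
  have z: "\<theta> (\<pi> t) \<oplus>\<^bsub>B\<^esub> \<chi> (\<pi> t) \<odot>\<^bsub>B\<^esub> e' = \<zero>\<^bsub>B\<^esub>" if t: "t \<in> carrier T" for t
  proof -
    \<comment> \<open>The sum is killed by \<kappa> and, because \<chi> e = -1, also by \<chi>.
      Writing zero as a zero multiple of e lets linearity evaluate the right-hand side.\<close>
    have "\<theta> (\<pi> t \<oplus>\<^bsub>T\<^esub> \<chi> (\<pi> t) \<odot>\<^bsub>T\<^esub> e) = \<theta> (\<zero>\<^bsub>K\<^esub> \<odot>\<^bsub>T\<^esub> e)"
    proof (rule lam_eqI)
      show "\<kappa> (\<pi> t \<oplus>\<^bsub>T\<^esub> \<chi> (\<pi> t) \<odot>\<^bsub>T\<^esub> e) = \<kappa> (\<zero>\<^bsub>K\<^esub> \<odot>\<^bsub>T\<^esub> e)"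
        using t \<kappa> e by (simp add: module_hom_def \<pi>_closed \<chi>_closed \<kappa>_\<pi> \<kappa>_zero)
      show "\<chi> (\<pi> t \<oplus>\<^bsub>T\<^esub> \<chi> (\<pi> t) \<odot>\<^bsub>T\<^esub> e) = \<chi> (\<zero>\<^bsub>K\<^esub> \<odot>\<^bsub>T\<^esub> e)"
        using t \<chi>_functional e \<chi>_smult[of "\<zero>\<^bsub>K\<^esub>" e]
        by (simp add: functional_def \<pi>_closed \<chi>_closed A.R.r_minus A.R.r_neg)
    qed (use t e in \<open>simp_all add: \<pi>_closed \<chi>_closed\<close>)
    also have "\<dots> = \<zero>\<^bsub>B\<^esub>"
      using e e'_closed by (subst lam_smult) simp_all
    finally show ?thesis using t e by (simp add: lam_add lam_smult \<pi>_closed \<chi>_closed e'_closed)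
  qed
  have "lamm n (pim n Y) \<oplus>\<^bsub>FB n\<^esub> pB n (ct n \<chi> (pim n Y)) e' = \<zero>\<^bsub>FB n\<^esub>"
    if "Y \<in> carrier (FT n)" for Y
    using that
  proof (induction rule: X.tens_induct)
    case (pure x t)
    then show ?case
      using XB.P.pure_zero_right[of x]
      by (simp add: lamm_pure \<pi>_closed X.contract_pure[OF \<chi>_functional] XB.pure_scalar \<chi>_closed
          e'_closed XB.pure_add_r[symmetric] lam_closed z)
  next
    case (add X Y)
    have "lamm n (pim n (X \<oplus>\<^bsub>FT n\<^esub> Y)) \<oplus>\<^bsub>FB n\<^esub> pB n (ct n \<chi> (pim n (X \<oplus>\<^bsub>FT n\<^esub> Y))) e'
       = (lamm n (pim n X) \<oplus>\<^bsub>FB n\<^esub> pB n (ct n \<chi> (pim n X)) e')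
         \<oplus>\<^bsub>FB n\<^esub> (lamm n (pim n Y) \<oplus>\<^bsub>FB n\<^esub> pB n (ct n \<chi> (pim n Y)) e')"
      using add(1,2)
      by (simp add: lamm_add X.contract_add[OF \<chi>_functional] X.contract_closed[OF \<chi>_functional]
          XB.pure_add_l e'_closed lamm_closed XB.add4)
    then show ?case using add(3,4) by simp
  qed
  from this[OF assms(1)] show ?thesis by (simp add: ker_pim assms)
qed

text \<open>By \<open>lamm_ker\<close> the curvature contributes minus the obstruction times e'. The
  homotopy contributes \<eta> d + d \<eta>, which is the obstruction, times e', and the two
  cancel.\<close>

lemma \<Delta>'_\<phi>': "x \<in> carrier (F n) \<Longrightarrow> \<Delta>' (n - 1) (\<phi>' n x) = \<zero>\<^bsub>FB (n - 2)\<^esub>"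
proof -
  assume x: "x \<in> carrier (F n)"
  interpret X: tensor_mod K R "F n" T by (rule tT)
  interpret Y: tensor_mod K R "F (n - 1)" B by (rule tB)
  interpret W: tensor_mod K R "F (n - 2)" B by (rule tB)
  interpret WT: tensor_mod K R "F (n - 2)" T by (rule tT)
  let ?Z = "D (n - 1) (D n (pT n x \<one>\<^bsub>T\<^esub>))"
  have c: "\<eta> (n - 1) (d n x) \<in> carrier (F (n - 2))" "d (n - 1) (\<eta> n x) \<in> carrier (F (n - 2))"
    using x \<eta>_closed[OF d_closed[OF x]] d_closed[OF \<eta>_closed[OF x]] by simp_all
  have Z: "?Z \<in> carrier (FT (n - 2))" "km (n - 2) ?Z = \<zero>\<^bsub>FA (n - 2)\<^esub>"
    using x by (simp_all add: DD_closed km_DD)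
  have "\<Delta>' (n - 1) (\<phi>' n x)
      = \<Delta>' (n - 1) (lamm (n - 1) (\<phi> n x)) \<oplus>\<^bsub>FB (n - 2)\<^esub> \<Delta>' (n - 1) (pB (n - 1) (\<eta> n x) e')"
    using x \<Delta>'_props(2)[of "lamm (n - 1) (\<phi> n x)" "n - 1"]
    by (simp add: \<phi>'_def lamm_closed \<phi>_closed \<eta>_closed e'_closed)
  also have "\<Delta>' (n - 1) (lamm (n - 1) (\<phi> n x))
      = lamm (n - 2) ?Z \<oplus>\<^bsub>FB (n - 2)\<^esub> pB (n - 2) (\<eta> (n - 1) (d n x)) e'"
    using x \<Delta>'_lamm[of "\<phi> n x" "n - 1"] by (simp add: \<phi>_closed ct_\<phi>[OF \<chi>] D_pure_one)
  also have "\<Delta>' (n - 1) (pB (n - 1) (\<eta> n x) e') = pB (n - 2) (d (n - 1) (\<eta> n x)) e'"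
    using \<Delta>'_e'[of "\<eta> n x" "n - 1"] x by (simp add: \<eta>_closed)
  also have "lamm (n - 2) ?Z \<oplus>\<^bsub>FB (n - 2)\<^esub> pB (n - 2) (\<eta> (n - 1) (d n x)) e'
      \<oplus>\<^bsub>FB (n - 2)\<^esub> pB (n - 2) (d (n - 1) (\<eta> n x)) e'
      = lamm (n - 2) ?Z \<oplus>\<^bsub>FB (n - 2)\<^esub> pB (n - 2) (obs \<chi> n x) e'"
    using x c Z(1) by (simp add: null W.pure_add_l e'_closed lamm_closed W.P.T.a_assoc)
  also have "obs \<chi> n x = ct (n - 2) \<chi> ?Z" using x by (simp add: obs_def)
  finally show ?thesis using lamm_ker[OF Z] by simp
qed

lemma \<Delta>'_lift: "\<Delta>' \<in> artinian_lifts K R F d B"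
proof -
  have sq: "\<Delta>' (n - 1) (\<Delta>' n X) = \<zero>\<^bsub>FB (n - 2)\<^esub>" if "X \<in> carrier (FB n)" for n X
  proof -
    interpret X: tensor_mod K R "F n" B by (rule tB)
    interpret W: tensor_mod K R "F (n - 2)" B by (rule tB)
    have 0: "aB (n - 2) \<one>\<^bsub>R\<^esub> b \<zero>\<^bsub>FB (n - 2)\<^esub> = \<zero>\<^bsub>FB (n - 2)\<^esub>" if "b \<in> carrier B" for b
      using that W.pact_pure[of "\<one>\<^bsub>R\<^esub>" b "\<zero>\<^bsub>F (n - 2)\<^esub>" "\<zero>\<^bsub>B\<^esub>"]
        W.P.pure_zero_right[of "\<zero>\<^bsub>F (n - 2)\<^esub>"] by (simp add: W.M.lsmult_one)
    show ?thesis using that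
    proof (induction rule: X.tens_induct)
      case (pure x b)
      then have "\<Delta>' (n - 1) (\<Delta>' n (pB n x b)) = aB (n - 2) \<one>\<^bsub>R\<^esub> b (\<Delta>' (n - 1) (\<phi>' n x))"
        using \<Delta>'_props(3)[of "\<one>\<^bsub>R\<^esub>" b "\<phi>' n x" "n - 1"] by (simp add: \<Delta>'_pure \<phi>'_closed)
      then show ?case using pure by (simp add: \<Delta>'_\<phi>' 0)
    next
      case (add X Y)
      then show ?case
        using \<Delta>'_props(2)[of "\<Delta>' n X" "n - 1" "\<Delta>' n Y"] by (simp add: \<Delta>'_props \<Delta>'_closed)
    qed
  qed
  have red: "ct (n - 1) (residue K B) (\<Delta>' n X) = d n (ct n (residue K B) X)"
    if "X \<in> carrier (FB n)" for n X
  proof -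
    interpret X: tensor_mod K R "F n" B by (rule tB)
    interpret Y: tensor_mod K R "F (n - 1)" B by (rule tB)
    \<comment> \<open>Multiplicativity of the residue is known through \<epsilon> on T, so b is
      first lifted to T.\<close>
    have *: "ct (n - 1) (residue K B) (aB (n - 1) \<one>\<^bsub>R\<^esub> b (lamm (n - 1) Z))
        = sc (n - 1) (residue K B b) (ct (n - 1) \<epsilon> Z)"
      if Z: "Z \<in> carrier (FT (n - 1))" and b: "b \<in> carrier B" for Z b
    proof -
      interpret XT: tensor_mod K R "F (n - 1)" T by (rule tT)
      obtain u where u: "u \<in> carrier T" "b = \<theta> u" using b lam_surj by blast
      show ?thesis using Z
        by (induction rule: XT.tens_induct)
          (simp_all add: u lam_closed lamm_pure Y.pact_pure Y.contract_pure[OF residue_B]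
            lam_mult[symmetric] residue_lam \<epsilon>_mult XT.contract_pure[OF \<epsilon>] \<epsilon>_closed
            Y.M.lsmult_one Y.M.lsmult_assoc[symmetric] X.R.scalar_mult_left X.R.smult_assoc1[symmetric]
            A.R.m_comm lamm_add Y.pact_add lamm_closed Y.contract_add[OF residue_B] Y.pact_closed
            XT.contract_add[OF \<epsilon>] XT.contract_closed[OF \<epsilon>] Y.M.lsmult_r_distr)
    qed
    show ?thesis using that
    proof (induction rule: X.tens_induct)
      case (pure x b)
      obtain u where u: "u \<in> carrier T" "b = \<theta> u" using pure lam_surj by blast
      \<comment> \<open>The correction lies over e', whose residue is zero, so it is invisible after
        reduction.\<close>
      have "residue K B (e' \<otimes>\<^bsub>B\<^esub> b) = residue K B (\<theta> (e \<otimes>\<^bsub>T\<^esub> u))"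
        using u e by (simp add: lam_mult)
      also have "\<dots> = \<zero>\<^bsub>K\<^esub>" using u(1) e by (simp add: residue_lam \<epsilon>_mult \<epsilon>_e \<epsilon>_closed)
      finally have r0: "residue K B (e' \<otimes>\<^bsub>B\<^esub> b) = \<zero>\<^bsub>K\<^esub>" .
      have "residue K B b \<in> carrier K" using u by (simp add: residue_lam \<epsilon>_closed)
      moreover have "\<zero>\<^bsub>R\<^esub> \<odot>\<^bsub>F (n - 1)\<^esub> \<eta> n x = \<zero>\<^bsub>F (n - 1)\<^esub>"
        using Y.P.V.smult_l_null[of "\<eta> n x"] pure by (simp add: \<eta>_closed)
      ultimately show ?case
        using pure
        by (simp add: \<Delta>'_pure \<phi>'_def Y.pact_add lamm_closed \<phi>_closed \<eta>_closed e'_closed Y.pact_pure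
            Y.contract_add[OF residue_B] Y.pact_closed * ct_\<phi>[OF \<chi>]
            Y.contract_pure[OF residue_B] X.contract_pure[OF residue_B] r0 Y.M.lsmult_one
            d_smult d_closed Y.M.lsmult_closed)
    next
      case (add X Y)
      then show ?case
        by (simp add: \<Delta>'_props \<Delta>'_closed X.contract_add[OF residue_B] Y.contract_add[OF residue_B]
            X.contract_closed[OF residue_B] d_add)
    qed
  qed
  show ?thesis
    using sq red \<Delta>'_hom
    by (simp add: artinian_lifts_def is_complex_def tensor_module_simps tensor_reduction_contract)
qed

lemma \<Delta>'_base_change: "is_base_change K R F A B h \<Delta>' \<Delta>"
proof -
  have "\<Delta> n (tensor_map K (VF n) A h X) = tensor_map K (VF (n - 1)) A h (\<Delta>' n X)"
    if "X \<in> carrier (FB n)" for n X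
  proof -
    interpret X: tensor_mod K R "F n" B by (rule tB)
    interpret XA: tensor_mod K R "F n" A by (rule tA)
    interpret Y: tensor_mod K R "F (n - 1)" B by (rule tB)
    interpret YA: tensor_mod K R "F (n - 1)" A by (rule tA)
    note [simp] = X.P.tensor_map_add[OF A.module_axioms h]
      X.P.tensor_map_pure[OF A.module_axioms h] X.P.tensor_map_closed[OF A.module_axioms h]
      Y.P.tensor_map_add[OF A.module_axioms h]
      Y.P.tensor_map_pure[OF A.module_axioms h] Y.P.tensor_map_closed[OF A.module_axioms h]
    have hc: "b \<in> carrier B \<Longrightarrow> h b \<in> carrier A" for b using h by (auto simp: module_hom_def)
    show ?thesis using that
    proof (induction rule: X.tens_induct)
      case (pure x b)
      have "\<Delta> n (pA n x (h b)) = \<Delta> n (aA n \<one>\<^bsub>R\<^esub> (h b) (pA n x \<one>\<^bsub>A\<^esub>))"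
        using pure by (simp add: XA.pact_pure hc X.M.lsmult_one)
      also have "\<dots> = aA (n - 1) \<one>\<^bsub>R\<^esub> (h b) (\<Delta> n (pA n x \<one>\<^bsub>A\<^esub>))"
        using pure by (simp add: \<Delta>_props hc)
      also have "\<Delta> n (pA n x \<one>\<^bsub>A\<^esub>) = km (n - 1) (\<phi> n x)"
        using pure by (simp add: \<phi>_def km_sm \<Delta>_closed)
      also have "\<dots> = tensor_map K (VF (n - 1)) A h (lamm (n - 1) (\<phi> n x))"
        using pure tensor_map_comp[OF tT tB tA lam h \<kappa> h_lam, of "\<phi> n x" "n - 1"]
        by (simp add: \<phi>_closed)
      \<comment> \<open>As h sends e' to \<kappa> e = 0, the correction term can be added for
        free.\<close>
      also have "\<dots> = tensor_map K (VF (n - 1)) A h (\<phi>' n x)"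
        using pure YA.P.pure_zero_right[of "\<eta> n x"]
        by (simp add: \<phi>'_def lamm_closed \<phi>_closed \<eta>_closed e'_closed h_lam e)
      also have "aA (n - 1) \<one>\<^bsub>R\<^esub> (h b) \<dots> = tensor_map K (VF (n - 1)) A h (\<Delta>' n (pB n x b))"
        using pure by (simp add: \<Delta>'_pure tensor_map_pact[OF tB tA h h_mult] \<phi>'_closed)
      finally show ?case using pure by simp
    qed (simp_all add: \<Delta>'_props \<Delta>'_closed \<Delta>_props)
  qed
  then show ?thesis using \<Delta>_hom by (simp add: is_base_change_def tensor_module_simps)
qed

end

section \<open>Coordinates on spaces of finite codimension\<close>

text \<open>Functions on \<open>nat\<close> form the type on which \<open>universal_lift\<close>
  places its test algebras, and a further coordinate enlarges the space within this type.\<close>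

definition vec_space :: "('k, 'e) ring_scheme \<Rightarrow> nat \<Rightarrow> ('k, nat \<Rightarrow> 'k) module" where
  "vec_space K N = \<lparr>carrier = {v. (\<forall>i. v i \<in> carrier K) \<and> (\<forall>i\<ge>N. v i = \<zero>\<^bsub>K\<^esub>)},
     mult = undefined, one = undefined, ring.zero = \<lambda>_. \<zero>\<^bsub>K\<^esub>,
     ring.add = \<lambda>v w i. v i \<oplus>\<^bsub>K\<^esub> w i, smult = \<lambda>c v i. c \<otimes>\<^bsub>K\<^esub> v i\<rparr>"

definition unit_vec :: "('k, 'e) ring_scheme \<Rightarrow> nat \<Rightarrow> nat \<Rightarrow> 'k" where
  "unit_vec K i = (\<lambda>j. if j = i then \<one>\<^bsub>K\<^esub> else \<zero>\<^bsub>K\<^esub>)"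

lemma vec_space_simps [simp]:
  "\<zero>\<^bsub>vec_space K N\<^esub> = (\<lambda>_. \<zero>\<^bsub>K\<^esub>)"
  "v \<oplus>\<^bsub>vec_space K N\<^esub> w = (\<lambda>i. v i \<oplus>\<^bsub>K\<^esub> w i)"
  "c \<odot>\<^bsub>vec_space K N\<^esub> v = (\<lambda>i. c \<otimes>\<^bsub>K\<^esub> v i)"
  by (simp_all add: vec_space_def)

lemma vec_space_carrier: "v \<in> carrier (vec_space K N) \<longleftrightarrow>
    (\<forall>i. v i \<in> carrier K) \<and> (\<forall>i\<ge>N. v i = \<zero>\<^bsub>K\<^esub>)"
  by (simp add: vec_space_def)

lemma (in cring) vec_space_module: "module R (vec_space R N)"
proof (rule moduleI)
  show "abelian_group (vec_space R N)"
  proof (rule abelian_groupI)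
    fix v assume "v \<in> carrier (vec_space R N)"
    then show "\<exists>w\<in>carrier (vec_space R N). w \<oplus>\<^bsub>vec_space R N\<^esub> v = \<zero>\<^bsub>vec_space R N\<^esub>"
      by (intro bexI[of _ "\<lambda>i. \<ominus> v i"]) (auto simp: vec_space_carrier l_neg)
  qed (auto simp: vec_space_carrier a_ac)
qed (auto simp: vec_space_carrier l_distr r_distr m_assoc is_cring)

lemma (in cring) unit_vec_closed: "i < N \<Longrightarrow> unit_vec R i \<in> carrier (vec_space R N)"
  by (auto simp: vec_space_carrier unit_vec_def)

lemma module_homD:
  assumes "f \<in> module_hom K M N"
  shows "x \<in> carrier M \<Longrightarrow> f x \<in> carrier N"
    "x \<in> carrier M \<Longrightarrow> y \<in> carrier M \<Longrightarrow> f (x \<oplus>\<^bsub>M\<^esub> y) = f x \<oplus>\<^bsub>N\<^esub> f y"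
    "c \<in> carrier K \<Longrightarrow> x \<in> carrier M \<Longrightarrow> f (c \<odot>\<^bsub>M\<^esub> x) = c \<odot>\<^bsub>N\<^esub> f x"
  using assms by (auto simp: module_hom_def)

lemma module_homI:
  assumes "\<And>x. x \<in> carrier M \<Longrightarrow> f x \<in> carrier N"
    "\<And>x y. x \<in> carrier M \<Longrightarrow> y \<in> carrier M \<Longrightarrow> f (x \<oplus>\<^bsub>M\<^esub> y) = f x \<oplus>\<^bsub>N\<^esub> f y"
    "\<And>c x. c \<in> carrier K \<Longrightarrow> x \<in> carrier M \<Longrightarrow> f (c \<odot>\<^bsub>M\<^esub> x) = c \<odot>\<^bsub>N\<^esub> f x"
  shows "f \<in> module_hom K M N"
  using assms by (auto simp: module_hom_def)

lemma module_hom_zero: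
  assumes "module K M" "module K N" "f \<in> module_hom K M N"
  shows "f \<zero>\<^bsub>M\<^esub> = \<zero>\<^bsub>N\<^esub>"
proof -
  interpret mod_hom K M N f using assms by (intro mod_hom.intro mod_hom_axioms.intro)
  show ?thesis by (rule f0_is_0)
qed

lemma module_hom_minus:
  assumes "module K M" "module K N" "f \<in> module_hom K M N" "x \<in> carrier M" "y \<in> carrier M"
  shows "f (x \<ominus>\<^bsub>M\<^esub> y) = f x \<ominus>\<^bsub>N\<^esub> f y"
proof -
  interpret mod_hom K M N f using assms by (intro mod_hom.intro mod_hom_axioms.intro)
  show ?thesis using assms by (intro f_minus)
qed

lemma vec_split:
  assumes "cring K" "v \<in> carrier (vec_space K (Suc N))"
  shows "v(N := \<zero>\<^bsub>K\<^esub>) \<in> carrier (vec_space K N)"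
    "v = v(N := \<zero>\<^bsub>K\<^esub>) \<oplus>\<^bsub>vec_space K (Suc N)\<^esub> v N \<odot>\<^bsub>vec_space K (Suc N)\<^esub> unit_vec K N"
proof -
  interpret cring K by fact
  show "v(N := \<zero>\<^bsub>K\<^esub>) \<in> carrier (vec_space K N)"
    using assms(2) by (auto simp: vec_space_carrier)
  show "v = v(N := \<zero>\<^bsub>K\<^esub>) \<oplus>\<^bsub>vec_space K (Suc N)\<^esub> v N \<odot>\<^bsub>vec_space K (Suc N)\<^esub> unit_vec K N"
    using assms(2) by (auto simp: vec_space_carrier unit_vec_def fun_eq_iff)
qed

lemma vec_space_mono: "v \<in> carrier (vec_space K N) \<Longrightarrow> N \<le> N' \<Longrightarrow> v \<in> carrier (vec_space K N')"
  by (auto simp: vec_space_carrier)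

lemma vec_map_in:
  assumes K: "cring K" and M: "module K M" and f: "f \<in> module_hom K (vec_space K N) M"
    and U: "submodule K U M" and u: "\<And>i. i < N \<Longrightarrow> f (unit_vec K i) \<in> U"
    and v: "v \<in> carrier (vec_space K N)"
  shows "f v \<in> U"
proof -
  interpret cring K by fact
  \<comment> \<open>The bound n on the support shrinks, while the domain of f stays the space of
    dimension N.\<close>
  have "v \<in> carrier (vec_space K n) \<Longrightarrow> f v \<in> U" if "n \<le> N" for n v
    using that
  proof (induction n arbitrary: v)
    case 0
    then have "v = \<zero>\<^bsub>vec_space K N\<^esub>" by (auto simp: vec_space_carrier)
    then have "f v = \<zero>\<^bsub>M\<^esub>" using module_hom_zero[OF vec_space_module M f] by simp
    then show ?case using submodule.zero_closed[OF U] by simp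
  next
    case (Suc n)
    note s = vec_split[OF K Suc.prems(1)]
    have c: "v n \<in> carrier K" using Suc.prems by (simp add: vec_space_carrier)
    have n: "unit_vec K n \<in> carrier (vec_space K N)" using Suc by (intro unit_vec_closed) simp
    have c': "v n \<odot>\<^bsub>vec_space K N\<^esub> unit_vec K n \<in> carrier (vec_space K N)"
      by (rule module.smult_closed[OF vec_space_module c n])
    have v': "v(n := \<zero>\<^bsub>K\<^esub>) \<in> carrier (vec_space K N)"
      using s(1) Suc.prems(2) by (auto intro: vec_space_mono)
    have "v = v(n := \<zero>\<^bsub>K\<^esub>) \<oplus>\<^bsub>vec_space K N\<^esub> v n \<odot>\<^bsub>vec_space K N\<^esub> unit_vec K n"
      unfolding vec_space_simps by (rule s(2)[unfolded vec_space_simps])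
    then have "f v = f (v(n := \<zero>\<^bsub>K\<^esub>) \<oplus>\<^bsub>vec_space K N\<^esub> v n \<odot>\<^bsub>vec_space K N\<^esub> unit_vec K n)"
      by (rule arg_cong)
    then have "f v = f (v(n := \<zero>\<^bsub>K\<^esub>)) \<oplus>\<^bsub>M\<^esub> v n \<odot>\<^bsub>M\<^esub> f (unit_vec K n)"
      by (simp only: module_homD(2)[OF f v' c'] module_homD(3)[OF f c n])
    moreover have "f (v(n := \<zero>\<^bsub>K\<^esub>)) \<in> U" by (rule Suc.IH[OF s(1)]) (use Suc.prems(2) in simp)
    moreover have "v n \<odot>\<^bsub>M\<^esub> f (unit_vec K n) \<in> U"
      using Suc.prems(2) c by (intro submodule.smult_closed[OF U] u) auto
    ultimately show ?case by (simp add: submodule.m_closed[OF U])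
  qed
  then show ?thesis using v by blast
qed

text \<open>\<open>\<kappa>\<close> are \<open>N\<close> independent coordinates on \<open>T\<close> and \<open>\<sigma>\<close> is a dual system of vectors.\<close>

definition coords :: "('k, 'e) ring_scheme \<Rightarrow> ('k, 't) module \<Rightarrow> nat \<Rightarrow> ('t \<Rightarrow> nat \<Rightarrow> 'k)
    \<Rightarrow> ((nat \<Rightarrow> 'k) \<Rightarrow> 't) \<Rightarrow> bool" where
  "coords K T N \<kappa> \<sigma> \<longleftrightarrow> \<kappa> \<in> module_hom K T (vec_space K N) \<and>
     \<sigma> \<in> module_hom K (vec_space K N) T \<and> (\<forall>v\<in>carrier (vec_space K N). \<kappa> (\<sigma> v) = v)"

definition append_coord :: "nat \<Rightarrow> ('t \<Rightarrow> nat \<Rightarrow> 'k) \<Rightarrow> ('t \<Rightarrow> 'k) \<Rightarrow> 't \<Rightarrow> nat \<Rightarrow> 'k" where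
  "append_coord N \<kappa> \<psi> = (\<lambda>t. (\<kappa> t)(N := \<psi> t))"

definition append_vec :: "('k, 'e) ring_scheme \<Rightarrow> ('k, 't) module \<Rightarrow> nat \<Rightarrow> ((nat \<Rightarrow> 'k) \<Rightarrow> 't) \<Rightarrow> 't
    \<Rightarrow> (nat \<Rightarrow> 'k) \<Rightarrow> 't" where
  "append_vec K T N \<sigma> e = (\<lambda>v. \<sigma> (v(N := \<zero>\<^bsub>K\<^esub>)) \<oplus>\<^bsub>T\<^esub> v N \<odot>\<^bsub>T\<^esub> e)"

lemma functionalD:
  assumes "functional K T \<psi>"
  shows "t \<in> carrier T \<Longrightarrow> \<psi> t \<in> carrier K"
    "t \<in> carrier T \<Longrightarrow> u \<in> carrier T \<Longrightarrow> \<psi> (t \<oplus>\<^bsub>T\<^esub> u) = \<psi> t \<oplus>\<^bsub>K\<^esub> \<psi> u"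
    "c \<in> carrier K \<Longrightarrow> t \<in> carrier T \<Longrightarrow> \<psi> (c \<odot>\<^bsub>T\<^esub> t) = c \<otimes>\<^bsub>K\<^esub> \<psi> t"
  using assms by (auto simp: functional_def)

lemma functional_zero:
  assumes "module K T" "functional K T \<psi>" shows "\<psi> \<zero>\<^bsub>T\<^esub> = \<zero>\<^bsub>K\<^esub>"
proof -
  interpret module K T by fact
  have "\<psi> (\<zero>\<^bsub>K\<^esub> \<odot>\<^bsub>T\<^esub> \<zero>\<^bsub>T\<^esub>) = \<zero>\<^bsub>K\<^esub> \<otimes>\<^bsub>K\<^esub> \<psi> \<zero>\<^bsub>T\<^esub>"
    by (rule functionalD(3)[OF assms(2)]) simp_all
  then show ?thesis using functionalD(1)[OF assms(2)] by simp
qed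

lemma functional_minus:
  assumes "module K T" "functional K T \<psi>" "t \<in> carrier T" "u \<in> carrier T"
  shows "\<psi> (t \<ominus>\<^bsub>T\<^esub> u) = \<psi> t \<ominus>\<^bsub>K\<^esub> \<psi> u"
proof -
  interpret module K T by fact
  note f = functionalD[OF assms(2)]
  have "\<psi> (t \<ominus>\<^bsub>T\<^esub> u) \<oplus>\<^bsub>K\<^esub> \<psi> u = \<psi> ((t \<ominus>\<^bsub>T\<^esub> u) \<oplus>\<^bsub>T\<^esub> u)"
    using assms by (intro f(2)[symmetric]) simp_all
  also have "\<dots> = \<psi> t" using assms by (simp add: M.minus_eq M.a_assoc M.l_neg)
  finally have "\<psi> t = \<psi> (t \<ominus>\<^bsub>T\<^esub> u) \<oplus>\<^bsub>K\<^esub> \<psi> u" by (rule sym)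
  then show ?thesis using assms f by (simp add: R.minus_eq R.a_assoc R.r_neg)
qed

text \<open>The conditions on \<psi> and e say that the enlarged matrix of coordinates against
  vectors is again the identity: \<psi> vanishes on the old vectors, the old coordinates vanish on
  e, and \<psi> e = 1.\<close>

lemma coords_append:
  assumes T: "module K T" and co: "coords K T N \<kappa> \<sigma>" and \<psi>: "functional K T \<psi>"
    and \<psi>\<sigma>: "\<And>v. v \<in> carrier (vec_space K N) \<Longrightarrow> \<psi> (\<sigma> v) = \<zero>\<^bsub>K\<^esub>"
    and e: "e \<in> carrier T" "\<kappa> e = (\<lambda>_. \<zero>\<^bsub>K\<^esub>)" "\<psi> e = \<one>\<^bsub>K\<^esub>"
  shows "coords K T (Suc N) (append_coord N \<kappa> \<psi>) (append_vec K T N \<sigma> e)"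
proof -
  interpret module K T by fact
  have \<kappa>: "\<kappa> \<in> module_hom K T (vec_space K N)" and \<sigma>: "\<sigma> \<in> module_hom K (vec_space K N) T"
    and inv: "\<And>v. v \<in> carrier (vec_space K N) \<Longrightarrow> \<kappa> (\<sigma> v) = v"
    using co by (auto simp: coords_def)
  note k = module_homD[OF \<kappa>] and g = module_homD[OF \<sigma>] and p = functionalD[OF \<psi>]
  note tr = vec_split(1)[OF R.is_cring]
  have vc: "v i \<in> carrier K" if "v \<in> carrier (vec_space K n)" for v i n
    using that by (simp add: vec_space_carrier)
  have "append_coord N \<kappa> \<psi> \<in> module_hom K T (vec_space K (Suc N))"
    using k p by (intro module_homI) (auto simp: append_coord_def vec_space_carrier fun_eq_iff)
  moreover have "append_vec K T N \<sigma> e \<in> module_hom K (vec_space K (Suc N)) T"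
  proof (intro module_homI)
    fix v w assume v: "v \<in> carrier (vec_space K (Suc N))" and w: "w \<in> carrier (vec_space K (Suc N))"
    have "(v \<oplus>\<^bsub>vec_space K (Suc N)\<^esub> w)(N := \<zero>\<^bsub>K\<^esub>)
        = v(N := \<zero>\<^bsub>K\<^esub>) \<oplus>\<^bsub>vec_space K N\<^esub> w(N := \<zero>\<^bsub>K\<^esub>)" by (auto simp: fun_eq_iff)
    then have "\<sigma> ((v \<oplus>\<^bsub>vec_space K (Suc N)\<^esub> w)(N := \<zero>\<^bsub>K\<^esub>))
        = \<sigma> (v(N := \<zero>\<^bsub>K\<^esub>)) \<oplus>\<^bsub>T\<^esub> \<sigma> (w(N := \<zero>\<^bsub>K\<^esub>))" using tr[OF v] tr[OF w] g by metis
    then show "append_vec K T N \<sigma> e (v \<oplus>\<^bsub>vec_space K (Suc N)\<^esub> w)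
        = append_vec K T N \<sigma> e v \<oplus>\<^bsub>T\<^esub> append_vec K T N \<sigma> e w"
      using v w tr[OF v] tr[OF w] g e vc by (simp add: append_vec_def smult_l_distr M.a_ac)
  next
    fix c v assume c: "c \<in> carrier K" and v: "v \<in> carrier (vec_space K (Suc N))"
    have "(c \<odot>\<^bsub>vec_space K (Suc N)\<^esub> v)(N := \<zero>\<^bsub>K\<^esub>) = c \<odot>\<^bsub>vec_space K N\<^esub> (v(N := \<zero>\<^bsub>K\<^esub>))"
      using c by (auto simp: fun_eq_iff)
    then have "\<sigma> ((c \<odot>\<^bsub>vec_space K (Suc N)\<^esub> v)(N := \<zero>\<^bsub>K\<^esub>)) = c \<odot>\<^bsub>T\<^esub> \<sigma> (v(N := \<zero>\<^bsub>K\<^esub>))"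
      using tr[OF v] g c by metis
    then show "append_vec K T N \<sigma> e (c \<odot>\<^bsub>vec_space K (Suc N)\<^esub> v) = c \<odot>\<^bsub>T\<^esub> append_vec K T N \<sigma> e v"
      using v c tr[OF v] g e vc by (simp add: append_vec_def smult_r_distr smult_assoc1)
  qed (use tr g e vc in \<open>auto simp: append_vec_def\<close>)
  moreover have "append_coord N \<kappa> \<psi> (append_vec K T N \<sigma> e v) = v"
    if v: "v \<in> carrier (vec_space K (Suc N))" for v
  proof -
    have c: "v N \<in> carrier K" using v vc by blast
    have "\<kappa> (append_vec K T N \<sigma> e v) = v(N := \<zero>\<^bsub>K\<^esub>)"
      using c tr[OF v] g e k inv vc[OF tr[OF v]] by (simp add: append_vec_def fun_eq_iff vec_space_carrier)
    moreover have "\<psi> (append_vec K T N \<sigma> e v) = v N"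
      using c tr[OF v] g e p \<psi>\<sigma> by (simp add: append_vec_def)
    ultimately show ?thesis by (simp add: append_coord_def)
  qed
  ultimately show ?thesis by (simp add: coords_def)
qed

definition adjoin :: "('k, 'e) ring_scheme \<Rightarrow> ('k, 't) module \<Rightarrow> 't \<Rightarrow> 't set \<Rightarrow> 't set" where
  "adjoin K T c Q = {a \<odot>\<^bsub>T\<^esub> c \<oplus>\<^bsub>T\<^esub> x | a x. a \<in> carrier K \<and> x \<in> Q}"

text \<open>Finite codimension, expressed by adding single vectors until the whole space is reached.
  Rule induction then descends from the whole space to Q and builds coordinates one at a
  time.\<close>

inductive fincod :: "('k, 'e) ring_scheme \<Rightarrow> ('k, 't) module \<Rightarrow> 't set \<Rightarrow> bool" for K T where
  top: "fincod K T (carrier T)"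
| step: "fincod K T (adjoin K T c Q) \<Longrightarrow> submodule K Q T \<Longrightarrow> c \<in> carrier T \<Longrightarrow> fincod K T Q"

lemma submodule_adjoin:
  assumes "submodule K Q T" "c \<in> carrier T"
  shows "submodule K (adjoin K T c Q) T"
proof -
  interpret Q: submodule K Q T by fact
  interpret module K T by (rule Q.module)
  have q: "x \<in> Q \<Longrightarrow> x \<in> carrier T" for x using Q.subset by blast
  show ?thesis
  proof (unfold_locales)
    show "adjoin K T c Q \<subseteq> carrier T" using assms(2) q by (auto simp: adjoin_def)
    show "\<zero>\<^bsub>T\<^esub> \<in> adjoin K T c Q"
      unfolding adjoin_def mem_Collect_eq
      by (rule exI[of _ "\<zero>\<^bsub>K\<^esub>"], rule exI[of _ "\<zero>\<^bsub>T\<^esub>"]) (use assms(2) Q.zero_closed in simp)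
  next
    fix v w assume "v \<in> adjoin K T c Q" "w \<in> adjoin K T c Q"
    then obtain a x b y where *: "a \<in> carrier K" "x \<in> Q" "b \<in> carrier K" "y \<in> Q"
      "v = a \<odot>\<^bsub>T\<^esub> c \<oplus>\<^bsub>T\<^esub> x" "w = b \<odot>\<^bsub>T\<^esub> c \<oplus>\<^bsub>T\<^esub> y" by (auto simp: adjoin_def)
    then have "v \<oplus>\<^bsub>T\<^esub> w = (a \<oplus>\<^bsub>K\<^esub> b) \<odot>\<^bsub>T\<^esub> c \<oplus>\<^bsub>T\<^esub> (x \<oplus>\<^bsub>T\<^esub> y)"
      using assms(2) q by (simp add: smult_l_distr M.a_ac)
    then show "v \<oplus>\<^bsub>T\<^esub> w \<in> adjoin K T c Q"
      using * Q.m_closed unfolding adjoin_def by blast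
  next
    fix b v assume b: "b \<in> carrier K" and "v \<in> adjoin K T c Q"
    then obtain a x where *: "a \<in> carrier K" "x \<in> Q" "v = a \<odot>\<^bsub>T\<^esub> c \<oplus>\<^bsub>T\<^esub> x" by (auto simp: adjoin_def)
    then have "b \<odot>\<^bsub>T\<^esub> v = (b \<otimes>\<^bsub>K\<^esub> a) \<odot>\<^bsub>T\<^esub> c \<oplus>\<^bsub>T\<^esub> b \<odot>\<^bsub>T\<^esub> x"
      using assms(2) q b by (simp add: smult_r_distr smult_assoc1)
    then show "b \<odot>\<^bsub>T\<^esub> v \<in> adjoin K T c Q"
      using * b Q.smult_closed unfolding adjoin_def by blast
  qed
qed

text \<open>The vectors that lead from Q up to the whole space also serve for the larger Q'.\<close>

lemma fincod_mono: "fincod K T Q \<Longrightarrow> Q \<subseteq> Q' \<Longrightarrow> submodule K Q' T \<Longrightarrow> fincod K T Q'"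
proof (induction arbitrary: Q' rule: fincod.induct)
  case top
  then have "Q' = carrier T" using submodule.subset[OF top(2)] by blast
  then show ?case using fincod.top[of K T] by simp
next
  case (step c Q)
  have "adjoin K T c Q \<subseteq> adjoin K T c Q'" using step.prems(1) by (auto simp: adjoin_def)
  then show ?case
    by (rule fincod.step[OF step.IH[OF _ submodule_adjoin[OF step.prems(2) step.hyps(3)]]
          step.prems(2) step.hyps(3)])
qed

text \<open>The induction hypothesis gives coordinates with kernel Q + K c. If c is not in Q, one
  further coordinate is the coefficient of c in the part of t that the old coordinates leave over;
  its kernel inside Q + K c is Q.\<close>

lemma fincod_coords:
  assumes "field K" "module K T" "fincod K T Q"
  shows "\<exists>N \<kappa> \<sigma>. coords K T N \<kappa> \<sigma> \<and> (\<forall>t\<in>carrier T. \<kappa> t = (\<lambda>_. \<zero>\<^bsub>K\<^esub>) \<longleftrightarrow> t \<in> Q)"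
  using assms(3)
proof induction
  case top
  interpret module K T by fact
  have "coords K T 0 (\<lambda>_ _. \<zero>\<^bsub>K\<^esub>) (\<lambda>_. \<zero>\<^bsub>T\<^esub>)"
    by (auto simp: coords_def vec_space_carrier intro!: module_homI)
  then show ?case by blast
next
  case (step c Q)
  interpret field K by fact
  interpret module K T by fact
  interpret Q: submodule K Q T by fact
  have q: "x \<in> Q \<Longrightarrow> x \<in> carrier T" for x using Q.subset by blast
  show ?case
  proof (cases "c \<in> Q")
    case True
    have "adjoin K T c Q = Q"
    proof (intro equalityI subsetI)
      fix x assume x: "x \<in> Q"
      then have "x = \<zero>\<^bsub>K\<^esub> \<odot>\<^bsub>T\<^esub> c \<oplus>\<^bsub>T\<^esub> x" using q step by simp
      then show "x \<in> adjoin K T c Q" using x unfolding adjoin_def by blast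
    qed (use True in \<open>auto simp: adjoin_def\<close>)
    then show ?thesis using step by simp
  next
    case False
    obtain N \<kappa> \<sigma> where co: "coords K T N \<kappa> \<sigma>"
      and ker: "\<And>t. t \<in> carrier T \<Longrightarrow> \<kappa> t = (\<lambda>_. \<zero>\<^bsub>K\<^esub>) \<longleftrightarrow> t \<in> adjoin K T c Q"
      using step.IH by blast
    have \<kappa>: "\<kappa> \<in> module_hom K T (vec_space K N)" and \<sigma>: "\<sigma> \<in> module_hom K (vec_space K N) T"
      and inv: "\<And>v. v \<in> carrier (vec_space K N) \<Longrightarrow> \<kappa> (\<sigma> v) = v"
      using co by (auto simp: coords_def)
    note k = module_homD[OF \<kappa>] and g = module_homD[OF \<sigma>]
    have K01: "\<zero>\<^bsub>K\<^esub> \<in> carrier K" "\<one>\<^bsub>K\<^esub> \<in> carrier K" by simp_all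
    \<comment> \<open>A nonzero scalar could be inverted and would put c into Q. This makes the
      coefficient of c unique.\<close>
    have zero: "a = \<zero>\<^bsub>K\<^esub>" if a: "a \<in> carrier K" "a \<odot>\<^bsub>T\<^esub> c \<in> Q" for a
    proof (rule ccontr)
      assume "a \<noteq> \<zero>\<^bsub>K\<^esub>"
      then have u: "a \<in> Units K" using a field_Units by simp
      have "inv\<^bsub>K\<^esub> a \<odot>\<^bsub>T\<^esub> (a \<odot>\<^bsub>T\<^esub> c) = c"
        using u a step(3) by (simp add: smult_assoc1[symmetric])
      then show False using False Q.smult_closed[OF Units_inv_closed[OF u] a(2)] by simp
    qed
    \<comment> \<open>The part of t that the old coordinates do not see. It lies in their kernel Q +
      K c.\<close>
    define pr where "pr t = t \<ominus>\<^bsub>T\<^esub> \<sigma> (\<kappa> t)" for t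
    have pr_c: "pr t \<in> carrier T" if "t \<in> carrier T" for t using that k g by (simp add: pr_def)
    have pr_add: "pr (t \<oplus>\<^bsub>T\<^esub> u) = pr t \<oplus>\<^bsub>T\<^esub> pr u" if "t \<in> carrier T" "u \<in> carrier T" for t u
    proof -
      have "\<sigma> (\<kappa> (t \<oplus>\<^bsub>T\<^esub> u)) = \<sigma> (\<kappa> t) \<oplus>\<^bsub>T\<^esub> \<sigma> (\<kappa> u)"
        using k(2)[OF that] g(2)[OF k(1)[OF that(1)] k(1)[OF that(2)]] by simp
      then show ?thesis using that k(1) g(1) by (simp add: pr_def M.minus_eq M.minus_add M.a_ac)
    qed
    have pr_smult: "pr (a \<odot>\<^bsub>T\<^esub> t) = a \<odot>\<^bsub>T\<^esub> pr t" if "t \<in> carrier T" "a \<in> carrier K" for t a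
    proof -
      have "\<sigma> (\<kappa> (a \<odot>\<^bsub>T\<^esub> t)) = a \<odot>\<^bsub>T\<^esub> \<sigma> (\<kappa> t)"
        using k(3)[OF that(2,1)] g(3)[OF that(2) k(1)[OF that(1)]] by simp
      then show ?thesis using that k(1) g(1) by (simp add: pr_def M.minus_eq smult_r_distr smult_r_minus)
    qed
    have pr_adj: "pr t \<in> adjoin K T c Q" if t: "t \<in> carrier T" for t
    proof -
      have "\<kappa> (pr t) \<oplus>\<^bsub>vec_space K N\<^esub> \<kappa> (\<sigma> (\<kappa> t)) = \<kappa> (pr t \<oplus>\<^bsub>T\<^esub> \<sigma> (\<kappa> t))"
        using t pr_c k(1) g(1) by (intro k(2)[symmetric]) auto
      also have "pr t \<oplus>\<^bsub>T\<^esub> \<sigma> (\<kappa> t) = t"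
        using t k(1) g(1) by (simp add: pr_def M.minus_eq M.a_assoc M.l_neg)
      finally have eq: "\<kappa> (pr t) i \<oplus>\<^bsub>K\<^esub> \<kappa> t i = \<kappa> t i" for i
        using inv[OF k(1)[OF t]] by (auto simp: fun_eq_iff)
      have "\<kappa> (pr t) i = \<zero>\<^bsub>K\<^esub>" for i
        using eq[of i] k(1)[OF t] k(1)[OF pr_c[OF t]] by (simp add: vec_space_carrier)
      then show ?thesis using ker[OF pr_c[OF t]] by auto
    qed
    define cf where "cf u = (THE a. a \<in> carrier K \<and> (\<exists>x\<in>Q. u = a \<odot>\<^bsub>T\<^esub> c \<oplus>\<^bsub>T\<^esub> x))" for u
    have cfI: "cf (a \<odot>\<^bsub>T\<^esub> c \<oplus>\<^bsub>T\<^esub> x) = a" if a: "a \<in> carrier K" "x \<in> Q" for a x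
      unfolding cf_def
    proof (rule the_equality)
      fix b assume "b \<in> carrier K \<and> (\<exists>y\<in>Q. a \<odot>\<^bsub>T\<^esub> c \<oplus>\<^bsub>T\<^esub> x = b \<odot>\<^bsub>T\<^esub> c \<oplus>\<^bsub>T\<^esub> y)"
      then obtain y where y: "b \<in> carrier K" "y \<in> Q" "a \<odot>\<^bsub>T\<^esub> c \<oplus>\<^bsub>T\<^esub> x = b \<odot>\<^bsub>T\<^esub> c \<oplus>\<^bsub>T\<^esub> y" by blast
      have "(b \<ominus>\<^bsub>K\<^esub> a) \<odot>\<^bsub>T\<^esub> c = (b \<odot>\<^bsub>T\<^esub> c \<oplus>\<^bsub>T\<^esub> y) \<oplus>\<^bsub>T\<^esub> (\<ominus>\<^bsub>T\<^esub> y \<ominus>\<^bsub>T\<^esub> a \<odot>\<^bsub>T\<^esub> c)"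
        using y(1,2) a step(3) q by (simp add: a_minus_def smult_l_distr smult_l_minus M.a_ac
            M.r_neg M.r_neg1 M.r_neg2)
      also have "\<dots> = (a \<odot>\<^bsub>T\<^esub> c \<oplus>\<^bsub>T\<^esub> x) \<oplus>\<^bsub>T\<^esub> (\<ominus>\<^bsub>T\<^esub> y \<ominus>\<^bsub>T\<^esub> a \<odot>\<^bsub>T\<^esub> c)" by (simp only: y(3))
      also have "\<dots> = x \<oplus>\<^bsub>T\<^esub> (\<ominus>\<^bsub>K\<^esub> \<one>\<^bsub>K\<^esub>) \<odot>\<^bsub>T\<^esub> y"
        using y(1,2) a step(3) q by (simp add: smult_l_minus M.minus_eq M.a_ac M.r_neg M.r_neg1 M.r_neg2)
      also have "\<dots> \<in> Q" using a(2) y(2) by (intro Q.m_closed Q.smult_closed) simp_all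
      finally have "b \<ominus>\<^bsub>K\<^esub> a = \<zero>\<^bsub>K\<^esub>" using a(1) y(1) by (intro zero) simp_all
      then show "b = a" using a(1) y(1) by simp
    qed (use that in blast)
    define \<psi> where "\<psi> t = cf (pr t)" for t
    have dec: "\<exists>a x. a \<in> carrier K \<and> x \<in> Q \<and> pr t = a \<odot>\<^bsub>T\<^esub> c \<oplus>\<^bsub>T\<^esub> x \<and> \<psi> t = a" if "t \<in> carrier T" for t
      using pr_adj[OF that] cfI by (fastforce simp: adjoin_def \<psi>_def)
    have \<psi>I: "\<psi> t = a" if "pr t = a \<odot>\<^bsub>T\<^esub> c \<oplus>\<^bsub>T\<^esub> x" "a \<in> carrier K" "x \<in> Q" for t a x
      using that cfI by (simp add: \<psi>_def)
    have lin: "functional K T \<psi>"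
      unfolding functional_def
    proof (intro conjI ballI Pi_I)
      fix t assume "t \<in> carrier T" then show "\<psi> t \<in> carrier K" using dec by blast
    next
      fix t u assume t: "t \<in> carrier T" and u: "u \<in> carrier T"
      obtain a x b y where *: "a \<in> carrier K" "x \<in> Q" "pr t = a \<odot>\<^bsub>T\<^esub> c \<oplus>\<^bsub>T\<^esub> x" "\<psi> t = a"
        "b \<in> carrier K" "y \<in> Q" "pr u = b \<odot>\<^bsub>T\<^esub> c \<oplus>\<^bsub>T\<^esub> y" "\<psi> u = b"
        using dec[OF t] dec[OF u] by blast
      have "pr (t \<oplus>\<^bsub>T\<^esub> u) = (a \<oplus>\<^bsub>K\<^esub> b) \<odot>\<^bsub>T\<^esub> c \<oplus>\<^bsub>T\<^esub> (x \<oplus>\<^bsub>T\<^esub> y)"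
        using * t u q step(3) by (simp add: pr_add smult_l_distr M.a_ac)
      then show "\<psi> (t \<oplus>\<^bsub>T\<^esub> u) = \<psi> t \<oplus>\<^bsub>K\<^esub> \<psi> u"
        using \<psi>I[of "t \<oplus>\<^bsub>T\<^esub> u" "a \<oplus>\<^bsub>K\<^esub> b" "x \<oplus>\<^bsub>T\<^esub> y"] * Q.m_closed by simp
    next
      fix b t assume b: "b \<in> carrier K" and t: "t \<in> carrier T"
      obtain a x where *: "a \<in> carrier K" "x \<in> Q" "pr t = a \<odot>\<^bsub>T\<^esub> c \<oplus>\<^bsub>T\<^esub> x" "\<psi> t = a"
        using dec[OF t] by blast
      have "pr (b \<odot>\<^bsub>T\<^esub> t) = (b \<otimes>\<^bsub>K\<^esub> a) \<odot>\<^bsub>T\<^esub> c \<oplus>\<^bsub>T\<^esub> b \<odot>\<^bsub>T\<^esub> x"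
        using * t b q step(3) by (simp add: pr_smult smult_r_distr smult_assoc1)
      then show "\<psi> (b \<odot>\<^bsub>T\<^esub> t) = b \<otimes>\<^bsub>K\<^esub> \<psi> t"
        using \<psi>I[of "b \<odot>\<^bsub>T\<^esub> t" "b \<otimes>\<^bsub>K\<^esub> a" "b \<odot>\<^bsub>T\<^esub> x"] * b Q.smult_closed by simp
    qed
    have \<sigma>0: "\<sigma> (\<lambda>_. \<zero>\<^bsub>K\<^esub>) = \<zero>\<^bsub>T\<^esub>"
      using module_hom_zero[OF vec_space_module assms(2) \<sigma>] by simp
    have pr_ker: "pr t = t" if "t \<in> carrier T" "\<kappa> t = (\<lambda>_. \<zero>\<^bsub>K\<^esub>)" for t
      using that by (simp add: pr_def \<sigma>0 M.minus_eq)
    have "c = \<one>\<^bsub>K\<^esub> \<odot>\<^bsub>T\<^esub> c \<oplus>\<^bsub>T\<^esub> \<zero>\<^bsub>T\<^esub>" using step(3) by simp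
    then have c: "c \<in> adjoin K T c Q" using Q.zero_closed K01 unfolding adjoin_def by blast
    have "coords K T (Suc N) (append_coord N \<kappa> \<psi>) (append_vec K T N \<sigma> c)"
    proof (rule coords_append[OF assms(2) co lin _ step(3)])
      show \<kappa>c: "\<kappa> c = (\<lambda>_. \<zero>\<^bsub>K\<^esub>)" using ker[OF step(3)] c by simp
      show "\<psi> c = \<one>\<^bsub>K\<^esub>"
        using step(3) by (intro \<psi>I[of _ _ "\<zero>\<^bsub>T\<^esub>"]) (simp_all add: pr_ker \<kappa>c)
      fix v assume v: "v \<in> carrier (vec_space K N)"
      have "pr (\<sigma> v) = \<zero>\<^bsub>T\<^esub>" using v g(1) by (simp add: pr_def inv M.minus_eq M.r_neg)
      then show "\<psi> (\<sigma> v) = \<zero>\<^bsub>K\<^esub>" using step(3) by (intro \<psi>I[of _ _ "\<zero>\<^bsub>T\<^esub>"]) simp_all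
    qed
    moreover have "append_coord N \<kappa> \<psi> t = (\<lambda>_. \<zero>\<^bsub>K\<^esub>) \<longleftrightarrow> t \<in> Q" if t: "t \<in> carrier T" for t
    proof
      assume "append_coord N \<kappa> \<psi> t = (\<lambda>_. \<zero>\<^bsub>K\<^esub>)"
      then have *: "(if i = N then \<psi> t else \<kappa> t i) = \<zero>\<^bsub>K\<^esub>" for i
        by (auto simp: append_coord_def fun_eq_iff)
      have "\<kappa> t i = \<zero>\<^bsub>K\<^esub>" for i using *[of i] k(1)[OF t] by (cases "i = N") (auto simp: vec_space_carrier)
      then have \<kappa>t: "\<kappa> t = (\<lambda>_. \<zero>\<^bsub>K\<^esub>)" by auto
      have \<psi>t: "\<psi> t = \<zero>\<^bsub>K\<^esub>" using *[of N] by simp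
      obtain x where "x \<in> Q" "pr t = \<zero>\<^bsub>K\<^esub> \<odot>\<^bsub>T\<^esub> c \<oplus>\<^bsub>T\<^esub> x" using dec[OF t] \<psi>t by auto
      then show "t \<in> Q" using pr_ker[OF t \<kappa>t] step(3) q by simp
    next
      assume tQ: "t \<in> Q"
      have "t = \<zero>\<^bsub>K\<^esub> \<odot>\<^bsub>T\<^esub> c \<oplus>\<^bsub>T\<^esub> t" using t step(3) by simp
      then have "t \<in> adjoin K T c Q" using tQ K01 unfolding adjoin_def by blast
      then have \<kappa>t: "\<kappa> t = (\<lambda>_. \<zero>\<^bsub>K\<^esub>)" using ker[OF t] by simp
      have "\<psi> t = \<zero>\<^bsub>K\<^esub>" using t tQ step(3) by (intro \<psi>I[of _ _ t]) (simp_all add: pr_ker \<kappa>t)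
      then show "append_coord N \<kappa> \<psi> t = (\<lambda>_. \<zero>\<^bsub>K\<^esub>)" by (auto simp: append_coord_def \<kappa>t)
    qed
    ultimately show ?thesis by blast
  qed
qed

text \<open>Among coordinates with common kernel Q one is nonzero at x, and rescaling it gives the
  value 1.\<close>

lemma fincod_separate:
  assumes "field K" "module K T" "fincod K T Q" "x \<in> carrier T" "x \<notin> Q"
  shows "\<exists>\<psi>. functional K T \<psi> \<and> (\<forall>t\<in>Q \<inter> carrier T. \<psi> t = \<zero>\<^bsub>K\<^esub>) \<and> \<psi> x = \<one>\<^bsub>K\<^esub>"
proof -
  interpret field K by fact
  obtain N \<kappa> \<sigma> where co: "coords K T N \<kappa> \<sigma>"
    and ker: "\<And>t. t \<in> carrier T \<Longrightarrow> \<kappa> t = (\<lambda>_. \<zero>\<^bsub>K\<^esub>) \<longleftrightarrow> t \<in> Q"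
    using fincod_coords[OF assms(1-3)] by blast
  have \<kappa>: "\<kappa> \<in> module_hom K T (vec_space K N)" using co by (simp add: coords_def)
  note k = module_homD[OF \<kappa>]
  have kc: "\<kappa> t i \<in> carrier K" if "t \<in> carrier T" for t i using k(1)[OF that] by (simp add: vec_space_carrier)
  obtain i where i: "\<kappa> x i \<noteq> \<zero>\<^bsub>K\<^esub>" using ker[OF assms(4)] assms(5) by auto
  then have u: "\<kappa> x i \<in> Units K" using kc assms(4) field_Units by simp
  define \<psi> where "\<psi> t = inv\<^bsub>K\<^esub> (\<kappa> x i) \<otimes>\<^bsub>K\<^esub> \<kappa> t i" for t
  have "functional K T \<psi>"
    using u kc k(2,3) by (auto simp: functional_def \<psi>_def r_distr m_lcomm)
  moreover have "\<psi> x = \<one>\<^bsub>K\<^esub>" using u by (simp add: \<psi>_def)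
  moreover have "\<psi> t = \<zero>\<^bsub>K\<^esub>" if "t \<in> Q \<inter> carrier T" for t
    using ker[of t] that u by (simp add: \<psi>_def)
  ultimately show ?thesis by blast
qed

text \<open>The predicate \<open>lin_dep\<close> concerns the set of images of the unit vectors and
  does not see repetitions. Two equal images are therefore treated first and give a difference of
  two unit vectors; otherwise there are p distinct images, too many to be independent.\<close>

lemma exists_kernel_vec:
  assumes "vectorspace K E" "vectorspace.fin_dim K E" "vectorspace.dim K E < p"
    and f: "f \<in> module_hom K (vec_space K p) E"
  shows "\<exists>a\<in>carrier (vec_space K p). a \<noteq> (\<lambda>_. \<zero>\<^bsub>K\<^esub>) \<and> f a = \<zero>\<^bsub>E\<^esub>"
proof (cases "inj_on (\<lambda>i. f (unit_vec K i)) {..<p}")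
  case False
  interpret E: vectorspace K E by fact
  have V: "module K (vec_space K p)" by (rule E.vec_space_module)
  obtain i j where ij: "i < p" "j < p" "i \<noteq> j" "f (unit_vec K i) = f (unit_vec K j)"
    using False by (auto simp: inj_on_def)
  define a where "a = unit_vec K i \<oplus>\<^bsub>vec_space K p\<^esub> (\<ominus>\<^bsub>K\<^esub> \<one>\<^bsub>K\<^esub>) \<odot>\<^bsub>vec_space K p\<^esub> unit_vec K j"
  note u = E.unit_vec_closed[OF ij(1)] E.unit_vec_closed[OF ij(2)]
  have a: "a \<in> carrier (vec_space K p)"
    unfolding a_def using u
    by (intro abelian_groupE(1)[OF module.axioms(2)[OF V]] module.smult_closed[OF V]) simp_all
  moreover have "a i = \<one>\<^bsub>K\<^esub>" using ij by (simp add: a_def unit_vec_def)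
  then have "a \<noteq> (\<lambda>_. \<zero>\<^bsub>K\<^esub>)" by auto
  moreover have "f a = \<zero>\<^bsub>E\<^esub>"
  proof -
    have "f a = f (unit_vec K i) \<oplus>\<^bsub>E\<^esub> (\<ominus>\<^bsub>K\<^esub> \<one>\<^bsub>K\<^esub>) \<odot>\<^bsub>E\<^esub> f (unit_vec K j)"
      unfolding a_def using u module.smult_closed[OF V _ u(2)]
      by (simp add: module_homD[OF f] del: vec_space_simps)
    then show ?thesis
      using module_homD(1)[OF f u(2)] ij(4) by (simp add: E.smult_l_minus E.M.r_neg)
  qed
  ultimately show ?thesis by blast
next
  case inj: True
  interpret E: vectorspace K E by fact
  let ?g = "\<lambda>i. f (unit_vec K i)"
  let ?S = "?g ` {..<p}"
  have gc: "?g i \<in> carrier E" if "i < p" for i using module_homD(1)[OF f E.unit_vec_closed[OF that]] .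
  have S: "?S \<subseteq> carrier E" using gc by auto
  have "card ?S = p" using inj by (simp add: card_image)
  then have "E.lin_dep ?S" using E.li_le_dim(2)[OF assms(2) S] assms(3) by linarith
  then obtain A c w where *: "finite A" "A \<subseteq> ?S" "c \<in> A \<rightarrow> carrier K" "E.lincomb c A = \<zero>\<^bsub>E\<^esub>"
    "w \<in> A" "c w \<noteq> \<zero>\<^bsub>K\<^esub>" unfolding E.lin_dep_def by blast
  define a where "a i = (if i < p \<and> ?g i \<in> A then c (?g i) else \<zero>\<^bsub>K\<^esub>)" for i
  have ac: "a i \<in> carrier K" for i using *(3) by (auto simp: a_def)
  have a: "a \<in> carrier (vec_space K p)" using ac by (auto simp: vec_space_carrier a_def)
  \<comment> \<open>The map is evaluated on initial segments of a, so that linearity for two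
    summands builds up the whole sum.\<close>
  have fa: "f (\<lambda>i. if i < n then a i else \<zero>\<^bsub>K\<^esub>) = (\<Oplus>\<^bsub>E\<^esub>i\<in>{..<n}. a i \<odot>\<^bsub>E\<^esub> ?g i)" if "n \<le> p" for n
    using that
  proof (induction n)
    case 0
    then show ?case using module_hom_zero[OF E.vec_space_module E.module_axioms f] by simp
  next
    case (Suc n)
    let ?t = "\<lambda>n i. if i < n then a i else \<zero>\<^bsub>K\<^esub>"
    have u: "unit_vec K n \<in> carrier (vec_space K p)" using Suc by (intro E.unit_vec_closed) simp
    have tc: "?t n \<in> carrier (vec_space K p)" using ac Suc by (auto simp: vec_space_carrier)
    have "?t (Suc n) = ?t n \<oplus>\<^bsub>vec_space K p\<^esub> a n \<odot>\<^bsub>vec_space K p\<^esub> unit_vec K n"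
      using ac by (auto simp: fun_eq_iff unit_vec_def less_Suc_eq)
    then have "f (?t (Suc n)) = f (?t n) \<oplus>\<^bsub>E\<^esub> a n \<odot>\<^bsub>E\<^esub> ?g n"
      using module_homD(2)[OF f tc module.smult_closed[OF E.vec_space_module ac u]]
        module_homD(3)[OF f ac u] by (simp only:)
    also have "\<dots> = (\<Oplus>\<^bsub>E\<^esub>i\<in>{..<Suc n}. a i \<odot>\<^bsub>E\<^esub> ?g i)"
      using Suc ac gc by (simp add: lessThan_Suc E.M.finsum_insert E.M.a_comm Pi_iff)
    finally show ?case .
  qed
  have "(\<lambda>i. if i < p then a i else \<zero>\<^bsub>K\<^esub>) = a" by (auto simp: a_def)
  then have "f a = (\<Oplus>\<^bsub>E\<^esub>i\<in>{..<p}. a i \<odot>\<^bsub>E\<^esub> ?g i)" using fa[of p] by simp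
  also have "\<dots> = (\<Oplus>\<^bsub>E\<^esub>i\<in>{i\<in>{..<p}. ?g i \<in> A}. c (?g i) \<odot>\<^bsub>E\<^esub> ?g i)"
    using gc ac *(3) by (intro E.M.add.finprod_mono_neutral_cong) (auto simp: a_def)
  also have "\<dots> = (\<Oplus>\<^bsub>E\<^esub>v\<in>?g ` {i\<in>{..<p}. ?g i \<in> A}. c v \<odot>\<^bsub>E\<^esub> v)"
    using gc *(3) inj by (intro E.M.add.finprod_reindex[symmetric]) (auto intro: inj_on_subset)
  also have "?g ` {i\<in>{..<p}. ?g i \<in> A} = A" using *(2) by auto
  also have "(\<Oplus>\<^bsub>E\<^esub>v\<in>A. c v \<odot>\<^bsub>E\<^esub> v) = \<zero>\<^bsub>E\<^esub>" using *(4) by (simp add: E.lincomb_def)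
  finally have "f a = \<zero>\<^bsub>E\<^esub>" .
  moreover obtain i where "i < p" "w = ?g i" using *(2,5) by blast
  then have "a i \<noteq> \<zero>\<^bsub>K\<^esub>" using *(5,6) by (simp add: a_def)
  then have "a \<noteq> (\<lambda>_. \<zero>\<^bsub>K\<^esub>)" by auto
  ultimately show ?thesis using a by blast
qed

section \<open>Quotients and homomorphic images\<close>

lemma quot_simps [simp]:
  "carrier (quot V B) = a_rcosets\<^bsub>V\<^esub> B"
  "\<zero>\<^bsub>quot V B\<^esub> = B" "ring.add (quot V B) = set_add V"
  "\<one>\<^bsub>quot V B\<^esub> = B +>\<^bsub>V\<^esub> \<one>\<^bsub>V\<^esub>" "monoid.mult (quot V B) = rcoset_mult V B"
  "c \<odot>\<^bsub>quot V B\<^esub> X = (\<Union>x\<in>X. B +>\<^bsub>V\<^esub> (c \<odot>\<^bsub>V\<^esub> x))"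
  by (simp_all add: quot_def mk_module_def FactRing_def)

text \<open>Closure and all laws of N are transported from M, so that nothing has to be computed in
  the target. The power series algebra, quotients and coordinate algebras get their structure in
  this way.\<close>

lemma module_surj_image:
  assumes M: "module K M"
    and f: "f ` carrier M = carrier N" "\<And>x y. x \<in> carrier M \<Longrightarrow> y \<in> carrier M \<Longrightarrow> f (x \<oplus>\<^bsub>M\<^esub> y) = f x \<oplus>\<^bsub>N\<^esub> f y"
      "f \<zero>\<^bsub>M\<^esub> = \<zero>\<^bsub>N\<^esub>"
      "\<And>c x. c \<in> carrier K \<Longrightarrow> x \<in> carrier M \<Longrightarrow> f (c \<odot>\<^bsub>M\<^esub> x) = c \<odot>\<^bsub>N\<^esub> f x"
  shows "module K N"
proof -
  interpret M: module K M by fact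
  have ex: "\<exists>x\<in>carrier M. y = f x" if "y \<in> carrier N" for y using that f(1) by blast
  have fc: "f x \<in> carrier N" if "x \<in> carrier M" for x using that f(1) by blast
  show ?thesis
  proof (rule moduleI)
    show "abelian_group N"
    proof (rule abelian_groupI)
      fix x y assume "x \<in> carrier N" "y \<in> carrier N"
      then show "x \<oplus>\<^bsub>N\<^esub> y \<in> carrier N" using ex fc f(2) by (metis M.M.a_closed)
    next
      show "\<zero>\<^bsub>N\<^esub> \<in> carrier N" using fc[of "\<zero>\<^bsub>M\<^esub>"] f(3) by simp
    next
      fix x y z assume "x \<in> carrier N" "y \<in> carrier N" "z \<in> carrier N"
      note ex = ex[OF this(1)] ex[OF this(2)] ex[OF this(3)]
      from ex(1) obtain a where a: "a \<in> carrier M" "x = f a" by blast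
      from ex(2) obtain b where b: "b \<in> carrier M" "y = f b" by blast
      from ex(3) obtain c where c: "c \<in> carrier M" "z = f c" by blast
      show "x \<oplus>\<^bsub>N\<^esub> y \<oplus>\<^bsub>N\<^esub> z = x \<oplus>\<^bsub>N\<^esub> (y \<oplus>\<^bsub>N\<^esub> z)"
        using a b c by (simp add: f(2)[symmetric] M.M.a_assoc)
    next
      fix x y assume "x \<in> carrier N" "y \<in> carrier N"
      then obtain a b where "a \<in> carrier M" "b \<in> carrier M" "x = f a" "y = f b" using ex by blast
      then show "x \<oplus>\<^bsub>N\<^esub> y = y \<oplus>\<^bsub>N\<^esub> x" by (simp add: f(2)[symmetric] M.M.a_comm)
    next
      fix x assume "x \<in> carrier N"
      then obtain a where a: "a \<in> carrier M" "x = f a" using ex by blast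
      then show "\<zero>\<^bsub>N\<^esub> \<oplus>\<^bsub>N\<^esub> x = x" by (simp add: f(2)[symmetric] f(3)[symmetric])
      show "\<exists>y\<in>carrier N. y \<oplus>\<^bsub>N\<^esub> x = \<zero>\<^bsub>N\<^esub>"
        using a by (intro bexI[of _ "f (\<ominus>\<^bsub>M\<^esub> a)"])
          (simp_all add: f(2)[symmetric] f(3)[symmetric] M.M.l_neg fc)
    qed
  next
    fix a x assume a: "a \<in> carrier K" and "x \<in> carrier N"
    then obtain u where u: "u \<in> carrier M" "x = f u" using ex by blast
    show "a \<odot>\<^bsub>N\<^esub> x \<in> carrier N" using a u fc by (simp add: f(4)[symmetric])
    fix b assume b: "b \<in> carrier K"
    show "(a \<oplus>\<^bsub>K\<^esub> b) \<odot>\<^bsub>N\<^esub> x = a \<odot>\<^bsub>N\<^esub> x \<oplus>\<^bsub>N\<^esub> b \<odot>\<^bsub>N\<^esub> x"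
      using a b u by (simp add: f(4)[symmetric] f(2)[symmetric] M.smult_l_distr)
    show "(a \<otimes>\<^bsub>K\<^esub> b) \<odot>\<^bsub>N\<^esub> x = a \<odot>\<^bsub>N\<^esub> (b \<odot>\<^bsub>N\<^esub> x)"
      using a b u by (simp add: f(4)[symmetric] M.smult_assoc1)
  next
    fix a x y assume a: "a \<in> carrier K" and "x \<in> carrier N" "y \<in> carrier N"
    then obtain u v where u: "u \<in> carrier M" "x = f u" "v \<in> carrier M" "y = f v" using ex by blast
    show "a \<odot>\<^bsub>N\<^esub> (x \<oplus>\<^bsub>N\<^esub> y) = a \<odot>\<^bsub>N\<^esub> x \<oplus>\<^bsub>N\<^esub> a \<odot>\<^bsub>N\<^esub> y"
      using a u by (simp add: f(4)[symmetric] f(2)[symmetric] M.smult_r_distr)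
  next
    fix x assume "x \<in> carrier N"
    then obtain u where "u \<in> carrier M" "x = f u" using ex by blast
    then show "\<one>\<^bsub>K\<^esub> \<odot>\<^bsub>N\<^esub> x = x" by (simp add: f(4)[symmetric])
  qed (rule M.R.is_cring)
qed

lemma nc_algebra_surj_image:
  assumes A: "nc_algebra K A"
    and f: "f ` carrier A = carrier B" "\<And>x y. x \<in> carrier A \<Longrightarrow> y \<in> carrier A \<Longrightarrow> f (x \<oplus>\<^bsub>A\<^esub> y) = f x \<oplus>\<^bsub>B\<^esub> f y"
      "f \<zero>\<^bsub>A\<^esub> = \<zero>\<^bsub>B\<^esub>"
      "\<And>c x. c \<in> carrier K \<Longrightarrow> x \<in> carrier A \<Longrightarrow> f (c \<odot>\<^bsub>A\<^esub> x) = c \<odot>\<^bsub>B\<^esub> f x"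
      "\<And>x y. x \<in> carrier A \<Longrightarrow> y \<in> carrier A \<Longrightarrow> f (x \<otimes>\<^bsub>A\<^esub> y) = f x \<otimes>\<^bsub>B\<^esub> f y"
      "f \<one>\<^bsub>A\<^esub> = \<one>\<^bsub>B\<^esub>"
  shows "nc_algebra K B"
proof -
  interpret A: nc_algebra K A by fact
  interpret B: module K B by (rule module_surj_image[OF A.module_axioms f(1-4)])
  have ex: "\<exists>x\<in>carrier A. y = f x" if "y \<in> carrier B" for y using that f(1) by blast
  have fc: "f x \<in> carrier B" if "x \<in> carrier A" for x using that f(1) by blast
  have ring: "ring B"
  proof (rule ringI)
    show "abelian_group B" by (rule B.abelian_group_axioms)
    show "monoid B"
    proof (rule monoidI)
      fix x y assume "x \<in> carrier B" "y \<in> carrier B"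
      then show "x \<otimes>\<^bsub>B\<^esub> y \<in> carrier B" using ex fc f(5) by (metis A.m_closed)
    next
      show "\<one>\<^bsub>B\<^esub> \<in> carrier B" using fc[of "\<one>\<^bsub>A\<^esub>"] f(6) by simp
    next
      fix x y z assume "x \<in> carrier B" "y \<in> carrier B" "z \<in> carrier B"
      note ex = ex[OF this(1)] ex[OF this(2)] ex[OF this(3)]
      from ex(1) obtain a where a: "a \<in> carrier A" "x = f a" by blast
      from ex(2) obtain b where b: "b \<in> carrier A" "y = f b" by blast
      from ex(3) obtain c where c: "c \<in> carrier A" "z = f c" by blast
      show "x \<otimes>\<^bsub>B\<^esub> y \<otimes>\<^bsub>B\<^esub> z = x \<otimes>\<^bsub>B\<^esub> (y \<otimes>\<^bsub>B\<^esub> z)"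
        using a b c by (simp add: f(5)[symmetric] A.m_assoc)
    next
      fix x assume "x \<in> carrier B"
      then obtain a where a: "a \<in> carrier A" "x = f a" using ex by blast
      then show "\<one>\<^bsub>B\<^esub> \<otimes>\<^bsub>B\<^esub> x = x" "x \<otimes>\<^bsub>B\<^esub> \<one>\<^bsub>B\<^esub> = x" by (simp_all add: f(5)[symmetric] f(6)[symmetric])
    qed
  next
    fix x y z assume "x \<in> carrier B" "y \<in> carrier B" "z \<in> carrier B"
      note ex = ex[OF this(1)] ex[OF this(2)] ex[OF this(3)]
    from ex(1) obtain a where a: "a \<in> carrier A" "x = f a" by blast
    from ex(2) obtain b where b: "b \<in> carrier A" "y = f b" by blast
    from ex(3) obtain c where c: "c \<in> carrier A" "z = f c" by blast
    show "(x \<oplus>\<^bsub>B\<^esub> y) \<otimes>\<^bsub>B\<^esub> z = x \<otimes>\<^bsub>B\<^esub> z \<oplus>\<^bsub>B\<^esub> y \<otimes>\<^bsub>B\<^esub> z"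
      "z \<otimes>\<^bsub>B\<^esub> (x \<oplus>\<^bsub>B\<^esub> y) = z \<otimes>\<^bsub>B\<^esub> x \<oplus>\<^bsub>B\<^esub> z \<otimes>\<^bsub>B\<^esub> y"
      using a b c by (simp_all add: f(5)[symmetric] f(2)[symmetric] A.l_distr A.r_distr)
  qed
  interpret ring B by (rule ring)
  show ?thesis
  proof (intro nc_algebra.intro nc_algebra_axioms.intro B.module_axioms ring)
    fix c x y assume c: "c \<in> carrier K" and xy: "x \<in> carrier B" "y \<in> carrier B"
    from ex[OF xy(1)] ex[OF xy(2)] obtain a b
      where a: "a \<in> carrier A" "x = f a" "b \<in> carrier A" "y = f b" by blast
    show "(c \<odot>\<^bsub>B\<^esub> x) \<otimes>\<^bsub>B\<^esub> y = c \<odot>\<^bsub>B\<^esub> (x \<otimes>\<^bsub>B\<^esub> y)"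
      using a c by (simp add: f(4)[symmetric] f(5)[symmetric] A.smult_mult_left)
    show "x \<otimes>\<^bsub>B\<^esub> (c \<odot>\<^bsub>B\<^esub> y) = c \<odot>\<^bsub>B\<^esub> (x \<otimes>\<^bsub>B\<^esub> y)"
      using a c by (simp add: f(4)[symmetric] f(5)[symmetric] A.smult_mult_right)
  qed
qed

lemma quot_class:
  assumes "submodule K B V"
  shows "a_rcosets\<^bsub>V\<^esub> B = (\<lambda>x. B +>\<^bsub>V\<^esub> x) ` carrier V"
    and "x \<in> carrier V \<Longrightarrow> y \<in> carrier V \<Longrightarrow> B +>\<^bsub>V\<^esub> (x \<oplus>\<^bsub>V\<^esub> y) = (B +>\<^bsub>V\<^esub> x) <+>\<^bsub>V\<^esub> (B +>\<^bsub>V\<^esub> y)"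
    and "B +>\<^bsub>V\<^esub> \<zero>\<^bsub>V\<^esub> = B"
    and "c \<in> carrier K \<Longrightarrow> x \<in> carrier V \<Longrightarrow>
      B +>\<^bsub>V\<^esub> (c \<odot>\<^bsub>V\<^esub> x) = (\<Union>y\<in>B +>\<^bsub>V\<^esub> x. B +>\<^bsub>V\<^esub> (c \<odot>\<^bsub>V\<^esub> y))"
    and "x \<in> carrier V \<Longrightarrow> y \<in> carrier V \<Longrightarrow> B +>\<^bsub>V\<^esub> x = B +>\<^bsub>V\<^esub> y \<longleftrightarrow> x \<ominus>\<^bsub>V\<^esub> y \<in> B"
proof -
  interpret B: submodule K B V by fact
  interpret module K V by (rule B.module)
  have neg: "\<ominus>\<^bsub>V\<^esub> x \<in> B" if "x \<in> B" for x
  proof -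
    have "(\<ominus>\<^bsub>K\<^esub> \<one>\<^bsub>K\<^esub>) \<odot>\<^bsub>V\<^esub> x = \<ominus>\<^bsub>V\<^esub> x" using subsetD[OF B.subset that] by (simp add: smult_l_minus)
    moreover have "(\<ominus>\<^bsub>K\<^esub> \<one>\<^bsub>K\<^esub>) \<odot>\<^bsub>V\<^esub> x \<in> B" using that by (intro B.smult_closed) simp_all
    ultimately show ?thesis by (simp only:)
  qed
  have sg: "subgroup B (add_monoid V)"
    using B.subset B.m_closed B.zero_closed neg by unfold_locales (auto simp: a_inv_def)
  interpret B: abelian_subgroup B V
    by (rule abelian_subgroupI3) (intro additive_subgroup.intro sg, rule M.abelian_group_axioms)
  show "a_rcosets\<^bsub>V\<^esub> B = (\<lambda>x. B +>\<^bsub>V\<^esub> x) ` carrier V"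
    by (auto simp: A_RCOSETS_def RCOSETS_def a_r_coset_def)
  show "x \<in> carrier V \<Longrightarrow> y \<in> carrier V \<Longrightarrow> B +>\<^bsub>V\<^esub> (x \<oplus>\<^bsub>V\<^esub> y) = (B +>\<^bsub>V\<^esub> x) <+>\<^bsub>V\<^esub> (B +>\<^bsub>V\<^esub> y)"
    by (simp add: B.a_rcos_sum)
  show "B +>\<^bsub>V\<^esub> \<zero>\<^bsub>V\<^esub> = B" using B.subset by (rule M.a_coset_add_zero)
  show eq: "B +>\<^bsub>V\<^esub> x = B +>\<^bsub>V\<^esub> y \<longleftrightarrow> x \<ominus>\<^bsub>V\<^esub> y \<in> B" if x: "x \<in> carrier V" and y: "y \<in> carrier V" for x y
    using B.a_rcos_self[OF x] B.a_rcos_module[OF y x] M.a_repr_independence[OF _ y sg, of x]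
    by (auto simp: a_minus_def)
  assume c: "c \<in> carrier K" and x: "x \<in> carrier V"
  \<comment> \<open>All representatives of a coset give the same member of the union in the scalar
    multiplication of \<open>quot\<close>, so the union is a single coset.\<close>
  have "B +>\<^bsub>V\<^esub> (c \<odot>\<^bsub>V\<^esub> y) = B +>\<^bsub>V\<^esub> (c \<odot>\<^bsub>V\<^esub> x)" if yx: "y \<in> B +>\<^bsub>V\<^esub> x" for y
  proof -
    obtain b where b: "b \<in> B" "y = b \<oplus>\<^bsub>V\<^esub> x" using yx by (auto simp: a_r_coset_def r_coset_def)
    have "b \<in> carrier V" using b(1) B.subset by blast
    then have "c \<odot>\<^bsub>V\<^esub> y \<ominus>\<^bsub>V\<^esub> c \<odot>\<^bsub>V\<^esub> x = c \<odot>\<^bsub>V\<^esub> b"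
      using b c x by (simp add: smult_r_distr M.minus_eq M.a_assoc M.r_neg)
    then show ?thesis using b c x B.subset by (subst eq) auto
  qed
  moreover have "x \<in> B +>\<^bsub>V\<^esub> x" using x by (rule B.a_rcos_self)
  ultimately show "B +>\<^bsub>V\<^esub> (c \<odot>\<^bsub>V\<^esub> x) = (\<Union>y\<in>B +>\<^bsub>V\<^esub> x. B +>\<^bsub>V\<^esub> (c \<odot>\<^bsub>V\<^esub> y))" by blast
qed

lemma quot_module: "submodule K B V \<Longrightarrow> module K (quot V B)"
  by (rule module_surj_image[OF submodule.module, where f = "\<lambda>x. B +>\<^bsub>V\<^esub> x"])
    (auto simp: quot_class)

lemma quot_class_hom: "submodule K B V \<Longrightarrow> (\<lambda>x. B +>\<^bsub>V\<^esub> x) \<in> module_hom K V (quot V B)"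
  by (intro module_homI) (auto simp: quot_class)

section \<open>Power series in non-commuting variables as functions on words\<close>

text \<open>Splitting off the first letter of a word turns the convolution product into a recursion, so
  that its laws follow by induction over words.\<close>

primrec conv :: "('k, 'e) ring_scheme \<Rightarrow> ('a list \<Rightarrow> 'k) \<Rightarrow> ('a list \<Rightarrow> 'k) \<Rightarrow> 'a list \<Rightarrow> 'k" where
  "conv K u v [] = u [] \<otimes>\<^bsub>K\<^esub> v []"
| "conv K u v (a # w) = u [] \<otimes>\<^bsub>K\<^esub> v (a # w) \<oplus>\<^bsub>K\<^esub> conv K (\<lambda>x. u (a # x)) v w"

definition series :: "('k, 'e) ring_scheme \<Rightarrow> nat \<Rightarrow> (nat list \<Rightarrow> 'k) set" where
  "series K r = {u. (\<forall>w. u w \<in> carrier K) \<and> (\<forall>w. u w \<noteq> \<zero>\<^bsub>K\<^esub> \<longrightarrow> set w \<subseteq> {..<r})}"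

context cring
begin

lemma conv_closed: "(\<And>w. u w \<in> carrier R) \<Longrightarrow> (\<And>w. v w \<in> carrier R) \<Longrightarrow> conv R u v w \<in> carrier R"
  by (induction w arbitrary: u) auto

text \<open>The term with i = 0 of the sum is the first summand of the recursion; the others belong
  to the shifted u.\<close>

lemma conv_finsum:
  "(\<And>w. u w \<in> carrier R) \<Longrightarrow> (\<And>w. v w \<in> carrier R) \<Longrightarrow>
    (\<Oplus>i\<in>{..length w}. u (take i w) \<otimes> v (drop i w)) = conv R u v w"
proof (induction w arbitrary: u)
  case Nil
  then show ?case by (simp add: finsum_0)
next
  case (Cons a w)
  have "(\<Oplus>i\<in>{..length (a # w)}. u (take i (a # w)) \<otimes> v (drop i (a # w)))
      = (\<Oplus>i\<in>{..length w}. u (a # take i w) \<otimes> v (drop i w)) \<oplus> u [] \<otimes> v (a # w)"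
    unfolding list.size add_0_right add_Suc_right
    using Cons.prems by (subst finsum_Suc2) simp_all
  also have "\<dots> = conv R u v (a # w)"
    using Cons.IH[of "\<lambda>x. u (a # x)"] Cons.prems conv_closed[of "\<lambda>x. u (a # x)" v w] by (simp add: a_comm)
  finally show ?case .
qed

lemma conv_add_left:
  "(\<And>w. u w \<in> carrier R) \<Longrightarrow> (\<And>w. u' w \<in> carrier R) \<Longrightarrow> (\<And>w. v w \<in> carrier R) \<Longrightarrow>
    conv R (\<lambda>w. u w \<oplus> u' w) v w = conv R u v w \<oplus> conv R u' v w"
  by (induction w arbitrary: u u') (simp_all add: l_distr a_ac conv_closed)

lemma conv_add_right:
  "(\<And>w. u w \<in> carrier R) \<Longrightarrow> (\<And>w. v w \<in> carrier R) \<Longrightarrow> (\<And>w. v' w \<in> carrier R) \<Longrightarrow>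
    conv R u (\<lambda>w. v w \<oplus> v' w) w = conv R u v w \<oplus> conv R u v' w"
  by (induction w arbitrary: u) (simp_all add: r_distr a_ac conv_closed)

lemma conv_smult_left:
  "c \<in> carrier R \<Longrightarrow> (\<And>w. u w \<in> carrier R) \<Longrightarrow> (\<And>w. v w \<in> carrier R) \<Longrightarrow>
    conv R (\<lambda>w. c \<otimes> u w) v w = c \<otimes> conv R u v w"
  by (induction w arbitrary: u) (simp_all add: r_distr m_assoc conv_closed)

lemma conv_smult_right:
  "c \<in> carrier R \<Longrightarrow> (\<And>w. u w \<in> carrier R) \<Longrightarrow> (\<And>w. v w \<in> carrier R) \<Longrightarrow>
    conv R u (\<lambda>w. c \<otimes> v w) w = c \<otimes> conv R u v w"
  by (induction w arbitrary: u) (simp_all add: r_distr m_lcomm conv_closed)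

text \<open>Shifting a product by its first letter gives u [] times the shifted v plus the product
  of the shifted u with v. Bilinearity then reduces the claim to the induction hypothesis for the
  shifted u.\<close>

lemma conv_assoc:
  "(\<And>w. u w \<in> carrier R) \<Longrightarrow> (\<And>w. v w \<in> carrier R) \<Longrightarrow> (\<And>w. x w \<in> carrier R) \<Longrightarrow>
    conv R (conv R u v) x w = conv R u (conv R v x) w"
proof (induction w arbitrary: u)
  case (Cons a w)
  have "conv R (conv R u v) x (a # w)
      = u [] \<otimes> v [] \<otimes> x (a # w) \<oplus>
        conv R (\<lambda>z. u [] \<otimes> v (a # z) \<oplus> conv R (\<lambda>y. u (a # y)) v z) x w" by simp
  also have "conv R (\<lambda>z. u [] \<otimes> v (a # z) \<oplus> conv R (\<lambda>y. u (a # y)) v z) x w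
      = u [] \<otimes> conv R (\<lambda>z. v (a # z)) x w \<oplus> conv R (conv R (\<lambda>y. u (a # y)) v) x w"
    using Cons.prems by (simp add: conv_add_left conv_smult_left conv_closed)
  also have "conv R (conv R (\<lambda>y. u (a # y)) v) x w = conv R (\<lambda>y. u (a # y)) (conv R v x) w"
    by (rule Cons.IH) (use Cons.prems in auto)
  finally show ?case
    using Cons.prems by (simp add: r_distr m_assoc a_assoc conv_closed)
qed (simp add: m_assoc)

lemma conv_zero_left: "(\<And>w. v w \<in> carrier R) \<Longrightarrow> conv R (\<lambda>_. \<zero>) v w = \<zero>"
  by (induction w) auto

lemma conv_one_left:
  "(\<And>w. v w \<in> carrier R) \<Longrightarrow> conv R (\<lambda>w. if w = [] then \<one> else \<zero>) v w = v w"
  by (cases w) (simp_all add: conv_zero_left)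

lemma conv_one_right:
  "(\<And>w. u w \<in> carrier R) \<Longrightarrow> conv R u (\<lambda>w. if w = [] then \<one> else \<zero>) w = u w"
  by (induction w arbitrary: u) simp_all

text \<open>This yields the closure properties of products: finite support, letters below r, and
  additivity of the order.\<close>

lemma conv_support:
  "(\<And>w. u w \<in> carrier R) \<Longrightarrow> (\<And>w. v w \<in> carrier R) \<Longrightarrow> conv R u v w \<noteq> \<zero> \<Longrightarrow>
    \<exists>x y. w = x @ y \<and> u x \<noteq> \<zero> \<and> v y \<noteq> \<zero>"
proof (induction w arbitrary: u)
  case Nil
  then show ?case by auto
next
  case (Cons a w)
  show ?case
  proof (cases "u [] \<otimes> v (a # w) = \<zero>")
    case True
    then have "conv R (\<lambda>x. u (a # x)) v w \<noteq> \<zero>" using Cons.prems by (simp add: conv_closed)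
    then obtain x y where "w = x @ y" "u (a # x) \<noteq> \<zero>" "v y \<noteq> \<zero>"
      using Cons.IH[of "\<lambda>x. u (a # x)"] Cons.prems by blast
    then show ?thesis by (intro exI[of _ "a # x"] exI[of _ y]) simp
  next
    case False
    then have "u [] \<noteq> \<zero>" "v (a # w) \<noteq> \<zero>" using Cons.prems by auto
    then show ?thesis by (intro exI[of _ "[]"] exI[of _ "a # w"]) simp
  qed
qed

text \<open>A coefficient at w involves only words no longer than w, which makes the product
  compatible with truncation.\<close>

lemma conv_cong:
  "(\<And>x. length x \<le> length w \<Longrightarrow> u x = u' x) \<Longrightarrow> (\<And>x. length x \<le> length w \<Longrightarrow> v x = v' x) \<Longrightarrow>
    conv R u v w = conv R u' v' w"
proof (induction w arbitrary: u u')
  case (Cons a w)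
  have "conv R (\<lambda>x. u (a # x)) v w = conv R (\<lambda>x. u' (a # x)) v' w"
    by (rule Cons.IH) (use Cons.prems in auto)
  then show ?case using Cons.prems by simp
qed simp

lemma conv_var:
  "(\<And>w. u w \<in> carrier R) \<Longrightarrow>
    conv R u (free_algebra_var R i) w = (if w \<noteq> [] \<and> last w = i then u (butlast w) else \<zero>)"
  by (induction w arbitrary: u) (auto simp: free_algebra_var_def)

end

text \<open>Right division: the solution v of v u = y when u [] is invertible. At the empty word v
  [] = y [] / u []; removing the first letter a leaves the same problem with y shifted by a and
  diminished by v [] times u shifted by a.\<close>

primrec rdiv :: "('k, 'e) ring_scheme \<Rightarrow> ('a list \<Rightarrow> 'k) \<Rightarrow> ('a list \<Rightarrow> 'k) \<Rightarrow> 'a list \<Rightarrow> 'k" where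
  "rdiv K u y [] = y [] \<otimes>\<^bsub>K\<^esub> inv\<^bsub>K\<^esub> (u [])"
| "rdiv K u y (a # w) =
     rdiv K u (\<lambda>z. y (a # z) \<ominus>\<^bsub>K\<^esub> (y [] \<otimes>\<^bsub>K\<^esub> inv\<^bsub>K\<^esub> (u [])) \<otimes>\<^bsub>K\<^esub> u (a # z)) w"

context cring
begin

lemma rdiv_closed:
  "u [] \<in> Units R \<Longrightarrow> (\<And>w. u w \<in> carrier R) \<Longrightarrow> (\<And>w. y w \<in> carrier R) \<Longrightarrow> rdiv R u y w \<in> carrier R"
  by (induction w arbitrary: y) simp_all

lemma conv_rdiv:
  "u [] \<in> Units R \<Longrightarrow> (\<And>w. u w \<in> carrier R) \<Longrightarrow> (\<And>w. y w \<in> carrier R) \<Longrightarrow>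
    conv R (rdiv R u y) u w = y w"
proof (induction w arbitrary: y)
  case Nil
  then show ?case by (simp add: m_assoc)
next
  case (Cons a w)
  let ?c = "y [] \<otimes> inv (u [])"
  have "conv R (rdiv R u y) u (a # w) = ?c \<otimes> u (a # w) \<oplus> (y (a # w) \<ominus> ?c \<otimes> u (a # w))"
    using Cons.IH[of "\<lambda>z. y (a # z) \<ominus> ?c \<otimes> u (a # z)"] Cons.prems by simp
  then show ?case
    using Cons.prems by (simp add: minus_eq a_lcomm r_neg)
qed

lemma rdiv_support:
  assumes "u \<in> series R r" "u [] \<in> Units R"
  shows "y \<in> series R r \<Longrightarrow> rdiv R u y w \<noteq> \<zero> \<Longrightarrow> set w \<subseteq> {..<r}"
proof (induction w arbitrary: y)
  case (Cons a w)
  let ?y = "\<lambda>z. y (a # z) \<ominus> (y [] \<otimes> inv (u [])) \<otimes> u (a # z)"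
  have c: "u w \<in> carrier R" "y w \<in> carrier R" for w using assms(1) Cons.prems by (auto simp: series_def)
  have z: "y x = \<zero>" "u x = \<zero>" if "\<not> set x \<subseteq> {..<r}" for x
    using assms(1) Cons.prems(1) that by (auto simp: series_def)
  have ser: "?y \<in> series R r"
    unfolding series_def mem_Collect_eq
  proof (intro conjI allI impI)
    fix z assume "?y z \<noteq> \<zero>"
    then have "set (a # z) \<subseteq> {..<r}"
      using z[of "a # z"] c assms(2) by (cases "set (a # z) \<subseteq> {..<r}") (auto simp: minus_eq)
    then show "set z \<subseteq> {..<r}" by simp
  qed (use c assms in auto)
  have "set w \<subseteq> {..<r}" using Cons.IH[OF ser] Cons.prems by simp
  \<comment> \<open>For a letter outside the alphabet the new dividend is zero, and dividing zero
    gives zero.\<close>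
  moreover have "a < r"
  proof (rule ccontr)
    assume "\<not> a < r"
    then have "?y z = \<zero>" for z
      using z[of "a # z"] c assms(2) by (simp add: minus_eq)
    moreover have "rdiv R u (\<lambda>_. \<zero>) w = \<zero>" for w
      using assms c by (induction w) (simp_all add: minus_eq)
    ultimately show False using Cons.prems(2) by simp
  qed
  ultimately show ?case by simp
qed simp

end

text \<open>The operations of \<open>free_algebra\<close> do not depend on r, so they can be put on
  any carrier. Polynomials and power series then share one proof of the algebra laws.\<close>

definition series_algebra :: "('k, 'e) ring_scheme \<Rightarrow> (nat list \<Rightarrow> 'k) set \<Rightarrow> ('k, nat list \<Rightarrow> 'k) module" where
  "series_algebra K C = (free_algebra K 0)\<lparr>carrier := C\<rparr>"

lemma series_algebra_simps [simp]:
  "carrier (series_algebra K C) = C"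
  "\<one>\<^bsub>series_algebra K C\<^esub> = (\<lambda>w. if w = [] then \<one>\<^bsub>K\<^esub> else \<zero>\<^bsub>K\<^esub>)"
  "\<zero>\<^bsub>series_algebra K C\<^esub> = (\<lambda>_. \<zero>\<^bsub>K\<^esub>)"
  "u \<oplus>\<^bsub>series_algebra K C\<^esub> v = (\<lambda>w. u w \<oplus>\<^bsub>K\<^esub> v w)"
  "c \<odot>\<^bsub>series_algebra K C\<^esub> u = (\<lambda>w. c \<otimes>\<^bsub>K\<^esub> u w)"
  by (simp_all add: series_algebra_def free_algebra_def)

lemma free_algebra_series: "free_algebra K r = series_algebra K (carrier (free_algebra K r))"
  by (simp add: series_algebra_def free_algebra_def)

lemma series_algebra_mult:
  assumes "cring K" "\<And>w. u w \<in> carrier K" "\<And>w. v w \<in> carrier K"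
  shows "u \<otimes>\<^bsub>series_algebra K C\<^esub> v = conv K u v"
proof -
  interpret cring K by fact
  show ?thesis using assms by (simp add: series_algebra_def free_algebra_def conv_finsum fun_eq_iff)
qed

lemma nc_algebra_series:
  assumes K: "cring K" and C: "\<And>u w. u \<in> C \<Longrightarrow> u w \<in> carrier K"
    and zero: "(\<lambda>_. \<zero>\<^bsub>K\<^esub>) \<in> C" and one: "(\<lambda>w. if w = [] then \<one>\<^bsub>K\<^esub> else \<zero>\<^bsub>K\<^esub>) \<in> C"
    and add: "\<And>u v. u \<in> C \<Longrightarrow> v \<in> C \<Longrightarrow> (\<lambda>w. u w \<oplus>\<^bsub>K\<^esub> v w) \<in> C"
    and smult: "\<And>c u. c \<in> carrier K \<Longrightarrow> u \<in> C \<Longrightarrow> (\<lambda>w. c \<otimes>\<^bsub>K\<^esub> u w) \<in> C"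
    and conv: "\<And>u v. u \<in> C \<Longrightarrow> v \<in> C \<Longrightarrow> conv K u v \<in> C"
  shows "nc_algebra K (series_algebra K C)"
proof -
  interpret cring K by fact
  note [simp] = C series_algebra_mult[OF K] conv_closed
  have mod: "module K (series_algebra K C)"
  proof (rule moduleI)
    show "abelian_group (series_algebra K C)"
    proof (rule abelian_groupI)
      fix u assume u: "u \<in> carrier (series_algebra K C)"
      have "(\<lambda>w. \<ominus>\<^bsub>K\<^esub> \<one>\<^bsub>K\<^esub> \<otimes>\<^bsub>K\<^esub> u w) \<in> C" using u by (intro smult) simp_all
      then show "\<exists>v\<in>carrier (series_algebra K C). v \<oplus>\<^bsub>series_algebra K C\<^esub> u = \<zero>\<^bsub>series_algebra K C\<^esub>"
        using u by (intro bexI[of _ "\<lambda>w. \<ominus>\<^bsub>K\<^esub> \<one>\<^bsub>K\<^esub> \<otimes>\<^bsub>K\<^esub> u w"]) (simp_all add: l_minus l_neg)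
    qed (simp_all add: zero add a_ac)
  qed (simp_all add: smult l_distr r_distr m_assoc K)
  have ring: "ring (series_algebra K C)"
  proof (rule ringI)
    show "monoid (series_algebra K C)"
      by (rule monoidI) (simp_all add: conv one fun_eq_iff conv_assoc conv_one_left conv_one_right)
  qed (simp_all add: module.axioms(2)[OF mod] fun_eq_iff conv_add_left conv_add_right add conv)
  show ?thesis
    by (intro nc_algebra.intro nc_algebra_axioms.intro mod ring)
      (simp_all add: fun_eq_iff conv_smult_left conv_smult_right smult conv)
qed

section \<open>Polynomials, power series and the filtration by order\<close>

locale power_series = field K for K :: "'k ring" (structure) +
  fixes r :: nat
begin

abbreviation "S \<equiv> series K r"
abbreviation "SA \<equiv> series_algebra K S"
abbreviation "FA \<equiv> free_algebra K r"
abbreviation "FC \<equiv> carrier FA"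

lemma S_closed: "u \<in> S \<Longrightarrow> u w \<in> carrier K"
  by (simp add: series_def)

lemma FC_iff: "u \<in> FC \<longleftrightarrow> u \<in> S \<and> finite {w. u w \<noteq> \<zero>}"
  by (auto simp: free_algebra_def series_def)

lemma FC_S: "u \<in> FC \<Longrightarrow> u \<in> S"
  by (simp add: FC_iff)

lemma S_zero: "(\<lambda>_. \<zero>) \<in> S" and S_one: "(\<lambda>w. if w = [] then \<one> else \<zero>) \<in> S"
  by (auto simp: series_def)

lemma S_add: "u \<in> S \<Longrightarrow> v \<in> S \<Longrightarrow> (\<lambda>w. u w \<oplus> v w) \<in> S"
  by (auto simp: series_def) (metis l_zero subsetD lessThan_iff zero_closed)

lemma S_smult: "c \<in> carrier K \<Longrightarrow> u \<in> S \<Longrightarrow> (\<lambda>w. c \<otimes> u w) \<in> S"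
  by (auto simp: series_def) (metis r_null subsetD lessThan_iff)

lemma S_conv:
  assumes "u \<in> S" "v \<in> S" shows "conv K u v \<in> S"
  unfolding series_def mem_Collect_eq
proof (intro conjI allI impI)
  fix w assume "conv K u v w \<noteq> \<zero>"
  then obtain x y where "w = x @ y" "u x \<noteq> \<zero>" "v y \<noteq> \<zero>"
    using conv_support[of u v w] assms S_closed by blast
  then show "set w \<subseteq> {..<r}" using assms by (auto simp: series_def)
qed (use assms S_closed in \<open>auto intro!: conv_closed\<close>)

lemma nc_algebra_SA: "nc_algebra K SA"
  by (rule nc_algebra_series) (simp_all add: is_cring S_closed S_zero S_one S_add S_smult S_conv)

lemma nc_algebra_FA: "nc_algebra K FA"
proof -
  have "nc_algebra K (series_algebra K FC)"
  proof (rule nc_algebra_series)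
    fix u v assume uv: "u \<in> FC" "v \<in> FC"
    show "(\<lambda>w. u w \<oplus> v w) \<in> FC"
    proof -
      have "{w. u w \<oplus> v w \<noteq> \<zero>} \<subseteq> {w. u w \<noteq> \<zero>} \<union> {w. v w \<noteq> \<zero>}" by auto
      then show ?thesis using uv S_add by (auto simp: FC_iff intro: finite_subset)
    qed
    show "conv K u v \<in> FC"
    proof -
      have "{w. conv K u v w \<noteq> \<zero>} \<subseteq> (\<lambda>(x, y). x @ y) ` ({w. u w \<noteq> \<zero>} \<times> {w. v w \<noteq> \<zero>})"
      proof
        fix w assume "w \<in> {w. conv K u v w \<noteq> \<zero>}"
        then obtain x y where "w = x @ y" "u x \<noteq> \<zero>" "v y \<noteq> \<zero>"
          using conv_support[of u v w] uv S_closed FC_S by blast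
        then show "w \<in> (\<lambda>(x, y). x @ y) ` ({w. u w \<noteq> \<zero>} \<times> {w. v w \<noteq> \<zero>})" by force
      qed
      then have "finite {w. conv K u v w \<noteq> \<zero>}"
        by (rule finite_subset) (use uv in \<open>simp add: FC_iff\<close>)
      then show ?thesis using uv S_conv by (simp add: FC_iff)
    qed
  next
    fix c u assume "c \<in> carrier K" "u \<in> FC"
    moreover from this have "{w. c \<otimes> u w \<noteq> \<zero>} \<subseteq> {w. u w \<noteq> \<zero>}" by auto
    ultimately show "(\<lambda>w. c \<otimes> u w) \<in> FC" using S_smult by (auto simp: FC_iff intro: finite_subset)
  qed (auto simp: is_cring S_closed FC_S FC_iff S_zero S_one)
  then show ?thesis using free_algebra_series[of K r] by simp
qed

sublocale SA: nc_algebra K SA by (rule nc_algebra_SA)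
sublocale FA: nc_algebra K FA by (rule nc_algebra_FA)

lemma FA_simps [simp]:
  "\<one>\<^bsub>FA\<^esub> = (\<lambda>w. if w = [] then \<one> else \<zero>)" "\<zero>\<^bsub>FA\<^esub> = (\<lambda>_. \<zero>)"
  "u \<oplus>\<^bsub>FA\<^esub> v = (\<lambda>w. u w \<oplus> v w)" "c \<odot>\<^bsub>FA\<^esub> u = (\<lambda>w. c \<otimes> u w)"
  by (simp_all add: free_algebra_def)

lemma FA_mult: "u \<in> FC \<Longrightarrow> v \<in> FC \<Longrightarrow> u \<otimes>\<^bsub>FA\<^esub> v = conv K u v"
  using S_closed FC_S by (subst free_algebra_series) (simp add: series_algebra_mult is_cring)

lemma SA_mult: "u \<in> S \<Longrightarrow> v \<in> S \<Longrightarrow> u \<otimes>\<^bsub>SA\<^esub> v = conv K u v"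
  by (simp add: series_algebra_mult is_cring S_closed)

abbreviation "var \<equiv> free_algebra_var K"

lemma var_FC: "i < r \<Longrightarrow> var i \<in> FC"
  by (auto simp: FC_iff series_def free_algebra_var_def)

definition fil :: "nat \<Rightarrow> (nat list \<Rightarrow> 'k) set" where
  "fil n = {u \<in> S. \<forall>w. length w < n \<longrightarrow> u w = \<zero>}"

text \<open>Grouping the words by their last letter writes \<open>u \<in> fil (n + 1)\<close> as a sum of products
  \<open>u\<^sub>i t\<^sub>i\<close> with \<open>u\<^sub>i \<in> fil n\<close>.\<close>

lemma last_letter_induct:
  assumes u: "u \<in> fil (Suc n) \<inter> C"
    and C: "C = S \<or> C = FC"
    and zero: "(\<lambda>_. \<zero>) \<in> U" and add: "\<And>x y. x \<in> U \<Longrightarrow> y \<in> U \<Longrightarrow> (\<lambda>w. x w \<oplus> y w) \<in> U"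
    and prod: "\<And>x i. x \<in> fil n \<inter> C \<Longrightarrow> i < r \<Longrightarrow> conv K x (var i) \<in> U"
  shows "u \<in> U"
proof -
  \<comment> \<open>The bound p on the last letters is lowered one letter at a time. The alphabet is
    finite, so this also works for infinite series.\<close>
  have "p \<le> r \<Longrightarrow> u \<in> fil (Suc n) \<inter> C \<Longrightarrow> (\<And>w. u w \<noteq> \<zero> \<Longrightarrow> last w < p) \<Longrightarrow> u \<in> U" for p
  proof (induction p arbitrary: u)
    case 0
    then have "u = (\<lambda>_. \<zero>)" by auto
    then show ?case using zero by simp
  next
    case (Suc p)
    have uS: "u \<in> S" using Suc.prems(2) by (simp add: fil_def)
    \<comment> \<open>The words ending in the letter p make up \<open>?x\<close> times the variable
      p, and \<open>?v\<close> keeps the other words.\<close>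
    let ?x = "\<lambda>w. u (w @ [p])"
    let ?v = "\<lambda>w. if w \<noteq> [] \<and> last w = p then \<zero> else u w"
    have fin: "finite {w. ?x w \<noteq> \<zero>} \<and> finite {w. ?v w \<noteq> \<zero>}" if "u \<in> FC"
    proof -
      have f: "finite {w. u w \<noteq> \<zero>}" using that by (simp add: FC_iff)
      have "{w. ?x w \<noteq> \<zero>} \<subseteq> butlast ` {w. u w \<noteq> \<zero>}"
      proof
        fix w assume "w \<in> {w. ?x w \<noteq> \<zero>}"
        then show "w \<in> butlast ` {w. u w \<noteq> \<zero>}" by (intro image_eqI[of _ _ "w @ [p]"]) auto
      qed
      moreover have "{w. ?v w \<noteq> \<zero>} \<subseteq> {w. u w \<noteq> \<zero>}" by auto
      ultimately show ?thesis using f finite_subset by blast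
    qed
    have x: "?x \<in> fil n \<inter> C"
    proof -
      have "?x \<in> S"
        unfolding series_def mem_Collect_eq
      proof (intro conjI allI impI)
        fix w assume "?x w \<noteq> \<zero>"
        then have "set (w @ [p]) \<subseteq> {..<r}" using uS unfolding series_def by blast
        then show "set w \<subseteq> {..<r}" by simp
      qed (use uS S_closed in auto)
      then show ?thesis using Suc.prems(2) C fin by (auto simp: fil_def FC_iff)
    qed
    have v: "?v \<in> fil (Suc n) \<inter> C"
    proof -
      have "?v \<in> S" using uS by (auto simp: series_def)
      then show ?thesis using Suc.prems(2) C fin by (auto simp: fil_def FC_iff)
    qed
    have "?v \<in> U"
    proof (rule Suc.IH[OF _ v])
      fix w assume w: "?v w \<noteq> \<zero>"
      then have "u w \<noteq> \<zero>" "\<not> (w \<noteq> [] \<and> last w = p)" by (auto split: if_splits)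
      moreover have "w \<noteq> []" using \<open>u w \<noteq> \<zero>\<close> Suc.prems(2) by (auto simp: fil_def)
      ultimately show "last w < p" using Suc.prems(3)[of w] by simp
    qed (use Suc.prems in simp)
    moreover have "conv K ?x (var p) \<in> U" using x Suc.prems(1) by (intro prod) auto
    ultimately have "(\<lambda>w. ?v w \<oplus> conv K ?x (var p) w) \<in> U" by (rule add)
    moreover have "(\<lambda>w. ?v w \<oplus> conv K ?x (var p) w) = u"
      using S_closed[OF uS] by (auto simp: conv_var fun_eq_iff)
    ultimately show ?case by simp
  qed
  moreover have "last w < r" if "u w \<noteq> \<zero>" for w
  proof -
    have "w \<noteq> []" using u that by (auto simp: fil_def)
    moreover have "set w \<subseteq> {..<r}" using u that by (auto simp: fil_def series_def)
    ultimately show ?thesis using last_in_set by blast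
  qed
  ultimately show ?thesis using u by blast
qed

lemma fil_conv:
  assumes "u \<in> fil m" "v \<in> fil n" shows "conv K u v \<in> fil (m + n)"
proof -
  have S: "u \<in> S" "v \<in> S" using assms by (auto simp: fil_def)
  have "conv K u v w = \<zero>" if w: "length w < m + n" for w
  proof (rule ccontr)
    assume "conv K u v w \<noteq> \<zero>"
    then obtain x y where "w = x @ y" "u x \<noteq> \<zero>" "v y \<noteq> \<zero>"
      using conv_support[of u v w] S S_closed by blast
    moreover from this have "\<not> length x < m" "\<not> length y < n" using assms by (auto simp: fil_def)
    ultimately show False using w by simp
  qed
  then show ?thesis using S S_conv by (simp add: fil_def)
qed

lemma fil_zero: "u \<in> S \<Longrightarrow> u \<in> fil 0"
  by (simp add: fil_def)

lemma FA_minus: "u \<in> FC \<Longrightarrow> \<ominus>\<^bsub>FA\<^esub> u = (\<lambda>w. \<ominus> u w)"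
proof -
  assume u: "u \<in> FC"
  have "\<ominus>\<^bsub>FA\<^esub> u = (\<ominus> \<one>) \<odot>\<^bsub>FA\<^esub> u"
    using FA.smult_l_minus[of \<one> u] FA.smult_one[OF u] u by (simp del: FA_simps)
  also have "\<dots> = (\<lambda>w. \<ominus> u w)" using S_closed[OF FC_S[OF u]] by (simp add: l_minus)
  finally show ?thesis .
qed

lemma fil_ideal: "ideal (fil n \<inter> FC) FA"
proof (rule idealI[OF FA.ring_axioms])
  show "subgroup (fil n \<inter> FC) (add_monoid FA)"
  proof (rule group.subgroupI[OF FA.a_group])
    show "fil n \<inter> FC \<noteq> {}" using FA.zero_closed S_zero by (auto simp: fil_def)
    fix u assume u: "u \<in> fil n \<inter> FC"
    have "\<ominus>\<^bsub>FA\<^esub> u \<in> FC" using u by simp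
    then have "\<ominus>\<^bsub>FA\<^esub> u \<in> fil n \<inter> FC" using u FC_S[of "\<ominus>\<^bsub>FA\<^esub> u"] by (auto simp: fil_def FA_minus)
    then show "inv\<^bsub>add_monoid FA\<^esub> u \<in> fil n \<inter> FC" by (simp only: a_inv_def)
    fix v assume v: "v \<in> fil n \<inter> FC"
    have "u \<oplus>\<^bsub>FA\<^esub> v \<in> FC" using u v by (intro FA.a_closed) auto
    then show "u \<otimes>\<^bsub>add_monoid FA\<^esub> v \<in> fil n \<inter> FC"
      using u v FC_S by (auto simp: fil_def)
  qed auto
next
  fix u x assume u: "u \<in> fil n \<inter> FC" and x: "x \<in> FC"
  have "x \<otimes>\<^bsub>FA\<^esub> u \<in> FC" "u \<otimes>\<^bsub>FA\<^esub> x \<in> FC" using u x by auto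
  then show "x \<otimes>\<^bsub>FA\<^esub> u \<in> fil n \<inter> FC" "u \<otimes>\<^bsub>FA\<^esub> x \<in> fil n \<inter> FC"
    using u x fil_conv[of x 0 u n] fil_conv[of u n x 0] FC_S by (auto simp: FA_mult fil_zero)
qed

lemma genideal_var: "genideal FA (var ` {..<r}) = fil 1 \<inter> FC"
proof
  have "var ` {..<r} \<subseteq> fil 1 \<inter> FC"
    using var_FC FC_S by (auto simp: fil_def free_algebra_var_def)
  then show "genideal FA (var ` {..<r}) \<subseteq> fil 1 \<inter> FC"
    by (rule FA.genideal_minimal[OF fil_ideal])
next
  show "fil 1 \<inter> FC \<subseteq> genideal FA (var ` {..<r})"
  proof
    fix u assume u: "u \<in> fil 1 \<inter> FC"
    have sub: "var ` {..<r} \<subseteq> FC" using var_FC by auto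
    interpret I: ideal "genideal FA (var ` {..<r})" FA by (rule FA.genideal_ideal[OF sub])
    show "u \<in> genideal FA (var ` {..<r})"
    proof (rule last_letter_induct[of u 0 FC])
      show "u \<in> fil (Suc 0) \<inter> FC" using u by simp
      show "(\<lambda>_. \<zero>) \<in> genideal FA (var ` {..<r})" using I.zero_closed by simp
      fix x i assume x: "x \<in> fil 0 \<inter> FC" and i: "i < r"
      have "var i \<in> genideal FA (var ` {..<r})" using FA.genideal_self[OF sub] i by blast
      then have "x \<otimes>\<^bsub>FA\<^esub> var i \<in> genideal FA (var ` {..<r})" using x by (intro I.I_l_closed) auto
      then show "conv K x (var i) \<in> genideal FA (var ` {..<r})" using x var_FC[OF i] by (simp add: FA_mult)
    qed (use I.a_closed in auto)
  qed
qed

lemma ideal_pow_var: "ideal_pow FA (fil 1 \<inter> FC) n = fil n \<inter> FC"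
proof (induction n)
  case 0
  then show ?case using FC_S by (auto simp: fil_def)
next
  case (Suc n)
  interpret I: ideal "fil (Suc n) \<inter> FC" FA by (rule fil_ideal)
  interpret P: ideal "ideal_prod FA (fil n \<inter> FC) (fil 1 \<inter> FC)" FA
    by (intro FA.ideal_prod_is_ideal fil_ideal)
  have "ideal_prod FA (fil n \<inter> FC) (fil 1 \<inter> FC) = fil (Suc n) \<inter> FC"
  proof
    show "ideal_prod FA (fil n \<inter> FC) (fil 1 \<inter> FC) \<subseteq> fil (Suc n) \<inter> FC"
    proof
      fix u assume "u \<in> ideal_prod FA (fil n \<inter> FC) (fil 1 \<inter> FC)"
      then show "u \<in> fil (Suc n) \<inter> FC"
      proof induction
        case (prod i j)
        have "i \<otimes>\<^bsub>FA\<^esub> j \<in> FC" using prod by (intro FA.m_closed) simp_all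
        then show ?case using prod fil_conv[of i n j 1] by (simp add: FA_mult)
      next
        case (sum a b)
        show ?case by (rule I.a_closed[OF sum(3,4)])
      qed
    qed
    show "fil (Suc n) \<inter> FC \<subseteq> ideal_prod FA (fil n \<inter> FC) (fil 1 \<inter> FC)"
    proof
      fix u assume u: "u \<in> fil (Suc n) \<inter> FC"
      show "u \<in> ideal_prod FA (fil n \<inter> FC) (fil 1 \<inter> FC)"
      proof (rule last_letter_induct[OF u])
        show "(\<lambda>_. \<zero>) \<in> ideal_prod FA (fil n \<inter> FC) (fil 1 \<inter> FC)" using P.zero_closed by simp
        fix x i assume x: "x \<in> fil n \<inter> FC" and i: "i < r"
        have "var i \<in> fil 1 \<inter> FC"
          using var_FC[OF i] FC_S[OF var_FC[OF i]] by (simp add: fil_def) (simp add: free_algebra_var_def)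
        then have "x \<otimes>\<^bsub>FA\<^esub> var i \<in> ideal_prod FA (fil n \<inter> FC) (fil 1 \<inter> FC)"
          using x by (intro ideal_prod.prod)
        then show "conv K x (var i) \<in> ideal_prod FA (fil n \<inter> FC) (fil 1 \<inter> FC)"
          using x var_FC[OF i] by (simp add: FA_mult)
      qed (use P.a_closed in auto)
    qed
  qed
  then show ?case using Suc by simp
qed

abbreviation "J n \<equiv> fil n \<inter> FC"
abbreviation "T \<equiv> nc_power_series K r"

lemma T_def': "T = completion FA (J 1)"
  by (simp add: nc_power_series_def genideal_var)

text \<open>The coset of u modulo words of length at least n, described by its members: the
  polynomials that agree with u below length n. This makes sense for an infinite series without
  choosing a representative, and it identifies \<open>S\<close> with the completion.\<close>

definition \<psi> :: "(nat list \<Rightarrow> 'k) \<Rightarrow> nat \<Rightarrow> (nat list \<Rightarrow> 'k) set" where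
  "\<psi> u n = {a \<in> FC. \<forall>w. length w < n \<longrightarrow> a w = u w}"

lemma coset_\<psi>: "a \<in> FC \<Longrightarrow> J n +>\<^bsub>FA\<^esub> a = \<psi> a n"
proof -
  assume a: "a \<in> FC"
  interpret I: ideal "J n" FA by (rule fil_ideal)
  note ac = S_closed[OF FC_S[OF a]]
  show ?thesis
  proof (intro equalityI subsetI)
    fix b assume "b \<in> J n +>\<^bsub>FA\<^esub> a"
    then obtain h where h: "h \<in> J n" "b = h \<oplus>\<^bsub>FA\<^esub> a" unfolding a_r_coset_def r_coset_def by auto
    then have "b \<in> FC" using a by (simp only: FA.a_closed Int_iff)
    then show "b \<in> \<psi> a n" using h ac by (auto simp: \<psi>_def fil_def)
  next
    fix b assume b: "b \<in> \<psi> a n"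
    then have bc: "b \<in> FC" by (simp add: \<psi>_def)
    have d: "b \<ominus>\<^bsub>FA\<^esub> a \<in> FC" using a bc by simp
    have d': "b \<ominus>\<^bsub>FA\<^esub> a = (\<lambda>w. b w \<oplus> \<ominus> a w)" using a by (simp add: FA.minus_eq FA_minus)
    have "b \<ominus>\<^bsub>FA\<^esub> a \<in> J n"
      using d FC_S[OF d] b ac unfolding d' by (auto simp: fil_def \<psi>_def r_neg)
    moreover have "b = (b \<ominus>\<^bsub>FA\<^esub> a) \<oplus>\<^bsub>FA\<^esub> a"
      using S_closed[OF FC_S[OF bc]] ac unfolding d' by (simp add: a_assoc l_neg)
    ultimately show "b \<in> J n +>\<^bsub>FA\<^esub> a" unfolding a_r_coset_def r_coset_def by auto
  qed
qed

definition cut :: "nat \<Rightarrow> (nat list \<Rightarrow> 'k) \<Rightarrow> nat list \<Rightarrow> 'k" where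
  "cut n u = (\<lambda>w. if length w < n then u w else \<zero>)"

lemma cut_FC: "u \<in> S \<Longrightarrow> cut n u \<in> FC"
proof -
  assume u: "u \<in> S"
  have "{w. cut n u w \<noteq> \<zero>} \<subseteq> {w. set w \<subseteq> {..<r} \<and> length w \<le> n}"
    using u by (auto simp: cut_def series_def)
  moreover have "finite {w. set w \<subseteq> {..<r} \<and> length w \<le> n}" by (rule finite_lists_length_le) simp
  moreover have "cut n u \<in> S" using u by (auto simp: cut_def series_def)
  ultimately show ?thesis using finite_subset by (auto simp: FC_iff)
qed

lemma \<psi>_coset: "u \<in> S \<Longrightarrow> \<psi> u n = J n +>\<^bsub>FA\<^esub> cut n u"
  by (simp add: coset_\<psi> cut_FC) (simp add: \<psi>_def cut_def)

lemma \<psi>_cong: "(\<And>w. length w < n \<Longrightarrow> u w = v w) \<Longrightarrow> \<psi> u n = \<psi> v n"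
  by (auto simp: \<psi>_def)

lemma \<psi>_cosets: "u \<in> S \<Longrightarrow> \<psi> u n \<in> a_rcosets\<^bsub>FA\<^esub> J n"
  using cut_FC[of u n] by (auto simp: \<psi>_coset A_RCOSETS_def RCOSETS_def a_r_coset_def)

lemma quot_trans: "J n <+>\<^bsub>FA\<^esub> \<psi> u (Suc n) = \<psi> u n" if u: "u \<in> S"
proof (intro equalityI subsetI)
  fix b assume "b \<in> J n <+>\<^bsub>FA\<^esub> \<psi> u (Suc n)"
  then obtain h a where h: "h \<in> J n" "a \<in> \<psi> u (Suc n)" "b = h \<oplus>\<^bsub>FA\<^esub> a"
    unfolding set_add_def set_mult_def by auto
  then have "b \<in> FC" by (simp only: FA.a_closed Int_iff \<psi>_def mem_Collect_eq)
  then show "b \<in> \<psi> u n" using h S_closed[OF u] by (auto simp: \<psi>_def fil_def)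
next
  fix b assume b: "b \<in> \<psi> u n"
  have c: "cut (Suc n) u \<in> \<psi> u (Suc n)" using cut_FC[OF u] by (simp add: \<psi>_def cut_def)
  have "\<psi> u n = \<psi> (cut (Suc n) u) n" by (rule \<psi>_cong) (simp add: cut_def)
  then have "b \<in> J n +>\<^bsub>FA\<^esub> cut (Suc n) u" using b coset_\<psi>[OF cut_FC[OF u]] by simp
  then obtain h where "h \<in> J n" "b = h \<oplus>\<^bsub>FA\<^esub> cut (Suc n) u" unfolding a_r_coset_def r_coset_def by auto
  then show "b \<in> J n <+>\<^bsub>FA\<^esub> \<psi> u (Suc n)" using c unfolding set_add_def set_mult_def by auto
qed

lemma T_simps:
  "carrier T = {x. \<forall>n. x n \<in> a_rcosets\<^bsub>FA\<^esub> J n \<and> J n <+>\<^bsub>FA\<^esub> x (Suc n) = x n}"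
  "\<zero>\<^bsub>T\<^esub> = J" "\<one>\<^bsub>T\<^esub> = (\<lambda>n. J n +>\<^bsub>FA\<^esub> \<one>\<^bsub>FA\<^esub>)"
  "x \<oplus>\<^bsub>T\<^esub> y = (\<lambda>n. x n <+>\<^bsub>FA\<^esub> y n)" "x \<otimes>\<^bsub>T\<^esub> y = (\<lambda>n. rcoset_mult FA (J n) (x n) (y n))"
  "c \<odot>\<^bsub>T\<^esub> x = (\<lambda>n. \<Union>a\<in>x n. J n +>\<^bsub>FA\<^esub> (c \<odot>\<^bsub>FA\<^esub> a))"
  by (simp_all add: T_def' completion_def mk_module_def inv_lim_def
      ideal_pow_var[unfolded One_nat_def])

lemma \<psi>_surj: "\<psi> ` S = carrier T"
proof (intro equalityI subsetI)
  fix x assume "x \<in> \<psi> ` S"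
  then show "x \<in> carrier T" using \<psi>_cosets quot_trans by (auto simp: T_simps)
next
  fix x assume x: "x \<in> carrier T"
  have "\<exists>a\<in>FC. x n = \<psi> a n" for n
    using x coset_\<psi> unfolding T_simps A_RCOSETS_def RCOSETS_def a_r_coset_def[symmetric] by force
  then obtain f where f: "\<And>n. f n \<in> FC" "\<And>n. x n = \<psi> (f n) n" by metis
  have step: "f (Suc n) w = f n w" if "length w < n" for n w
  proof -
    have "J n <+>\<^bsub>FA\<^esub> x (Suc n) = x n" using x unfolding T_simps by blast
    then have "x n = J n <+>\<^bsub>FA\<^esub> \<psi> (f (Suc n)) (Suc n)" using f(2)[of "Suc n"] by simp
    also have "\<dots> = \<psi> (f (Suc n)) n" by (rule quot_trans[OF FC_S[OF f(1)]])
    finally have "\<psi> (f n) n = \<psi> (f (Suc n)) n" using f(2)[of n] by simp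
    moreover have "f (Suc n) \<in> \<psi> (f (Suc n)) n" using f(1) by (simp add: \<psi>_def)
    ultimately show ?thesis using that by (auto simp: \<psi>_def)
  qed
  \<comment> \<open>Level \<open>length w + 1\<close> is the first at which the coset determines the
    coefficient at w.\<close>
  define u where "u w = f (Suc (length w)) w" for w
  have agree: "f n w = u w" if "length w < n" for n w
    using that
  proof (induction n)
    case (Suc n)
    then show ?case using step[of w n] by (cases "length w = n") (auto simp: u_def)
  qed simp
  have "u \<in> S" using FC_S[OF f(1)] by (auto simp: u_def series_def)
  moreover have "x = \<psi> u" using agree f(2) by (auto simp: \<psi>_def)
  ultimately show "x \<in> \<psi> ` S" by blast
qed

lemma \<psi>_inj: "inj_on \<psi> S"
proof (rule inj_onI)
  fix u v assume u: "u \<in> S" and v: "v \<in> S" and eq: "\<psi> u = \<psi> v"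
  show "u = v"
  proof
    fix w :: "nat list"
    have "cut (Suc (length w)) u \<in> \<psi> v (Suc (length w))"
      using cut_FC[OF u] by (simp add: eq[symmetric] \<psi>_def cut_def)
    then show "u w = v w" by (auto simp: \<psi>_def cut_def)
  qed
qed

lemma J_submodule: "submodule K (J n) FA"
proof -
  interpret I: ideal "J n" FA by (rule fil_ideal)
  have "c \<odot>\<^bsub>FA\<^esub> u \<in> J n" if "c \<in> carrier K" "u \<in> J n" for c u
    using I.I_l_closed[of u "c \<odot>\<^bsub>FA\<^esub> \<one>\<^bsub>FA\<^esub>"] that FA.scalar_mult_left[of c u]
      FA.scalar_closed[of c] by (auto simp del: FA_simps)
  then show ?thesis
    using I.a_closed I.zero_closed I.a_subset
    by (intro submodule.intro FA.module_axioms) (auto simp del: FA_simps)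
qed

lemma \<psi>_add: "u \<in> S \<Longrightarrow> v \<in> S \<Longrightarrow> \<psi> (\<lambda>w. u w \<oplus> v w) = \<psi> u \<oplus>\<^bsub>T\<^esub> \<psi> v"
proof
  fix n assume u: "u \<in> S" and v: "v \<in> S"
  have "\<psi> (\<lambda>w. u w \<oplus> v w) n = \<psi> (cut n u \<oplus>\<^bsub>FA\<^esub> cut n v) n" by (rule \<psi>_cong) (simp add: cut_def)
  also have "\<dots> = J n +>\<^bsub>FA\<^esub> (cut n u \<oplus>\<^bsub>FA\<^esub> cut n v)"
    using cut_FC[OF u, of n] cut_FC[OF v, of n] by (intro coset_\<psi>[symmetric] FA.a_closed)
  also have "\<dots> = (J n +>\<^bsub>FA\<^esub> cut n u) <+>\<^bsub>FA\<^esub> (J n +>\<^bsub>FA\<^esub> cut n v)"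
    by (rule quot_class(2)[OF J_submodule cut_FC[OF u] cut_FC[OF v]])
  also have "\<dots> = (\<psi> u \<oplus>\<^bsub>T\<^esub> \<psi> v) n" by (simp add: T_simps \<psi>_coset u v)
  finally show "\<psi> (\<lambda>w. u w \<oplus> v w) n = (\<psi> u \<oplus>\<^bsub>T\<^esub> \<psi> v) n" .
qed

lemma \<psi>_smult: "c \<in> carrier K \<Longrightarrow> u \<in> S \<Longrightarrow> \<psi> (\<lambda>w. c \<otimes> u w) = c \<odot>\<^bsub>T\<^esub> \<psi> u"
proof
  fix n assume c: "c \<in> carrier K" and u: "u \<in> S"
  have "\<psi> (\<lambda>w. c \<otimes> u w) n = \<psi> (c \<odot>\<^bsub>FA\<^esub> cut n u) n" by (rule \<psi>_cong) (simp add: cut_def)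
  also have "\<dots> = J n +>\<^bsub>FA\<^esub> (c \<odot>\<^bsub>FA\<^esub> cut n u)"
    using cut_FC[OF u, of n] c by (intro coset_\<psi>[symmetric] FA.smult_closed)
  also have "\<dots> = (\<Union>y\<in>J n +>\<^bsub>FA\<^esub> cut n u. J n +>\<^bsub>FA\<^esub> (c \<odot>\<^bsub>FA\<^esub> y))"
    by (rule quot_class(4)[OF J_submodule c cut_FC[OF u]])
  also have "\<dots> = (c \<odot>\<^bsub>T\<^esub> \<psi> u) n" by (simp only: T_simps \<psi>_coset[OF u])
  finally show "\<psi> (\<lambda>w. c \<otimes> u w) n = (c \<odot>\<^bsub>T\<^esub> \<psi> u) n" .
qed

lemma \<psi>_mult: "u \<in> S \<Longrightarrow> v \<in> S \<Longrightarrow> \<psi> (conv K u v) = \<psi> u \<otimes>\<^bsub>T\<^esub> \<psi> v"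
proof
  fix n assume u: "u \<in> S" and v: "v \<in> S"
  interpret I: ideal "J n" FA by (rule fil_ideal)
  have "\<psi> (conv K u v) n = \<psi> (cut n u \<otimes>\<^bsub>FA\<^esub> cut n v) n"
    by (rule \<psi>_cong) (auto simp: FA_mult cut_FC u v intro!: conv_cong, auto simp: cut_def)
  also have "\<dots> = J n +>\<^bsub>FA\<^esub> (cut n u \<otimes>\<^bsub>FA\<^esub> cut n v)"
    using cut_FC[OF u, of n] cut_FC[OF v, of n] by (intro coset_\<psi>[symmetric] FA.m_closed)
  also have "\<dots> = rcoset_mult FA (J n) (J n +>\<^bsub>FA\<^esub> cut n u) (J n +>\<^bsub>FA\<^esub> cut n v)"
    by (rule I.rcoset_mult_add[OF cut_FC[OF u] cut_FC[OF v], symmetric])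
  also have "\<dots> = (\<psi> u \<otimes>\<^bsub>T\<^esub> \<psi> v) n" by (simp only: T_simps \<psi>_coset[OF u] \<psi>_coset[OF v])
  finally show "\<psi> (conv K u v) n = (\<psi> u \<otimes>\<^bsub>T\<^esub> \<psi> v) n" .
qed

lemma \<psi>_zero: "\<psi> (\<lambda>_. \<zero>) = \<zero>\<^bsub>T\<^esub>"
  using FC_S by (auto simp: T_simps \<psi>_def fil_def fun_eq_iff)

lemma \<psi>_one: "\<psi> (\<lambda>w. if w = [] then \<one> else \<zero>) = \<one>\<^bsub>T\<^esub>"
  using coset_\<psi>[OF FA.one_closed] by (auto simp: T_simps fun_eq_iff)

lemma nc_algebra_T: "nc_algebra K T"
  by (rule nc_algebra_surj_image[OF nc_algebra_SA, of \<psi>])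
    (simp_all add: \<psi>_surj \<psi>_add \<psi>_zero \<psi>_smult \<psi>_mult \<psi>_one SA_mult)

sublocale T: nc_algebra K T by (rule nc_algebra_T)

definition cf :: "(nat \<Rightarrow> (nat list \<Rightarrow> 'k) set) \<Rightarrow> nat list \<Rightarrow> 'k" where
  "cf x = inv_into S \<psi> x"

lemma cf_\<psi>: "u \<in> S \<Longrightarrow> cf (\<psi> u) = u"
  by (simp add: cf_def \<psi>_inj)

lemma cf_S: "x \<in> carrier T \<Longrightarrow> cf x \<in> S" and \<psi>_cf: "x \<in> carrier T \<Longrightarrow> \<psi> (cf x) = x"
  unfolding cf_def using inv_into_into[of x \<psi> S] f_inv_into_f[of x \<psi> S] by (simp_all add: \<psi>_surj)

lemma \<psi>_closed: "u \<in> S \<Longrightarrow> \<psi> u \<in> carrier T"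
  using \<psi>_surj by blast

lemma cf_add: "x \<in> carrier T \<Longrightarrow> y \<in> carrier T \<Longrightarrow> cf (x \<oplus>\<^bsub>T\<^esub> y) = (\<lambda>w. cf x w \<oplus> cf y w)"
  using \<psi>_add[OF cf_S cf_S, of x y] cf_\<psi>[OF S_add[OF cf_S cf_S], of x y] by (simp add: \<psi>_cf)

lemma cf_mult: "x \<in> carrier T \<Longrightarrow> y \<in> carrier T \<Longrightarrow> cf (x \<otimes>\<^bsub>T\<^esub> y) = conv K (cf x) (cf y)"
  using \<psi>_mult[OF cf_S cf_S, of x y] cf_\<psi>[OF S_conv[OF cf_S cf_S], of x y] by (simp add: \<psi>_cf)

lemma cf_smult: "c \<in> carrier K \<Longrightarrow> x \<in> carrier T \<Longrightarrow> cf (c \<odot>\<^bsub>T\<^esub> x) = (\<lambda>w. c \<otimes> cf x w)"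
  using \<psi>_smult[OF _ cf_S, of c x] cf_\<psi>[OF S_smult[OF _ cf_S], of c x] by (simp add: \<psi>_cf)

lemma cf_one: "cf \<one>\<^bsub>T\<^esub> = (\<lambda>w. if w = [] then \<one> else \<zero>)"
  using cf_\<psi>[OF S_one] by (simp add: \<psi>_one)

lemma cf_zero: "cf \<zero>\<^bsub>T\<^esub> = (\<lambda>_. \<zero>)"
  using cf_\<psi>[OF S_zero] by (simp add: \<psi>_zero)

lemma cf_closed: "x \<in> carrier T \<Longrightarrow> cf x w \<in> carrier K"
  using cf_S S_closed by blast

definition const :: "(nat \<Rightarrow> (nat list \<Rightarrow> 'k) set) \<Rightarrow> 'k" where
  "const x = cf x []"

lemma const_functional: "functional K T const"
  by (auto simp: functional_def const_def cf_closed cf_add cf_smult)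

lemma const_mult: "x \<in> carrier T \<Longrightarrow> y \<in> carrier T \<Longrightarrow> const (x \<otimes>\<^bsub>T\<^esub> y) = const x \<otimes> const y"
  by (simp add: const_def cf_mult)

lemma const_one: "const \<one>\<^bsub>T\<^esub> = \<one>"
  by (simp add: const_def cf_one)

text \<open>The series 1 is divided by \<open>cf x\<close> from the right, which is possible because
  the constant term is a unit of K.\<close>

lemma const_left_inverse:
  assumes x: "x \<in> carrier T" "const x \<noteq> \<zero>" shows "\<exists>y\<in>carrier T. y \<otimes>\<^bsub>T\<^esub> x = \<one>\<^bsub>T\<^esub>"
proof -
  let ?e = "\<lambda>w. if w = [] then \<one> else \<zero>"
  let ?v = "rdiv K (cf x) ?e"
  have u: "cf x [] \<in> Units K" using x cf_closed by (simp add: const_def field_Units)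
  have v: "?v \<in> S"
    unfolding series_def mem_Collect_eq
    using rdiv_support[OF cf_S[OF x(1)] u S_one] rdiv_closed[of "cf x" ?e, OF u] cf_closed[OF x(1)]
    by auto
  have "conv K ?v (cf x) = ?e" using conv_rdiv[where u = "cf x" and y = ?e, OF u] cf_closed[OF x(1)] by auto
  then have "\<psi> ?v \<otimes>\<^bsub>T\<^esub> x = \<one>\<^bsub>T\<^esub>"
    using \<psi>_mult[OF v cf_S[OF x(1)]] by (simp add: \<psi>_cf x \<psi>_one)
  then show ?thesis using \<psi>_closed[OF v] by blast
qed

text \<open>Releasing the condition at one word amounts to adjoining the monomial of that word. For
  a word with a letter outside the alphabet the condition is automatic.\<close>

lemma fincod_coeffs:
  assumes "finite W" shows "fincod K T {x \<in> carrier T. \<forall>w\<in>W. cf x w = \<zero>}"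
  using assms
proof (induction W rule: finite_induct)
  case empty
  then show ?case using fincod.top[of K T] by simp
next
  case (insert v W)
  let ?Q = "\<lambda>W. {x \<in> carrier T. \<forall>w\<in>W. cf x w = \<zero>}"
  have sub: "submodule K (?Q W) T" for W
    by (intro submodule.intro T.module_axioms) (auto simp: cf_add cf_smult cf_zero)
  show ?case
  proof (cases "set v \<subseteq> {..<r}")
    case False
    then have "?Q (insert v W) = ?Q W" using cf_S by (auto simp: series_def)
    then show ?thesis using insert.IH by simp
  next
    case True
    let ?d = "\<lambda>w. if w = v then \<one> else \<zero>"
    have d: "?d \<in> S" using True by (auto simp: series_def)
    have "?Q W \<subseteq> adjoin K T (\<psi> ?d) (?Q (insert v W))"
    proof
      fix x assume x: "x \<in> ?Q W"
      then have xc: "x \<in> carrier T" by simp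
      let ?y = "\<lambda>w. if w = v then \<zero> else cf x w"
      have y: "?y \<in> S" using cf_S[OF xc] by (auto simp: series_def)
      have "cf x = (\<lambda>w. cf x v \<otimes> ?d w \<oplus> ?y w)" using cf_closed[OF xc] by auto
      then have "\<psi> (cf x) = \<psi> (\<lambda>w. cf x v \<otimes> ?d w \<oplus> ?y w)" by (rule arg_cong)
      also have "\<dots> = cf x v \<odot>\<^bsub>T\<^esub> \<psi> ?d \<oplus>\<^bsub>T\<^esub> \<psi> ?y"
        by (simp only: \<psi>_add[OF S_smult[OF cf_closed[OF xc] d] y] \<psi>_smult[OF cf_closed[OF xc] d])
      finally have "\<psi> (cf x) = cf x v \<odot>\<^bsub>T\<^esub> \<psi> ?d \<oplus>\<^bsub>T\<^esub> \<psi> ?y" .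
      then have "x = cf x v \<odot>\<^bsub>T\<^esub> \<psi> ?d \<oplus>\<^bsub>T\<^esub> \<psi> ?y" using \<psi>_cf[OF xc] by simp
      moreover have "\<psi> ?y \<in> ?Q (insert v W)" using x y by (auto simp: cf_\<psi> \<psi>_closed)
      ultimately show "x \<in> adjoin K T (\<psi> ?d) (?Q (insert v W))"
        unfolding adjoin_def using cf_closed[OF xc] by blast
    qed
    then have "fincod K T (adjoin K T (\<psi> ?d) (?Q (insert v W)))"
      by (rule fincod_mono[OF insert.IH _ submodule_adjoin[OF sub \<psi>_closed[OF d]]])
    then show ?thesis by (rule fincod.step[OF _ sub \<psi>_closed[OF d]])
  qed
qed

end

text \<open>An element with a left inverse lies in no proper left ideal, so every proper left ideal
  is contained in M.\<close>

lemma maximal_left_ideal_unique: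
  assumes "ring A" "ideal M A" "M \<noteq> carrier A"
    and inv: "\<And>a. a \<in> carrier A \<Longrightarrow> a \<notin> M \<Longrightarrow> \<exists>b\<in>carrier A. b \<otimes>\<^bsub>A\<^esub> a = \<one>\<^bsub>A\<^esub>"
  shows "maximal_left_ideal I A \<longleftrightarrow> I = M"
proof -
  interpret ring A by fact
  interpret M: ideal M A by fact
  have small: "I \<subseteq> M" if I: "left_ideal I A" "I \<noteq> carrier A" for I
  proof
    fix a assume a: "a \<in> I"
    have Ic: "I \<subseteq> carrier A" using I(1) by (simp add: left_ideal_def additive_subgroup.a_subset)
    show "a \<in> M"
    proof (rule ccontr)
      assume "a \<notin> M"
      then obtain b where "b \<in> carrier A" "b \<otimes>\<^bsub>A\<^esub> a = \<one>\<^bsub>A\<^esub>" using inv a Ic by blast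
      then have "\<one>\<^bsub>A\<^esub> \<in> I" using I(1) a unfolding left_ideal_def by metis
      then have "x \<in> I" if "x \<in> carrier A" for x
        using I(1) that unfolding left_ideal_def by (metis r_one)
      then show False using I(2) Ic by blast
    qed
  qed
  have M: "left_ideal M A"
    by (simp add: left_ideal_def M.additive_subgroup_axioms M.I_l_closed)
  show ?thesis
  proof
    assume "maximal_left_ideal I A"
    then show "I = M" using small[of I] M assms(3) unfolding maximal_left_ideal_def by blast
  next
    assume "I = M"
    then show "maximal_left_ideal I A"
      using M assms(3) small unfolding maximal_left_ideal_def by blast
  qed
qed

section \<open>The maximal ideal of the power series algebra and its powers\<close>

context power_series
begin

definition \<mm> :: "(nat \<Rightarrow> (nat list \<Rightarrow> 'k) set) set" where
  "\<mm> = {x \<in> carrier T. const x = \<zero>}"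

lemma \<mm>_ideal: "ideal \<mm> T"
proof (rule idealI[OF T.ring_axioms])
  note c = functionalD[OF const_functional]
  show "subgroup \<mm> (add_monoid T)"
  proof (rule group.subgroupI[OF T.a_group])
    show "\<mm> \<noteq> {}" using functional_zero[OF T.module_axioms const_functional] T.zero_closed
      by (auto simp: \<mm>_def)
    fix x assume x: "x \<in> \<mm>"
    then show "inv\<^bsub>add_monoid T\<^esub> x \<in> \<mm>"
      using functional_minus[OF T.module_axioms const_functional T.zero_closed, of x]
        functional_zero[OF T.module_axioms const_functional]
      by (simp add: \<mm>_def a_inv_def[symmetric] T.minus_eq a_minus_def)
  qed (auto simp: \<mm>_def c)
qed (auto simp: \<mm>_def const_mult functionalD[OF const_functional])

lemma jacobson_radical_T: "jacobson_radical T = \<mm>"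
proof -
  have "\<one>\<^bsub>T\<^esub> \<notin> \<mm>" by (simp add: \<mm>_def const_one)
  then have "\<mm> \<noteq> carrier T" using T.one_closed by blast
  then have "maximal_left_ideal I T \<longleftrightarrow> I = \<mm>" for I
    by (rule maximal_left_ideal_unique[OF T.ring_axioms \<mm>_ideal])
      (use const_left_inverse in \<open>auto simp: \<mm>_def\<close>)
  then have "{I. maximal_left_ideal I T} = {\<mm>}" by auto
  then show ?thesis unfolding jacobson_radical_def by (auto simp: \<mm>_def)
qed

lemma ideal_pow_ideal: "ideal (ideal_pow T \<mm> n) T"
  by (induction n) (simp_all add: T.oneideal T.ideal_prod_is_ideal \<mm>_ideal)

text \<open>Grouping by the last letter writes even an infinite series as a finite sum of products,
  because the alphabet is finite. So the algebraic power of \<mm>, without any closure, contains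
  every series of order at least n.\<close>

lemma fil_ideal_pow: "x \<in> carrier T \<Longrightarrow> cf x \<in> fil n \<Longrightarrow> x \<in> ideal_pow T \<mm> n"
proof (induction n arbitrary: x)
  case (Suc n)
  interpret P: ideal "ideal_pow T \<mm> (Suc n)" T by (rule ideal_pow_ideal)
  have "cf x \<in> cf ` ideal_pow T \<mm> (Suc n)"
  proof (rule last_letter_induct[of _ n S])
    show "(\<lambda>_. \<zero>) \<in> cf ` ideal_pow T \<mm> (Suc n)"
      using P.zero_closed cf_zero by (metis image_eqI)
    fix a b assume "a \<in> cf ` ideal_pow T \<mm> (Suc n)" "b \<in> cf ` ideal_pow T \<mm> (Suc n)"
    then obtain p q where pq: "p \<in> ideal_pow T \<mm> (Suc n)" "q \<in> ideal_pow T \<mm> (Suc n)"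
      and ab: "a = cf p" "b = cf q" by blast
    show "(\<lambda>w. a w \<oplus> b w) \<in> cf ` ideal_pow T \<mm> (Suc n)"
      unfolding ab cf_add[OF P.Icarr[OF pq(1)] P.Icarr[OF pq(2)], symmetric]
      by (rule imageI) (rule P.a_closed[OF pq])
  next
    fix y i assume y: "y \<in> fil n \<inter> S" and i: "i < r"
    have v: "var i \<in> S" using var_FC[OF i] FC_S by blast
    have 1: "\<psi> y \<in> ideal_pow T \<mm> n" using y by (intro Suc.IH) (auto simp: \<psi>_closed cf_\<psi>)
    have 2: "\<psi> (var i) \<in> \<mm>"
      using v by (auto simp: \<mm>_def \<psi>_closed const_def cf_\<psi> free_algebra_var_def)
    have "conv K y (var i) = cf (\<psi> y \<otimes>\<^bsub>T\<^esub> \<psi> (var i))"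
      using y v by (simp add: cf_mult \<psi>_closed cf_\<psi>)
    moreover have "\<psi> y \<otimes>\<^bsub>T\<^esub> \<psi> (var i) \<in> ideal_pow T \<mm> (Suc n)"
      using ideal_prod.prod[OF 1 2] by simp
    ultimately show "conv K y (var i) \<in> cf ` ideal_pow T \<mm> (Suc n)" by blast
  qed (use Suc.prems cf_S in auto)
  then obtain y where y: "y \<in> ideal_pow T \<mm> (Suc n)" "cf x = cf y" by blast
  have "x = y" using \<psi>_cf[OF Suc.prems(1)] \<psi>_cf[OF P.Icarr[OF y(1)]] y(2) by argo
  then show ?case using y(1) by (simp only:)
qed simp

lemma ideal_submodule: "ideal I T \<Longrightarrow> submodule K I T"
proof -
  assume "ideal I T"
  then interpret I: ideal I T .
  have "c \<odot>\<^bsub>T\<^esub> u \<in> I" if "c \<in> carrier K" "u \<in> I" for c u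
    using I.I_l_closed[of u "c \<odot>\<^bsub>T\<^esub> \<one>\<^bsub>T\<^esub>"] that T.scalar_mult_left[of c u] I.Icarr by simp
  then show ?thesis
    using I.a_closed I.zero_closed I.a_subset by (intro submodule.intro T.module_axioms) auto
qed

lemma fincod_ideal_pow: "fincod K T (ideal_pow T \<mm> n)"
proof (rule fincod_mono[OF fincod_coeffs _ ideal_submodule[OF ideal_pow_ideal]])
  show "finite {w. set w \<subseteq> {..<r} \<and> length w \<le> n}" by (rule finite_lists_length_le) simp
  show "{x \<in> carrier T. \<forall>w\<in>{w. set w \<subseteq> {..<r} \<and> length w \<le> n}. cf x w = \<zero>} \<subseteq> ideal_pow T \<mm> n"
  proof
    fix x assume x: "x \<in> {x \<in> carrier T. \<forall>w\<in>{w. set w \<subseteq> {..<r} \<and> length w \<le> n}. cf x w = \<zero>}"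
    then have "cf x \<in> fil n" using cf_S[of x] by (auto simp: fil_def series_def)
    then show "x \<in> ideal_pow T \<mm> n" using x by (intro fil_ideal_pow) auto
  qed
qed

end

section \<open>Finite-dimensional quotients of the power series algebra\<close>

lemma fin_dim_surj:
  assumes E: "vectorspace K E" and f: "f \<in> module_hom K (vec_space K N) E"
    and surj: "f ` carrier (vec_space K N) = carrier E"
  shows "vectorspace.fin_dim K E"
proof -
  interpret E: vectorspace K E by fact
  let ?S = "(\<lambda>i. f (unit_vec K i)) ` {..<N}"
  have S: "?S \<subseteq> carrier E" using module_homD(1)[OF f E.unit_vec_closed] by auto
  have sub: "submodule K (E.span ?S) E" by (rule E.span_is_submodule[OF S])
  have "carrier E \<subseteq> E.span ?S"
  proof
    fix y assume "y \<in> carrier E"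
    then obtain v where v: "v \<in> carrier (vec_space K N)" "y = f v" using surj by blast
    have "f (unit_vec K i) \<in> E.span ?S" if "i < N" for i
      using that S by (intro subsetD[OF E.in_own_span[OF S]]) auto
    then show "y \<in> E.span ?S"
      unfolding v(2) by (rule vec_map_in[OF E.R.is_cring E.module_axioms f sub _ v(1)])
  qed
  then have "E.span ?S = carrier E" using submodule.subset[OF sub] by blast
  then show ?thesis unfolding E.fin_dim_def using S by blast
qed

text \<open>The positions of the last nonzero entries, that is, the pivots of an echelon form. Their
  number plays the role of the dimension.\<close>

definition leading :: "('k, 'e) ring_scheme \<Rightarrow> (nat \<Rightarrow> 'k) set \<Rightarrow> nat set" where
  "leading K U = {i. \<exists>v\<in>U. v i \<noteq> \<zero>\<^bsub>K\<^esub> \<and> (\<forall>j>i. v j = \<zero>\<^bsub>K\<^esub>)}"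

text \<open>Gaussian elimination: the last entry of v in U' is cleared with an element of U that has
  its last entry at the same place, and what remains has smaller support.\<close>

lemma leading_eq:
  assumes K: "field K" and U: "submodule K U (vec_space K N)" and U': "submodule K U' (vec_space K N)"
    and sub: "U \<subseteq> U'" and eq: "leading K U = leading K U'"
  shows "U = U'"
proof
  interpret field K by fact
  interpret U: submodule K U "vec_space K N" by fact
  interpret U': submodule K U' "vec_space K N" by fact
  have "v \<in> U' \<Longrightarrow> (\<And>j. j \<ge> p \<Longrightarrow> v j = \<zero>\<^bsub>K\<^esub>) \<Longrightarrow> v \<in> U" for v p
  proof (induction p arbitrary: v)
    case 0
    then have "v = (\<lambda>_. \<zero>\<^bsub>K\<^esub>)" by auto
    then show ?case using U.zero_closed by simp
  next
    case (Suc p)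
    have vc: "v j \<in> carrier K" for j using Suc.prems(1) U'.subset by (auto simp: vec_space_carrier)
    show ?case
    proof (cases "v p = \<zero>\<^bsub>K\<^esub>")
      case True
      then have "v j = \<zero>\<^bsub>K\<^esub>" if "j \<ge> p" for j using Suc.prems(2)[of j] that by (cases "j = p") auto
      then show ?thesis using Suc.IH Suc.prems(1) by blast
    next
      case False
      then have "p \<in> leading K U'"
        unfolding leading_def mem_Collect_eq using Suc.prems by (intro bexI[of _ v]) auto
      then have "p \<in> leading K U" by (simp only: eq)
      then obtain u where u: "u \<in> U" "u p \<noteq> \<zero>\<^bsub>K\<^esub>" "\<And>j. j > p \<Longrightarrow> u j = \<zero>\<^bsub>K\<^esub>"
        unfolding leading_def mem_Collect_eq by blast
      have uc: "u j \<in> carrier K" for j using u(1) U.subset by (auto simp: vec_space_carrier)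
      have un: "u p \<in> Units K" using uc u(2) field_Units by simp
      let ?c = "v p \<otimes>\<^bsub>K\<^esub> inv\<^bsub>K\<^esub> (u p)"
      have cc: "?c \<in> carrier K" using vc un by simp
      let ?w = "v \<oplus>\<^bsub>vec_space K N\<^esub> (\<ominus>\<^bsub>K\<^esub> ?c) \<odot>\<^bsub>vec_space K N\<^esub> u"
      have cu: "?c \<otimes>\<^bsub>K\<^esub> u p = v p"
        using vc[of p] uc[of p] un Units_l_inv[OF un] Units_inv_closed[OF un] by (simp add: m_assoc)
      have "?w \<in> U'" using Suc.prems(1) u(1) sub cc by (intro U'.m_closed U'.smult_closed) auto
      moreover have "?w j = \<zero>\<^bsub>K\<^esub>" if "j \<ge> p" for j
      proof (cases "j = p")
        case True
        then show ?thesis using cc uc vc cu by (simp add: l_minus r_neg)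
      next
        case False
        then show ?thesis using that Suc.prems(2)[of j] u(3)[of j] cc by simp
      qed
      ultimately have w: "?w \<in> U" by (rule Suc.IH)
      have "v = ?w \<oplus>\<^bsub>vec_space K N\<^esub> ?c \<odot>\<^bsub>vec_space K N\<^esub> u"
        using cc uc vc by (simp add: fun_eq_iff l_minus a_assoc l_neg)
      also have "\<dots> \<in> U" by (rule U.m_closed[OF w U.smult_closed[OF cc u(1)]])
      finally show ?thesis .
    qed
  qed
  moreover have "v j = \<zero>\<^bsub>K\<^esub>" if "v \<in> U'" "j \<ge> N" for v j
    using that U'.subset by (auto simp: vec_space_carrier)
  ultimately show "U' \<subseteq> U" by blast
qed (rule sub)

lemma vec_space_chain:
  assumes K: "field K" and U: "\<And>n. submodule K (U n) (vec_space K N)" "\<And>n. U (Suc n) \<subseteq> U n"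
  shows "\<exists>n. \<forall>m\<ge>n. U m = U n"
proof -
  have fin: "finite (leading K (U n))" for n
  proof (rule finite_subset)
    show "leading K (U n) \<subseteq> {..<N}"
    proof
      fix i assume "i \<in> leading K (U n)"
      then obtain v where v: "v \<in> U n" "v i \<noteq> \<zero>\<^bsub>K\<^esub>" unfolding leading_def by blast
      have "v \<in> carrier (vec_space K N)" using submodule.subset[OF U(1)] v(1) by blast
      then have "\<not> N \<le> i" using v(2) by (auto simp: vec_space_carrier)
      then show "i \<in> {..<N}" by simp
    qed
  qed simp
  \<comment> \<open>At a level with the fewest pivots the later sets of pivots, being subsets, must
    coincide with the present one.\<close>
  obtain n where n: "\<And>m. card (leading K (U n)) \<le> card (leading K (U m))"
    using ex_has_least_nat[of "\<lambda>_. True" 0 "\<lambda>n. card (leading K (U n))"] by blast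
  have "U m = U n" if "m \<ge> n" for m
  proof -
    have sub: "U m \<subseteq> U n" using lift_Suc_antimono_le[of U n m] U(2) that by blast
    then have "leading K (U m) \<subseteq> leading K (U n)" by (auto simp: leading_def)
    then have "leading K (U m) = leading K (U n)" by (rule card_seteq[OF fin _ n])
    then show ?thesis by (rule leading_eq[OF K U(1) U(1) sub])
  qed
  then show ?thesis by blast
qed

lemma (in abelian_group) minus_zero_iff:
  assumes "x \<in> carrier G" "y \<in> carrier G" shows "x \<ominus> y = \<zero> \<longleftrightarrow> x = y"
proof
  assume *: "x \<ominus> y = \<zero>"
  have "x = (x \<ominus> y) \<oplus> y" using assms by (simp add: minus_eq a_assoc l_neg)
  then show "x = y" using assms by (simp add: *)
qed (use assms in \<open>simp add: minus_eq r_neg\<close>)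

lemma (in ring) ideal_pow_is_ideal: "ideal I R \<Longrightarrow> ideal (ideal_pow R I n) R"
  by (induction n) (simp_all add: oneideal ideal_prod_is_ideal)

lemma (in ring) ideal_pow_Suc_subset: "ideal I R \<Longrightarrow> ideal_pow R I (Suc n) \<subseteq> ideal_pow R I n"
  using ideal_prod_inter[OF ideal_pow_is_ideal, of I I n] by auto

text \<open>From level p on the cosets are singletons, so a compatible sequence is given by one
  element at level p: lower levels follow by the transition maps, and at higher levels the element
  stays the same.\<close>

lemma completion_nilpotent:
  fixes A :: "('k, 'a) module"
  assumes "ring A" "ideal I A" and nil: "ideal_pow A I p = {\<zero>\<^bsub>A\<^esub>}"
  shows "bij_betw (\<lambda>a n. ideal_pow A I n +>\<^bsub>A\<^esub> a) (carrier A) (carrier (completion A I))"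
proof -
  interpret ring A by fact
  let ?P = "ideal_pow A I"
  have carr: "carrier (completion A I) =
      {x. \<forall>n. x n \<in> a_rcosets\<^bsub>A\<^esub> (?P n) \<and> ?P n <+>\<^bsub>A\<^esub> x (Suc n) = x n}"
    by (simp add: completion_def mk_module_def inv_lim_def)
  have id: "ideal (?P n) A" for n by (rule ideal_pow_is_ideal[OF assms(2)])
  have dec: "?P (Suc n) \<subseteq> ?P n" for n by (rule ideal_pow_Suc_subset[OF assms(2)])
  have tr: "?P n <+>\<^bsub>A\<^esub> (?P (Suc n) +>\<^bsub>A\<^esub> a) = ?P n +>\<^bsub>A\<^esub> a" if a: "a \<in> carrier A" for n a
  proof -
    interpret P: ideal "?P n" A by (rule id)
    interpret Q: ideal "?P (Suc n)" A by (rule id)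
    show ?thesis
    proof (intro equalityI subsetI)
      fix b assume "b \<in> ?P n <+>\<^bsub>A\<^esub> (?P (Suc n) +>\<^bsub>A\<^esub> a)"
      then obtain h k where h: "h \<in> ?P n" "k \<in> ?P (Suc n)" "b = h \<oplus>\<^bsub>A\<^esub> (k \<oplus>\<^bsub>A\<^esub> a)"
        unfolding set_add_def set_mult_def a_r_coset_def r_coset_def by auto
      have k: "k \<in> ?P n" using dec h(2) by blast
      have "b = (h \<oplus>\<^bsub>A\<^esub> k) \<oplus>\<^bsub>A\<^esub> a"
        unfolding h(3) using P.Icarr[OF h(1)] P.Icarr[OF k] a by (simp add: a_assoc)
      then show "b \<in> ?P n +>\<^bsub>A\<^esub> a"
        using P.a_closed[OF h(1) k] unfolding a_r_coset_def r_coset_def by auto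
    next
      fix b assume "b \<in> ?P n +>\<^bsub>A\<^esub> a"
      then obtain h where h: "h \<in> ?P n" "b = h \<oplus>\<^bsub>A\<^esub> a" unfolding a_r_coset_def r_coset_def by auto
      have "\<zero>\<^bsub>A\<^esub> \<oplus>\<^bsub>A\<^esub> a \<in> ?P (Suc n) +>\<^bsub>A\<^esub> a"
        using Q.zero_closed unfolding a_r_coset_def r_coset_def by auto
      then have "a \<in> ?P (Suc n) +>\<^bsub>A\<^esub> a" using a by simp
      then show "b \<in> ?P n <+>\<^bsub>A\<^esub> (?P (Suc n) +>\<^bsub>A\<^esub> a)"
        using h unfolding set_add_def set_mult_def by auto
    qed
  qed
  have single: "{\<zero>\<^bsub>A\<^esub>} +>\<^bsub>A\<^esub> a = {a}" if "a \<in> carrier A" for a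
    using that by (auto simp: a_r_coset_def r_coset_def)
  have inj: "inj_on (\<lambda>a n. ?P n +>\<^bsub>A\<^esub> a) (carrier A)"
  proof (rule inj_onI)
    fix a b assume "a \<in> carrier A" "b \<in> carrier A" "(\<lambda>n. ?P n +>\<^bsub>A\<^esub> a) = (\<lambda>n. ?P n +>\<^bsub>A\<^esub> b)"
    then show "a = b" using fun_cong[of "\<lambda>n. ?P n +>\<^bsub>A\<^esub> a" "\<lambda>n. ?P n +>\<^bsub>A\<^esub> b" p] by (simp add: nil single)
  qed
  have cosets: "a_rcosets\<^bsub>A\<^esub> B = (\<lambda>a. B +>\<^bsub>A\<^esub> a) ` carrier A" for B
    by (auto simp: A_RCOSETS_def RCOSETS_def a_r_coset_def)
  have "(\<lambda>a n. ?P n +>\<^bsub>A\<^esub> a) ` carrier A = carrier (completion A I)"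
  proof (intro equalityI subsetI)
    fix x assume "x \<in> (\<lambda>a n. ?P n +>\<^bsub>A\<^esub> a) ` carrier A"
    then obtain a where a: "a \<in> carrier A" "x = (\<lambda>n. ?P n +>\<^bsub>A\<^esub> a)" by blast
    have "x n \<in> a_rcosets\<^bsub>A\<^esub> (?P n)" for n unfolding a(2) cosets using a(1) by (rule imageI)
    moreover have "?P n <+>\<^bsub>A\<^esub> x (Suc n) = x n" for n unfolding a(2) by (rule tr[OF a(1)])
    ultimately show "x \<in> carrier (completion A I)" unfolding carr by blast
  next
    fix x assume "x \<in> carrier (completion A I)"
    then have x: "x n \<in> a_rcosets\<^bsub>A\<^esub> (?P n)" "?P n <+>\<^bsub>A\<^esub> x (Suc n) = x n" for n
      unfolding carr by blast+
    obtain a where a: "a \<in> carrier A" "x p = ?P p +>\<^bsub>A\<^esub> a" using x(1)[of p] unfolding cosets by blast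
    have "x n = ?P n +>\<^bsub>A\<^esub> a" for n
    proof (cases "n \<le> p")
      case True
      then show ?thesis
      proof (induction rule: inc_induct)
        case (step m)
        then show ?case using x(2)[of m] tr[OF a(1), of m] by simp
      qed (rule a(2))
    next
      case False
      then have "p \<le> n" by simp
      then have "?P n = {\<zero>\<^bsub>A\<^esub>} \<and> x n = {a}"
      proof (induction rule: dec_induct)
        case base
        then show ?case using a nil by (simp add: single)
      next
        case (step m)
        have 1: "?P (Suc m) = {\<zero>\<^bsub>A\<^esub>}"
          using dec[of m] step.IH additive_subgroup.zero_closed[OF ideal.axioms(1)[OF id[of "Suc m"]]] by blast
        obtain b where b: "b \<in> carrier A" "x (Suc m) = ?P (Suc m) +>\<^bsub>A\<^esub> b"
          using x(1)[of "Suc m"] unfolding cosets by blast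
        then have "x (Suc m) = {b}" unfolding 1 by (simp add: single)
        moreover have "{\<zero>\<^bsub>A\<^esub>} <+>\<^bsub>A\<^esub> {b} = {b}" using b(1) by (auto simp: set_add_def set_mult_def)
        ultimately show ?case using 1 x(2)[of m] step.IH by simp
      qed
      then show ?thesis using a(1) by (simp add: single)
    qed
    then show "x \<in> (\<lambda>a n. ?P n +>\<^bsub>A\<^esub> a) ` carrier A" using a(1) by blast
  qed
  then show ?thesis using inj by (simp add: bij_betw_def)
qed

text \<open>The quotient of T by the kernel of \<kappa>, moved to coordinate vectors:
  representatives are multiplied in T and coordinates are taken again. Its carrier has the type
  \<open>nat \<Rightarrow> 'k\<close> of the test algebras.\<close>

definition coord_algebra :: "('k, 'e) ring_scheme \<Rightarrow> ('k, 't) module \<Rightarrow> nat \<Rightarrow> ('t \<Rightarrow> nat \<Rightarrow> 'k)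
    \<Rightarrow> ((nat \<Rightarrow> 'k) \<Rightarrow> 't) \<Rightarrow> ('k, nat \<Rightarrow> 'k) module" where
  "coord_algebra K T N \<kappa> \<sigma> =
     (vec_space K N)\<lparr>mult := \<lambda>v w. \<kappa> (\<sigma> v \<otimes>\<^bsub>T\<^esub> \<sigma> w), one := \<kappa> \<one>\<^bsub>T\<^esub>\<rparr>"

lemma coord_algebra_simps [simp]:
  "carrier (coord_algebra K T N \<kappa> \<sigma>) = carrier (vec_space K N)"
  "\<zero>\<^bsub>coord_algebra K T N \<kappa> \<sigma>\<^esub> = (\<lambda>_. \<zero>\<^bsub>K\<^esub>)"
  "\<one>\<^bsub>coord_algebra K T N \<kappa> \<sigma>\<^esub> = \<kappa> \<one>\<^bsub>T\<^esub>"
  "v \<otimes>\<^bsub>coord_algebra K T N \<kappa> \<sigma>\<^esub> w = \<kappa> (\<sigma> v \<otimes>\<^bsub>T\<^esub> \<sigma> w)"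
  "v \<oplus>\<^bsub>coord_algebra K T N \<kappa> \<sigma>\<^esub> w = (\<lambda>i. v i \<oplus>\<^bsub>K\<^esub> w i)"
  "c \<odot>\<^bsub>coord_algebra K T N \<kappa> \<sigma>\<^esub> v = (\<lambda>i. c \<otimes>\<^bsub>K\<^esub> v i)"
  by (simp_all add: coord_algebra_def vec_space_def)

text \<open>The kernel of \<kappa> is an ideal between \<mm>^p and \<mm>. The lower bound makes the
  maximal ideal of the quotient nilpotent, the upper bound keeps the residue field equal to K, and
  finitely many coordinates give the descending chain condition.\<close>

locale coord_quotient = power_series K r for K :: "'k ring" (structure) and r +
  fixes N :: nat and \<kappa> :: "(nat \<Rightarrow> (nat list \<Rightarrow> 'k) set) \<Rightarrow> nat \<Rightarrow> 'k"
    and \<sigma> :: "(nat \<Rightarrow> 'k) \<Rightarrow> nat \<Rightarrow> (nat list \<Rightarrow> 'k) set" and p :: nat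
  assumes coords: "coords K T N \<kappa> \<sigma>"
    and ker_ideal: "ideal {t \<in> carrier T. \<kappa> t = (\<lambda>_. \<zero>)} T"
    and pow_ker: "\<And>t. t \<in> ideal_pow T \<mm> p \<Longrightarrow> \<kappa> t = (\<lambda>_. \<zero>)"
    and ker_\<mm>: "\<And>t. t \<in> carrier T \<Longrightarrow> \<kappa> t = (\<lambda>_. \<zero>) \<Longrightarrow> t \<in> \<mm>"
begin

abbreviation "V \<equiv> vec_space K N"
abbreviation "A \<equiv> coord_algebra K T N \<kappa> \<sigma>"

lemma \<kappa>: "\<kappa> \<in> module_hom K T V" and \<sigma>: "\<sigma> \<in> module_hom K V T"
  and \<kappa>_\<sigma>: "v \<in> carrier V \<Longrightarrow> \<kappa> (\<sigma> v) = v"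
  using coords by (auto simp: coords_def)

lemmas k = module_homD[OF \<kappa>] and g = module_homD[OF \<sigma>]

lemma V_module: "module K V" by (rule vec_space_module)

sublocale V: module K V by (rule V_module)

lemma \<kappa>_eq_iff: "t \<in> carrier T \<Longrightarrow> u \<in> carrier T \<Longrightarrow> \<kappa> t = \<kappa> u \<longleftrightarrow> \<kappa> (t \<ominus>\<^bsub>T\<^esub> u) = (\<lambda>_. \<zero>)"
proof -
  assume t: "t \<in> carrier T" and u: "u \<in> carrier T"
  have "\<kappa> (t \<ominus>\<^bsub>T\<^esub> u) = \<kappa> t \<ominus>\<^bsub>V\<^esub> \<kappa> u"
    by (rule module_hom_minus[OF T.module_axioms V_module \<kappa> t u])
  moreover have "\<kappa> t \<ominus>\<^bsub>V\<^esub> \<kappa> u = \<zero>\<^bsub>V\<^esub> \<longleftrightarrow> \<kappa> t = \<kappa> u"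
    using k(1)[OF t] k(1)[OF u] by (rule abelian_group.minus_zero_iff[OF module.axioms(2)[OF V_module]])
  ultimately show ?thesis by simp
qed

definition "Ker = {t \<in> carrier T. \<kappa> t = (\<lambda>_. \<zero>)}"

lemma Ker_ideal: "ideal Ker T"
  unfolding Ker_def by (rule ker_ideal)

lemma \<kappa>_eq_Ker: "t \<in> carrier T \<Longrightarrow> u \<in> carrier T \<Longrightarrow> \<kappa> t = \<kappa> u \<longleftrightarrow> t \<ominus>\<^bsub>T\<^esub> u \<in> Ker"
  using \<kappa>_eq_iff by (simp add: Ker_def)

lemma \<kappa>_mult_cong:
  assumes "t \<in> carrier T" "t' \<in> carrier T" "u \<in> carrier T" "u' \<in> carrier T" "\<kappa> t = \<kappa> t'" "\<kappa> u = \<kappa> u'"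
  shows "\<kappa> (t \<otimes>\<^bsub>T\<^esub> u) = \<kappa> (t' \<otimes>\<^bsub>T\<^esub> u')"
proof -
  interpret J: ideal Ker T by (rule Ker_ideal)
  have "t \<ominus>\<^bsub>T\<^esub> t' \<in> Ker" "u \<ominus>\<^bsub>T\<^esub> u' \<in> Ker"
    using assms \<kappa>_eq_Ker by blast+
  then have "(t \<ominus>\<^bsub>T\<^esub> t') \<otimes>\<^bsub>T\<^esub> u \<oplus>\<^bsub>T\<^esub> t' \<otimes>\<^bsub>T\<^esub> (u \<ominus>\<^bsub>T\<^esub> u') \<in> Ker"
    using assms(2,3) by (intro J.a_closed J.I_r_closed J.I_l_closed)
  moreover have "(t \<ominus>\<^bsub>T\<^esub> t') \<otimes>\<^bsub>T\<^esub> u \<oplus>\<^bsub>T\<^esub> t' \<otimes>\<^bsub>T\<^esub> (u \<ominus>\<^bsub>T\<^esub> u') = t \<otimes>\<^bsub>T\<^esub> u \<ominus>\<^bsub>T\<^esub> t' \<otimes>\<^bsub>T\<^esub> u'"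
    using assms(1-4) by (simp add: T.minus_eq T.l_distr T.r_distr T.l_minus T.r_minus T.a_assoc T.r_neg1)
  ultimately show ?thesis using assms(1-4) by (simp add: \<kappa>_eq_Ker)
qed

lemma \<kappa>_mult: "t \<in> carrier T \<Longrightarrow> u \<in> carrier T \<Longrightarrow> \<kappa> (t \<otimes>\<^bsub>T\<^esub> u) = \<kappa> t \<otimes>\<^bsub>A\<^esub> \<kappa> u"
  unfolding coord_algebra_simps by (rule \<kappa>_mult_cong) (auto simp: k g \<kappa>_\<sigma>)

lemma \<kappa>_surj: "\<kappa> ` carrier T = carrier A"
proof (intro equalityI subsetI)
  fix v assume "v \<in> carrier A"
  then have "v = \<kappa> (\<sigma> v)" "\<sigma> v \<in> carrier T" using \<kappa>_\<sigma> g by simp_all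
  then show "v \<in> \<kappa> ` carrier T" by (rule image_eqI)
qed (use k in auto)

lemma \<kappa>_zero: "\<kappa> \<zero>\<^bsub>T\<^esub> = (\<lambda>_. \<zero>)"
  using module_hom_zero[OF T.module_axioms V_module \<kappa>] by simp

lemma nc_algebra_A: "nc_algebra K A"
proof (rule nc_algebra_surj_image[OF nc_algebra_T \<kappa>_surj])
  show "\<And>x y. x \<in> carrier T \<Longrightarrow> y \<in> carrier T \<Longrightarrow> \<kappa> (x \<otimes>\<^bsub>T\<^esub> y) = \<kappa> x \<otimes>\<^bsub>A\<^esub> \<kappa> y" by (rule \<kappa>_mult)
qed (simp_all add: k \<kappa>_zero)

sublocale A: nc_algebra K A by (rule nc_algebra_A)

lemma \<kappa>_hom: "\<kappa> \<in> module_hom K T A"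
  using \<kappa> by (simp add: module_hom_def)

lemma \<kappa>_minus: "t \<in> carrier T \<Longrightarrow> u \<in> carrier T \<Longrightarrow> \<kappa> (t \<ominus>\<^bsub>T\<^esub> u) = \<kappa> t \<ominus>\<^bsub>A\<^esub> \<kappa> u"
  by (rule module_hom_minus[OF T.module_axioms A.module_axioms \<kappa>_hom])

lemma \<sigma>_hom: "\<sigma> \<in> module_hom K A T"
  using \<sigma> by (simp add: module_hom_def)

definition "mA = \<kappa> ` \<mm>"

text \<open>Because the kernel of \<kappa> lies in \<mm>, no element outside \<mm> has the same
  image as one inside.\<close>

lemma \<kappa>_mA_iff: "t \<in> carrier T \<Longrightarrow> \<kappa> t \<in> mA \<longleftrightarrow> t \<in> \<mm>"
proof
  assume t: "t \<in> carrier T" and "\<kappa> t \<in> mA"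
  then obtain u where u: "u \<in> \<mm>" "\<kappa> t = \<kappa> u" by (auto simp: mA_def)
  interpret M: ideal \<mm> T by (rule \<mm>_ideal)
  have "t \<ominus>\<^bsub>T\<^esub> u \<in> \<mm>" using t u M.Icarr \<kappa>_eq_iff[of t u] by (intro ker_\<mm>) auto
  then have "t \<ominus>\<^bsub>T\<^esub> u \<oplus>\<^bsub>T\<^esub> u \<in> \<mm>" using u by (intro M.a_closed)
  then show "t \<in> \<mm>" using t M.Icarr[OF u(1)] by (simp add: T.minus_eq T.a_assoc T.l_neg)
qed (simp add: mA_def)

lemma A_rep: "a \<in> carrier A \<Longrightarrow> \<exists>t\<in>carrier T. a = \<kappa> t"
  using \<kappa>_surj by blast

lemma image_ideal:
  assumes "ideal I T" shows "ideal (\<kappa> ` I) A"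
proof (rule idealI[OF A.ring_axioms])
  interpret I: ideal I T by fact
  show "subgroup (\<kappa> ` I) (add_monoid A)"
  proof (rule group.subgroupI[OF A.a_group])
    show "\<kappa> ` I \<subseteq> carrier (add_monoid A)" using k(1) I.Icarr by auto
    show "\<kappa> ` I \<noteq> {}" using I.zero_closed by blast
    fix a assume "a \<in> \<kappa> ` I"
    then obtain t where t: "t \<in> I" "a = \<kappa> t" by blast
    have "\<ominus>\<^bsub>A\<^esub> a = \<kappa> (\<ominus>\<^bsub>T\<^esub> t)"
    proof (rule A.add.inv_equality)
      have tc: "t \<in> carrier T" by (rule I.Icarr[OF t(1)])
      have "\<kappa> (\<ominus>\<^bsub>T\<^esub> t) \<oplus>\<^bsub>A\<^esub> a = \<kappa> (\<ominus>\<^bsub>T\<^esub> t \<oplus>\<^bsub>T\<^esub> t)" using tc t(2) k(2) by simp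
      then show "\<kappa> (\<ominus>\<^bsub>T\<^esub> t) \<oplus>\<^bsub>A\<^esub> a = \<zero>\<^bsub>A\<^esub>" using tc by (simp add: T.l_neg \<kappa>_zero)
      show "a \<in> carrier A" "\<kappa> (\<ominus>\<^bsub>T\<^esub> t) \<in> carrier A" using tc t(2) k(1) by simp_all
    qed
    then show "inv\<^bsub>add_monoid A\<^esub> a \<in> \<kappa> ` I" using I.a_inv_closed[OF t(1)] by (auto simp only: a_inv_def)
    fix b assume "b \<in> \<kappa> ` I"
    then obtain u where u: "u \<in> I" "b = \<kappa> u" by blast
    have "a \<otimes>\<^bsub>add_monoid A\<^esub> b = \<kappa> (t \<oplus>\<^bsub>T\<^esub> u)" using t u I.Icarr k by simp
    then show "a \<otimes>\<^bsub>add_monoid A\<^esub> b \<in> \<kappa> ` I" using I.a_closed[OF t(1) u(1)] by blast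
  qed
  fix a x assume "a \<in> \<kappa> ` I" "x \<in> carrier A"
  then obtain t u where t: "t \<in> I" "a = \<kappa> t" and u: "u \<in> carrier T" "x = \<kappa> u" using A_rep by blast
  have "x \<otimes>\<^bsub>A\<^esub> a = \<kappa> (u \<otimes>\<^bsub>T\<^esub> t)" "a \<otimes>\<^bsub>A\<^esub> x = \<kappa> (t \<otimes>\<^bsub>T\<^esub> u)"
    using t u I.Icarr \<kappa>_mult by (simp_all del: coord_algebra_simps)
  then show "x \<otimes>\<^bsub>A\<^esub> a \<in> \<kappa> ` I" "a \<otimes>\<^bsub>A\<^esub> x \<in> \<kappa> ` I"
    using I.I_l_closed[OF t(1) u(1)] I.I_r_closed[OF t(1) u(1)] by blast+
qed

lemma mA_ideal: "ideal mA A"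
  unfolding mA_def by (rule image_ideal[OF \<mm>_ideal])

lemma one_notin_mA: "\<one>\<^bsub>A\<^esub> \<notin> mA"
  using \<kappa>_mA_iff[OF T.one_closed] by (simp add: \<mm>_def const_one)

lemma maximal_A: "maximal_left_ideal I A \<longleftrightarrow> I = mA"
proof (rule maximal_left_ideal_unique[OF A.ring_axioms mA_ideal])
  show "mA \<noteq> carrier A" using one_notin_mA A.one_closed by blast
  fix a assume a: "a \<in> carrier A" "a \<notin> mA"
  then obtain t where t: "t \<in> carrier T" "a = \<kappa> t" using A_rep by blast
  then have "const t \<noteq> \<zero>" using a \<kappa>_mA_iff by (auto simp: \<mm>_def)
  then obtain u where u: "u \<in> carrier T" "u \<otimes>\<^bsub>T\<^esub> t = \<one>\<^bsub>T\<^esub>" using const_left_inverse t(1) by blast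
  then have "\<kappa> u \<otimes>\<^bsub>A\<^esub> a = \<one>\<^bsub>A\<^esub>" using \<kappa>_mult[OF u(1) t(1)] t(2) by (simp del: coord_algebra_simps(4))
  then show "\<exists>b\<in>carrier A. b \<otimes>\<^bsub>A\<^esub> a = \<one>\<^bsub>A\<^esub>" using \<kappa>_surj u(1) by blast
qed

lemma jacobson_A: "jacobson_radical A = mA"
proof -
  have "{I. maximal_left_ideal I A} = {mA}" using maximal_A by auto
  moreover have "mA \<subseteq> carrier A" using \<mm>_ideal k(1) by (auto simp: mA_def \<mm>_def)
  ultimately show ?thesis unfolding jacobson_radical_def by auto
qed

lemma local_A: "local_ring A"
  using maximal_A by (simp add: local_ring_def A.ring_axioms)

lemma scalar_minus: "t \<in> carrier T \<Longrightarrow> c \<in> carrier K \<Longrightarrow>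
    \<kappa> t \<ominus>\<^bsub>A\<^esub> c \<odot>\<^bsub>A\<^esub> \<one>\<^bsub>A\<^esub> \<in> mA \<longleftrightarrow> const t = c"
proof -
  assume t: "t \<in> carrier T" and c: "c \<in> carrier K"
  have "\<kappa> t \<ominus>\<^bsub>A\<^esub> c \<odot>\<^bsub>A\<^esub> \<one>\<^bsub>A\<^esub> = \<kappa> (t \<ominus>\<^bsub>T\<^esub> c \<odot>\<^bsub>T\<^esub> \<one>\<^bsub>T\<^esub>)"
    using t c by (simp add: \<kappa>_minus k)
  moreover have "const (t \<ominus>\<^bsub>T\<^esub> c \<odot>\<^bsub>T\<^esub> \<one>\<^bsub>T\<^esub>) = const t \<ominus> c"
    using t c by (simp add: functional_minus[OF T.module_axioms const_functional]
        functionalD(3)[OF const_functional] const_one)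
  moreover have "const t \<ominus> c = \<zero> \<longleftrightarrow> const t = c"
    using functionalD(1)[OF const_functional t] c by (rule abelian_group.minus_zero_iff[OF abelian_group_axioms])
  ultimately show ?thesis using t c \<kappa>_mA_iff[of "t \<ominus>\<^bsub>T\<^esub> c \<odot>\<^bsub>T\<^esub> \<one>\<^bsub>T\<^esub>"] by (simp add: \<mm>_def)
qed

lemma residue_\<kappa>: "t \<in> carrier T \<Longrightarrow> residue K A (\<kappa> t) = const t"
  unfolding residue_def jacobson_A
  by (rule the_equality) (use scalar_minus functionalD(1)[OF const_functional] in blast)+

lemma mA_submodule: "submodule K mA A"
proof -
  interpret M: ideal mA A by (rule mA_ideal)
  have "c \<odot>\<^bsub>A\<^esub> u \<in> mA" if "c \<in> carrier K" "u \<in> mA" for c u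
    using M.I_l_closed[OF that(2) A.scalar_closed[OF that(1)]] A.scalar_mult_left[OF that(1) M.Icarr[OF that(2)]]
    by (simp only:)
  then show ?thesis
    using M.a_closed M.zero_closed M.a_subset by (intro submodule.intro A.module_axioms)
qed

lemma residue_bij: "bij_betw (\<lambda>c. mA +>\<^bsub>A\<^esub> (c \<odot>\<^bsub>A\<^esub> \<one>\<^bsub>A\<^esub>)) (carrier K) (carrier (quot A mA))"
proof -
  note cl = quot_class[OF mA_submodule]
  have sc: "c \<odot>\<^bsub>A\<^esub> \<one>\<^bsub>A\<^esub> = \<kappa> (c \<odot>\<^bsub>T\<^esub> \<one>\<^bsub>T\<^esub>)" "const (c \<odot>\<^bsub>T\<^esub> \<one>\<^bsub>T\<^esub>) = c" if "c \<in> carrier K" for c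
    using that by (simp_all add: k functionalD(3)[OF const_functional] const_one)
  have eq: "mA +>\<^bsub>A\<^esub> \<kappa> t = mA +>\<^bsub>A\<^esub> (c \<odot>\<^bsub>A\<^esub> \<one>\<^bsub>A\<^esub>) \<longleftrightarrow> const t = c"
    if "t \<in> carrier T" "c \<in> carrier K" for t c
    using cl(5)[of "\<kappa> t" "c \<odot>\<^bsub>A\<^esub> \<one>\<^bsub>A\<^esub>"] scalar_minus[OF that] A.scalar_closed[OF that(2)] k(1)[OF that(1)]
    by (simp only: coord_algebra_simps(1))
  have "inj_on (\<lambda>c. mA +>\<^bsub>A\<^esub> (c \<odot>\<^bsub>A\<^esub> \<one>\<^bsub>A\<^esub>)) (carrier K)"
  proof (rule inj_onI)
    fix c c' assume c: "c \<in> carrier K" "c' \<in> carrier K"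
      and e: "mA +>\<^bsub>A\<^esub> (c \<odot>\<^bsub>A\<^esub> \<one>\<^bsub>A\<^esub>) = mA +>\<^bsub>A\<^esub> (c' \<odot>\<^bsub>A\<^esub> \<one>\<^bsub>A\<^esub>)"
    have "mA +>\<^bsub>A\<^esub> \<kappa> (c \<odot>\<^bsub>T\<^esub> \<one>\<^bsub>T\<^esub>) = mA +>\<^bsub>A\<^esub> (c' \<odot>\<^bsub>A\<^esub> \<one>\<^bsub>A\<^esub>)" using e unfolding sc(1)[OF c(1)] .
    then have "const (c \<odot>\<^bsub>T\<^esub> \<one>\<^bsub>T\<^esub>) = c'" by (rule iffD1[OF eq[OF T.scalar_closed[OF c(1)] c(2)]])
    then show "c = c'" by (simp only: sc(2)[OF c(1)])
  qed
  moreover have "(\<lambda>c. mA +>\<^bsub>A\<^esub> (c \<odot>\<^bsub>A\<^esub> \<one>\<^bsub>A\<^esub>)) ` carrier K = a_rcosets\<^bsub>A\<^esub> mA"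
  proof (intro equalityI subsetI)
    fix X assume "X \<in> (\<lambda>c. mA +>\<^bsub>A\<^esub> (c \<odot>\<^bsub>A\<^esub> \<one>\<^bsub>A\<^esub>)) ` carrier K"
    then show "X \<in> a_rcosets\<^bsub>A\<^esub> mA" unfolding cl(1) using A.scalar_closed by blast
  next
    fix X assume "X \<in> a_rcosets\<^bsub>A\<^esub> mA"
    then obtain t where t: "t \<in> carrier T" "X = mA +>\<^bsub>A\<^esub> \<kappa> t" unfolding cl(1) using A_rep by blast
    have "X = mA +>\<^bsub>A\<^esub> (const t \<odot>\<^bsub>A\<^esub> \<one>\<^bsub>A\<^esub>)"
      using eq[OF t(1)] functionalD(1)[OF const_functional t(1)] t(2) by blast
    then show "X \<in> (\<lambda>c. mA +>\<^bsub>A\<^esub> (c \<odot>\<^bsub>A\<^esub> \<one>\<^bsub>A\<^esub>)) ` carrier K"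
      using functionalD(1)[OF const_functional t(1)] by blast
  qed
  ultimately show ?thesis unfolding bij_betw_def quot_simps ..
qed

lemma mA_pow: "a \<in> ideal_pow A mA n \<Longrightarrow> \<exists>t\<in>ideal_pow T \<mm> n. a = \<kappa> t"
proof (induction n arbitrary: a)
  case 0
  then show ?case using A_rep by simp
next
  case (Suc n)
  interpret P: ideal "ideal_pow T \<mm> n" T by (rule ideal_pow_ideal)
  interpret P': ideal "ideal_pow T \<mm> (Suc n)" T by (rule ideal_pow_ideal)
  interpret M: ideal \<mm> T by (rule \<mm>_ideal)
  have "a \<in> ideal_prod A (ideal_pow A mA n) mA" using Suc.prems by simp
  then show ?case
  proof induction
    case (prod i j)
    obtain t where t: "t \<in> ideal_pow T \<mm> n" "i = \<kappa> t" using Suc.IH[OF prod(1)] by blast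
    obtain u where u: "u \<in> \<mm>" "j = \<kappa> u" using prod(2) unfolding mA_def by blast
    have "i \<otimes>\<^bsub>A\<^esub> j = \<kappa> (t \<otimes>\<^bsub>T\<^esub> u)"
      unfolding t(2) u(2) by (rule \<kappa>_mult[symmetric, OF P.Icarr[OF t(1)] M.Icarr[OF u(1)]])
    moreover have "t \<otimes>\<^bsub>T\<^esub> u \<in> ideal_pow T \<mm> (Suc n)" using t(1) u(1) by (simp add: ideal_prod.prod)
    ultimately show ?case by blast
  next
    case (sum a b)
    then obtain t u where t: "t \<in> ideal_pow T \<mm> (Suc n)" "a = \<kappa> t" and u: "u \<in> ideal_pow T \<mm> (Suc n)" "b = \<kappa> u"
      by blast
    have "a \<oplus>\<^bsub>A\<^esub> b = \<kappa> (t \<oplus>\<^bsub>T\<^esub> u)" using t u k P'.Icarr by simp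
    then show ?case using P'.a_closed[OF t(1) u(1)] by blast
  qed
qed

lemma mA_nilpotent: "ideal_pow A mA p = {\<zero>\<^bsub>A\<^esub>}"
proof -
  interpret P: ideal "ideal_pow A mA p" A by (rule A.ideal_pow_is_ideal[OF mA_ideal])
  have "a = \<zero>\<^bsub>A\<^esub>" if "a \<in> ideal_pow A mA p" for a
    using mA_pow[OF that] pow_ker by auto
  then show ?thesis using P.zero_closed by blast
qed

lemma left_ideal_submodule: "left_ideal I A \<Longrightarrow> submodule K I V"
proof -
  assume I: "left_ideal I A"
  interpret I: additive_subgroup I A using I by (simp add: left_ideal_def)
  have "c \<odot>\<^bsub>A\<^esub> u \<in> I" if "c \<in> carrier K" "u \<in> I" for c u
  proof -
    have "u \<in> carrier A" using I.a_subset that(2) by blast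
    then have "c \<odot>\<^bsub>A\<^esub> u = (c \<odot>\<^bsub>A\<^esub> \<one>\<^bsub>A\<^esub>) \<otimes>\<^bsub>A\<^esub> u" using A.scalar_mult_left[OF that(1)] by simp
    then show ?thesis using I that A.scalar_closed[OF that(1)] unfolding left_ideal_def by metis
  qed
  then show ?thesis
    using I.a_closed I.zero_closed I.a_subset by (intro submodule.intro V_module) auto
qed

lemma left_artinian_A: "left_artinian A"
  unfolding left_artinian_def
proof (intro allI impI)
  fix I assume "\<forall>n. left_ideal (I n) A \<and> I (Suc n) \<subseteq> I n"
  then show "\<exists>n. \<forall>m\<ge>n. I m = I n"
    by (intro vec_space_chain[OF field_axioms, of I N] left_ideal_submodule) auto
qed

lemma cotangent_fin_dim:
  "vectorspace.fin_dim K (quot (A\<lparr>carrier := mA\<rparr>) (ideal_pow A mA 2))"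
proof -
  let ?M = "A\<lparr>carrier := mA\<rparr>" and ?B = "ideal_pow A mA 2"
  have M: "module K ?M" by (rule A.submodule_is_module[OF mA_submodule])
  interpret I: ideal mA A by (rule mA_ideal)
  interpret B: ideal ?B A by (rule A.ideal_pow_is_ideal[OF mA_ideal])
  have Bm: "?B \<subseteq> mA"
  proof -
    have "ideal_pow A mA 2 = ideal_prod A (ideal_prod A (carrier A) mA) mA" by (simp add: numeral_2_eq_2)
    also have "\<dots> \<subseteq> mA"
      using A.ideal_prod_inter[OF A.ideal_prod_is_ideal[OF A.oneideal mA_ideal] mA_ideal] by blast
    finally show ?thesis .
  qed
  have sub: "submodule K ?B ?M"
  proof -
    have "c \<odot>\<^bsub>A\<^esub> u \<in> ?B" if "c \<in> carrier K" "u \<in> ?B" for c u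
      using B.I_l_closed[OF that(2) A.scalar_closed[OF that(1)]] A.scalar_mult_left[OF that(1) B.Icarr[OF that(2)]]
      by (simp only:)
    then show ?thesis using Bm B.a_closed B.zero_closed by (intro submodule.intro M) auto
  qed
  have E: "vectorspace K (quot ?M ?B)" by (intro vectorspace.intro quot_module[OF sub] field_axioms)
  \<comment> \<open>The projection of the algebra onto its maximal ideal along K 1. It presents the
    cotangent space as the image of a coordinate space, which is the form
    \<open>fin_dim_surj\<close> takes.\<close>
  define \<rho> where "\<rho> v = v \<ominus>\<^bsub>A\<^esub> const (\<sigma> v) \<odot>\<^bsub>A\<^esub> \<one>\<^bsub>A\<^esub>" for v
  have cc: "const (\<sigma> v) \<in> carrier K" if "v \<in> carrier A" for v
    using that g(1) functionalD(1)[OF const_functional] by simp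
  have \<rho>_mA: "\<rho> v \<in> mA" if "v \<in> carrier A" for v
    using scalar_minus[of "\<sigma> v" "const (\<sigma> v)"] that cc[OF that] g(1) \<kappa>_\<sigma> by (simp add: \<rho>_def)
  have \<rho>_id: "\<rho> v = v" if v: "v \<in> mA" for v
  proof -
    have vA: "v \<in> carrier A" using v by (rule I.Icarr)
    have "\<sigma> v \<in> \<mm>" using \<kappa>_mA_iff[of "\<sigma> v"] vA v g(1) \<kappa>_\<sigma> by simp
    then have "const (\<sigma> v) = \<zero>" by (simp add: \<mm>_def)
    then show ?thesis using A.smult_l_null[OF A.one_closed] vA by (simp add: \<rho>_def A.minus_eq del: coord_algebra_simps)
  qed
  have \<rho>_add: "\<rho> (v \<oplus>\<^bsub>A\<^esub> w) = \<rho> v \<oplus>\<^bsub>A\<^esub> \<rho> w" if v: "v \<in> carrier A" and w: "w \<in> carrier A" for v w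
  proof -
    have "const (\<sigma> (v \<oplus>\<^bsub>A\<^esub> w)) = const (\<sigma> v) \<oplus> const (\<sigma> w)"
      using v w module_homD[OF \<sigma>_hom] functionalD[OF const_functional] by (simp del: coord_algebra_simps)
    then show ?thesis
      using v w cc[OF v] cc[OF w] A.one_closed
      by (simp add: \<rho>_def A.smult_l_distr A.minus_eq A.minus_add A.a_ac del: coord_algebra_simps)
  qed
  have \<rho>_smult: "\<rho> (c \<odot>\<^bsub>A\<^esub> v) = c \<odot>\<^bsub>A\<^esub> \<rho> v" if c: "c \<in> carrier K" and v: "v \<in> carrier A" for c v
  proof -
    have "const (\<sigma> (c \<odot>\<^bsub>A\<^esub> v)) = c \<otimes> const (\<sigma> v)"
      using c v module_homD[OF \<sigma>_hom] functionalD[OF const_functional] by (simp del: coord_algebra_simps)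
    then show ?thesis
      using c v cc[OF v] A.one_closed
      by (simp add: \<rho>_def A.smult_r_distr A.minus_eq A.smult_r_minus A.smult_assoc1 del: coord_algebra_simps)
  qed
  let ?f = "\<lambda>v. ?B +>\<^bsub>?M\<^esub> \<rho> v"
  note q = module_homD[OF quot_class_hom[OF sub]]
  have f: "?f \<in> module_hom K V (quot ?M ?B)"
  proof (rule module_homI)
    fix v assume "v \<in> carrier V"
    then show "?f v \<in> carrier (quot ?M ?B)" using q(1)[of "\<rho> v"] \<rho>_mA by simp
  next
    fix v w assume v: "v \<in> carrier V" and w: "w \<in> carrier V"
    then show "?f (v \<oplus>\<^bsub>V\<^esub> w) = ?f v \<oplus>\<^bsub>quot ?M ?B\<^esub> ?f w"
      using q(2)[of "\<rho> v" "\<rho> w"] \<rho>_mA \<rho>_add[of v w] by simp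
  next
    fix c v assume c: "c \<in> carrier K" and v: "v \<in> carrier V"
    then show "?f (c \<odot>\<^bsub>V\<^esub> v) = c \<odot>\<^bsub>quot ?M ?B\<^esub> ?f v"
      using q(3)[of c "\<rho> v"] \<rho>_mA \<rho>_smult[of c v] by simp
  qed
  moreover have "?f ` carrier V = carrier (quot ?M ?B)"
  proof (intro equalityI subsetI)
    fix X assume "X \<in> ?f ` carrier V"
    then show "X \<in> carrier (quot ?M ?B)" using module_homD(1)[OF f] by blast
  next
    fix X assume "X \<in> carrier (quot ?M ?B)"
    then obtain v where v: "v \<in> mA" "X = ?B +>\<^bsub>?M\<^esub> v" using quot_class(1)[OF sub] by auto
    have "v \<in> carrier V" using I.Icarr[OF v(1)] by simp
    then show "X \<in> ?f ` carrier V" using v by (intro image_eqI[of _ _ v]) (simp_all add: \<rho>_id)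
  qed
  ultimately show ?thesis by (rule fin_dim_surj[OF E])
qed

lemma artinian_A: "artinian_local_algebra K A"
  unfolding artinian_local_algebra_def complete_local_algebra_def Let_def jacobson_A
  using nc_algebra_A local_A residue_bij cotangent_fin_dim left_artinian_A
    completion_nilpotent[OF A.ring_axioms mA_ideal mA_nilpotent] by blast

end

section \<open>The Ext spaces\<close>

lemma (in abelian_group) idem_zero: "x \<in> carrier G \<Longrightarrow> x \<oplus> x = x \<Longrightarrow> x = \<zero>"
  using add.l_cancel_one' by auto

context complex_setup
begin

lemma graded_homs_iff: "f \<in> carrier (graded_homs R F j) \<longleftrightarrow> (\<forall>n. f n \<in> lmod_hom R (F n) (F (n + j)))"
  by (simp add: graded_homs_def)

lemma lmod_homD:
  assumes "f \<in> lmod_hom R (F n) M"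
  shows "x \<in> carrier (F n) \<Longrightarrow> f x \<in> carrier M"
    "x \<in> carrier (F n) \<Longrightarrow> y \<in> carrier (F n) \<Longrightarrow> f (x \<oplus>\<^bsub>F n\<^esub> y) = f x \<oplus>\<^bsub>M\<^esub> f y"
    "a \<in> carrier R \<Longrightarrow> x \<in> carrier (F n) \<Longrightarrow> f (a \<odot>\<^bsub>F n\<^esub> x) = a \<odot>\<^bsub>M\<^esub> f x"
    "x \<notin> carrier (F n) \<Longrightarrow> f x = undefined"
  using assms by (auto simp: lmod_hom_def)

lemma graded_homs_module: "module K (graded_homs R F j)"
proof -
  interpret R: nc_algebra K R by (rule R)
  interpret M: lmodule R "F n" for n by (rule lm)
  let ?H = "graded_homs R F j"
  note H = lmod_homD[OF spec[OF iffD1[OF graded_homs_iff]]]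
  \<comment> \<open>Scalars of K are central in R, so a scalar multiple of an R-linear map is
    R-linear.\<close>
  have sc: "r \<odot>\<^bsub>F n\<^esub> ((c \<odot>\<^bsub>R\<^esub> \<one>\<^bsub>R\<^esub>) \<odot>\<^bsub>F n\<^esub> x) = (c \<odot>\<^bsub>R\<^esub> \<one>\<^bsub>R\<^esub>) \<odot>\<^bsub>F n\<^esub> (r \<odot>\<^bsub>F n\<^esub> x)"
    if "c \<in> carrier K" "r \<in> carrier R" "x \<in> carrier (F n)" for r c n x
    using that by (simp add: M.lsmult_assoc[symmetric] R.scalar_mult_left R.scalar_mult_right)
  have sm: "c \<odot>\<^bsub>?H\<^esub> f \<in> carrier ?H" if "c \<in> carrier K" "f \<in> carrier ?H" for c f
    using that(1) H[OF that(2)]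
    by (auto simp: graded_homs_def lmod_hom_def M.lsmult_closed M.lsmult_r_distr sc)
  \<comment> \<open>Off the carriers all homomorphisms are \<open>undefined\<close>, so equality is
    decided on the carriers.\<close>
  have ext: "f = g" if "f \<in> carrier ?H" "g \<in> carrier ?H" "\<And>n x. x \<in> carrier (F n) \<Longrightarrow> f n x = g n x" for f g
  proof (intro HOL.ext)
    fix n x show "f n x = g n x" using that(3) H(4)[OF that(1)] H(4)[OF that(2)] by (cases "x \<in> carrier (F n)") simp_all
  qed
  have ad: "f \<oplus>\<^bsub>?H\<^esub> g \<in> carrier ?H" if "f \<in> carrier ?H" "g \<in> carrier ?H" for f g
    using H[OF that(1)] H[OF that(2)]
    by (auto simp: graded_homs_def lmod_hom_def M.lsmult_closed M.lsmult_r_distr M.M.a_ac)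
  have z0: "a \<odot>\<^bsub>F n\<^esub> \<zero>\<^bsub>F n\<^esub> = \<zero>\<^bsub>F n\<^esub>" if "a \<in> carrier R" for a n
    using M.lsmult_r_distr[of a "\<zero>\<^bsub>F n\<^esub>" n "\<zero>\<^bsub>F n\<^esub>"] M.lsmult_closed[OF that, of "\<zero>\<^bsub>F n\<^esub>" n] that
    by (metis M.M.add.r_cancel_one' M.M.l_zero M.M.zero_closed)
  have ze: "\<zero>\<^bsub>?H\<^esub> \<in> carrier ?H"
    by (auto simp: graded_homs_def lmod_hom_def z0 M.lsmult_closed)
  have app: "(f \<oplus>\<^bsub>?H\<^esub> g) n x = f n x \<oplus>\<^bsub>F (n + j)\<^esub> g n x" "\<zero>\<^bsub>?H\<^esub> n x = \<zero>\<^bsub>F (n + j)\<^esub>"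
    "(c \<odot>\<^bsub>?H\<^esub> f) n x = (c \<odot>\<^bsub>R\<^esub> \<one>\<^bsub>R\<^esub>) \<odot>\<^bsub>F (n + j)\<^esub> f n x" if "x \<in> carrier (F n)" for f g n x c
    using that by (simp_all add: graded_homs_def)
  have inv: "(\<ominus>\<^bsub>R\<^esub> \<one>\<^bsub>R\<^esub>) \<odot>\<^bsub>F n\<^esub> x \<oplus>\<^bsub>F n\<^esub> x = \<zero>\<^bsub>F n\<^esub>" if "x \<in> carrier (F n)" for n x
  proof -
    interpret V: module K "restrict_scalars K R (F n)" by (rule restrict_scalars_module[OF R lm])
    have "(\<ominus>\<^bsub>R\<^esub> \<one>\<^bsub>R\<^esub> \<oplus>\<^bsub>R\<^esub> \<one>\<^bsub>R\<^esub>) \<odot>\<^bsub>F n\<^esub> x = (\<ominus>\<^bsub>R\<^esub> \<one>\<^bsub>R\<^esub>) \<odot>\<^bsub>F n\<^esub> x \<oplus>\<^bsub>F n\<^esub> \<one>\<^bsub>R\<^esub> \<odot>\<^bsub>F n\<^esub> x"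
      using that by (intro M.lsmult_l_distr) simp_all
    moreover have "\<zero>\<^bsub>R\<^esub> \<odot>\<^bsub>F n\<^esub> x = \<zero>\<^bsub>F n\<^esub>" using V.smult_l_null[of x] that by simp
    ultimately show ?thesis using that by (simp add: M.lsmult_one R.l_neg)
  qed
  show ?thesis
  proof (rule moduleI)
    show "abelian_group ?H"
    proof (rule abelian_groupI)
      fix f g h assume *: "f \<in> carrier ?H" "g \<in> carrier ?H" "h \<in> carrier ?H"
      show "f \<oplus>\<^bsub>?H\<^esub> g \<oplus>\<^bsub>?H\<^esub> h = f \<oplus>\<^bsub>?H\<^esub> (g \<oplus>\<^bsub>?H\<^esub> h)"
        by (rule ext) (simp_all add: * ad app H(1)[OF *(1)] H(1)[OF *(2)] H(1)[OF *(3)] M.M.a_assoc)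
    next
      fix f g assume *: "f \<in> carrier ?H" "g \<in> carrier ?H"
      show "f \<oplus>\<^bsub>?H\<^esub> g = g \<oplus>\<^bsub>?H\<^esub> f"
        by (rule ext) (simp_all add: * ad app H(1)[OF *(1)] H(1)[OF *(2)] M.M.a_comm)
    next
      fix f assume *: "f \<in> carrier ?H"
      show "\<zero>\<^bsub>?H\<^esub> \<oplus>\<^bsub>?H\<^esub> f = f"
        by (rule ext) (simp_all add: * ad ze app H(1)[OF *])
      have m: "(\<ominus>\<^bsub>K\<^esub> \<one>\<^bsub>K\<^esub>) \<odot>\<^bsub>?H\<^esub> f \<in> carrier ?H" by (rule sm[OF _ *]) simp
      have "(\<ominus>\<^bsub>K\<^esub> \<one>\<^bsub>K\<^esub>) \<odot>\<^bsub>R\<^esub> \<one>\<^bsub>R\<^esub> = \<ominus>\<^bsub>R\<^esub> \<one>\<^bsub>R\<^esub>" by (simp add: R.smult_l_minus)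
      then have "(\<ominus>\<^bsub>K\<^esub> \<one>\<^bsub>K\<^esub>) \<odot>\<^bsub>?H\<^esub> f \<oplus>\<^bsub>?H\<^esub> f = \<zero>\<^bsub>?H\<^esub>"
        by (intro ext) (simp_all add: m * ad ze app H(1)[OF *] inv)
      then show "\<exists>g\<in>carrier ?H. g \<oplus>\<^bsub>?H\<^esub> f = \<zero>\<^bsub>?H\<^esub>" using m by blast
    qed (rule ad ze; assumption)+
  next
    fix a b f assume *: "a \<in> carrier K" "b \<in> carrier K" "f \<in> carrier ?H"
    show "(a \<oplus>\<^bsub>K\<^esub> b) \<odot>\<^bsub>?H\<^esub> f = a \<odot>\<^bsub>?H\<^esub> f \<oplus>\<^bsub>?H\<^esub> b \<odot>\<^bsub>?H\<^esub> f"
      by (rule ext) (simp_all add: * ad sm app H(1)[OF *(3)] R.smult_l_distr M.lsmult_l_distr)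
    show "(a \<otimes>\<^bsub>K\<^esub> b) \<odot>\<^bsub>?H\<^esub> f = a \<odot>\<^bsub>?H\<^esub> (b \<odot>\<^bsub>?H\<^esub> f)"
      by (rule ext) (simp_all add: * sm app H(1)[OF *(3)] M.lsmult_assoc[symmetric]
          R.scalar_mult_left R.smult_assoc1)
  next
    fix a f g assume *: "a \<in> carrier K" "f \<in> carrier ?H" "g \<in> carrier ?H"
    show "a \<odot>\<^bsub>?H\<^esub> (f \<oplus>\<^bsub>?H\<^esub> g) = a \<odot>\<^bsub>?H\<^esub> f \<oplus>\<^bsub>?H\<^esub> a \<odot>\<^bsub>?H\<^esub> g"
      by (rule ext) (simp_all add: * ad sm app H(1)[OF *(2)] H(1)[OF *(3)] M.lsmult_r_distr)
  next
    fix f assume *: "f \<in> carrier ?H"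
    show "\<one>\<^bsub>K\<^esub> \<odot>\<^bsub>?H\<^esub> f = f"
      by (rule ext) (simp_all add: * sm app H(1)[OF *] M.lsmult_one)
  qed (rule R.is_cring sm; assumption)+
qed

text \<open>In degree -2 the sign rule becomes plain commutation with d, and for homotopies below it
  becomes a plain sum.\<close>

lemma chain_homs_2:
  "f \<in> chain_homs R F d (- 2) \<longleftrightarrow> f \<in> carrier (graded_homs R F (- 2)) \<and>
     (\<forall>n. \<forall>x\<in>carrier (F n). f (n - 1) (d n x) = d (n - 2) (f n x))"
proof -
  interpret M: lmodule R "F n" for n by (rule lm)
  have "(f (n - 1) (d n x) \<oplus>\<^bsub>F (n - 3)\<^esub> (\<ominus>\<^bsub>F (n - 3)\<^esub> d (n - 2) (f n x)) = \<zero>\<^bsub>F (n - 3)\<^esub>)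
      = (f (n - 1) (d n x) = d (n - 2) (f n x))"
    if f: "\<And>n. f n \<in> lmod_hom R (F n) (F (n - 2))" and x: "x \<in> carrier (F n)" for n x
  proof -
    have "f (n - 1) (d n x) \<in> carrier (F (n - 3))" "d (n - 2) (f n x) \<in> carrier (F (n - 3))"
      using lmod_homD(1)[OF f d_closed[OF x]] d_closed[OF lmod_homD(1)[OF f x]] by simp_all
    then show ?thesis using M.M.minus_zero_iff[of "f (n - 1) (d n x)" "n - 3"] by (simp add: M.M.minus_eq)
  qed
  then show ?thesis by (auto simp: chain_homs_def signed_def graded_homs_iff)
qed

lemma null_homotopic_2:
  "f \<in> null_homotopic R F d (- 2) \<longleftrightarrow> f \<in> carrier (graded_homs R F (- 2)) \<and>
     (\<exists>h. (\<forall>n. h n \<in> lmod_hom R (F n) (F (n - 1))) \<and> (\<forall>n. \<forall>x\<in>carrier (F n).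
        f n x = h (n - 1) (d n x) \<oplus>\<^bsub>F (n - 2)\<^esub> d (n - 1) (h n x)))"
  by (simp add: null_homotopic_def signed_def graded_homs_iff Bex_def)

lemma d_d: "x \<in> carrier (F n) \<Longrightarrow> d (n - 1) (d n x) = \<zero>\<^bsub>F (n - 2)\<^esub>"
  using cx by (simp add: is_complex_def)

lemma d_zero: "d n \<zero>\<^bsub>F n\<^esub> = \<zero>\<^bsub>F (n - 1)\<^esub>"
proof -
  interpret M: lmodule R "F i" for i by (rule lm)
  have "d n (\<zero>\<^bsub>F n\<^esub> \<oplus>\<^bsub>F n\<^esub> \<zero>\<^bsub>F n\<^esub>) = d n \<zero>\<^bsub>F n\<^esub> \<oplus>\<^bsub>F (n - 1)\<^esub> d n \<zero>\<^bsub>F n\<^esub>"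
    by (intro d_add M.M.zero_closed)
  then have "d n \<zero>\<^bsub>F n\<^esub> \<oplus>\<^bsub>F (n - 1)\<^esub> d n \<zero>\<^bsub>F n\<^esub> = d n \<zero>\<^bsub>F n\<^esub>"
    unfolding M.M.l_zero[OF M.M.zero_closed] by (rule sym)
  then show ?thesis by (rule M.M.idem_zero[OF d_closed[OF M.M.zero_closed]])
qed

lemma chain_homs_submodule: "submodule K (chain_homs R F d (- 2)) (graded_homs R F (- 2))"
proof -
  interpret H: module K "graded_homs R F (- 2)" by (rule graded_homs_module)
  interpret R: nc_algebra K R by (rule R)
  interpret M: lmodule R "F n" for n by (rule lm)
  show ?thesis
  proof (rule submodule.intro[OF graded_homs_module])
    fix f g assume f: "f \<in> chain_homs R F d (- 2)" and g: "g \<in> chain_homs R F d (- 2)"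
    have "d (n - 2) (f n x \<oplus>\<^bsub>F (n - 2)\<^esub> g n x) = d (n - 2) (f n x) \<oplus>\<^bsub>F (n - 3)\<^esub> d (n - 2) (g n x)"
      if x: "x \<in> carrier (F n)" for n x
    proof -
      have "f n x \<in> carrier (F (n - 2))" "g n x \<in> carrier (F (n - 2))"
        using f g x by (auto simp: chain_homs_2 graded_homs_iff intro: lmod_homD(1))
      then show ?thesis using d_add[of "f n x" "n - 2" "g n x"] by simp
    qed
    then show "f \<oplus>\<^bsub>graded_homs R F (- 2)\<^esub> g \<in> chain_homs R F d (- 2)"
      using f g H.M.a_closed[of f g] unfolding chain_homs_2
      by (auto simp: graded_homs_def d_closed)
  next
    fix c f assume c: "c \<in> carrier K" and f: "f \<in> chain_homs R F d (- 2)"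
    have "d (n - 2) (sc (n - 2) c (f n x)) = sc (n - 3) c (d (n - 2) (f n x))"
      if x: "x \<in> carrier (F n)" for n x
    proof -
      have "f n x \<in> carrier (F (n - 2))"
        using f x by (auto simp: chain_homs_2 graded_homs_iff intro: lmod_homD(1))
      then show ?thesis using d_smult[of "c \<odot>\<^bsub>R\<^esub> \<one>\<^bsub>R\<^esub>" "f n x" "n - 2"] c by simp
    qed
    then show "c \<odot>\<^bsub>graded_homs R F (- 2)\<^esub> f \<in> chain_homs R F d (- 2)"
      using c f H.smult_closed[of c f] unfolding chain_homs_2
      by (auto simp: graded_homs_def d_closed)
  next
    have "d (n - 2) \<zero>\<^bsub>F (n - 2)\<^esub> = \<zero>\<^bsub>F (n - 3)\<^esub>" for n using d_zero[of "n - 2"] by simp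
    then show "\<zero>\<^bsub>graded_homs R F (- 2)\<^esub> \<in> chain_homs R F d (- 2)"
      unfolding chain_homs_2 using H.M.zero_closed
      by (auto simp: graded_homs_def d_closed)
  qed (auto simp: chain_homs_2)
qed

lemma null_homotopic_submodule: "submodule K (null_homotopic R F d (- 2))
    ((graded_homs R F (- 2))\<lparr>carrier := chain_homs R F d (- 2)\<rparr>)"
proof -
  interpret H: module K "graded_homs R F (- 2)" by (rule graded_homs_module)
  interpret H1: module K "graded_homs R F (- 1)" by (rule graded_homs_module)
  interpret R: nc_algebra K R by (rule R)
  interpret M: lmodule R "F n" for n by (rule lm)
  show ?thesis
  proof (rule submodule.intro[OF H.submodule_is_module[OF chain_homs_submodule]], simp_all)
    show "null_homotopic R F d (- 2) \<subseteq> chain_homs R F d (- 2)"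
    proof
      fix f assume f: "f \<in> null_homotopic R F d (- 2)"
      then obtain h where fc: "f \<in> carrier (graded_homs R F (- 2))"
        and h: "\<And>n. h n \<in> lmod_hom R (F n) (F (n - 1))"
        and fh: "\<And>n x. x \<in> carrier (F n) \<Longrightarrow> f n x = h (n - 1) (d n x) \<oplus>\<^bsub>F (n - 2)\<^esub> d (n - 1) (h n x)"
        unfolding null_homotopic_2 by blast
      \<comment> \<open>Both sides equal d h d, since d d = 0 removes the other term of h d + d
        h.\<close>
      have "f (n - 1) (d n x) = d (n - 2) (f n x)" if x: "x \<in> carrier (F n)" for n x
      proof -
        have h0: "h (n - 2) \<zero>\<^bsub>F (n - 2)\<^esub> = \<zero>\<^bsub>F (n - 3)\<^esub>"
          using lmod_homD(2)[OF h, of "\<zero>\<^bsub>F (n - 2)\<^esub>" "n - 2" "\<zero>\<^bsub>F (n - 2)\<^esub>"]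
            lmod_homD(1)[OF h, of "\<zero>\<^bsub>F (n - 2)\<^esub>" "n - 2"] by (intro M.M.idem_zero) simp_all
        have c: "h (n - 1) (d n x) \<in> carrier (F (n - 2))" "d (n - 1) (h n x) \<in> carrier (F (n - 2))"
          using lmod_homD(1)[OF h d_closed[OF x]] d_closed[OF lmod_homD(1)[OF h x]] by simp_all
        have c': "d (n - 2) (h (n - 1) (d n x)) \<in> carrier (F (n - 3))" using d_closed[OF c(1)] by simp
        have "f (n - 1) (d n x) = d (n - 2) (h (n - 1) (d n x))"
          using fh[OF d_closed[OF x]] d_d[OF x] h0 c' by simp
        moreover have "d (n - 2) (f n x) = d (n - 2) (h (n - 1) (d n x))"
          using fh[OF x] c c' d_add[OF c] d_d[OF lmod_homD(1)[OF h x]] by simp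
        ultimately show ?thesis by simp
      qed
      then show "f \<in> chain_homs R F d (- 2)" using fc by (simp add: chain_homs_2)
    qed
  next
    fix f g assume f: "f \<in> null_homotopic R F d (- 2)" and g: "g \<in> null_homotopic R F d (- 2)"
    obtain h where fc: "f \<in> carrier (graded_homs R F (- 2))"
      and h: "\<And>n. h n \<in> lmod_hom R (F n) (F (n - 1))"
      and fh: "\<And>n x. x \<in> carrier (F n) \<Longrightarrow> f n x = h (n - 1) (d n x) \<oplus>\<^bsub>F (n - 2)\<^esub> d (n - 1) (h n x)"
      using f unfolding null_homotopic_2 by blast
    obtain k where gc: "g \<in> carrier (graded_homs R F (- 2))"
      and k: "\<And>n. k n \<in> lmod_hom R (F n) (F (n - 1))"
      and gk: "\<And>n x. x \<in> carrier (F n) \<Longrightarrow> g n x = k (n - 1) (d n x) \<oplus>\<^bsub>F (n - 2)\<^esub> d (n - 1) (k n x)"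
      using g unfolding null_homotopic_2 by blast
    have hk: "h \<oplus>\<^bsub>graded_homs R F (- 1)\<^esub> k \<in> carrier (graded_homs R F (- 1))"
      by (rule H1.M.a_closed) (simp_all add: graded_homs_iff h k)
    have "(f \<oplus>\<^bsub>graded_homs R F (- 2)\<^esub> g) n x = (h \<oplus>\<^bsub>graded_homs R F (- 1)\<^esub> k) (n - 1) (d n x)
        \<oplus>\<^bsub>F (n - 2)\<^esub> d (n - 1) ((h \<oplus>\<^bsub>graded_homs R F (- 1)\<^esub> k) n x)" if x: "x \<in> carrier (F n)" for n x
    proof -
      have "h (n - 1) (d n x) \<in> carrier (F (n - 2))" "d (n - 1) (h n x) \<in> carrier (F (n - 2))"
        "k (n - 1) (d n x) \<in> carrier (F (n - 2))" "d (n - 1) (k n x) \<in> carrier (F (n - 2))"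
        using lmod_homD(1)[OF h d_closed[OF x]] d_closed[OF lmod_homD(1)[OF h x]]
          lmod_homD(1)[OF k d_closed[OF x]] d_closed[OF lmod_homD(1)[OF k x]] by simp_all
      moreover have "d (n - 1) (h n x \<oplus>\<^bsub>F (n - 1)\<^esub> k n x) = d (n - 1) (h n x) \<oplus>\<^bsub>F (n - 2)\<^esub> d (n - 1) (k n x)"
        using d_add[OF lmod_homD(1)[OF h x] lmod_homD(1)[OF k x]] by simp
      ultimately show ?thesis
        using x by (simp add: graded_homs_def fh gk d_closed M.M.a_ac)
    qed
    then show "f \<oplus>\<^bsub>graded_homs R F (- 2)\<^esub> g \<in> null_homotopic R F d (- 2)"
      unfolding null_homotopic_2 using H.M.a_closed[OF fc gc] hk
      by (intro conjI exI[of _ "h \<oplus>\<^bsub>graded_homs R F (- 1)\<^esub> k"]) (simp_all add: graded_homs_iff)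
  next
    fix c f assume c: "c \<in> carrier K" and f: "f \<in> null_homotopic R F d (- 2)"
    obtain h where fc: "f \<in> carrier (graded_homs R F (- 2))"
      and h: "\<And>n. h n \<in> lmod_hom R (F n) (F (n - 1))"
      and fh: "\<And>n x. x \<in> carrier (F n) \<Longrightarrow> f n x = h (n - 1) (d n x) \<oplus>\<^bsub>F (n - 2)\<^esub> d (n - 1) (h n x)"
      using f unfolding null_homotopic_2 by blast
    have ch: "c \<odot>\<^bsub>graded_homs R F (- 1)\<^esub> h \<in> carrier (graded_homs R F (- 1))"
      by (rule H1.smult_closed[OF c]) (simp add: graded_homs_iff h)
    have "(c \<odot>\<^bsub>graded_homs R F (- 2)\<^esub> f) n x = (c \<odot>\<^bsub>graded_homs R F (- 1)\<^esub> h) (n - 1) (d n x)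
        \<oplus>\<^bsub>F (n - 2)\<^esub> d (n - 1) ((c \<odot>\<^bsub>graded_homs R F (- 1)\<^esub> h) n x)" if x: "x \<in> carrier (F n)" for n x
    proof -
      have "h (n - 1) (d n x) \<in> carrier (F (n - 2))" "d (n - 1) (h n x) \<in> carrier (F (n - 2))"
        using lmod_homD(1)[OF h d_closed[OF x]] d_closed[OF lmod_homD(1)[OF h x]] by simp_all
      moreover have "d (n - 1) (sc (n - 1) c (h n x)) = sc (n - 2) c (d (n - 1) (h n x))"
        using d_smult[OF R.scalar_closed[OF c] lmod_homD(1)[OF h x]] by simp
      ultimately show ?thesis
        using x c by (simp add: graded_homs_def fh d_closed M.lsmult_r_distr)
    qed
    then show "c \<odot>\<^bsub>graded_homs R F (- 2)\<^esub> f \<in> null_homotopic R F d (- 2)"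
      unfolding null_homotopic_2 using H.smult_closed[OF c fc] ch
      by (intro conjI exI[of _ "c \<odot>\<^bsub>graded_homs R F (- 1)\<^esub> h"]) (simp_all add: graded_homs_iff)
  next
    have z: "\<zero>\<^bsub>graded_homs R F (- 1)\<^esub> \<in> carrier (graded_homs R F (- 1))" by simp
    have "\<zero>\<^bsub>graded_homs R F (- 2)\<^esub> n x = \<zero>\<^bsub>graded_homs R F (- 1)\<^esub> (n - 1) (d n x)
        \<oplus>\<^bsub>F (n - 2)\<^esub> d (n - 1) (\<zero>\<^bsub>graded_homs R F (- 1)\<^esub> n x)" if x: "x \<in> carrier (F n)" for n x
      using x d_zero[of "n - 1"] by (simp add: graded_homs_def d_closed)
    then show "\<zero>\<^bsub>graded_homs R F (- 2)\<^esub> \<in> null_homotopic R F d (- 2)"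
      unfolding null_homotopic_2 using H.M.zero_closed z
      by (intro conjI exI[of _ "\<zero>\<^bsub>graded_homs R F (- 1)\<^esub>"]) (simp_all add: graded_homs_iff)
  qed
qed

end

section \<open>Isomorphism of lifts is an equivalence relation\<close>

lemma complexes_isomorphic_refl:
  assumes cx: "is_complex S G D"
    and cl: "\<And>n x y. x \<in> carrier (G n) \<Longrightarrow> y \<in> carrier (G n) \<Longrightarrow> x \<oplus>\<^bsub>G n\<^esub> y \<in> carrier (G n)"
      "\<And>n a x. a \<in> carrier S \<Longrightarrow> x \<in> carrier (G n) \<Longrightarrow> a \<odot>\<^bsub>G n\<^esub> x \<in> carrier (G n)"
  shows "complexes_isomorphic S G D D"
proof -
  have Dc: "D n x \<in> carrier (G (n - 1))" if "x \<in> carrier (G n)" for n x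
    using cx that by (auto simp: is_complex_def lmod_hom_def)
  show ?thesis
    unfolding complexes_isomorphic_def
    by (rule exI[of _ "\<lambda>n. \<lambda>x\<in>carrier (G n). x"])
      (auto simp: lmod_hom_def cl Dc bij_betw_def inj_on_def)
qed

lemma complexes_isomorphic_sym:
  assumes cx: "is_complex S G D"
    and cl: "\<And>n x y. x \<in> carrier (G n) \<Longrightarrow> y \<in> carrier (G n) \<Longrightarrow> x \<oplus>\<^bsub>G n\<^esub> y \<in> carrier (G n)"
      "\<And>n a x. a \<in> carrier S \<Longrightarrow> x \<in> carrier (G n) \<Longrightarrow> a \<odot>\<^bsub>G n\<^esub> x \<in> carrier (G n)"
    and iso: "complexes_isomorphic S G D D'"
  shows "complexes_isomorphic S G D' D"
proof -
  obtain f where f: "\<And>n. f n \<in> lmod_hom S (G n) (G n)"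
    and b: "\<And>n. bij_betw (f n) (carrier (G n)) (carrier (G n))"
    and c: "\<And>n x. x \<in> carrier (G n) \<Longrightarrow> f (n - 1) (D n x) = D' n (f n x)"
    using iso unfolding complexes_isomorphic_def by blast
  \<comment> \<open>The inverse is made \<open>undefined\<close> off the carrier, as
    \<open>lmod_hom\<close> demands.\<close>
  define g where "g n = (\<lambda>x\<in>carrier (G n). inv_into (carrier (G n)) (f n) x)" for n
  have Dc: "D n x \<in> carrier (G (n - 1))" if "x \<in> carrier (G n)" for n x
    using cx that by (auto simp: is_complex_def lmod_hom_def)
  have gc: "g n x \<in> carrier (G n)" "f n (g n x) = x" if "x \<in> carrier (G n)" for n x
    using that b[of n] by (auto simp: g_def bij_betw_def inv_into_into f_inv_into_f)
  have gI: "g n (f n x) = x" if "x \<in> carrier (G n)" for n x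
    using that b[of n] by (auto simp: g_def bij_betw_def)
  have "g n \<in> lmod_hom S (G n) (G n)" for n
  proof -
    have "g n (x \<oplus>\<^bsub>G n\<^esub> y) = g n x \<oplus>\<^bsub>G n\<^esub> g n y" if "x \<in> carrier (G n)" "y \<in> carrier (G n)" for x y
    proof -
      have "f n (g n x \<oplus>\<^bsub>G n\<^esub> g n y) = x \<oplus>\<^bsub>G n\<^esub> y" using f[of n] that gc by (simp add: lmod_hom_def)
      then show ?thesis using gI[OF cl(1)[OF gc(1)[OF that(1)] gc(1)[OF that(2)]]] by simp
    qed
    moreover have "g n (a \<odot>\<^bsub>G n\<^esub> x) = a \<odot>\<^bsub>G n\<^esub> g n x" if "a \<in> carrier S" "x \<in> carrier (G n)" for a x
    proof -
      have "f n (a \<odot>\<^bsub>G n\<^esub> g n x) = a \<odot>\<^bsub>G n\<^esub> x" using f[of n] that gc by (simp add: lmod_hom_def)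
      then show ?thesis using gI[OF cl(2)[OF that(1) gc(1)[OF that(2)]]] by simp
    qed
    ultimately show ?thesis using gc by (auto simp: lmod_hom_def g_def)
  qed
  moreover have "bij_betw (g n) (carrier (G n)) (carrier (G n))" for n
    by (rule bij_betw_byWitness[of _ "f n"]) (use gc gI b[of n] in \<open>auto simp: bij_betw_def\<close>)
  moreover have "g (n - 1) (D' n x) = D n (g n x)" if "x \<in> carrier (G n)" for n x
  proof -
    have "D' n x = f (n - 1) (D n (g n x))" using c[OF gc(1)[OF that]] gc(2)[OF that] by simp
    then show ?thesis using gI[OF Dc[OF gc(1)[OF that]]] by simp
  qed
  ultimately show ?thesis unfolding complexes_isomorphic_def by blast
qed

lemma complexes_isomorphic_trans:
  assumes cx: "is_complex S G D" and cx': "is_complex S G D'"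
    and cl: "\<And>n x y. x \<in> carrier (G n) \<Longrightarrow> y \<in> carrier (G n) \<Longrightarrow> x \<oplus>\<^bsub>G n\<^esub> y \<in> carrier (G n)"
      "\<And>n a x. a \<in> carrier S \<Longrightarrow> x \<in> carrier (G n) \<Longrightarrow> a \<odot>\<^bsub>G n\<^esub> x \<in> carrier (G n)"
    and iso: "complexes_isomorphic S G D D'" and iso': "complexes_isomorphic S G D' D''"
  shows "complexes_isomorphic S G D D''"
proof -
  obtain f where f: "\<And>n. f n \<in> lmod_hom S (G n) (G n)"
    and b: "\<And>n. bij_betw (f n) (carrier (G n)) (carrier (G n))"
    and c: "\<And>n x. x \<in> carrier (G n) \<Longrightarrow> f (n - 1) (D n x) = D' n (f n x)"
    using iso unfolding complexes_isomorphic_def by blast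
  obtain g where g: "\<And>n. g n \<in> lmod_hom S (G n) (G n)"
    and b': "\<And>n. bij_betw (g n) (carrier (G n)) (carrier (G n))"
    and c': "\<And>n x. x \<in> carrier (G n) \<Longrightarrow> g (n - 1) (D' n x) = D'' n (g n x)"
    using iso' unfolding complexes_isomorphic_def by blast
  have Dc: "D n x \<in> carrier (G (n - 1))" if "x \<in> carrier (G n)" for n x
    using cx that by (auto simp: is_complex_def lmod_hom_def)
  have fc: "f n x \<in> carrier (G n)" if "x \<in> carrier (G n)" for n x
    using f[of n] that by (auto simp: lmod_hom_def)
  have "compose (carrier (G n)) (g n) (f n) \<in> lmod_hom S (G n) (G n)" for n
    using f[of n] g[of n] cl fc by (auto simp: lmod_hom_def compose_def)
  moreover have "bij_betw (compose (carrier (G n)) (g n) (f n)) (carrier (G n)) (carrier (G n))" for n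
    by (rule bij_betw_compose[OF b b'])
  moreover have "compose (carrier (G (n - 1))) (g (n - 1)) (f (n - 1)) (D n x)
      = D'' n (compose (carrier (G n)) (g n) (f n) x)" if "x \<in> carrier (G n)" for n x
    using that by (simp add: compose_def Dc c fc c')
  ultimately show ?thesis
    unfolding complexes_isomorphic_def
    by (intro exI[of _ "\<lambda>n. compose (carrier (G n)) (g n) (f n)"]) blast
qed

context complex_setup
begin

lemma tensor_module_closed:
  assumes "nc_algebra K A"
  shows "x \<in> carrier (tensor_module K R (F n) A) \<Longrightarrow> y \<in> carrier (tensor_module K R (F n) A) \<Longrightarrow>
      x \<oplus>\<^bsub>tensor_module K R (F n) A\<^esub> y \<in> carrier (tensor_module K R (F n) A)"
    and "a \<in> carrier (tensor_algebra K R (opp A)) \<Longrightarrow> x \<in> carrier (tensor_module K R (F n) A) \<Longrightarrow>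
      a \<odot>\<^bsub>tensor_module K R (F n) A\<^esub> x \<in> carrier (tensor_module K R (F n) A)"
proof -
  interpret tensor_mod K R "F n" A by (rule tm[OF assms])
  show "x \<in> carrier (tensor_module K R (F n) A) \<Longrightarrow> y \<in> carrier (tensor_module K R (F n) A) \<Longrightarrow>
      x \<oplus>\<^bsub>tensor_module K R (F n) A\<^esub> y \<in> carrier (tensor_module K R (F n) A)"
    by (simp add: tensor_module_simps(1,3))
  show "a \<in> carrier (tensor_algebra K R (opp A)) \<Longrightarrow> x \<in> carrier (tensor_module K R (F n) A) \<Longrightarrow>
      a \<odot>\<^bsub>tensor_module K R (F n) A\<^esub> x \<in> carrier (tensor_module K R (F n) A)"
    using act_closed[of a x] by (simp add: tensor_module_simps(1))
qed

lemma equiv_lift_iso: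
  assumes A: "nc_algebra K A"
  shows "equiv (artinian_lifts K R F d A) (lift_iso K R F d A)"
proof (rule equivI)
  note cl = tensor_module_closed[OF A]
  show "lift_iso K R F d A \<subseteq> artinian_lifts K R F d A \<times> artinian_lifts K R F d A"
    by (auto simp: lift_iso_def)
  show "refl_on (artinian_lifts K R F d A) (lift_iso K R F d A)"
    by (rule refl_onI)
      (auto simp: lift_iso_def artinian_lifts_def intro!: complexes_isomorphic_refl cl)
  show "sym (lift_iso K R F d A)"
    by (rule symI)
      (auto simp: lift_iso_def artinian_lifts_def intro!: complexes_isomorphic_sym cl)
  show "trans (lift_iso K R F d A)"
  proof (rule transI)
    fix x y z assume "(x, y) \<in> lift_iso K R F d A" "(y, z) \<in> lift_iso K R F d A"
    then show "(x, z) \<in> lift_iso K R F d A"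
      unfolding lift_iso_def mem_Collect_eq prod.case
      by (auto intro: complexes_isomorphic_trans[OF _ _ cl, of _ _ _ y] simp: artinian_lifts_def)
  qed
qed

end

lemma (in complex_setup) Ext_vectorspace:
  assumes "field K" shows "vectorspace K (Ext_space R F d 2)"
  using quot_module[OF null_homotopic_submodule] assms
  by (simp add: Ext_space_def vectorspace_def)

lemma quot_class_zero_iff:
  assumes B: "submodule K B V" and x: "x \<in> carrier V"
  shows "B +>\<^bsub>V\<^esub> x = \<zero>\<^bsub>quot V B\<^esub> \<longleftrightarrow> x \<in> B"
proof -
  interpret module K V using B by (simp add: submodule_def)
  have "\<ominus>\<^bsub>V\<^esub> \<zero>\<^bsub>V\<^esub> = \<zero>\<^bsub>V\<^esub>" using M.l_zero[of "\<ominus>\<^bsub>V\<^esub> \<zero>\<^bsub>V\<^esub>"] M.r_neg[of "\<zero>\<^bsub>V\<^esub>"] by simp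
  then have "x \<ominus>\<^bsub>V\<^esub> \<zero>\<^bsub>V\<^esub> = x" using x by (simp only: M.minus_eq M.r_zero)
  then show ?thesis using quot_class(5)[OF B x M.zero_closed] quot_class(3)[OF B] by simp
qed

section \<open>Homomorphisms out of quotients of the power series algebra\<close>

lemma alg_homsD:
  assumes "f \<in> alg_homs K A B"
  shows "x \<in> carrier A \<Longrightarrow> f x \<in> carrier B"
    "x \<in> carrier A \<Longrightarrow> y \<in> carrier A \<Longrightarrow> f (x \<otimes>\<^bsub>A\<^esub> y) = f x \<otimes>\<^bsub>B\<^esub> f y"
    "x \<in> carrier A \<Longrightarrow> y \<in> carrier A \<Longrightarrow> f (x \<oplus>\<^bsub>A\<^esub> y) = f x \<oplus>\<^bsub>B\<^esub> f y"
    "f \<one>\<^bsub>A\<^esub> = \<one>\<^bsub>B\<^esub>"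
    "c \<in> carrier K \<Longrightarrow> x \<in> carrier A \<Longrightarrow> f (c \<odot>\<^bsub>A\<^esub> x) = c \<odot>\<^bsub>B\<^esub> f x"
  using assms by (auto simp: alg_homs_def ring_hom_def)

lemma alg_homsI:
  assumes "f \<in> extensional (carrier A)"
    "\<And>x. x \<in> carrier A \<Longrightarrow> f x \<in> carrier B"
    "\<And>x y. x \<in> carrier A \<Longrightarrow> y \<in> carrier A \<Longrightarrow> f (x \<otimes>\<^bsub>A\<^esub> y) = f x \<otimes>\<^bsub>B\<^esub> f y"
    "\<And>x y. x \<in> carrier A \<Longrightarrow> y \<in> carrier A \<Longrightarrow> f (x \<oplus>\<^bsub>A\<^esub> y) = f x \<oplus>\<^bsub>B\<^esub> f y"
    "f \<one>\<^bsub>A\<^esub> = \<one>\<^bsub>B\<^esub>"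
    "\<And>c x. c \<in> carrier K \<Longrightarrow> x \<in> carrier A \<Longrightarrow> f (c \<odot>\<^bsub>A\<^esub> x) = c \<odot>\<^bsub>B\<^esub> f x"
  shows "f \<in> alg_homs K A B"
  using assms by (auto simp: alg_homs_def intro: ring_hom_memI)

lemma alg_homs_compose:
  assumes A: "nc_algebra K A" and f: "f \<in> alg_homs K A B" and g: "g \<in> alg_homs K B C"
  shows "compose (carrier A) g f \<in> alg_homs K A C"
proof -
  interpret A: nc_algebra K A by (rule A)
  show ?thesis
    by (rule alg_homsI) (simp_all add: compose_def alg_homsD[OF f] alg_homsD[OF g] A.smult_closed)
qed

context power_series
begin

lemma quot_T:
  assumes I: "ideal I T"
  shows "X \<in> carrier (quot T I) \<longleftrightarrow> (\<exists>t\<in>carrier T. X = I +>\<^bsub>T\<^esub> t)"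
    and "t \<in> carrier T \<Longrightarrow> I +>\<^bsub>T\<^esub> t \<in> carrier (quot T I)"
    and "t \<in> carrier T \<Longrightarrow> u \<in> carrier T \<Longrightarrow> (I +>\<^bsub>T\<^esub> t) \<otimes>\<^bsub>quot T I\<^esub> (I +>\<^bsub>T\<^esub> u) = I +>\<^bsub>T\<^esub> (t \<otimes>\<^bsub>T\<^esub> u)"
    and "t \<in> carrier T \<Longrightarrow> u \<in> carrier T \<Longrightarrow> (I +>\<^bsub>T\<^esub> t) \<oplus>\<^bsub>quot T I\<^esub> (I +>\<^bsub>T\<^esub> u) = I +>\<^bsub>T\<^esub> (t \<oplus>\<^bsub>T\<^esub> u)"
    and "c \<in> carrier K \<Longrightarrow> t \<in> carrier T \<Longrightarrow> c \<odot>\<^bsub>quot T I\<^esub> (I +>\<^bsub>T\<^esub> t) = I +>\<^bsub>T\<^esub> (c \<odot>\<^bsub>T\<^esub> t)"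
proof -
  note q = quot_class[OF ideal_submodule[OF I]]
  show "X \<in> carrier (quot T I) \<longleftrightarrow> (\<exists>t\<in>carrier T. X = I +>\<^bsub>T\<^esub> t)"
    unfolding quot_simps q(1) by blast
  show "t \<in> carrier T \<Longrightarrow> I +>\<^bsub>T\<^esub> t \<in> carrier (quot T I)"
    unfolding quot_simps q(1) by blast
  show "t \<in> carrier T \<Longrightarrow> u \<in> carrier T \<Longrightarrow> (I +>\<^bsub>T\<^esub> t) \<otimes>\<^bsub>quot T I\<^esub> (I +>\<^bsub>T\<^esub> u) = I +>\<^bsub>T\<^esub> (t \<otimes>\<^bsub>T\<^esub> u)"
    unfolding quot_simps by (rule ideal.rcoset_mult_add[OF I])
  show "t \<in> carrier T \<Longrightarrow> u \<in> carrier T \<Longrightarrow> (I +>\<^bsub>T\<^esub> t) \<oplus>\<^bsub>quot T I\<^esub> (I +>\<^bsub>T\<^esub> u) = I +>\<^bsub>T\<^esub> (t \<oplus>\<^bsub>T\<^esub> u)"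
    unfolding quot_simps by (rule q(2)[symmetric])
  show "c \<in> carrier K \<Longrightarrow> t \<in> carrier T \<Longrightarrow> c \<odot>\<^bsub>quot T I\<^esub> (I +>\<^bsub>T\<^esub> t) = I +>\<^bsub>T\<^esub> (c \<odot>\<^bsub>T\<^esub> t)"
    unfolding quot_simps by (rule q(4)[symmetric])
qed

lemma nc_algebra_quot_T:
  assumes I: "ideal I T" shows "nc_algebra K (quot T I)"
proof (rule nc_algebra_surj_image[OF nc_algebra_T, of "\<lambda>t. I +>\<^bsub>T\<^esub> t"])
  note q = quot_T[OF I]
  show "(+>\<^bsub>T\<^esub>) I ` carrier T = carrier (quot T I)" using q(1,2) by blast
  show "I +>\<^bsub>T\<^esub> \<zero>\<^bsub>T\<^esub> = \<zero>\<^bsub>quot T I\<^esub>"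
    unfolding quot_simps by (rule quot_class(3)[OF ideal_submodule[OF I]])
  show "I +>\<^bsub>T\<^esub> \<one>\<^bsub>T\<^esub> = \<one>\<^bsub>quot T I\<^esub>" unfolding quot_simps ..
qed (rule quot_T(3-5)[OF I, symmetric]; assumption)+

end

context coord_quotient
begin

text \<open>The factorisation of \<kappa> through T/I. Any representative may be chosen once I lies
  in the kernel of \<kappa>.\<close>

definition quot_hom :: "(nat \<Rightarrow> (nat list \<Rightarrow> 'k) set) set \<Rightarrow> (nat \<Rightarrow> (nat list \<Rightarrow> 'k) set) set \<Rightarrow> nat \<Rightarrow> 'k" where
  "quot_hom I = (\<lambda>X\<in>carrier (quot T I). \<kappa> (SOME t. t \<in> carrier T \<and> X = I +>\<^bsub>T\<^esub> t))"

lemma quot_hom: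
  assumes I: "ideal I T" and I\<kappa>: "\<And>t. t \<in> I \<Longrightarrow> \<kappa> t = (\<lambda>_. \<zero>)"
  shows "t \<in> carrier T \<Longrightarrow> quot_hom I (I +>\<^bsub>T\<^esub> t) = \<kappa> t" and "quot_hom I \<in> alg_homs K (quot T I) A"
proof -
  note q = quot_T[OF I]
  show v: "quot_hom I (I +>\<^bsub>T\<^esub> t) = \<kappa> t" if t: "t \<in> carrier T" for t
  proof -
    define u where "u = (SOME u. u \<in> carrier T \<and> I +>\<^bsub>T\<^esub> t = I +>\<^bsub>T\<^esub> u)"
    have u: "u \<in> carrier T \<and> I +>\<^bsub>T\<^esub> t = I +>\<^bsub>T\<^esub> u"
      unfolding u_def by (rule someI[of _ t]) (use t in blast)
    then have "t \<ominus>\<^bsub>T\<^esub> u \<in> I" using quot_class(5)[OF ideal_submodule[OF I] t] by blast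
    then have "\<kappa> t = \<kappa> u" using \<kappa>_eq_iff[OF t] u I\<kappa> by blast
    then show ?thesis using q(2)[OF t] unfolding quot_hom_def u_def by (simp only: restrict_apply' if_True)
  qed
  show "quot_hom I \<in> alg_homs K (quot T I) A"
  proof (rule alg_homsI)
    show "quot_hom I \<in> extensional (carrier (quot T I))" by (simp only: quot_hom_def restrict_extensional)
    fix X assume "X \<in> carrier (quot T I)"
    then obtain t where t: "t \<in> carrier T" "X = I +>\<^bsub>T\<^esub> t" using q(1) by blast
    show "quot_hom I X \<in> carrier A" unfolding t(2) v[OF t(1)] using k(1)[OF t(1)] by simp
    show "quot_hom I (c \<odot>\<^bsub>quot T I\<^esub> X) = c \<odot>\<^bsub>A\<^esub> quot_hom I X" if c: "c \<in> carrier K" for c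
      unfolding t(2) v[OF t(1)] q(5)[OF c t(1)] v[OF T.smult_closed[OF c t(1)]]
      using k(3)[OF c t(1)] by simp
    fix Y assume "Y \<in> carrier (quot T I)"
    then obtain u where u: "u \<in> carrier T" "Y = I +>\<^bsub>T\<^esub> u" using q(1) by blast
    show "quot_hom I (X \<otimes>\<^bsub>quot T I\<^esub> Y) = quot_hom I X \<otimes>\<^bsub>A\<^esub> quot_hom I Y"
      unfolding t(2) u(2) v[OF t(1)] v[OF u(1)] q(3)[OF t(1) u(1)] v[OF T.m_closed[OF t(1) u(1)]]
      by (rule \<kappa>_mult[OF t(1) u(1)])
    show "quot_hom I (X \<oplus>\<^bsub>quot T I\<^esub> Y) = quot_hom I X \<oplus>\<^bsub>A\<^esub> quot_hom I Y"
      unfolding t(2) u(2) v[OF t(1)] v[OF u(1)] q(4)[OF t(1) u(1)] v[OF T.a_closed[OF t(1) u(1)]]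
      using k(2)[OF t(1) u(1)] by simp
  next
    show "quot_hom I \<one>\<^bsub>quot T I\<^esub> = \<one>\<^bsub>A\<^esub>"
      unfolding quot_simps v[OF T.one_closed] by simp
  qed
qed

end

section \<open>Sums and products of ideals\<close>

context ring
begin

lemma ideal_sum_left:
  assumes "ideal J R" "ideal J' R" "x \<in> J" shows "x \<in> J <+>\<^bsub>R\<^esub> J'"
proof -
  have "\<zero> \<in> J'" "x \<in> carrier R"
    using assms by (simp_all add: additive_subgroup.zero_closed ideal.axioms(1) ideal.Icarr)
  then show ?thesis using assms(3) unfolding set_add_def' by (force intro: r_zero[symmetric])
qed

lemma ideal_sum_right:
  assumes "ideal J R" "ideal J' R" "x \<in> J'" shows "x \<in> J <+>\<^bsub>R\<^esub> J'"
proof -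
  have "\<zero> \<in> J" "x \<in> carrier R"
    using assms by (simp_all add: additive_subgroup.zero_closed ideal.axioms(1) ideal.Icarr)
  then show ?thesis using assms(3) unfolding set_add_def' by (force intro: l_zero[symmetric])
qed

lemma ideal_sum_least:
  assumes "ideal L R" "J \<subseteq> L" "J' \<subseteq> L" shows "J <+>\<^bsub>R\<^esub> J' \<subseteq> L"
proof -
  interpret L: ideal L R by fact
  show ?thesis using assms(2,3) by (auto simp: set_add_def')
qed

lemma ideal_prod_least:
  assumes L: "ideal L R" and prod: "\<And>x y. x \<in> X \<Longrightarrow> y \<in> Y \<Longrightarrow> x \<otimes> y \<in> L"
  shows "ideal_prod R X Y \<subseteq> L"
proof
  interpret L: ideal L R by fact
  fix z assume "z \<in> ideal_prod R X Y"
  then show "z \<in> L" by induction (use prod in auto)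
qed

end

section \<open>The presentation T/I of the parameter algebra\<close>

locale universal_setup = power_series K r + complex_setup K R F d
  for K :: "'k ring" (structure) and r and R :: "('k, 'r) module"
    and F :: "int \<Rightarrow> ('r, 'm) module" and d +
  fixes I U
  assumes I: "ideal I T" and I_sub: "I \<subseteq> ideal_pow T \<mm> 2"
    and universal: "universal_lift K R F d (quot T I) U"
begin

abbreviation "P \<equiv> quot T I"

definition trunc_ideal :: "nat \<Rightarrow> (nat \<Rightarrow> (nat list \<Rightarrow> 'k) set) set" where
  "trunc_ideal n = I <+>\<^bsub>T\<^esub> ideal_pow T \<mm> n"

text \<open>Generators of I are counted in I modulo \<mm>I + I\<mm>; the summand \<mm>^n is added to
  make the codimension in T finite.\<close>

definition small_ideal :: "nat \<Rightarrow> (nat \<Rightarrow> (nat list \<Rightarrow> 'k) set) set" where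
  "small_ideal n = (ideal_prod T \<mm> I <+>\<^bsub>T\<^esub> ideal_prod T I \<mm>) <+>\<^bsub>T\<^esub> ideal_pow T \<mm> n"

lemma trunc_ideal: "ideal (trunc_ideal n) T"
  unfolding trunc_ideal_def by (rule T.add_ideals[OF I ideal_pow_ideal])

lemma small_ideal: "ideal (small_ideal n) T"
  unfolding small_ideal_def
  by (intro T.add_ideals T.ideal_prod_is_ideal I \<mm>_ideal ideal_pow_ideal)

lemma pow2_subset: "ideal_pow T \<mm> 2 \<subseteq> \<mm>"
proof -
  interpret M: ideal \<mm> T by (rule \<mm>_ideal)
  have "ideal_pow T \<mm> 1 \<subseteq> carrier T" using ideal.Icarr[OF ideal_pow_ideal] by blast
  then show ?thesis unfolding numeral_2_eq_2 ideal_pow.simps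
    by (intro T.ideal_prod_least[OF \<mm>_ideal]) (auto intro!: M.I_l_closed)
qed

lemma I_\<mm>: "I \<subseteq> \<mm>" using I_sub pow2_subset by blast

lemma ideal_pow_mono: "m \<le> n \<Longrightarrow> ideal_pow T \<mm> n \<subseteq> ideal_pow T \<mm> m"
  by (rule lift_Suc_antimono_le[of "ideal_pow T \<mm>"]) (rule T.ideal_pow_Suc_subset[OF \<mm>_ideal])

lemma trunc_ideal_\<mm>: "2 \<le> n \<Longrightarrow> trunc_ideal n \<subseteq> \<mm>"
  unfolding trunc_ideal_def
  using ideal_pow_mono[of 2 n] pow2_subset by (intro T.ideal_sum_least[OF \<mm>_ideal I_\<mm>]) blast

lemma fincod_small: "fincod K T (small_ideal n)" and fincod_trunc: "fincod K T (trunc_ideal n)"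
proof -
  have "ideal (ideal_prod T \<mm> I <+>\<^bsub>T\<^esub> ideal_prod T I \<mm>) T"
    by (intro T.add_ideals T.ideal_prod_is_ideal I \<mm>_ideal)
  then have "ideal_pow T \<mm> n \<subseteq> small_ideal n"
    unfolding small_ideal_def using T.ideal_sum_right[OF _ ideal_pow_ideal] by blast
  then show "fincod K T (small_ideal n)"
    by (rule fincod_mono[OF fincod_ideal_pow _ ideal_submodule[OF small_ideal]])
  have "ideal_pow T \<mm> n \<subseteq> trunc_ideal n"
    unfolding trunc_ideal_def using T.ideal_sum_right[OF I ideal_pow_ideal] by blast
  then show "fincod K T (trunc_ideal n)"
    by (rule fincod_mono[OF fincod_ideal_pow _ ideal_submodule[OF trunc_ideal]])
qed

lemma const_minus: "t \<in> carrier T \<Longrightarrow> t \<ominus>\<^bsub>T\<^esub> const t \<odot>\<^bsub>T\<^esub> \<one>\<^bsub>T\<^esub> \<in> \<mm>"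
  using functional_minus[OF T.module_axioms const_functional, of t "const t \<odot>\<^bsub>T\<^esub> \<one>\<^bsub>T\<^esub>"]
    functionalD[OF const_functional] by (simp add: \<mm>_def const_one T.smult_closed)

text \<open>A functional that vanishes on \<open>\<mm>I + I\<mm> + \<mm>\<^sup>n\<close> also vanishes on \<open>\<mm>J + J\<mm>\<close> for
  \<open>J = I + \<mm>\<^sup>n\<close>, and \<open>T = K1 + \<mm>\<close>.\<close>

lemma small_functional:
  assumes \<chi>: "functional K T \<chi>" and \<chi>0: "\<And>t. t \<in> small_ideal n \<Longrightarrow> \<chi> t = \<zero>"
    and j: "j \<in> trunc_ideal n" and t: "t \<in> carrier T"
  shows "\<chi> (j \<otimes>\<^bsub>T\<^esub> t) = const t \<otimes> \<chi> j" "\<chi> (t \<otimes>\<^bsub>T\<^esub> j) = const t \<otimes> \<chi> j"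
proof -
  let ?L = "ideal_prod T \<mm> I" and ?R = "ideal_prod T I \<mm>"
  have L: "ideal ?L T" and R: "ideal ?R T" by (intro T.ideal_prod_is_ideal I \<mm>_ideal)+
  note LR = T.add_ideals[OF L R]
  interpret M: ideal \<mm> T by (rule \<mm>_ideal)
  interpret Q: ideal "ideal_pow T \<mm> n" T by (rule ideal_pow_ideal)
  interpret S: ideal "small_ideal n" T by (rule small_ideal)
  have in1: "x \<in> small_ideal n" if "x \<in> ?L" for x
    unfolding small_ideal_def using T.ideal_sum_left[OF LR ideal_pow_ideal] T.ideal_sum_left[OF L R] that by blast
  have in2: "x \<in> small_ideal n" if "x \<in> ?R" for x
    unfolding small_ideal_def using T.ideal_sum_left[OF LR ideal_pow_ideal] T.ideal_sum_right[OF L R] that by blast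
  have in3: "x \<in> small_ideal n" if "x \<in> ideal_pow T \<mm> n" for x
    unfolding small_ideal_def using T.ideal_sum_right[OF LR ideal_pow_ideal] that by blast
  obtain i q where iq: "i \<in> I" "q \<in> ideal_pow T \<mm> n" "j = i \<oplus>\<^bsub>T\<^esub> q"
    using j unfolding trunc_ideal_def set_add_def' by blast
  define m where "m = t \<ominus>\<^bsub>T\<^esub> const t \<odot>\<^bsub>T\<^esub> \<one>\<^bsub>T\<^esub>"
  have m: "m \<in> \<mm>" unfolding m_def by (rule const_minus[OF t])
  have c: "const t \<in> carrier K" by (rule functionalD(1)[OF const_functional t])
  have cl: "i \<in> carrier T" "q \<in> carrier T" "m \<in> carrier T" "j \<in> carrier T"
    using iq m ideal.Icarr[OF I] by auto
  have tm: "t = m \<oplus>\<^bsub>T\<^esub> const t \<odot>\<^bsub>T\<^esub> \<one>\<^bsub>T\<^esub>"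
    unfolding m_def using t c by (simp add: T.minus_eq T.a_assoc T.l_neg T.smult_closed)
  have "i \<otimes>\<^bsub>T\<^esub> m \<in> small_ideal n" by (rule in2[OF ideal_prod.prod[OF iq(1) m]])
  moreover have "m \<otimes>\<^bsub>T\<^esub> i \<in> small_ideal n" by (rule in1[OF ideal_prod.prod[OF m iq(1)]])
  moreover have "q \<otimes>\<^bsub>T\<^esub> m \<in> small_ideal n" "m \<otimes>\<^bsub>T\<^esub> q \<in> small_ideal n"
    using iq(2) cl by (auto intro: in3 Q.I_l_closed Q.I_r_closed)
  ultimately have z: "\<chi> (j \<otimes>\<^bsub>T\<^esub> m) = \<zero>" "\<chi> (m \<otimes>\<^bsub>T\<^esub> j) = \<zero>"
    unfolding iq(3) using cl by (simp_all add: T.l_distr T.r_distr \<chi>0)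
  have "j \<otimes>\<^bsub>T\<^esub> t = j \<otimes>\<^bsub>T\<^esub> m \<oplus>\<^bsub>T\<^esub> const t \<odot>\<^bsub>T\<^esub> j"
    by (subst tm) (use cl c in \<open>simp add: T.r_distr T.smult_mult_right T.smult_closed\<close>)
  then show "\<chi> (j \<otimes>\<^bsub>T\<^esub> t) = const t \<otimes> \<chi> j"
    using cl c z functionalD[OF \<chi>] by (simp add: T.smult_closed)
  have "t \<otimes>\<^bsub>T\<^esub> j = m \<otimes>\<^bsub>T\<^esub> j \<oplus>\<^bsub>T\<^esub> const t \<odot>\<^bsub>T\<^esub> j"
    by (subst tm) (use cl c in \<open>simp add: T.l_distr T.smult_mult_left T.smult_closed\<close>)
  then show "\<chi> (t \<otimes>\<^bsub>T\<^esub> j) = const t \<otimes> \<chi> j"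
    using cl c z functionalD[OF \<chi>] by (simp add: T.smult_closed)
qed

end

section \<open>The bound on the number of generators\<close>

lemma Image_equiv_class_eq:
  assumes "equiv X E" "C \<in> X // E" "x \<in> C" shows "C = E `` {x}"
  using assms by (metis Image_singleton_iff equiv_class_eq quotientE)

context universal_setup
begin

definition null_on :: "((nat \<Rightarrow> (nat list \<Rightarrow> 'k) set) \<Rightarrow> 'k) \<Rightarrow> nat \<Rightarrow> bool" where
  "null_on \<chi> n \<longleftrightarrow> functional K T \<chi> \<and> (\<forall>t\<in>small_ideal n. \<chi> t = \<zero>)"

end

locale trunc_setup = universal_setup K r R F d I U
  for K :: "'k ring" (structure) and r and R :: "('k, 'r) module"
    and F :: "int \<Rightarrow> ('r, 'm) module" and d and I U +
  fixes n N \<kappa> \<sigma>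
  assumes n: "2 \<le> n" and coords': "coords K T N \<kappa> \<sigma>"
    and ker: "\<And>t. t \<in> carrier T \<Longrightarrow> \<kappa> t = (\<lambda>_. \<zero>) \<longleftrightarrow> t \<in> trunc_ideal n"
begin

lemma ker_eq: "{t \<in> carrier T. \<kappa> t = (\<lambda>_. \<zero>)} = trunc_ideal n"
  using ker ideal.Icarr[OF trunc_ideal] by blast

lemma pow_trunc: "t \<in> ideal_pow T \<mm> n \<Longrightarrow> t \<in> trunc_ideal n"
  unfolding trunc_ideal_def by (rule T.ideal_sum_right[OF I ideal_pow_ideal])

lemma I_trunc: "t \<in> I \<Longrightarrow> t \<in> trunc_ideal n"
  unfolding trunc_ideal_def by (rule T.ideal_sum_left[OF I ideal_pow_ideal])

sublocale coord_quotient K r N \<kappa> \<sigma> n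
proof (intro coord_quotient.intro coord_quotient_axioms.intro power_series_axioms)
  show "coords K T N \<kappa> \<sigma>" by (rule coords')
  show "ideal {t \<in> carrier T. \<kappa> t = (\<lambda>_. \<zero>)} T" unfolding ker_eq by (rule trunc_ideal)
  show "\<kappa> t = (\<lambda>_. \<zero>)" if "t \<in> ideal_pow T \<mm> n" for t
    using pow_trunc[OF that] ker ideal.Icarr[OF trunc_ideal] by blast
  show "t \<in> \<mm>" if "t \<in> carrier T" "\<kappa> t = (\<lambda>_. \<zero>)" for t
    using that ker trunc_ideal_\<mm>[OF n] by blast
qed

lemma I_ker: "t \<in> I \<Longrightarrow> \<kappa> t = (\<lambda>_. \<zero>)"
  using I_trunc ker ideal.Icarr[OF I] by blast

abbreviation "f0 \<equiv> quot_hom I"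

lemma f0: "t \<in> carrier T \<Longrightarrow> f0 (I +>\<^bsub>T\<^esub> t) = \<kappa> t" "f0 \<in> alg_homs K P A"
  using quot_hom[OF I] I_ker by blast+

lemma bij: "artinian_local_algebra K B \<Longrightarrow>
    bij_betw (lift_transformation K R F d B P U) (alg_homs K P B) (lift_functor K R F d B)"
  for B :: "('k, nat \<Rightarrow> 'k) module"
  using universal by (simp add: universal_lift_def)

lemma natural: "artinian_local_algebra K B \<Longrightarrow> artinian_local_algebra K C \<Longrightarrow> h \<in> alg_homs K B C \<Longrightarrow>
    f \<in> alg_homs K P B \<Longrightarrow> lift_transformation K R F d C P U (compose (carrier P) h f) =
      lift_functor_map K R F d C B h (lift_transformation K R F d B P U f)"
  for B C :: "('k, nat \<Rightarrow> 'k) module"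
  using universal unfolding universal_lift_def by blast

lemma exists_lift: "\<exists>\<Delta>\<in>artinian_lifts K R F d A.
    lift_transformation K R F d A P U f0 = lift_iso K R F d A `` {\<Delta>}"
proof -
  have "lift_transformation K R F d A P U f0 \<in> artinian_lifts K R F d A // lift_iso K R F d A"
    using bij_betwE[OF bij[OF artinian_A]] f0(2) unfolding lift_functor_def by blast
  then show ?thesis by (rule quotientE) blast
qed

end

locale trunc_lift = trunc_setup K r R F d I U n N \<kappa> \<sigma>
  for K :: "'k ring" (structure) and r and R :: "('k, 'r) module"
    and F :: "int \<Rightarrow> ('r, 'm) module" and d and I U n N \<kappa> \<sigma> +
  fixes \<Delta> :: "int \<Rightarrow> ('m, nat \<Rightarrow> 'k) tensor \<Rightarrow> ('m, nat \<Rightarrow> 'k) tensor"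
  assumes \<Delta>: "\<Delta> \<in> artinian_lifts K R F d A"
    and f0_\<Delta>: "lift_transformation K R F d A P U f0 = lift_iso K R F d A `` {\<Delta>}"
begin

sublocale O: obstruction K R F d A T \<kappa> \<sigma> const \<Delta>
proof (intro obstruction.intro obstruction_axioms.intro complex_setup_axioms)
  show "nc_algebra K A" by (rule nc_algebra_A)
  show "nc_algebra K T" by (rule nc_algebra_T)
  show "\<kappa> \<in> module_hom K T A" by (rule \<kappa>_hom)
  show "\<sigma> \<in> module_hom K A T" by (rule \<sigma>_hom)
qed (auto simp: \<kappa>_mult \<kappa>_\<sigma> const_functional const_one const_mult residue_\<kappa> \<Delta>)

lemma small: "null_on \<chi> n \<Longrightarrow> O.small \<chi>"
  using small_functional[of \<chi> n] ker by (auto simp: O.small_def null_on_def)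

end

text \<open>Subtracting the part of \<psi> that \<kappa> determines makes it vanish on the image of
  \<sigma>, as \<open>coords_append\<close> demands, and leaves it unchanged on the kernel of
  \<kappa>.\<close>

lemma functional_residual:
  assumes K: "cring K" and T: "module K T" and co: "coords K T N \<kappa> \<sigma>" and \<psi>: "functional K T \<psi>"
  shows "functional K T (\<lambda>t. \<psi> t \<ominus>\<^bsub>K\<^esub> \<psi> (\<sigma> (\<kappa> t)))"
proof -
  interpret K: cring K by (rule K)
  interpret T: module K T by (rule T)
  note X = functionalD[OF \<psi>]
  note k = module_homD[OF conjunct1[OF co[unfolded coords_def]]]
  note g = module_homD[OF conjunct1[OF conjunct2[OF co[unfolded coords_def]]]]
  have sk: "\<sigma> (\<kappa> t) \<in> carrier T" if "t \<in> carrier T" for t using that k(1) g(1) by blast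
  have 1: "\<psi> (\<sigma> (\<kappa> (t \<oplus>\<^bsub>T\<^esub> u))) = \<psi> (\<sigma> (\<kappa> t)) \<oplus>\<^bsub>K\<^esub> \<psi> (\<sigma> (\<kappa> u))" if "t \<in> carrier T" "u \<in> carrier T" for t u
    unfolding k(2)[OF that] g(2)[OF k(1)[OF that(1)] k(1)[OF that(2)]]
    by (rule X(2)[OF sk[OF that(1)] sk[OF that(2)]])
  have 2: "\<psi> (\<sigma> (\<kappa> (c \<odot>\<^bsub>T\<^esub> t))) = c \<otimes>\<^bsub>K\<^esub> \<psi> (\<sigma> (\<kappa> t))" if "c \<in> carrier K" "t \<in> carrier T" for c t
    unfolding k(3)[OF that] g(3)[OF that(1) k(1)[OF that(2)]] by (rule X(3)[OF that(1) sk[OF that(2)]])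
  show ?thesis
    unfolding functional_def
    by (auto simp: X 1 2 sk K.minus_eq K.minus_add K.a_ac K.r_distr K.r_minus)
qed

text \<open>If \<open>g x = \<kappa> (x + l)\<close> and \<open>g y = \<kappa> (y + l')\<close>, the cross terms of \<open>g (x y)\<close> vanish.\<close>

lemma (in coord_quotient) agree_on_ideal_pow_2:
  assumes g: "\<And>t. t \<in> carrier T \<Longrightarrow> g t \<in> carrier A"
      "\<And>t u. t \<in> carrier T \<Longrightarrow> u \<in> carrier T \<Longrightarrow> g (t \<oplus>\<^bsub>T\<^esub> u) = g t \<oplus>\<^bsub>A\<^esub> g u"
      "\<And>t u. t \<in> carrier T \<Longrightarrow> u \<in> carrier T \<Longrightarrow> g (t \<otimes>\<^bsub>T\<^esub> u) = g t \<otimes>\<^bsub>A\<^esub> g u"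
    and L: "L \<subseteq> \<mm>" and Lm: "\<And>x y. x \<in> L \<Longrightarrow> y \<in> \<mm> \<Longrightarrow> \<kappa> (x \<otimes>\<^bsub>T\<^esub> y) = (\<lambda>_. \<zero>)"
      "\<And>x y. x \<in> L \<Longrightarrow> y \<in> \<mm> \<Longrightarrow> \<kappa> (y \<otimes>\<^bsub>T\<^esub> x) = (\<lambda>_. \<zero>)"
    and gL: "\<And>t. t \<in> carrier T \<Longrightarrow> \<exists>l\<in>L. g t = \<kappa> t \<oplus>\<^bsub>A\<^esub> \<kappa> l"
    and t: "t \<in> ideal_pow T \<mm> 2"
  shows "g t = \<kappa> t"
proof -
  interpret M: ideal \<mm> T by (rule \<mm>_ideal)
  have pr: "g (x \<otimes>\<^bsub>T\<^esub> y) = \<kappa> (x \<otimes>\<^bsub>T\<^esub> y)" if x: "x \<in> \<mm>" and y: "y \<in> \<mm>" for x y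
  proof -
    obtain l where l: "l \<in> L" "g x = \<kappa> x \<oplus>\<^bsub>A\<^esub> \<kappa> l" using gL[OF M.Icarr[OF x]] by blast
    obtain l' where l': "l' \<in> L" "g y = \<kappa> y \<oplus>\<^bsub>A\<^esub> \<kappa> l'" using gL[OF M.Icarr[OF y]] by blast
    have lm: "l \<in> \<mm>" "l' \<in> \<mm>" using l l' L by auto
    note cl = M.Icarr[OF x] M.Icarr[OF y] M.Icarr[OF lm(1)] M.Icarr[OF lm(2)]
    have ka: "\<kappa> a \<oplus>\<^bsub>A\<^esub> \<kappa> b = \<kappa> (a \<oplus>\<^bsub>T\<^esub> b)" if "a \<in> carrier T" "b \<in> carrier T" for a b
      using k(2)[OF that] by simp
    have "g (x \<otimes>\<^bsub>T\<^esub> y) = \<kappa> (x \<oplus>\<^bsub>T\<^esub> l) \<otimes>\<^bsub>A\<^esub> \<kappa> (y \<oplus>\<^bsub>T\<^esub> l')"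
      unfolding g(3)[OF cl(1,2)] l(2) l'(2) ka[OF cl(1,3)] ka[OF cl(2,4)] ..
    also have "\<dots> = \<kappa> ((x \<oplus>\<^bsub>T\<^esub> l) \<otimes>\<^bsub>T\<^esub> (y \<oplus>\<^bsub>T\<^esub> l'))"
      using cl by (intro \<kappa>_mult[symmetric]) simp_all
    also have "(x \<oplus>\<^bsub>T\<^esub> l) \<otimes>\<^bsub>T\<^esub> (y \<oplus>\<^bsub>T\<^esub> l')
        = x \<otimes>\<^bsub>T\<^esub> y \<oplus>\<^bsub>T\<^esub> (x \<otimes>\<^bsub>T\<^esub> l' \<oplus>\<^bsub>T\<^esub> (l \<otimes>\<^bsub>T\<^esub> y \<oplus>\<^bsub>T\<^esub> l \<otimes>\<^bsub>T\<^esub> l'))"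
      using cl by (simp add: T.l_distr T.r_distr T.a_ac)
    also have "\<kappa> \<dots> = \<kappa> (x \<otimes>\<^bsub>T\<^esub> y) \<oplus>\<^bsub>A\<^esub> (\<kappa> (x \<otimes>\<^bsub>T\<^esub> l') \<oplus>\<^bsub>A\<^esub> (\<kappa> (l \<otimes>\<^bsub>T\<^esub> y) \<oplus>\<^bsub>A\<^esub> \<kappa> (l \<otimes>\<^bsub>T\<^esub> l')))"
      using cl by (simp add: ka del: coord_algebra_simps)
    also have "\<dots> = \<kappa> (x \<otimes>\<^bsub>T\<^esub> y)"
      using Lm(2)[OF l'(1) x] Lm(1)[OF l(1) y] Lm(1)[OF l(1) lm(2)]
        k(1)[OF T.m_closed[OF cl(1,2)]] by (simp add: vec_space_carrier)
    finally show ?thesis .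
  qed
  have m1: "ideal_prod T (carrier T) \<mm> \<subseteq> \<mm>"
    by (rule T.ideal_prod_least[OF \<mm>_ideal M.I_l_closed])
  have "t \<in> ideal_prod T (ideal_prod T (carrier T) \<mm>) \<mm>" using t by (simp add: numeral_2_eq_2)
  then show ?thesis
  proof induction
    case (prod i j) then show ?case using m1 by (blast intro: pr)
  next
    case (sum a b)
    then have "a \<in> carrier T" "b \<in> carrier T"
      using ideal.Icarr[OF T.ideal_prod_is_ideal[OF T.ideal_prod_is_ideal[OF T.oneideal \<mm>_ideal] \<mm>_ideal]] by blast+
    then show ?case using g(2) k(2) sum by simp
  qed
qed

context trunc_lift
begin

lemma pow_small: "t \<in> ideal_pow T \<mm> n \<Longrightarrow> t \<in> small_ideal n"
  unfolding small_ideal_def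
  by (intro T.ideal_sum_right ideal_pow_ideal T.add_ideals T.ideal_prod_is_ideal I \<mm>_ideal)

lemma not_null_homotopic:
  assumes \<chi>: "null_on \<chi> n" and e: "e \<in> I" "\<chi> e = \<one>"
  shows "O.obs \<chi> \<notin> null_homotopic R F d (- 2)"
proof
  assume null: "O.obs \<chi> \<in> null_homotopic R F d (- 2)"
  note \<chi>f = conjunct1[OF \<chi>[unfolded null_on_def]]
  note X = functionalD[OF \<chi>f]
  have sm: "O.small \<chi>" by (rule small[OF \<chi>])
  have sm1: "\<chi> (j \<otimes>\<^bsub>T\<^esub> t) = const t \<otimes> \<chi> j" "\<chi> (t \<otimes>\<^bsub>T\<^esub> j) = const t \<otimes> \<chi> j"
    if "j \<in> trunc_ideal n" "t \<in> carrier T" for j t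
    using small_functional[OF \<chi>f _ that] \<chi> by (auto simp: null_on_def)
  interpret J: ideal "trunc_ideal n" T by (rule trunc_ideal)
  have ec: "e \<in> carrier T" using e(1) I_trunc J.Icarr by blast
  have \<kappa>e: "\<kappa> e = (\<lambda>_. \<zero>)" by (rule I_ker[OF e(1)])
  \<comment> \<open>\<chi> itself need not vanish on the image of \<sigma>. Its residual does, and
    agrees with \<chi> on J; as an extra coordinate it therefore presents T modulo the intersection
    of J with the kernel of \<chi>.\<close>
  define \<psi>' where "\<psi>' t = \<chi> t \<ominus> \<chi> (\<sigma> (\<kappa> t))" for t
  define \<theta> where "\<theta> = append_coord N \<kappa> \<psi>'"
  define \<rho> where "\<rho> = append_vec K T N \<sigma> e"
  have \<psi>'f: "functional K T \<psi>'"
    unfolding \<psi>'_def by (rule functional_residual[OF is_cring T.module_axioms coords' \<chi>f])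
  have \<psi>'0: "\<psi>' t = \<chi> t" if "t \<in> carrier T" "\<kappa> t = (\<lambda>_. \<zero>)" for t
  proof -
    have "\<sigma> (\<lambda>_. \<zero>) = \<zero>\<^bsub>T\<^esub>"
      using module_hom_zero[OF V_module T.module_axioms \<sigma>] by simp
    then show ?thesis
      using that X(1)[OF that(1)] functional_zero[OF T.module_axioms \<chi>f] by (simp add: \<psi>'_def minus_eq)
  qed
  have co: "coords K T (Suc N) \<theta> \<rho>"
    unfolding \<theta>_def \<rho>_def
  proof (rule coords_append[OF T.module_axioms coords' \<psi>'f])
    show "\<psi>' (\<sigma> v) = \<zero>" if "v \<in> carrier V" for v
      using X(1)[OF g(1)[OF that]] by (simp add: \<psi>'_def \<kappa>_\<sigma>[OF that] minus_eq r_neg)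
    show "e \<in> carrier T" "\<kappa> e = (\<lambda>_. \<zero>)" by (rule ec, rule \<kappa>e)
    show "\<psi>' e = \<one>" using \<psi>'0[OF ec \<kappa>e] e(2) by simp
  qed
  have ker\<theta>: "\<theta> t = (\<lambda>_. \<zero>) \<longleftrightarrow> t \<in> trunc_ideal n \<and> \<chi> t = \<zero>" if t: "t \<in> carrier T" for t
  proof -
    have "\<kappa> t N = \<zero>" using k(1)[OF t] by (simp add: vec_space_carrier)
    then have "\<theta> t = (\<lambda>_. \<zero>) \<longleftrightarrow> \<kappa> t = (\<lambda>_. \<zero>) \<and> \<psi>' t = \<zero>"
      unfolding \<theta>_def append_coord_def fun_eq_iff by (auto split: if_splits)
    then show ?thesis using ker[OF t] \<psi>'0[OF t] by auto
  qed
  have Q: "coord_quotient K r (Suc N) \<theta> \<rho> n"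
  proof (intro coord_quotient.intro coord_quotient_axioms.intro power_series_axioms)
    show "coords K T (Suc N) \<theta> \<rho>" by (rule co)
    show "ideal {t \<in> carrier T. \<theta> t = (\<lambda>_. \<zero>)} T"
    proof (rule idealI[OF T.ring_axioms])
      note neg = functional_minus[OF T.module_axioms \<chi>f T.zero_closed]
      note zero = functional_zero[OF T.module_axioms \<chi>f]
      show "subgroup {t \<in> carrier T. \<theta> t = (\<lambda>_. \<zero>)} (add_monoid T)"
      proof (rule T.add.subgroupI)
        show "{t \<in> carrier T. \<theta> t = (\<lambda>_. \<zero>)} \<noteq> {}"
          using zero J.zero_closed by (auto simp: ker\<theta> intro!: exI[of _ "\<zero>\<^bsub>T\<^esub>"])
        fix a assume a: "a \<in> {t \<in> carrier T. \<theta> t = (\<lambda>_. \<zero>)}"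
        then have a': "a \<in> carrier T" "a \<in> trunc_ideal n" "\<chi> a = \<zero>" using ker\<theta> by blast+
        have "\<chi> (\<ominus>\<^bsub>T\<^esub> a) = \<zero>" using a' neg[of a] zero by (simp add: T.minus_eq minus_eq)
        then show "\<ominus>\<^bsub>T\<^esub> a \<in> {t \<in> carrier T. \<theta> t = (\<lambda>_. \<zero>)}"
          using a' by (simp add: ker\<theta> J.a_inv_closed)
        show "a \<oplus>\<^bsub>T\<^esub> b \<in> {t \<in> carrier T. \<theta> t = (\<lambda>_. \<zero>)}" if "b \<in> {t \<in> carrier T. \<theta> t = (\<lambda>_. \<zero>)}" for b
        proof -
          have "b \<in> carrier T" "b \<in> trunc_ideal n" "\<chi> b = \<zero>" using that ker\<theta> by blast+
          then show ?thesis using a' by (simp add: ker\<theta> J.a_closed X)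
        qed
      qed auto
      fix a x assume a: "a \<in> {t \<in> carrier T. \<theta> t = (\<lambda>_. \<zero>)}" and x: "x \<in> carrier T"
      have c: "const x \<in> carrier K" by (rule functionalD(1)[OF const_functional x])
      show "x \<otimes>\<^bsub>T\<^esub> a \<in> {t \<in> carrier T. \<theta> t = (\<lambda>_. \<zero>)}" "a \<otimes>\<^bsub>T\<^esub> x \<in> {t \<in> carrier T. \<theta> t = (\<lambda>_. \<zero>)}"
        using a x c by (auto simp: ker\<theta> sm1 J.I_l_closed J.I_r_closed)
    qed
    show "\<theta> t = (\<lambda>_. \<zero>)" if t: "t \<in> ideal_pow T \<mm> n" for t
      using ker\<theta> pow_trunc[OF t] pow_small[OF t] J.Icarr \<chi> by (auto simp: null_on_def)
    show "t \<in> \<mm>" if "t \<in> carrier T" "\<theta> t = (\<lambda>_. \<zero>)" for t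
      using that ker\<theta> trunc_ideal_\<mm>[OF n] by blast
  qed
  interpret B: coord_quotient K r "Suc N" \<theta> \<rho> n by (rule Q)
  \<comment> \<open>Dropping the last coordinate is the projection of the small extension onto
    A.\<close>
  define h where "h = (\<lambda>v\<in>carrier B.A. v(N := \<zero>))"
  have h\<theta>: "h (\<theta> t) = \<kappa> t" if t: "t \<in> carrier T" for t
  proof -
    have "\<kappa> t N = \<zero>" using k(1)[OF t] by (simp add: vec_space_carrier)
    then show ?thesis using B.k(1)[OF t]
      by (simp add: h_def) (simp add: \<theta>_def append_coord_def fun_upd_idem)
  qed
  have h: "h \<in> alg_homs K B.A A"
  proof (rule alg_homsI)
    show "h \<in> extensional (carrier B.A)" by (simp add: h_def)
    show "h \<one>\<^bsub>B.A\<^esub> = \<one>\<^bsub>A\<^esub>" by (simp add: h\<theta>)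
    fix v assume "v \<in> carrier B.A"
    then obtain t where t: "t \<in> carrier T" "v = \<theta> t" using B.A_rep by blast
    show "h v \<in> carrier A" unfolding t(2) h\<theta>[OF t(1)] using k(1)[OF t(1)] by simp
    show "h (c \<odot>\<^bsub>B.A\<^esub> v) = c \<odot>\<^bsub>A\<^esub> h v" if c: "c \<in> carrier K" for c
      using h\<theta>[OF T.smult_closed[OF c t(1)]] k(3)[OF c t(1)] B.k(3)[OF c t(1)] h\<theta>[OF t(1)] t(2) by simp
    fix w assume "w \<in> carrier B.A"
    then obtain u where u: "u \<in> carrier T" "w = \<theta> u" using B.A_rep by blast
    show "h (v \<otimes>\<^bsub>B.A\<^esub> w) = h v \<otimes>\<^bsub>A\<^esub> h w"
      unfolding t(2) u(2) B.\<kappa>_mult[OF t(1) u(1), symmetric] h\<theta>[OF T.m_closed[OF t(1) u(1)]]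
        h\<theta>[OF t(1)] h\<theta>[OF u(1)] by (rule \<kappa>_mult[OF t(1) u(1)])
    show "h (v \<oplus>\<^bsub>B.A\<^esub> w) = h v \<oplus>\<^bsub>A\<^esub> h w"
      using h\<theta>[OF T.a_closed[OF t(1) u(1)]] k(2)[OF t(1) u(1)] B.k(2)[OF t(1) u(1)] h\<theta>[OF t(1)] h\<theta>[OF u(1)] t(2) u(2)
      by simp
  qed
  obtain \<eta> where \<eta>: "\<And>i. \<eta> i \<in> lmod_hom R (F i) (F (i - 1))"
    and \<eta>_eq: "\<And>i x. x \<in> carrier (F i) \<Longrightarrow>
      O.obs \<chi> i x = \<eta> (i - 1) (d i x) \<oplus>\<^bsub>F (i - 2)\<^esub> d (i - 1) (\<eta> i x)"
  proof -
    from null have "\<exists>h. (\<forall>n. h n \<in> lmod_hom R (F n) (F (n - 1))) \<and> (\<forall>n. \<forall>x\<in>carrier (F n).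
        O.obs \<chi> n x = h (n - 1) (d n x) \<oplus>\<^bsub>F (n - 2)\<^esub> d (n - 1) (h n x))"
      unfolding null_homotopic_2 by (rule conjunct2)
    then show thesis by (elim exE conjE) (rule that, simp_all)
  qed
  \<comment> \<open>The locale wants an element on which \<chi> is -1, hence the negative of
    e.\<close>
  interpret C: correction K R F d A T \<kappa> \<sigma> const \<Delta> B.A \<theta> h \<chi> "\<ominus>\<^bsub>T\<^esub> e" \<eta>
  proof (intro correction.intro correction_axioms.intro O.obstruction_axioms)
    show "nc_algebra K B.A" by (rule B.nc_algebra_A)
    show "\<theta> \<in> module_hom K T B.A" by (rule B.\<kappa>_hom)
    show "\<theta> ` carrier T = carrier B.A" by (rule B.\<kappa>_surj)
    show "h \<in> module_hom K B.A A" by (rule module_homI) (rule alg_homsD[OF h]; assumption)+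
    show "\<theta> t = \<theta> u" if "t \<in> carrier T" "u \<in> carrier T" "\<kappa> t = \<kappa> u" "\<chi> t = \<chi> u" for t u
      using that(3,4) by (simp add: \<theta>_def append_coord_def \<psi>'_def)
    show "functional K B.A (residue K B.A)"
    proof (unfold functional_def, intro conjI ballI funcsetI)
      fix v assume "v \<in> carrier B.A"
      then obtain t where t: "t \<in> carrier T" "v = \<theta> t" using B.A_rep by blast
      show "residue K B.A v \<in> carrier K"
        unfolding t(2) B.residue_\<kappa>[OF t(1)] by (rule functionalD(1)[OF const_functional t(1)])
      show "residue K B.A (c \<odot>\<^bsub>B.A\<^esub> v) = c \<otimes> residue K B.A v" if c: "c \<in> carrier K" for c
        using B.residue_\<kappa>[OF T.smult_closed[OF c t(1)]] B.k(3)[OF c t(1)]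
          functionalD(3)[OF const_functional c t(1)] B.residue_\<kappa>[OF t(1)] t(2) by simp
      fix w assume "w \<in> carrier B.A"
      then obtain u where u: "u \<in> carrier T" "w = \<theta> u" using B.A_rep by blast
      show "residue K B.A (v \<oplus>\<^bsub>B.A\<^esub> w) = residue K B.A v \<oplus> residue K B.A w"
        using B.residue_\<kappa>[OF T.a_closed[OF t(1) u(1)]] B.k(2)[OF t(1) u(1)]
          functionalD(2)[OF const_functional t(1) u(1)] B.residue_\<kappa>[OF t(1)] B.residue_\<kappa>[OF u(1)] t(2) u(2) by simp
    qed
    have "\<kappa> (\<ominus>\<^bsub>T\<^esub> e) = (\<lambda>_. \<zero>)"
      by (rule I_ker[OF additive_subgroup.a_inv_closed[OF ideal.axioms(1)[OF I] e(1)]])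
    then show "\<kappa> (\<ominus>\<^bsub>T\<^esub> e) = \<zero>\<^bsub>A\<^esub>" by simp
    show "\<chi> (\<ominus>\<^bsub>T\<^esub> e) = \<ominus> \<one>"
      using functional_minus[OF T.module_axioms \<chi>f T.zero_closed ec] functional_zero[OF T.module_axioms \<chi>f] ec e(2)
      by (simp add: T.minus_eq minus_eq)
    show "h (v \<otimes>\<^bsub>B.A\<^esub> w) = h v \<otimes>\<^bsub>A\<^esub> h w" if "v \<in> carrier B.A" "w \<in> carrier B.A" for v w
      by (rule alg_homsD(2)[OF h that])
  qed (simp_all add: B.\<kappa>_mult B.residue_\<kappa> h\<theta> sm ec \<eta> \<eta>_eq del: coord_algebra_simps, simp)
  note art = B.artinian_A
  have cl: "lift_iso K R F d B.A `` {C.\<Delta>'} \<in> lift_functor K R F d B.A"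
    unfolding lift_functor_def by (rule quotientI[OF C.\<Delta>'_lift])
  obtain f where f: "f \<in> alg_homs K P B.A"
    and f\<Delta>': "lift_transformation K R F d B.A P U f = lift_iso K R F d B.A `` {C.\<Delta>'}"
  proof -
    have "lift_iso K R F d B.A `` {C.\<Delta>'} \<in> lift_transformation K R F d B.A P U ` alg_homs K P B.A"
      unfolding bij_betw_imp_surj_on[OF bij[OF art]] by (rule cl)
    then show thesis by (rule imageE) (rule that, simp_all only:)
  qed
  have hf: "compose (carrier P) h f \<in> alg_homs K P A"
    by (rule alg_homs_compose[OF nc_algebra_quot_T[OF I] f h])
  have "lift_transformation K R F d A P U (compose (carrier P) h f)
      = lift_functor_map K R F d A B.A h (lift_iso K R F d B.A `` {C.\<Delta>'})"
    unfolding natural[OF art artinian_A h f] f\<Delta>' ..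
  \<comment> \<open>The corrected lift base changes to \<Delta>, so by naturality the composite of f
    and h is sent to the class of \<Delta>.\<close>
  moreover have "\<Delta> \<in> \<dots>"
  proof -
    note eB = equiv_class_self[OF equiv_lift_iso[OF B.nc_algebra_A] C.\<Delta>'_lift]
    note eA = equiv_class_self[OF equiv_lift_iso[OF nc_algebra_A] \<Delta>]
    show ?thesis unfolding lift_functor_map_def using eA eB C.\<Delta>'_base_change by blast
  qed
  moreover have "lift_transformation K R F d A P U (compose (carrier P) h f) \<in> lift_functor K R F d A"
    using bij_betwE[OF bij[OF artinian_A]] hf by blast
  ultimately have "lift_transformation K R F d A P U (compose (carrier P) h f)
      = lift_iso K R F d A `` {\<Delta>}"
    unfolding lift_functor_def
    by (intro Image_equiv_class_eq[OF equiv_lift_iso[OF nc_algebra_A]]) simp_all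
  \<comment> \<open>Injectivity of the transformation at A: the composite and the projection
    \<open>f0\<close> are sent to the same class of lifts.\<close>
  then have hf0: "compose (carrier P) h f = f0"
    using bij_betw_imp_inj_on[OF bij[OF artinian_A]] hf f0(2) f0_\<Delta> by (simp add: inj_on_def)
  \<comment> \<open>The composite T -> P -> B. It agrees with \<theta> up to the image of J, and
    products of J with \<mm> vanish in B.\<close>
  define u where "u t = f (I +>\<^bsub>T\<^esub> t)" for t
  note q = quot_T[OF I]
  have u: "u t = \<theta> t" if "t \<in> ideal_pow T \<mm> 2" for t
  proof (rule B.agree_on_ideal_pow_2[OF _ _ _ trunc_ideal_\<mm>[OF n] _ _ _ that])
    fix t assume t: "t \<in> carrier T"
    show ut: "u t \<in> carrier B.A" unfolding u_def by (rule alg_homsD(1)[OF f q(2)[OF t]])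
    show "u (t \<oplus>\<^bsub>T\<^esub> s) = u t \<oplus>\<^bsub>B.A\<^esub> u s" if s: "s \<in> carrier T" for s
      unfolding u_def q(4)[OF t s, symmetric] by (rule alg_homsD(3)[OF f q(2)[OF t] q(2)[OF s]])
    show "u (t \<otimes>\<^bsub>T\<^esub> s) = u t \<otimes>\<^bsub>B.A\<^esub> u s" if s: "s \<in> carrier T" for s
      unfolding u_def q(3)[OF t s, symmetric] by (rule alg_homsD(2)[OF f q(2)[OF t] q(2)[OF s]])
    have hu: "h (u t) = \<kappa> t"
      using fun_cong[OF hf0, of "I +>\<^bsub>T\<^esub> t"] q(2)[OF t] f0(1)[OF t] unfolding u_def compose_def
      by (simp del: quot_simps)
    obtain s where s: "s \<in> carrier T" "u t = \<theta> s" using B.A_rep[OF ut] by blast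
    have "\<kappa> s = \<kappa> t" using hu h\<theta>[OF s(1)] s(2) by simp
    then have "\<kappa> (s \<ominus>\<^bsub>T\<^esub> t) = (\<lambda>_. \<zero>)" using \<kappa>_eq_iff[OF s(1) t] by blast
    then have "s \<ominus>\<^bsub>T\<^esub> t \<in> trunc_ideal n" using ker s(1) t by simp
    moreover have "u t = \<theta> t \<oplus>\<^bsub>B.A\<^esub> \<theta> (s \<ominus>\<^bsub>T\<^esub> t)"
    proof -
      have "s = t \<oplus>\<^bsub>T\<^esub> (s \<ominus>\<^bsub>T\<^esub> t)" using s(1) t by (simp add: T.minus_eq T.a_lcomm[of t s] T.r_neg)
      then have "\<theta> s = \<theta> (t \<oplus>\<^bsub>T\<^esub> (s \<ominus>\<^bsub>T\<^esub> t))" by (rule arg_cong)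
      then show ?thesis using B.k(2)[OF t T.minus_closed[OF s(1) t]] s(2) by simp
    qed
    ultimately show "\<exists>l\<in>trunc_ideal n. u t = \<theta> t \<oplus>\<^bsub>B.A\<^esub> \<theta> l" by blast
  next
    fix x y assume x: "x \<in> trunc_ideal n" and y: "y \<in> \<mm>"
    have c: "y \<in> carrier T" "const y = \<zero>" using y by (simp_all add: \<mm>_def)
    have "\<chi> x \<in> carrier K" using X(1) x J.Icarr by blast
    then show "\<theta> (x \<otimes>\<^bsub>T\<^esub> y) = (\<lambda>_. \<zero>)" "\<theta> (y \<otimes>\<^bsub>T\<^esub> x) = (\<lambda>_. \<zero>)"
      using x c J.Icarr[OF x] by (simp_all add: ker\<theta> sm1 J.I_l_closed J.I_r_closed)
  qed
  \<comment> \<open>e is zero in P because it lies in I, while \<theta> e is nonzero because \<chi>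
    e = 1.\<close>
  have "u e = (\<lambda>_. \<zero>)"
  proof -
    interpret Q: nc_algebra K P by (rule nc_algebra_quot_T[OF I])
    have "I +>\<^bsub>T\<^esub> e = \<zero>\<^bsub>P\<^esub>" using quot_class_zero_iff[OF ideal_submodule[OF I] ec] e(1) by blast
    moreover have "f \<in> module_hom K P B.A" by (rule module_homI) (rule alg_homsD[OF f]; assumption)+
    then have "f \<zero>\<^bsub>P\<^esub> = \<zero>\<^bsub>B.A\<^esub>" by (rule module_hom_zero[OF Q.module_axioms B.A.module_axioms])
    ultimately show ?thesis by (simp add: u_def del: quot_simps)
  qed
  then have "\<theta> e = (\<lambda>_. \<zero>)" using u I_sub e(1) by auto
  then show False using ker\<theta>[OF ec] e(2) by simp
qed

end

section \<open>Linear combinations of dual functionals\<close>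

primrec dot :: "('k, 'e) ring_scheme \<Rightarrow> nat \<Rightarrow> (nat \<Rightarrow> 'k) \<Rightarrow> (nat \<Rightarrow> 'k) \<Rightarrow> 'k" where
  "dot K 0 a v = \<zero>\<^bsub>K\<^esub>"
| "dot K (Suc p) a v = dot K p a v \<oplus>\<^bsub>K\<^esub> a p \<otimes>\<^bsub>K\<^esub> v p"

context cring
begin

lemma dot_closed: "(\<And>i. a i \<in> carrier R) \<Longrightarrow> (\<And>i. v i \<in> carrier R) \<Longrightarrow> dot R p a v \<in> carrier R"
  by (induction p) auto

lemma dot_add_left: "(\<And>i. a i \<in> carrier R) \<Longrightarrow> (\<And>i. b i \<in> carrier R) \<Longrightarrow> (\<And>i. v i \<in> carrier R) \<Longrightarrow>
    dot R p (\<lambda>i. a i \<oplus> b i) v = dot R p a v \<oplus> dot R p b v"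
  by (induction p) (auto simp: dot_closed l_distr a_ac)

lemma dot_smult_left: "c \<in> carrier R \<Longrightarrow> (\<And>i. a i \<in> carrier R) \<Longrightarrow> (\<And>i. v i \<in> carrier R) \<Longrightarrow>
    dot R p (\<lambda>i. c \<otimes> a i) v = c \<otimes> dot R p a v"
  by (induction p) (auto simp: dot_closed r_distr m_assoc)

lemma dot_commute: "(\<And>i. a i \<in> carrier R) \<Longrightarrow> (\<And>i. v i \<in> carrier R) \<Longrightarrow> dot R p a v = dot R p v a"
  by (induction p) (auto simp: m_comm)

lemma dot_unit_vec: "(\<And>i. a i \<in> carrier R) \<Longrightarrow> dot R p a (unit_vec R j) = (if j < p then a j else \<zero>)"
  by (induction p) (auto simp: unit_vec_def less_Suc_eq)

lemma dot_zero: "(\<And>i. a i \<in> carrier R) \<Longrightarrow> dot R p a (\<lambda>_. \<zero>) = \<zero>"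
  by (induction p) auto

lemma dot_functional:
  assumes \<chi>: "\<chi> \<in> module_hom R T (vec_space R p)" and a: "\<And>i. a i \<in> carrier R"
  shows "functional R T (\<lambda>t. dot R p a (\<chi> t))"
proof -
  note h = module_homD[OF \<chi>]
  have c: "\<chi> t i \<in> carrier R" if "t \<in> carrier T" for t i using h(1)[OF that] by (simp add: vec_space_carrier)
  show ?thesis
    unfolding functional_def
    by (auto simp: c a h dot_closed dot_commute[of a] dot_add_left dot_smult_left)
qed

end

text \<open>\<open>ideal_pow\<close> multiplies by I on the right, so multiplication from the left
  takes an induction that reassociates the product.\<close>

lemma (in ring) ideal_mult_pow:
  assumes I: "ideal I R" and x: "x \<in> I"
  shows "q \<in> ideal_pow R I j \<Longrightarrow> x \<otimes> q \<in> ideal_pow R I (Suc j)"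
proof (induction j arbitrary: q)
  case 0
  interpret I: ideal I R by (rule I)
  have "\<one> \<otimes> (x \<otimes> q) \<in> ideal_pow R I (Suc 0)"
    unfolding ideal_pow.simps using 0 x by (intro ideal_prod.prod) (simp_all add: I.I_r_closed)
  then show ?case using 0 I.Icarr[OF x] by simp
next
  case (Suc j)
  interpret I: ideal I R by (rule I)
  interpret L: ideal "ideal_pow R I (Suc (Suc j))" R by (rule ideal_pow_is_ideal[OF I])
  have "q \<in> ideal_prod R (ideal_pow R I j) I" using Suc.prems by simp
  then show ?case
  proof induction
    case (prod a b)
    have ab: "a \<in> carrier R" "b \<in> carrier R" using prod ideal.Icarr[OF ideal_pow_is_ideal[OF I]] I.Icarr by blast+
    have "(x \<otimes> a) \<otimes> b \<in> ideal_pow R I (Suc (Suc j))"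
      unfolding ideal_pow.simps(2)[of _ _ "Suc j"] by (rule ideal_prod.prod[OF Suc.IH[OF prod(1)] prod(2)])
    then show ?case using ab I.Icarr[OF x] by (simp add: m_assoc)
  next
    case (sum a b)
    then have "a \<in> carrier R" "b \<in> carrier R"
      using ideal.Icarr[OF ideal_prod_is_ideal[OF ideal_pow_is_ideal[OF I] I]] by blast+
    then show ?case using sum L.a_closed I.Icarr[OF x] by (simp add: r_distr)
  qed
qed

context universal_setup
begin

text \<open>\<open>\<tau>\<close> lists \<open>p\<close> elements of \<open>I\<close> that are independent modulo \<open>\<mm>I + I\<mm> + \<mm>\<^sup>n\<close>, and \<open>\<chi>\<close> lists dual
  functionals.\<close>

definition dual_system where
  "dual_system n p \<chi> \<tau> \<longleftrightarrow> coords K T p \<chi> \<tau> \<and> (\<forall>v\<in>carrier (vec_space K p). \<tau> v \<in> I) \<and>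
     (\<forall>t\<in>small_ideal n. \<chi> t = (\<lambda>_. \<zero>))"

text \<open>The classes of the obstructions define a linear map from K^p to Ext^2. If p exceeded the
  dimension, some nonzero combination \<open>w a\<close> of the functionals would have a null
  homotopic obstruction, yet it takes the value 1 on I, against
  \<open>not_null_homotopic\<close>.\<close>

lemma dual_system_bound:
  assumes n: "2 \<le> n" and ds: "dual_system n p \<chi> \<tau>"
    and fd: "vectorspace.fin_dim K (Ext_space R F d 2)"
  shows "p \<le> vectorspace.dim K (Ext_space R F d 2)"
proof (rule ccontr)
  assume "\<not> p \<le> vectorspace.dim K (Ext_space R F d 2)"
  then have less: "vectorspace.dim K (Ext_space R F d 2) < p" by simp
  have co: "\<chi> \<in> module_hom K T (vec_space K p)" "\<tau> \<in> module_hom K (vec_space K p) T"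
    and \<chi>\<tau>: "\<And>v. v \<in> carrier (vec_space K p) \<Longrightarrow> \<chi> (\<tau> v) = v"
    and \<tau>I: "\<And>v. v \<in> carrier (vec_space K p) \<Longrightarrow> \<tau> v \<in> I"
    and \<chi>0: "\<And>t. t \<in> small_ideal n \<Longrightarrow> \<chi> t = (\<lambda>_. \<zero>)"
    using ds by (auto simp: dual_system_def coords_def)
  obtain N \<kappa> \<sigma> where cN: "coords K T N \<kappa> \<sigma>"
    and ker: "\<forall>t\<in>carrier T. \<kappa> t = (\<lambda>_. \<zero>) \<longleftrightarrow> t \<in> trunc_ideal n"
    using fincod_coords[OF field_axioms T.module_axioms fincod_trunc] by blast
  interpret S: trunc_setup K r R F d I U n N \<kappa> \<sigma>
    by (intro trunc_setup.intro trunc_setup_axioms.intro universal_setup_axioms n cN) (use ker in blast)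
  obtain \<Delta> where "\<Delta> \<in> artinian_lifts K R F d S.A"
    and "lift_transformation K R F d S.A P U S.f0 = lift_iso K R F d S.A `` {\<Delta>}"
    using S.exists_lift by blast
  then interpret L: trunc_lift K r R F d I U n N \<kappa> \<sigma> \<Delta>
    by (intro trunc_lift.intro trunc_lift_axioms.intro S.trunc_setup_axioms)
  define w where "w a t = dot K p a (\<chi> t)" for a t
  have c: "\<chi> t i \<in> carrier K" if "t \<in> carrier T" for t i
    using module_homD(1)[OF co(1) that] by (simp add: vec_space_carrier)
  have ac: "a i \<in> carrier K" if "a \<in> carrier (vec_space K p)" for a i
    using that by (simp add: vec_space_carrier)
  have wf: "functional K T (w a)" if "a \<in> carrier (vec_space K p)" for a
    unfolding w_def by (rule dot_functional[OF co(1) ac[OF that]])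
  have w: "null_on (w a) n" if "a \<in> carrier (vec_space K p)" for a
    using wf[OF that] dot_zero[OF ac[OF that]] by (simp add: null_on_def \<chi>0) (simp add: w_def \<chi>0)
  let ?C = "(graded_homs R F (- 2))\<lparr>carrier := chain_homs R F d (- 2)\<rparr>"
  let ?B = "null_homotopic R F d (- 2)"
  interpret V: module K "vec_space K p" by (rule vec_space_module)
  have oh: "(\<lambda>a. L.O.obs (w a)) \<in> module_hom K (vec_space K p) ?C"
  proof (rule module_homI)
    fix a assume a: "a \<in> carrier (vec_space K p)"
    show "L.O.obs (w a) \<in> carrier ?C" using L.O.obs_chain_homs[OF L.small[OF w[OF a]]] by simp
    show "L.O.obs (w (e \<odot>\<^bsub>vec_space K p\<^esub> a)) = e \<odot>\<^bsub>?C\<^esub> L.O.obs (w a)" if e: "e \<in> carrier K" for e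
      using L.O.obs_smult[OF wf[OF a] wf[OF V.smult_closed[OF e a]] e]
      by (simp add: w_def dot_smult_left e ac[OF a] c)
    fix b assume b: "b \<in> carrier (vec_space K p)"
    show "L.O.obs (w (a \<oplus>\<^bsub>vec_space K p\<^esub> b)) = L.O.obs (w a) \<oplus>\<^bsub>?C\<^esub> L.O.obs (w b)"
      using L.O.obs_add[OF wf[OF a] wf[OF b] wf[OF V.M.a_closed[OF a b]]]
      by (simp add: w_def dot_add_left ac[OF a] ac[OF b] c)
  qed
  note q = module_homD[OF quot_class_hom[OF null_homotopic_submodule]] and o = module_homD[OF oh]
  have "(\<lambda>a. ?B +>\<^bsub>?C\<^esub> L.O.obs (w a)) \<in> module_hom K (vec_space K p) (Ext_space R F d 2)"
    unfolding Ext_space_def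
  proof (rule module_homI)
    fix a assume a: "a \<in> carrier (vec_space K p)"
    show "?B +>\<^bsub>?C\<^esub> L.O.obs (w a) \<in> carrier (quot ?C ?B)" by (rule q(1)[OF o(1)[OF a]])
    show "?B +>\<^bsub>?C\<^esub> L.O.obs (w (e \<odot>\<^bsub>vec_space K p\<^esub> a)) = e \<odot>\<^bsub>quot ?C ?B\<^esub> (?B +>\<^bsub>?C\<^esub> L.O.obs (w a))"
      if e: "e \<in> carrier K" for e
      unfolding o(3)[OF e a] by (rule q(3)[OF e o(1)[OF a]])
    fix b assume b: "b \<in> carrier (vec_space K p)"
    show "?B +>\<^bsub>?C\<^esub> L.O.obs (w (a \<oplus>\<^bsub>vec_space K p\<^esub> b))
        = (?B +>\<^bsub>?C\<^esub> L.O.obs (w a)) \<oplus>\<^bsub>quot ?C ?B\<^esub> (?B +>\<^bsub>?C\<^esub> L.O.obs (w b))"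
      unfolding o(2)[OF a b] by (rule q(2)[OF o(1)[OF a] o(1)[OF b]])
  qed
  then obtain a where a: "a \<in> carrier (vec_space K p)" "a \<noteq> (\<lambda>_. \<zero>)"
    and ka: "?B +>\<^bsub>?C\<^esub> L.O.obs (w a) = \<zero>\<^bsub>Ext_space R F d 2\<^esub>"
    using exists_kernel_vec[OF Ext_vectorspace[OF field_axioms] fd less] by blast
  have "L.O.obs (w a) \<in> ?B"
    using ka quot_class_zero_iff[OF null_homotopic_submodule o(1)[OF a(1)]] by (simp only: Ext_space_def)
  moreover obtain j where j: "a j \<noteq> \<zero>" using a(2) by blast
  then have jp: "j < p" using a(1) by (auto simp: vec_space_carrier not_less[symmetric])
  \<comment> \<open>At the j-th dual vector \<open>w a\<close> has the value a j, so division by a j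
    gives the value 1.\<close>
  define e where "e = inv (a j) \<odot>\<^bsub>T\<^esub> \<tau> (unit_vec K j)"
  have aj: "a j \<in> carrier K" by (rule ac[OF a(1)])
  have ij: "inv (a j) \<in> carrier K" "inv (a j) \<otimes> a j = \<one>" using aj j by (simp_all add: field_Units)
  have \<tau>j: "\<tau> (unit_vec K j) \<in> I" by (rule \<tau>I[OF unit_vec_closed[OF jp]])
  have "e \<in> I"
    unfolding e_def using submodule.smult_closed[OF ideal_submodule[OF I]] ij(1) \<tau>j by blast
  moreover have "w a e = \<one>"
    using functionalD(3)[OF wf[OF a(1)] ij(1) ideal.Icarr[OF I \<tau>j]] ij(2) jp
    by (simp add: e_def w_def \<chi>\<tau>[OF unit_vec_closed[OF jp]] dot_unit_vec[OF ac[OF a(1)]])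
  ultimately show False using L.not_null_homotopic[OF w[OF a(1)]] by blast
qed

end

context universal_setup
begin

lemma small_ideal_antimono: "m \<le> n \<Longrightarrow> small_ideal n \<subseteq> small_ideal m"
  unfolding small_ideal_def set_add_def' using ideal_pow_mono[of m n] by blast

text \<open>A remainder of i outside the small ideal could be separated from it by a functional. The
  residual of that functional, together with the remainder itself, would extend the dual
  system.\<close>

lemma dual_system_extend:
  assumes ds: "dual_system n p \<chi> \<tau>" and max: "\<And>\<chi>' \<tau>'. \<not> dual_system n (Suc p) \<chi>' \<tau>'" and i: "i \<in> I"
  shows "i \<ominus>\<^bsub>T\<^esub> \<tau> (\<chi> i) \<in> small_ideal n"
proof (rule ccontr)
  define x where "x = i \<ominus>\<^bsub>T\<^esub> \<tau> (\<chi> i)"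
  assume "i \<ominus>\<^bsub>T\<^esub> \<tau> (\<chi> i) \<notin> small_ideal n"
  then have nx: "x \<notin> small_ideal n" by (simp add: x_def)
  have coo: "coords K T p \<chi> \<tau>" using ds by (simp add: dual_system_def)
  have co: "\<chi> \<in> module_hom K T (vec_space K p)" "\<tau> \<in> module_hom K (vec_space K p) T"
    and \<chi>\<tau>: "\<And>v. v \<in> carrier (vec_space K p) \<Longrightarrow> \<chi> (\<tau> v) = v"
    and \<tau>I: "\<And>v. v \<in> carrier (vec_space K p) \<Longrightarrow> \<tau> v \<in> I"
    and \<chi>0: "\<And>t. t \<in> small_ideal n \<Longrightarrow> \<chi> t = (\<lambda>_. \<zero>)"
    using ds by (auto simp: dual_system_def coords_def)
  note c = module_homD[OF co(1)] and t = module_homD[OF co(2)]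
  interpret V: module K "vec_space K p" by (rule vec_space_module)
  interpret I: ideal I T by (rule I)
  have ic: "i \<in> carrier T" by (rule I.Icarr[OF i])
  have \<tau>i: "\<tau> (\<chi> i) \<in> I" by (rule \<tau>I[OF c(1)[OF ic]])
  have xI: "x \<in> I" unfolding x_def T.minus_eq by (intro I.a_closed i I.a_inv_closed \<tau>i)
  have xc: "x \<in> carrier T" by (rule I.Icarr[OF xI])
  obtain \<psi> where \<psi>: "functional K T \<psi>" "\<forall>t\<in>small_ideal n \<inter> carrier T. \<psi> t = \<zero>" "\<psi> x = \<one>"
    using fincod_separate[OF field_axioms T.module_axioms fincod_small xc nx] by blast
  define \<psi>' where "\<psi>' t = \<psi> t \<ominus> \<psi> (\<tau> (\<chi> t))" for t
  have \<psi>': "functional K T \<psi>'"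
    unfolding \<psi>'_def by (rule functional_residual[OF is_cring T.module_axioms coo \<psi>(1)])
  have "\<tau> (\<lambda>_. \<zero>) = \<zero>\<^bsub>T\<^esub>" using module_hom_zero[OF V.module_axioms T.module_axioms co(2)] by simp
  then have \<psi>'_eq: "\<psi>' t = \<psi> t" if "t \<in> carrier T" "\<chi> t = (\<lambda>_. \<zero>)" for t
    using that functionalD(1)[OF \<psi>(1) that(1)] functional_zero[OF T.module_axioms \<psi>(1)]
    by (simp add: \<psi>'_def minus_eq)
  have "\<chi> x = \<chi> i \<ominus>\<^bsub>vec_space K p\<^esub> \<chi> (\<tau> (\<chi> i))"
    unfolding x_def by (rule module_hom_minus[OF T.module_axioms V.module_axioms co(1) ic I.Icarr[OF \<tau>i]])
  also have "\<dots> = \<zero>\<^bsub>vec_space K p\<^esub>"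
    unfolding \<chi>\<tau>[OF c(1)[OF ic]] V.M.minus_eq by (rule V.M.r_neg[OF c(1)[OF ic]])
  finally have \<chi>x: "\<chi> x = (\<lambda>_. \<zero>)" by simp
  have "dual_system n (Suc p) (append_coord p \<chi> \<psi>') (append_vec K T p \<tau> x)"
    unfolding dual_system_def
  proof (intro conjI ballI)
    show "coords K T (Suc p) (append_coord p \<chi> \<psi>') (append_vec K T p \<tau> x)"
    proof (rule coords_append[OF T.module_axioms coo \<psi>'])
      show "\<psi>' (\<tau> v) = \<zero>" if "v \<in> carrier (vec_space K p)" for v
        using functionalD(1)[OF \<psi>(1) t(1)[OF that]] by (simp add: \<psi>'_def \<chi>\<tau>[OF that] minus_eq r_neg)
      show "x \<in> carrier T" "\<chi> x = (\<lambda>_. \<zero>)" by (rule xc, rule \<chi>x)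
      show "\<psi>' x = \<one>" using \<psi>'_eq[OF xc \<chi>x] \<psi>(3) by simp
    qed
    show "append_vec K T p \<tau> x v \<in> I" if v: "v \<in> carrier (vec_space K (Suc p))" for v
    proof -
      have "v p \<odot>\<^bsub>T\<^esub> x \<in> I"
        using submodule.smult_closed[OF ideal_submodule[OF I] _ xI, of "v p"] v by (simp add: vec_space_carrier)
      then show ?thesis
        unfolding append_vec_def by (intro I.a_closed \<tau>I vec_split(1)[OF is_cring v])
    qed
    show "append_coord p \<chi> \<psi>' s = (\<lambda>_. \<zero>)" if "s \<in> small_ideal n" for s
    proof -
      have "s \<in> carrier T" by (rule ideal.Icarr[OF small_ideal that])
      then show ?thesis using \<psi>'_eq[of s] \<chi>0[OF that] \<psi>(2) that by (auto simp: append_coord_def fun_eq_iff)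
    qed
  qed
  then show False using max by blast
qed

text \<open>Induction on j shows that I lies in G + \<mm>^j. An element of I is a combination of the
  generators plus an element of \<mm>I + I\<mm> + \<mm>^m, and the induction hypothesis puts \<mm>I
  + I\<mm> into G + \<mm>^(j + 1). Maximality is assumed at every level m \<ge> n because m grows
  with j.\<close>

lemma analytically_generated_if_dual_system:
  assumes closed: "I = ideal_closure T I" and ds: "dual_system n p \<chi> \<tau>"
    and max: "\<And>m \<chi>' \<tau>'. n \<le> m \<Longrightarrow> \<not> dual_system m (Suc p) \<chi>' \<tau>'"
  shows "analytically_generated T I (\<tau> ` unit_vec K ` {..<p})"
proof -
  define S where "S = \<tau> ` unit_vec K ` {..<p}"
  have co: "\<chi> \<in> module_hom K T (vec_space K p)" "\<tau> \<in> module_hom K (vec_space K p) T"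
    and \<tau>I: "\<And>v. v \<in> carrier (vec_space K p) \<Longrightarrow> \<tau> v \<in> I"
    using ds by (auto simp: dual_system_def coords_def)
  interpret I: ideal I T by (rule I)
  interpret M: ideal \<mm> T by (rule \<mm>_ideal)
  have S: "S \<subseteq> I" unfolding S_def using \<tau>I unit_vec_closed[of _ p] by blast
  then have ST: "S \<subseteq> carrier T" using I.Icarr by blast
  define G where "G = genideal T S"
  have G: "ideal G T" unfolding G_def by (rule T.genideal_ideal[OF ST])
  have GI: "G \<subseteq> I" unfolding G_def by (rule T.genideal_minimal[OF I S])
  have \<tau>G: "\<tau> v \<in> G" if "v \<in> carrier (vec_space K p)" for v
  proof (rule vec_map_in[OF is_cring T.module_axioms co(2) ideal_submodule[OF G] _ that])
    show "\<tau> (unit_vec K i) \<in> G" if "i < p" for i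
      unfolding G_def using T.genideal_self[OF ST] that by (auto simp: S_def)
  qed
  have pow: "I \<subseteq> G <+>\<^bsub>T\<^esub> ideal_pow T \<mm> j" for j
  proof (induction j)
    case 0
    then show ?case using T.ideal_sum_right[OF G T.oneideal] I.Icarr by auto
  next
    case (Suc j)
    let ?L = "G <+>\<^bsub>T\<^esub> ideal_pow T \<mm> (Suc j)"
    have L: "ideal ?L T" by (rule T.add_ideals[OF G ideal_pow_ideal])
    interpret L: ideal ?L T by (rule L)
    have Q: "ideal (ideal_pow T \<mm> (Suc j)) T" by (rule ideal_pow_ideal)
    \<comment> \<open>The level must be at least n for the maximality hypothesis and at least j + 1
      for \<mm>^m to lie in the target.\<close>
    define m where "m = max n (Suc j)"
    have xy: "x \<otimes>\<^bsub>T\<^esub> y \<in> ?L" "y \<otimes>\<^bsub>T\<^esub> x \<in> ?L" if x: "x \<in> \<mm>" and y: "y \<in> I" for x y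
    proof -
      obtain a b where ab: "a \<in> G" "b \<in> ideal_pow T \<mm> j" "y = a \<oplus>\<^bsub>T\<^esub> b"
        using y Suc.IH unfolding set_add_def' by blast
      have c: "x \<in> carrier T" "a \<in> carrier T" "b \<in> carrier T"
        using M.Icarr[OF x] ideal.Icarr[OF G ab(1)] ideal.Icarr[OF ideal_pow_ideal ab(2)] by auto
      have "x \<otimes>\<^bsub>T\<^esub> a \<in> ?L" "a \<otimes>\<^bsub>T\<^esub> x \<in> ?L"
        using ideal.I_l_closed[OF G ab(1) c(1)] ideal.I_r_closed[OF G ab(1) c(1)]
        by (blast intro: T.ideal_sum_left[OF G Q])+
      moreover have "x \<otimes>\<^bsub>T\<^esub> b \<in> ?L"
        by (rule T.ideal_sum_right[OF G Q T.ideal_mult_pow[OF \<mm>_ideal x ab(2)]])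
      moreover have "b \<otimes>\<^bsub>T\<^esub> x \<in> ?L"
        by (rule T.ideal_sum_right[OF G Q]) (simp add: ideal_prod.prod ab(2) x)
      ultimately show "x \<otimes>\<^bsub>T\<^esub> y \<in> ?L" "y \<otimes>\<^bsub>T\<^esub> x \<in> ?L"
        unfolding ab(3) using c by (simp_all add: T.l_distr T.r_distr L.a_closed del: ideal_pow.simps)
    qed
    have "ideal_pow T \<mm> m \<subseteq> ?L"
      using ideal_pow_mono[of "Suc j" m] T.ideal_sum_right[OF G Q] by (auto simp: m_def)
    then have sm: "small_ideal m \<subseteq> ?L"
      unfolding small_ideal_def
      using xy by (intro T.ideal_sum_least[OF L] T.ideal_prod_least[OF L]) blast+
    show ?case
    proof
      fix i assume i: "i \<in> I"
      have ic: "i \<in> carrier T" by (rule I.Icarr[OF i])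
      have \<chi>i: "\<chi> i \<in> carrier (vec_space K p)" by (rule module_homD(1)[OF co(1) ic])
      have "dual_system m p \<chi> \<tau>"
        using ds small_ideal_antimono[of n m] by (auto simp: dual_system_def m_def)
      then have "i \<ominus>\<^bsub>T\<^esub> \<tau> (\<chi> i) \<in> small_ideal m"
        by (rule dual_system_extend[OF _ max i]) (simp add: m_def)
      then have "i \<ominus>\<^bsub>T\<^esub> \<tau> (\<chi> i) \<in> ?L" using sm by blast
      moreover have "\<tau> (\<chi> i) \<in> ?L" by (rule T.ideal_sum_left[OF G Q \<tau>G[OF \<chi>i]])
      ultimately have "(i \<ominus>\<^bsub>T\<^esub> \<tau> (\<chi> i)) \<oplus>\<^bsub>T\<^esub> \<tau> (\<chi> i) \<in> ?L"
        by (rule L.a_closed)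
      moreover have "(i \<ominus>\<^bsub>T\<^esub> \<tau> (\<chi> i)) \<oplus>\<^bsub>T\<^esub> \<tau> (\<chi> i) = i"
        using ic I.Icarr[OF \<tau>I[OF \<chi>i]] by (simp add: T.minus_eq T.a_assoc T.l_neg)
      ultimately show "i \<in> ?L" by (simp only:)
    qed
  qed
  \<comment> \<open>This inclusion brings in that I is closed; intersecting \<open>pow\<close> over
    all j gives the other one.\<close>
  have "ideal_closure T G \<subseteq> ideal_closure T I"
    unfolding ideal_closure_def set_add_def' by (rule INF_mono') (use GI in blast)
  moreover have "I \<subseteq> ideal_closure T G"
    unfolding ideal_closure_def jacobson_radical_T using pow by blast
  ultimately have "I = ideal_closure T G" using closed by blast
  then show ?thesis using ST by (simp add: analytically_generated_def S_def G_def)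
qed

lemma few_generators:
  assumes closed: "I = ideal_closure T I" and fd: "vectorspace.fin_dim K (Ext_space R F d 2)"
  shows "\<exists>S. finite S \<and> card S \<le> vectorspace.dim K (Ext_space R F d 2) \<and> analytically_generated T I S"
proof -
  let ?D = "vectorspace.dim K (Ext_space R F d 2)"
  \<comment> \<open>The level n is quantified inside, so that the greatest p is maximal over all
    levels at once. It exists because the bound is the same for every level.\<close>
  define Q where "Q p \<longleftrightarrow> (\<exists>n\<ge>2. \<exists>\<chi> \<tau>. dual_system n p \<chi> \<tau>)" for p
  have "dual_system 2 0 (\<lambda>_ _. \<zero>) (\<lambda>_. \<zero>\<^bsub>T\<^esub>)"
    using additive_subgroup.zero_closed[OF ideal.axioms(1)[OF I]]
    by (auto simp: dual_system_def coords_def vec_space_carrier intro!: module_homI)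
  then have "Q 0" unfolding Q_def by blast
  moreover have bound: "p \<le> ?D" if "Q p" for p
    using that dual_system_bound[OF _ _ fd] unfolding Q_def by blast
  ultimately obtain p where p: "Q p" "\<And>q. Q q \<Longrightarrow> q \<le> p"
    using Nat.ex_has_greatest_nat[of Q 0 ?D] by blast
  obtain n \<chi> \<tau> where n: "2 \<le> n" and ds: "dual_system n p \<chi> \<tau>" using p(1) unfolding Q_def by blast
  have "\<not> dual_system m (Suc p) \<chi>' \<tau>'" if "n \<le> m" for m \<chi>' \<tau>'
    using p(2)[of "Suc p"] that n unfolding Q_def by (auto dest: order_trans)
  then have "analytically_generated T I (\<tau> ` unit_vec K ` {..<p})"
    by (rule analytically_generated_if_dual_system[OF closed ds])
  moreover have "card (\<tau> ` unit_vec K ` {..<p}) \<le> p"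
    using card_image_le[of "unit_vec K ` {..<p}" \<tau>] card_image_le[of "{..<p}" "unit_vec K"] by simp
  ultimately show ?thesis using bound[OF p(1)]
    by (intro exI[of _ "\<tau> ` unit_vec K ` {..<p}"]) auto
qed

end

theorem theorem4p7:
  fixes K :: "'k ring"
    and R :: "('k, 'r) module"
    and F :: "int \<Rightarrow> ('r, 'm) module"
    and d :: "int \<Rightarrow> 'm \<Rightarrow> 'm"
    and r :: nat
    and T :: "('k, nat \<Rightarrow> (nat list \<Rightarrow> 'k) set) module"
    and I\<^sub>0 :: "(nat \<Rightarrow> (nat list \<Rightarrow> 'k) set) set"
  assumes "field K"
    and "nc_algebra K R"
    and "projective_complex R F d"
    and "vectorspace.fin_dim K (Ext_space R F d 1)"
    and "T = nc_power_series K r"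
    and "closed_ideal I\<^sub>0 T"
    and "I\<^sub>0 \<subseteq> ideal_pow T (jacobson_radical T) 2"
    and "is_parameter_algebra K R F d (quot T I\<^sub>0)"
    and "vectorspace.fin_dim K (Ext_space R F d 2)"
  shows "\<exists>S. finite S \<and> card S \<le> vectorspace.dim K (Ext_space R F d 2) \<and>
           analytically_generated T I\<^sub>0 S"
proof -
  interpret power_series K r by (rule power_series.intro[OF assms(1)])
  obtain U where U: "universal_lift K R F d (quot T I\<^sub>0) U"
    using assms(8) unfolding is_parameter_algebra_def by blast
  interpret complex_setup K R F d
    using assms(2,3) by (intro complex_setup.intro) (auto simp: projective_complex_def projective_lmodule_def)
  interpret universal_setup K r R F d "I\<^sub>0" U
    using assms(6,7) U unfolding assms(5) closed_ideal_def jacobson_radical_T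
    by (intro universal_setup.intro universal_setup_axioms.intro power_series_axioms complex_setup_axioms) auto
  show ?thesis
    using few_generators assms(6,9) unfolding assms(5) closed_ideal_def by blast
qed

end
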